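(* Let $g\ge2$. For primary $v_{\gamma_k}\in\mathcal W_{\gamma_k}$ of weight $m_k\in\mathbb C$ inserted at $y_k$ for $k=1,\ldots,n$ (with intermediate labels $\boldsymbol\delta$, and admissible labels $\boldsymbol\alpha,\boldsymbol\beta$), and with $\omega\in V_2$ the Virasoro conformal vector, $$\mathcal F_{\boldsymbol{\alpha\beta}}(\omega,x;\boldsymbol{v_\gamma},\boldsymbol y\,|\,0,\boldsymbol\gamma;0,\boldsymbol\delta)=\nabla^{(\boldsymbol m)}_{\boldsymbol y}(x)\,\mathcal F_{\boldsymbol{\alpha\beta}}(\boldsymbol{v_\gamma},\boldsymbol y\,|\,\boldsymbol\gamma;\boldsymbol\delta).$$
   Context: **VOA.** $V=(V,Y,\mathbf{1},\omega)$ is a simple vertex operator algebra over $\mathbb{C}$ of strong CFT type ($V=\bigoplus_{n\ge0}V_n$, $\dim V_n<\infty$, $V_0=\mathbb{C}\mathbf{1}$, $L(1)V_1=0$), isomorphic to its contragredient module; $Y(\omega,z)=\sum_nL(n)z^{-n-2}$. A homogeneous vector $v$ (of $V$ or a module) is primary if $L(n)v=0$ for all $n>0$. $\langle\cdot,\cdot\rangle$ is the unique non-degenerate invariant bilinear form on $V$ with $\langle\mathbf 1,\mathbf 1\rangle=1$: $\langle Y(u,z)v,w\rangle=\langle v,Y(e^{zL(1)}(-z^{-2})^{L(0)}u,z^{-1})w\rangle$. **Modules and intertwiners.** $\{(Y_\alpha,\mathcal W_\alpha)\}_{\alpha\in\mathcal A}$ are the inequivalent irreducible ordinary $V$-modules,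 $\mathcal W_0=V$, $\mathcal W_\alpha=\bigoplus_{n\ge0}\mathcal W_{\alpha,n+h_\alpha}$ with finite-dimensional $L(0)$-eigenspaces of weight $n+h_\alpha$, $h_\alpha\in\mathbb C$. $\mathcal W_{\alpha'}$ is the contragredient module; $\langle\cdot,\cdot\rangle$ also denotes the canonical pairing. $\mathcal Y^\gamma_{\alpha\beta}$ is an intertwining operator of type $\binom{\gamma}{\alpha\ \beta}$ (Frenkel–Huang–Lepowsky), $N^\gamma_{\alpha\beta}$ the dimension of the space of these. It is assumed that $N^\gamma_{\alpha0}=\delta_{\alpha\gamma}$, $N^0_{\alpha\beta}=\delta_{\alpha\beta'}$. Normalizations: $\mathcal Y^\beta_{0\beta}=Y_\beta$; $\mathcal Y^\alpha_{\alpha0}(v_\alpha,z)u=e^{zL(-1)}Y_\alpha(u,-z)v_\alpha$; $\langle u,\mathcal Y^0_{\alpha\alpha'}(v_\alpha,z)v_{\alpha'}\rangle=\langle\mathcal Y^\alpha_{\alpha0}(e^{zL(1)}(-z^{-2})^{L(0)}v_\alpha,z^{-1})u,v_{\alpha'}\rangle$; for other types an intertwining operator is fixed. **Correlation forms.** For $v_{\gamma_k}\in\mathcal W_{\gamma_k}$ and intermediate labels $\boldsymbol\delta=\delta_1,\ldots,\delta_{n-1}$ (with $\delta_1=\gamma_1'$, $\delta_{n-1}=\gamma_n$), $\mathcal Y^{\boldsymbol\delta}_{\boldsymbol\gamma}(\boldsymbol{v_\gamma},\boldsymbol y)=\mathcal Y^0_{\gamma_1\delta_1}(v_{\gamma_1},y_1)\cdots\mathcal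 Y^{\delta_{k-1}}_{\gamma_k\delta_k}(v_{\gamma_k},y_k)\cdots\mathcal Y^{\delta_{n-1}}_{\gamma_n0}(v_{\gamma_n},y_n)$. Let $\mathcal I=\{\pm1,\ldots,\pm g\}$, with formal variables $w_a$ ($a\in\mathcal I$), $\rho_a=\rho_{-a}$. For labels $\boldsymbol\alpha=\alpha_1,\ldots,\alpha_g$ let $\{b_a\}$ be a homogeneous basis of $\mathcal W_{\alpha_a}$, $\{b_a'\}$ the dual basis of $\mathcal W_{\alpha_a'}$, $b_{-a}:=\rho_a^{\mathrm{wt}(b_a)}b_a'$. For labels $\boldsymbol\beta=\beta_1,\ldots,\beta_{2g-1}$ with $\beta_1=\alpha_1'$, $\beta_{2g-1}=\alpha_g'$, $\mathcal Y^{\boldsymbol\beta}_{\boldsymbol{\alpha\alpha'}}(\boldsymbol b,\boldsymbol w)=\mathcal Y^0_{\alpha_1\beta_1}(b_1,w_1)\mathcal Y^{\beta_1}_{\alpha_1'\beta_2}(b_{-1},w_{-1})\cdots\mathcal Y^{\beta_{2g-2}}_{\alpha_g\beta_{2g-1}}(b_g,w_g)\mathcal Y^{\beta_{2g-1}}_{\alpha_g'0}(b_{-g},w_{-g})$. Then $$\mathcal F_{\boldsymbol{\alpha\beta}}(\boldsymbol{v_\gamma},\boldsymbol y|\boldsymbol\gamma;\boldsymbol\delta)=\sum_{b_1,\ldots,b_g}\langle\mathbf 1,\mathcal Y^{\boldsymbol\delta}_{\boldsymbol\gamma}(\boldsymbol{v_\gamma},\boldsymbol y)\,\mathcal Y^{\boldsymbol\beta}_{\boldsymbol{\alpha\alpha'}}(\boldsymbol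 b,\boldsymbol w)\mathbf 1\rangle\prod_kdy_k^{\mathrm{wt}(v_{\gamma_k})},$$ and $\mathcal F_{\boldsymbol{\alpha\beta}}(\omega,x;\boldsymbol{v_\gamma},\boldsymbol y|0,\boldsymbol\gamma;0,\boldsymbol\delta)$ is obtained by inserting $Y(\omega,x)$ immediately to the right of $\langle\mathbf 1,$ and multiplying by $dx^2$. **Differential operators.** For Schottky parameters satisfying $|w_a-w_b|>|\rho_a|^{1/2}+|\rho_b|^{1/2}$ for $a\ne b$ in $\mathcal I$, $\Gamma$ is the free (Schottky) group generated by $\gamma_az=w_{-a}+\rho_a/(z-w_a)$, $a=1,\ldots,g$, with limit set $\Lambda(\Gamma)$. The Bers quasiform is $\Psi_2(x,y)=\sum_{\gamma\in\Gamma}\Pi_2(\gamma x,y)$, $\Pi_2(x,y)=\pi_2(x,y)dx^2dy^{-1}$, $\pi_2(x,y)=\frac1{x-y}\prod_{\ell=0}^2\frac{y-A_\ell}{x-A_\ell}$ with $A_0,A_1,A_2$ distinct points of $\Lambda(\Gamma)$. The holomorphic $2$-forms $\Theta_{2,a}^\ell(x)$ ($a=1,\ldots,g$; $\ell=0,1,2$) are defined by $\Psi_2(x,\gamma_ay)-\Psi_2(x,y)=-\sum_{\ell=0}^2\Theta_{2,a}^\ell(x)(y-w_a)^\ell dy^{-1}$. With $\partial_a^0=\partial_{w_a}$, $\partial_a^1=\rho_a\partial_{\rho_a}$, $\partial_a^2=\rho_a\partial_{w_{-a}}$, put $\nabla(x)=\sum_{a=1}^g\sum_{\ell=0}^2\Theta_{2,a}^\ell(x)\partial_a^\ell$.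 On forms $H(\boldsymbol y)=h(\boldsymbol y)\prod_kdy_k^{m_k}$, $$\nabla^{(\boldsymbol m)}_{\boldsymbol y}(x)=\nabla(x)+\sum_{k=1}^n\big(\Psi_2(x,y_k)d_{y_k}+m_k\,d_{y_k}\Psi_2(x,y_k)\big),$$ i.e. with $\Psi_2=\psi_2(x,y)dx^2dy^{-1}$: $\nabla^{(\boldsymbol m)}_{\boldsymbol y}(x)H=\big[\nabla(x)h+dx^2\sum_k\big(\psi_2(x,y_k)\partial_{y_k}h+m_k(\partial_{y_k}\psi_2(x,y_k))h\big)\big]\prod_kdy_k^{m_k}$, where $\nabla(x)$ acts on the Schottky-parameter dependence of $h$ at fixed $\boldsymbol y$. **Expansions in $\rho$.** The identity is formal, $\Psi_2,\Theta_{2,a}^\ell$ being represented by the following expansions in the $\rho_a$ ($f^{(i)}=\frac1{i!}\partial^if$, $h^{(i,j)}=\frac1{i!j!}\partial_x^i\partial_y^jh$). Write $\pi_2(x,y)=\frac1{x-y}+\sum_{\ell=0}^2f_\ell(x)y^\ell$. For $a,b\in\mathcal I$, $m,n\ge0$ let $L_b^n(x)=\rho_b^{n/2}\pi_2^{(0,n)}(x,w_b)dx^2$, $R_a^m(y)=\rho_a^{(m+1)/2}\pi_2^{(m,0)}(w_{-a},y)dy^{-1}$, $A_{ab}^{mn}=\rho_a^{(m+1)/2}\rho_b^{n/2}\pi_2^{(m,n)}(w_{-a},w_b)$ if $a\ne-b$, $A_{a,-a}^{mn}=\rho_a^{(m+n+1)/2}\sum_{\ell=0}^2\binom{\ell}{n}f_\ell^{(m)}(w_{-a})w_{-a}^{\ell-n}$,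 $\Delta_{ab}^{mn}=\delta_{m,n+3}\delta_{ab}$, $\widetilde L=L\Delta$, $\widetilde A=A\Delta$, $(I-\widetilde A)^{-1}=\sum_{k\ge0}\widetilde A^k$. Then $\Psi_2=\Pi_2+\widetilde L(x)(I-\widetilde A)^{-1}R(y)$ and $\Theta_{2,a}^\ell(x)=T_a^\ell(x)+\rho_a^{1-\ell}T_{-a}^{2-\ell}(x)$ with $T_a^\ell(x)=\rho_a^{-\ell/2}\big(L(x)+\widetilde L(x)(I-\widetilde A)^{-1}A\big)_a^\ell$. *)

theory Defs
  imports Complex_Main "HOL-Library.Function_Algebras" "HOL-Library.Extended_Nat" "HOL-Library.FuncSet"
begin

section \<open>Vertex operator algebras, modules and intertwining operators\<close>

text \<open>Sum of a finitely supported family. Every use below is on families whose support is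
  finite (by lower truncation, or by the support properties of the formal series involved).\<close>

definition lfsum :: "('i \<Rightarrow> 'b::comm_monoid_add) \<Rightarrow> 'b" where
  "lfsum f = (\<Sum>i | f i \<noteq> 0. f i)"

text \<open>All modules live on subspaces \<open>carr S \<alpha>\<close> of one ambient complex vector space \<open>'m\<close>;
  the type \<open>'a\<close> is the set of labels of the irreducible modules, \<open>lab0 S\<close> the label \<open>0\<close> of
  \<open>V\<close> itself.
  Vertex operators are given by modes: \<open>mode S \<alpha> u n w\<close> is the coefficient of \<open>z\<close> to the power
  \<open>- n - 1\<close> in \<open>Y\<^sub>\<alpha>(u,z)w\<close>, and \<open>inter S \<gamma> \<alpha> \<beta> v c w\<close> is the coefficient of \<open>z\<close> to the complex
  power \<open>- c - 1\<close> in the fixed intertwining operator of type \<open>\<gamma>\<close> over \<open>\<alpha> \<beta>\<close>.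
  \<open>pairing S \<alpha>\<close> is the canonical pairing of \<open>W\<^sub>\<alpha>\<close> with its contragredient \<open>carr S (dual S \<alpha>)\<close>;
  for \<open>\<alpha> = 0\<close> it is the invariant form on \<open>V\<close>.\<close>

record ('a, 'm) voa_system =
  smult :: "complex \<Rightarrow> 'm \<Rightarrow> 'm"
  vac :: 'm
  conf :: 'm
  lab0 :: 'a
  carr :: "'a \<Rightarrow> 'm set"
  mode :: "'a \<Rightarrow> 'm \<Rightarrow> int \<Rightarrow> 'm \<Rightarrow> 'm"
  dual :: "'a \<Rightarrow> 'a"
  pairing :: "'a \<Rightarrow> 'm \<Rightarrow> 'm \<Rightarrow> complex"
  inter :: "'a \<Rightarrow> 'a \<Rightarrow> 'a \<Rightarrow> 'm \<Rightarrow> complex \<Rightarrow> 'm \<Rightarrow> 'm"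

abbreviation alg :: "('a, 'm) voa_system \<Rightarrow> 'm set" where
  "alg S \<equiv> carr S (lab0 S)"

abbreviation Ymode :: "('a, 'm) voa_system \<Rightarrow> 'm \<Rightarrow> int \<Rightarrow> 'm \<Rightarrow> 'm" where
  "Ymode S \<equiv> mode S (lab0 S)"

definition bilin_on ::
  "(complex \<Rightarrow> 'm \<Rightarrow> 'm) \<Rightarrow> 'm set \<Rightarrow> 'm set \<Rightarrow> (complex \<Rightarrow> 'b \<Rightarrow> 'b) \<Rightarrow> 'b set
    \<Rightarrow> ('m::ab_group_add \<Rightarrow> 'm \<Rightarrow> 'b::ab_group_add) \<Rightarrow> bool" where
  "bilin_on s W1 W2 t W3 f \<longleftrightarrow>
     (\<forall>x\<in>W1. \<forall>y\<in>W2. f x y \<in> W3) \<and>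
     (\<forall>x\<in>W1. \<forall>x'\<in>W1. \<forall>y\<in>W2. f (x + x') y = f x y + f x' y) \<and>
     (\<forall>x\<in>W1. \<forall>y\<in>W2. \<forall>y'\<in>W2. f x (y + y') = f x y + f x y') \<and>
     (\<forall>k. \<forall>x\<in>W1. \<forall>y\<in>W2. f (s k x) y = t k (f x y) \<and> f x (s k y) = t k (f x y))"

text \<open>\<open>vir S Y n\<close> is \<open>L(n)\<close> on the module with action \<open>Y\<close>.\<close>

definition vir :: "('a, 'm) voa_system \<Rightarrow> ('m \<Rightarrow> int \<Rightarrow> 'm \<Rightarrow> 'm) \<Rightarrow> int \<Rightarrow> 'm \<Rightarrow> 'm" where
  "vir S Y n w = Y (conf S) (n + 1) w"

definition wspace ::
  "('a, 'm) voa_system \<Rightarrow> 'm set \<Rightarrow> ('m \<Rightarrow> int \<Rightarrow> 'm \<Rightarrow> 'm) \<Rightarrow> complex \<Rightarrow> 'm set" where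
  "wspace S W Y c = {w \<in> W. vir S Y 0 w = smult S c w}"

text \<open>A series in integral powers regarded as a series in complex powers.\<close>

definition cmodes :: "('m \<Rightarrow> int \<Rightarrow> 'm \<Rightarrow> 'm::zero) \<Rightarrow> 'm \<Rightarrow> complex \<Rightarrow> 'm \<Rightarrow> 'm" where
  "cmodes Y u c w = (if c \<in> \<int> then Y u \<lfloor>Re c\<rfloor> w else 0)"

text \<open>Intertwining operators of type \<open>(W3,Y3)\<close> over \<open>(W1,Y1) (W2,Y2)\<close>. The Jacobi identity
  is written in modes (Borcherds identity); the last clause is the \<open>L(-1)\<close>-derivative property.\<close>

definition intertwining ::
  "('a, 'm::ab_group_add) voa_system \<Rightarrow> 'm set \<Rightarrow> ('m \<Rightarrow> int \<Rightarrow> 'm \<Rightarrow> 'm)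
    \<Rightarrow> 'm set \<Rightarrow> ('m \<Rightarrow> int \<Rightarrow> 'm \<Rightarrow> 'm) \<Rightarrow> 'm set \<Rightarrow> ('m \<Rightarrow> int \<Rightarrow> 'm \<Rightarrow> 'm)
    \<Rightarrow> ('m \<Rightarrow> complex \<Rightarrow> 'm \<Rightarrow> 'm) \<Rightarrow> bool" where
  "intertwining S W3 Y3 W1 Y1 W2 Y2 I \<longleftrightarrow>
     (\<forall>c. bilin_on (smult S) W1 W2 (smult S) W3 (\<lambda>v w. I v c w)) \<and>
     (\<forall>v\<in>W1. \<forall>w\<in>W2. \<forall>c. \<exists>N. \<forall>k\<ge>N. I v (c + of_nat k) w = 0) \<and>
     (\<forall>u\<in>alg S. \<forall>v\<in>W1. \<forall>w\<in>W2. \<forall>l m :: int. \<forall>n :: complex.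
        lfsum (\<lambda>i::nat. smult S (of_int m gchoose i)
                 (I (Y1 u (l + int i) v) (of_int m + n - of_nat i) w)) =
        lfsum (\<lambda>i::nat. smult S ((- 1) ^ i * (of_int l gchoose i))
                 (Y3 u (m + l - int i) (I v (n + of_nat i) w)
                  - smult S ((- 1) powi l)
                      (I v (n + of_int l - of_nat i) (Y2 u (m + int i) w))))) \<and>
     (\<forall>v\<in>W1. \<forall>w\<in>W2. \<forall>c. I (vir S Y1 (- 1) v) c w = smult S (- c) (I v (c - 1) w))"

definition ordinary_module ::
  "('a, 'm::ab_group_add) voa_system \<Rightarrow> 'm set \<Rightarrow> ('m \<Rightarrow> int \<Rightarrow> 'm \<Rightarrow> 'm) \<Rightarrow> bool" where
  "ordinary_module S W Y \<longleftrightarrow>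
     module.subspace (smult S) W \<and>
     intertwining S W Y (alg S) (Ymode S) W Y (cmodes Y) \<and>
     (\<forall>n. \<forall>w\<in>W. Y (vac S) n w = (if n = - 1 then w else 0)) \<and>
     (\<exists>h. module.span (smult S) (\<Union>n::nat. wspace S W Y (h + of_nat n)) = W \<and>
          (\<forall>n::nat. \<exists>B. finite B \<and> module.span (smult S) B = wspace S W Y (h + of_nat n)))"

definition irreducible_module ::
  "('a, 'm::ab_group_add) voa_system \<Rightarrow> 'm set \<Rightarrow> ('m \<Rightarrow> int \<Rightarrow> 'm \<Rightarrow> 'm) \<Rightarrow> bool" where
  "irreducible_module S W Y \<longleftrightarrow> ordinary_module S W Y \<and> W \<noteq> {0} \<and>
     (\<forall>U. module.subspace (smult S) U \<and> U \<subseteq> W \<and> (\<forall>u\<in>alg S. \<forall>n. \<forall>w\<in>U. Y u n w \<in> U)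
        \<longrightarrow> U = {0} \<or> U = W)"

definition module_iso ::
  "('a, 'm::ab_group_add) voa_system \<Rightarrow> 'm set \<Rightarrow> ('m \<Rightarrow> int \<Rightarrow> 'm \<Rightarrow> 'm)
    \<Rightarrow> 'm set \<Rightarrow> ('m \<Rightarrow> int \<Rightarrow> 'm \<Rightarrow> 'm) \<Rightarrow> bool" where
  "module_iso S W Y W' Y' \<longleftrightarrow> (\<exists>\<phi>. bij_betw \<phi> W W' \<and>
     (\<forall>x\<in>W. \<forall>y\<in>W. \<phi> (x + y) = \<phi> x + \<phi> y) \<and>
     (\<forall>k. \<forall>x\<in>W. \<phi> (smult S k x) = smult S k (\<phi> x)) \<and>
     (\<forall>u\<in>alg S. \<forall>n. \<forall>x\<in>W. \<phi> (Y u n x) = Y' u n (\<phi> x)))"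

text \<open>\<open>fusion S \<gamma> \<alpha> \<beta>\<close> is the dimension of the space of intertwining operators of the given type;
  operators are made \<open>0\<close> off the carriers so that equal operators are equal functions.\<close>

definition intertwiners ::
  "('a, 'm::ab_group_add) voa_system \<Rightarrow> 'a \<Rightarrow> 'a \<Rightarrow> 'a \<Rightarrow> ('m \<Rightarrow> complex \<Rightarrow> 'm \<Rightarrow> 'm) set" where
  "intertwiners S \<gamma> \<alpha> \<beta> =
     {I. intertwining S (carr S \<gamma>) (mode S \<gamma>) (carr S \<alpha>) (mode S \<alpha>) (carr S \<beta>) (mode S \<beta>) I \<and>
         (\<forall>v c w. v \<notin> carr S \<alpha> \<or> w \<notin> carr S \<beta> \<longrightarrow> I v c w = 0)}"

definition fusion :: "('a, 'm::ab_group_add) voa_system \<Rightarrow> 'a \<Rightarrow> 'a \<Rightarrow> 'a \<Rightarrow> enat" where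
  "fusion S \<gamma> \<alpha> \<beta> =
     (let scl = (\<lambda>k I v c w. smult S k (I v c w))
      in if \<exists>B. finite B \<and> module.span scl B = intertwiners S \<gamma> \<alpha> \<beta>
         then enat (vector_space.dim scl (intertwiners S \<gamma> \<alpha> \<beta>)) else \<infinity>)"

text \<open>The simple strong CFT type algebra \<open>V\<close>, its irreducible ordinary modules, and the fixed
  intertwining operators. Simplicity of \<open>V\<close> is \<open>irreducible\<close> for \<open>\<alpha> = lab0 S\<close>, and
  \<open>V\<close> is its own contragredient by \<open>dual_lab0\<close>.

  \<open>complete\<close> loses nothing by considering modules on subspaces of \<open>'m\<close> only: an ordinary module
  has countable dimension, and the subspace \<open>alg S\<close> of \<open>'m\<close> is infinite-dimensional unless
  \<open>V\<close> is \<open>\<complex>\<one>\<close>, whose irreducible modules are one-dimensional.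

  For \<open>u\<close> of weight \<open>k\<close>, extracting coefficients of \<open>z\<close> from
  \<open>Y(e\<^bsup>zL(1)\<^esup>(-z\<^bsup>-2\<^esup>)\<^bsup>L(0)\<^esup>u, z\<^bsup>-1\<^esup>)\<close> gives the sums of modes in \<open>contragredient\<close>
  and \<open>norm_dual\<close>. In \<open>norm_dual\<close>, where \<open>k\<close> is complex, \<open>(-1)\<^bsup>k\<^esup>\<close> is read
  as \<open>exp (\<i>\<pi>k)\<close>.\<close>

locale voa_modules =
  fixes S :: "('a, 'm::ab_group_add) voa_system" (structure)
  assumes vector_space: "vector_space (smult S)"
    and vac: "vac S \<in> alg S" "vac S \<noteq> 0"
    and conf: "conf S \<in> alg S"
    and creation: "\<And>u. u \<in> alg S \<Longrightarrow> Ymode S u (- 1) (vac S) = u"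
      "\<And>u n. u \<in> alg S \<Longrightarrow> n \<ge> 0 \<Longrightarrow> Ymode S u n (vac S) = 0"
    and virasoro: "\<exists>c. \<forall>m n. \<forall>v\<in>alg S.
        vir S (Ymode S) m (vir S (Ymode S) n v) - vir S (Ymode S) n (vir S (Ymode S) m v) =
          smult S (of_int (m - n)) (vir S (Ymode S) (m + n) v)
          + (if m + n = 0 then smult S (c * of_int (m ^ 3 - m) / 12) v else 0)"
    and cft_grading:
      "module.span (smult S) (\<Union>n::nat. wspace S (alg S) (Ymode S) (of_nat n)) = alg S"
      "\<And>n::nat. \<exists>B. finite B \<and>
         module.span (smult S) B = wspace S (alg S) (Ymode S) (of_nat n)"
    and cft_type: "wspace S (alg S) (Ymode S) 0 = module.span (smult S) {vac S}"
    and strong_cft_type: "\<And>v. v \<in> wspace S (alg S) (Ymode S) 1 \<Longrightarrow> vir S (Ymode S) 1 v = 0"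
    and irreducible: "\<And>\<alpha>. irreducible_module S (carr S \<alpha>) (mode S \<alpha>)"
    and inequivalent: "\<And>\<alpha> \<beta>. module_iso S (carr S \<alpha>) (mode S \<alpha>) (carr S \<beta>) (mode S \<beta>) \<Longrightarrow> \<alpha> = \<beta>"
    and complete: "\<And>W Y. irreducible_module S W Y \<Longrightarrow>
        \<exists>\<alpha>. module_iso S (carr S \<alpha>) (mode S \<alpha>) W Y"
    and pairing_bilinear:
      "\<And>\<alpha>. bilin_on (smult S) (carr S \<alpha>) (carr S (dual S \<alpha>)) (*) UNIV (pairing S \<alpha>)"
    and pairing_nondegenerate:
      "\<And>\<alpha> w. w \<in> carr S \<alpha> \<Longrightarrow> (\<forall>w'\<in>carr S (dual S \<alpha>). pairing S \<alpha> w w' = 0) \<Longrightarrow> w = 0"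
      "\<And>\<alpha> w'. w' \<in> carr S (dual S \<alpha>) \<Longrightarrow> (\<forall>w\<in>carr S \<alpha>. pairing S \<alpha> w w' = 0) \<Longrightarrow> w' = 0"
    and contragredient:
      "\<And>\<alpha> (k::nat) u p w w'. u \<in> wspace S (alg S) (Ymode S) (of_nat k) \<Longrightarrow> w \<in> carr S \<alpha> \<Longrightarrow>
         w' \<in> carr S (dual S \<alpha>) \<Longrightarrow>
         pairing S \<alpha> w (mode S (dual S \<alpha>) u p w') =
           (\<Sum>i\<le>k. (- 1) ^ k / fact i *
              pairing S \<alpha> (mode S \<alpha> ((vir S (Ymode S) 1 ^^ i) u) (2 * int k - int i - p - 2) w) w')"
    and dual_lab0: "dual S (lab0 S) = lab0 S"
    and form_normalized: "pairing S (lab0 S) (vac S) (vac S) = 1"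
    and fusion_right: "\<And>\<alpha> \<gamma>. fusion S \<gamma> \<alpha> (lab0 S) = (if \<alpha> = \<gamma> then 1 else 0)"
    and fusion_vac: "\<And>\<alpha> \<beta>. fusion S (lab0 S) \<alpha> \<beta> = (if \<alpha> = dual S \<beta> then 1 else 0)"
    and inter: "\<And>\<gamma> \<alpha> \<beta>. intertwining S (carr S \<gamma>) (mode S \<gamma>) (carr S \<alpha>) (mode S \<alpha>)
        (carr S \<beta>) (mode S \<beta>) (inter S \<gamma> \<alpha> \<beta>)"
    and norm_left: "\<And>\<beta> u c w. u \<in> alg S \<Longrightarrow> w \<in> carr S \<beta> \<Longrightarrow>
        inter S \<beta> (lab0 S) \<beta> u c w = cmodes (mode S \<beta>) u c w"
    and norm_right: "\<And>\<alpha> v u c. v \<in> carr S \<alpha> \<Longrightarrow> u \<in> alg S \<Longrightarrow>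
        inter S \<alpha> \<alpha> (lab0 S) v c u =
          cmodes (\<lambda>v p u. lfsum (\<lambda>i::nat. smult S ((- 1) powi (p + int i + 1) / fact i)
            ((vir S (mode S \<alpha>) (- 1) ^^ i) (mode S \<alpha> u (p + int i) v)))) v c u"
    and norm_dual: "\<And>\<alpha> k v v' u c. v \<in> wspace S (carr S \<alpha>) (mode S \<alpha>) k \<Longrightarrow>
        v' \<in> carr S (dual S \<alpha>) \<Longrightarrow> u \<in> alg S \<Longrightarrow>
        pairing S (lab0 S) u (inter S (lab0 S) \<alpha> (dual S \<alpha>) v c v') =
          lfsum (\<lambda>i::nat. exp (\<i> * of_real pi * k) / fact i *
            pairing S \<alpha> (inter S \<alpha> \<alpha> (lab0 S) ((vir S (mode S \<alpha>) 1 ^^ i) v)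
                           (2 * k - of_nat i - c - 2) u) v')"

definition primary :: "('a, 'm) voa_system \<Rightarrow> 'a \<Rightarrow> complex \<Rightarrow> ('m::zero) \<Rightarrow> bool" where
  "primary S \<alpha> m v \<longleftrightarrow>
     v \<in> wspace S (carr S \<alpha>) (mode S \<alpha>) m \<and> (\<forall>n>0. vir S (mode S \<alpha>) n v = 0)"

definition wt :: "('a, 'm) voa_system \<Rightarrow> 'a \<Rightarrow> 'm \<Rightarrow> complex" where
  "wt S \<alpha> v = (THE c. vir S (mode S \<alpha>) 0 v = smult S c v)"

definition homogeneous_basis ::
  "('a, 'm::ab_group_add) voa_system \<Rightarrow> 'a \<Rightarrow> 'm set \<Rightarrow> bool" where
  "homogeneous_basis S \<alpha> B \<longleftrightarrow>
     \<not> module.dependent (smult S) B \<and> module.span (smult S) B = carr S \<alpha> \<and>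
     (\<forall>b\<in>B. \<exists>c. b \<in> wspace S (carr S \<alpha>) (mode S \<alpha>) c)"

definition dual_basis ::
  "('a, 'm) voa_system \<Rightarrow> 'a \<Rightarrow> 'm set \<Rightarrow> ('m \<Rightarrow> 'm) \<Rightarrow> bool" where
  "dual_basis S \<alpha> B b' \<longleftrightarrow>
     (\<forall>b\<in>B. b' b \<in> carr S (dual S \<alpha>)) \<and>
     (\<forall>b\<in>B. \<forall>c\<in>B. pairing S \<alpha> b (b' c) = (if b = c then 1 else 0))"


section \<open>Formal series\<close>

text \<open>The variables \<open>x\<close>, \<open>y\<^sub>k\<close>, \<open>w\<^sub>a\<close>, \<open>\<rho>\<^sub>a\<close> (\<open>a > 0\<close>) and \<open>A\<^sub>\<ell>\<close>. A series is
  its coefficient function on monomials, a monomial its complex exponent vector.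

  A series with integral exponents belongs to the ring of iterated Laurent series
  determined by an order of the variables, with the \<open>\<rho>\<^sub>a\<close> smallest; the series below lie in
  products of this ring with a monomial (half-integral powers of \<open>\<rho>\<^sub>a\<close> and complex
  powers occur only in this way), so that the sums in \<open>ser_mult\<close> are finite.\<close>

datatype var = VarX | VarY nat | VarW int | VarR nat | VarA nat

type_synonym monom = "var \<Rightarrow> complex"
type_synonym ser = "monom \<Rightarrow> complex"

definition ser_mult :: "ser \<Rightarrow> ser \<Rightarrow> ser" (infixl "\<odot>" 70) where
  "f \<odot> g = (\<lambda>e. \<Sum>d | f d \<noteq> 0 \<and> g (\<lambda>u. e u - d u) \<noteq> 0. f d * g (\<lambda>u. e u - d u))"

definition ser_smult :: "complex \<Rightarrow> ser \<Rightarrow> ser" where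
  "ser_smult c f = (\<lambda>e. c * f e)"

definition ser_sum :: "('i \<Rightarrow> ser) \<Rightarrow> ser" where
  "ser_sum f = (\<lambda>e. lfsum (\<lambda>i. f i e))"

definition mon :: "monom \<Rightarrow> ser" where
  "mon d = (\<lambda>e. if e = d then 1 else 0)"

definition pw :: "var \<Rightarrow> complex \<Rightarrow> ser" where
  "pw u c = mon (\<lambda>u'. if u' = u then c else 0)"

definition pd :: "var \<Rightarrow> ser \<Rightarrow> ser" where
  "pd u f = (\<lambda>e. (e u + 1) * f (e(u := e u + 1)))"

definition pdd :: "var \<Rightarrow> nat \<Rightarrow> ser \<Rightarrow> ser" where
  "pdd u m f = ser_smult (1 / fact m) ((pd u ^^ m) f)"


section \<open>Correlation forms\<close>

text \<open>An operator \<open>(z, \<alpha>, v, \<beta>)\<close> in a list stands for the intertwining operator applied to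
  \<open>v\<close> of label \<open>\<alpha>\<close> at \<open>z\<close>, with source label \<open>\<beta>\<close>; its target label is the source
  label of its left neighbour. \<open>op_prod\<close> is the coefficient, in the product applied to the
  vacuum, of the monomial with exponents \<open>e\<close>.\<close>

primrec op_prod :: "('a, 'm) voa_system \<Rightarrow> monom \<Rightarrow> 'a \<Rightarrow> (var \<times> 'a \<times> 'm \<times> 'a) list \<Rightarrow> 'm" where
  "op_prod S e \<gamma> [] = vac S"
| "op_prod S e \<gamma> (q # qs) =
     (case q of (z, \<alpha>, v, \<beta>) \<Rightarrow> inter S \<gamma> \<alpha> \<beta> v (- e z - 1) (op_prod S e \<beta> qs))"

definition vev :: "('a, 'm) voa_system \<Rightarrow> (var \<times> 'a \<times> 'm \<times> 'a) list \<Rightarrow> ser" where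
  "vev S qs = (\<lambda>e. if \<forall>u. u \<notin> fst ` set qs \<longrightarrow> e u = 0
                   then pairing S (lab0 S) (vac S) (op_prod S e (lab0 S) qs) else 0)"

text \<open>\<open>\<beta>\<^sub>j\<close> for \<open>1 \<le> j \<le> 2g-1\<close>, and label \<open>0\<close> at both ends of the chain.\<close>

definition int_lab :: "('a, 'm) voa_system \<Rightarrow> nat \<Rightarrow> (nat \<Rightarrow> 'a) \<Rightarrow> nat \<Rightarrow> 'a" where
  "int_lab S g \<beta> j = (if 1 \<le> j \<and> j < 2 * g then \<beta> j else lab0 S)"

definition handle_ops ::
  "('a, 'm) voa_system \<Rightarrow> nat \<Rightarrow> (nat \<Rightarrow> 'a) \<Rightarrow> (nat \<Rightarrow> 'a) \<Rightarrow> (nat \<Rightarrow> 'm \<Rightarrow> 'm) \<Rightarrow> (nat \<Rightarrow> 'm)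
    \<Rightarrow> (var \<times> 'a \<times> 'm \<times> 'a) list" where
  "handle_ops S g \<alpha> \<beta> b' b = concat (map (\<lambda>a.
     [(VarW (int a), \<alpha> a, b a, int_lab S g \<beta> (2 * a - 1)),
      (VarW (- int a), dual S (\<alpha> a), b' a (b a), int_lab S g \<beta> (2 * a))]) [1..<Suc g])"

definition admissible ::
  "('a, 'm::ab_group_add) voa_system \<Rightarrow> nat \<Rightarrow> (nat \<Rightarrow> 'a) \<Rightarrow> (nat \<Rightarrow> 'a) \<Rightarrow> bool" where
  "admissible S g \<alpha> \<beta> \<longleftrightarrow>
     \<beta> 1 = dual S (\<alpha> 1) \<and> \<beta> (2 * g - 1) = dual S (\<alpha> g) \<and>
     (\<forall>a\<in>{1..g}.
        fusion S (int_lab S g \<beta> (2 * a - 2)) (\<alpha> a) (int_lab S g \<beta> (2 * a - 1)) \<noteq> 0 \<and>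
        fusion S (int_lab S g \<beta> (2 * a - 1)) (dual S (\<alpha> a)) (int_lab S g \<beta> (2 * a)) \<noteq> 0)"

text \<open>A form \<open>h dx\<^bsup>k\<^esup> \<Prod> dy\<^sub>k\<^bsup>m\<^sub>k\<^esup>\<close> is the coefficient \<open>h\<close> together with the powers of
  the differentials.\<close>

type_synonym form = "ser \<times> (var \<Rightarrow> complex)"

text \<open>An insertion is \<open>(z, \<gamma>, v, m)\<close>: the vector \<open>v\<close> of label \<open>\<gamma>\<close> and weight \<open>m\<close> at \<open>z\<close>.
  The last insertion has source label \<open>0\<close>. The factor \<open>\<rho>\<^sub>a\<^bsup>wt(b\<^sub>a)\<^esup>\<close> of \<open>b\<^bsub>-a\<^esub>\<close> is
  taken out of the intertwining operator.\<close>

definition corr_form ::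
  "('a, 'm) voa_system \<Rightarrow> nat \<Rightarrow> (nat \<Rightarrow> 'm set) \<Rightarrow> (nat \<Rightarrow> 'm \<Rightarrow> 'm)
    \<Rightarrow> (nat \<Rightarrow> 'a) \<Rightarrow> (nat \<Rightarrow> 'a) \<Rightarrow> (var \<times> 'a \<times> 'm \<times> complex) list \<Rightarrow> 'a list \<Rightarrow> form" where
  "corr_form S g B b' \<alpha> \<beta> ins \<delta> =
     (let ops = map (\<lambda>((z, \<gamma>, v, m), \<delta>'). (z, \<gamma>, v, \<delta>')) (zip ins (\<delta> @ [lab0 S])) in
      (ser_sum (\<lambda>b. if b \<in> (\<Pi>\<^sub>E a\<in>{1..g}. B a)
         then mon (\<lambda>u. case u of VarR a \<Rightarrow> if a \<in> {1..g} then wt S (\<alpha> a) (b a) else 0 | _ \<Rightarrow> 0)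
              \<odot> vev S (ops @ handle_ops S g \<alpha> \<beta> b' b)
         else 0),
       \<lambda>u. \<Sum>(z, \<gamma>, v, m)\<leftarrow>ins. if z = u then m else 0))"


section \<open>The Bers quasiform and the differential operator\<close>

definition idx :: "nat \<Rightarrow> int set" where
  "idx g = {a. a \<noteq> 0 \<and> \<bar>a\<bar> \<le> int g}"

definition rho :: "int \<Rightarrow> var" where
  "rho a = VarR (nat \<bar>a\<bar>)"

text \<open>Rational functions are expanded in the region \<open>|u| > |v|\<close> for \<open>r u > r v\<close>. The region
  is that of the correlation form with \<open>Y(\<omega>,x)\<close> inserted on the left, i.e.
  \<open>|x| > |y\<^sub>1| > \<dots> > |y\<^sub>n| > |w\<^sub>1| > |w\<^bsub>-1\<^esub>| > \<dots> > |w\<^sub>g| > |w\<^bsub>-g\<^esub>|\<close>; the positions of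
  the parameters \<open>A\<^sub>\<ell>\<close>, on which the correlation forms do not depend, are arbitrary.\<close>

definition wpos :: "int \<Rightarrow> int" where
  "wpos a = (if a > 0 then 2 * a - 1 else - 2 * a)"

definition expansion_order :: "nat \<Rightarrow> nat \<Rightarrow> (var \<Rightarrow> nat) \<Rightarrow> bool" where
  "expansion_order g n r \<longleftrightarrow>
     inj_on r ({VarX} \<union> VarY ` {1..n} \<union> VarW ` idx g \<union> VarA ` {0..2}) \<and>
     (\<forall>k\<in>{1..n}. r (VarY k) < r VarX) \<and>
     (\<forall>k\<in>{1..n}. \<forall>l\<in>{1..n}. k < l \<longrightarrow> r (VarY l) < r (VarY k)) \<and>
     (\<forall>a\<in>idx g. r (VarW a) < r VarX) \<and>
     (\<forall>a\<in>idx g. \<forall>k\<in>{1..n}. r (VarW a) < r (VarY k)) \<and>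
     (\<forall>a\<in>idx g. \<forall>b\<in>idx g. wpos a < wpos b \<longrightarrow> r (VarW b) < r (VarW a))"

text \<open>The expansion of \<open>1/(u-v)\<close>.\<close>

definition inv_diff :: "(var \<Rightarrow> nat) \<Rightarrow> var \<Rightarrow> var \<Rightarrow> ser" where
  "inv_diff r u v =
     (if r v < r u then ser_sum (\<lambda>k::nat. pw v (of_nat k) \<odot> pw u (- of_nat k - 1))
      else - ser_sum (\<lambda>k::nat. pw u (of_nat k) \<odot> pw v (- of_nat k - 1)))"

text \<open>\<open>\<pi>\<^sub>2(u,v)\<close>.\<close>

definition pi2 :: "(var \<Rightarrow> nat) \<Rightarrow> var \<Rightarrow> var \<Rightarrow> ser" where
  "pi2 r u v =
     (let q = (\<lambda>l. (pw v 1 - pw (VarA l) 1) \<odot> inv_diff r u (VarA l))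
      in inv_diff r u v \<odot> (q 0 \<odot> q 1 \<odot> q 2))"

text \<open>The functions \<open>f\<^sub>\<ell>\<close> with \<open>\<pi>\<^sub>2(u,v) = 1/(u-v) + \<Sum>\<^sub>\<ell> f\<^sub>\<ell>(u) v\<^sup>\<ell>\<close>. They are determined by
  this identity, which is checked for rational functions in \<open>pi2_decomposition\<close>.\<close>

lemma pi2_decomposition:
  fixes u v A0 A1 A2 :: "'k::field"
  assumes "u \<noteq> v" "u \<noteq> A0" "u \<noteq> A1" "u \<noteq> A2"
  shows "1 / (u - v) * ((v - A0) / (u - A0) * ((v - A1) / (u - A1)) * ((v - A2) / (u - A2))) =
    1 / (u - v)
    + (- (u\<^sup>2 - (A0 + A1 + A2) * u + (A0 * A1 + A0 * A2 + A1 * A2)) / ((u - A0) * (u - A1) * (u - A2)))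
    + (- (u - (A0 + A1 + A2)) / ((u - A0) * (u - A1) * (u - A2))) * v
    + (- 1 / ((u - A0) * (u - A1) * (u - A2))) * v\<^sup>2"
proof -
  have "u - v \<noteq> 0" "u - A0 \<noteq> 0" "u - A1 \<noteq> 0" "u - A2 \<noteq> 0" using assms by auto
  then show ?thesis
    by (simp add: divide_simps) (simp add: algebra_simps power2_eq_square)
qed

definition f2 :: "(var \<Rightarrow> nat) \<Rightarrow> nat \<Rightarrow> var \<Rightarrow> ser" where
  "f2 r l u =
     (let A = (\<lambda>i. pw (VarA i) 1); s1 = A 0 + A 1 + A 2; s2 = A 0 \<odot> A 1 + A 0 \<odot> A 2 + A 1 \<odot> A 2;
          num = (if l = 0 then pw u 2 - s1 \<odot> pw u 1 + s2 else if l = 1 then pw u 1 - s1 else pw u 0)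
      in - (num \<odot> (inv_diff r u (VarA 0) \<odot> inv_diff r u (VarA 1) \<odot> inv_diff r u (VarA 2))))"

text \<open>Rows, columns and matrices of series are indexed by pairs \<open>(a,m)\<close> with \<open>a\<close> in
  \<open>\<I> = {\<plusminus>1, \<dots>, \<plusminus>g}\<close> and \<open>m \<ge> 0\<close>.\<close>

type_synonym mindex = "int \<times> nat"

definition dot :: "nat \<Rightarrow> (mindex \<Rightarrow> ser) \<Rightarrow> (mindex \<Rightarrow> ser) \<Rightarrow> ser" where
  "dot g p q = ser_sum (\<lambda>i. if fst i \<in> idx g then p i \<odot> q i else 0)"

definition row_mult :: "nat \<Rightarrow> (mindex \<Rightarrow> ser) \<Rightarrow> (mindex \<Rightarrow> mindex \<Rightarrow> ser) \<Rightarrow> mindex \<Rightarrow> ser" where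
  "row_mult g p M = (\<lambda>j. dot g p (\<lambda>i. M i j))"

definition mat_mult ::
  "nat \<Rightarrow> (mindex \<Rightarrow> mindex \<Rightarrow> ser) \<Rightarrow> (mindex \<Rightarrow> mindex \<Rightarrow> ser) \<Rightarrow> mindex \<Rightarrow> mindex \<Rightarrow> ser" where
  "mat_mult g M N = (\<lambda>i. row_mult g (M i) N)"

definition mat_id :: "mindex \<Rightarrow> mindex \<Rightarrow> ser" where
  "mat_id i j = (if i = j then mon (\<lambda>_. 0) else 0)"

definition mat_geometric :: "nat \<Rightarrow> (mindex \<Rightarrow> mindex \<Rightarrow> ser) \<Rightarrow> mindex \<Rightarrow> mindex \<Rightarrow> ser" where
  "mat_geometric g M = (\<lambda>i j. ser_sum (\<lambda>k::nat. ((mat_mult g M ^^ k) mat_id) i j))"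

definition Lrow :: "(var \<Rightarrow> nat) \<Rightarrow> mindex \<Rightarrow> ser" where
  "Lrow r = (\<lambda>(b, n). pw (rho b) (of_nat n / 2) \<odot> pdd (VarW b) n (pi2 r VarX (VarW b)))"

definition Rcol :: "(var \<Rightarrow> nat) \<Rightarrow> var \<Rightarrow> mindex \<Rightarrow> ser" where
  "Rcol r y = (\<lambda>(a, m). pw (rho a) (of_nat (m + 1) / 2) \<odot> pdd (VarW (- a)) m (pi2 r (VarW (- a)) y))"

definition Amat :: "(var \<Rightarrow> nat) \<Rightarrow> mindex \<Rightarrow> mindex \<Rightarrow> ser" where
  "Amat r = (\<lambda>(a, m) (b, n).
     if a \<noteq> - b then
       pw (rho a) (of_nat (m + 1) / 2) \<odot> pw (rho b) (of_nat n / 2) \<odot>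
         pdd (VarW (- a)) m (pdd (VarW b) n (pi2 r (VarW (- a)) (VarW b)))
     else
       pw (rho a) (of_nat (m + n + 1) / 2) \<odot>
         (\<Sum>l\<le>2. ser_smult (of_nat (l choose n))
            (pdd (VarW (- a)) m (f2 r l (VarW (- a))) \<odot> pw (VarW (- a)) (of_nat l - of_nat n))))"

definition Delta :: "mindex \<Rightarrow> mindex \<Rightarrow> ser" where
  "Delta = (\<lambda>(a, m) (b, n). if m = n + 3 \<and> a = b then mon (\<lambda>_. 0) else 0)"

text \<open>\<open>Linv\<close> is the row \<open>L\<Delta>(I - A\<Delta>)\<^bsup>-1\<^esup>\<close>.\<close>

definition Linv :: "nat \<Rightarrow> (var \<Rightarrow> nat) \<Rightarrow> mindex \<Rightarrow> ser" where
  "Linv g r = row_mult g (row_mult g (Lrow r) Delta) (mat_geometric g (mat_mult g (Amat r) Delta))"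

text \<open>The quasiform and the 2-forms are represented by their expansions in the \<open>\<rho>\<^sub>a\<close>, in which
  the \<open>A\<^sub>\<ell>\<close> are independent of the other variables. Below are the coefficients of \<open>\<Psi>\<^sub>2(x,y)\<close> (as \<open>dx\<^sup>2 dy\<^bsup>-1\<^esup>\<close>) and of \<open>T\<^sub>a\<^sup>\<ell>(x)\<close>, \<open>\<Theta>\<^sub>2\<^sub>,\<^sub>a\<^sup>\<ell>(x)\<close>
  (as \<open>dx\<^sup>2\<close>).\<close>

definition psi2 :: "nat \<Rightarrow> (var \<Rightarrow> nat) \<Rightarrow> var \<Rightarrow> ser" where
  "psi2 g r y = pi2 r VarX y + dot g (Linv g r) (Rcol r y)"

definition Tform :: "nat \<Rightarrow> (var \<Rightarrow> nat) \<Rightarrow> int \<Rightarrow> nat \<Rightarrow> ser" where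
  "Tform g r a l =
     pw (rho a) (- of_nat l / 2) \<odot> (Lrow r (a, l) + row_mult g (Linv g r) (Amat r) (a, l))"

definition Theta :: "nat \<Rightarrow> (var \<Rightarrow> nat) \<Rightarrow> nat \<Rightarrow> nat \<Rightarrow> ser" where
  "Theta g r a l =
     Tform g r (int a) l + pw (VarR a) (1 - of_nat l) \<odot> Tform g r (- int a) (2 - l)"

definition schottky_pd :: "nat \<Rightarrow> nat \<Rightarrow> ser \<Rightarrow> ser" where
  "schottky_pd a l h =
     (if l = 0 then pd (VarW (int a)) h
      else if l = 1 then pw (VarR a) 1 \<odot> pd (VarR a) h
      else pw (VarR a) 1 \<odot> pd (VarW (- int a)) h)"

definition nabla :: "nat \<Rightarrow> (var \<Rightarrow> nat) \<Rightarrow> ser \<Rightarrow> ser" where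
  "nabla g r h = (\<Sum>a=1..g. \<Sum>l\<le>2. Theta g r a l \<odot> schottky_pd a l h)"

definition nabla_form :: "nat \<Rightarrow> (var \<Rightarrow> nat) \<Rightarrow> nat \<Rightarrow> (nat \<Rightarrow> complex) \<Rightarrow> form \<Rightarrow> form" where
  "nabla_form g r n m H =
     (nabla g r (fst H)
        + (\<Sum>k=1..n. psi2 g r (VarY k) \<odot> pd (VarY k) (fst H)
                    + ser_smult (m k) (pd (VarY k) (psi2 g r (VarY k)) \<odot> fst H)),
      (snd H)(VarX := snd H VarX + 2))"

end

theory Submission
  imports Defs
begin

text \<open>The identity is the conformal Ward identity on the sphere, with the \<open>2g\<close> ends of the handles
  as further points, solved for those modes of the conformal vector that are not differential
  operators.

  Moving \<open>Y(\<omega>,x)\<close> through the chain of intertwining operators turns it into a sum over all points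
  \<open>z\<close> of the modes \<open>L(s-1)\<close> applied to the vector at \<open>z\<close>, with coefficients the divided derivatives
  \<open>\<partial>\<^sub>z\<^sup>s\<close> of \<open>1/(x-z)\<close>. The vacuum is annihilated by \<open>L(-1)\<close>, \<open>L(0)\<close> and \<open>L(1)\<close> on both sides
  (\<open>ward\<close>), so that the polynomials \<open>f\<^sub>\<ell>(x)z\<^sup>\<ell>\<close> may be added to the kernel, and \<open>1/(x-z)\<close>
  becomes \<open>\<pi>\<^sub>2(x,z)\<close> (\<open>conf_pi2\<close>). At a primary vector only \<open>s = 0\<close> and \<open>s = 1\<close> contribute, and give
  the derivative and the weight. At the end \<open>w\<^sub>a\<close> of a handle one sums over dual bases, and there
  \<open>L(k)\<close> at one end is \<open>\<rho>\<^sub>a\<^sup>k\<close> times \<open>L(-k)\<close> at the other (\<open>D_dual\<close>). Hence the modes \<open>s = 0, 1, 2\<close>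
  are \<open>\<partial>\<^sub>w\<close> at \<open>w\<^sub>a\<close>, \<open>\<rho>\<^sub>a\<partial>\<^sub>\<rho>\<close>, and \<open>\<rho>\<^sub>a\<partial>\<^sub>w\<close> at \<open>w\<^bsub>-a\<^esub>\<close>: these are the operators in \<open>\<nabla>(x)\<close>.

  The mode \<open>s = j+3\<close> at \<open>w\<^sub>a\<close> is, by the same duality, a creation mode \<open>L(-j-2)\<close> at \<open>w\<^bsub>-a\<^esub>\<close>. Such a
  mode is a Taylor coefficient of the regular part of the conformal field at \<open>w\<^bsub>-a\<^esub>\<close>, and so it is
  again a sum over the modes at the other points, with the derivatives of \<open>\<pi>\<^sub>2(w\<^bsub>-a\<^esub>,z)\<close> as
  coefficients (\<open>creation_mode\<close>, \<open>D_creation\<close>). The suitably normalised modes \<open>X\<close> therefore satisfy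
  a linear recursion with matrix \<open>A\<close> (\<open>X_recursion\<close>). Solving it for the modes beyond \<open>2\<close> requires
  the inverse of \<open>I - A\<Delta>\<close> (\<open>Linv_solve\<close>), and substituting the solution produces \<open>\<Psi>\<^sub>2\<close> and
  the \<open>\<Theta>\<close>.

  All of this takes place among formal series with complex exponents, where a product is meaningful
  only if its coefficients are finite sums. Every series that occurs has its exponents in a cone,
  given by finitely many linear forms whose values lie in a translate of the natural numbers. The
  forms separate the exponents, so two cones always give finite convolutions (\<open>cone_finite\<close>), and
  the laws of a commutative ring follow. For the correlation series the forms are partial sums of
  exponents; these are weights of intermediate states, and the cone condition is the lower bound on
  the weights of a module (\<open>good_C\<close>).\<close>

section \<open>Formal series\<close>

lemma lfsum_eq_sum:
  assumes "finite A" "\<And>i. i \<notin> A \<Longrightarrow> f i = 0"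
  shows "lfsum f = sum f A"
  unfolding lfsum_def using assms by (intro sum.mono_neutral_left) auto

lemma lfsum_zero [simp]: "lfsum (\<lambda>i. 0) = 0"
  by (simp add: lfsum_def)

lemma lfsum_single: "lfsum (\<lambda>i. if i = j then x else 0) = x"
  by (subst lfsum_eq_sum[of "{j}"]) auto

lemma lfsum_cong: "(\<And>i. f i = h i) \<Longrightarrow> lfsum f = lfsum h"
  by (simp add: lfsum_def)

lemma lfsum_le:
  assumes "\<And>i. i > N \<Longrightarrow> f i = 0"
  shows "lfsum f = (\<Sum>i\<le>N::nat. f i)"
  by (rule lfsum_eq_sum) (use assms in auto)

lemma lfsum_cmult:
  fixes f :: "'i \<Rightarrow> complex"
  shows "lfsum (\<lambda>i. c * f i) = c * lfsum f"
proof (cases "c = 0")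
  case False
  then show ?thesis by (simp add: lfsum_def sum_distrib_left)
qed simp

lemma lfsum_add:
  assumes "finite {i. f i \<noteq> 0}" "finite {i. g i \<noteq> 0}"
  shows "lfsum (\<lambda>i. f i + g i) = lfsum f + lfsum g"
proof -
  let ?A = "{i. f i \<noteq> 0} \<union> {i. g i \<noteq> 0}"
  have fin: "finite ?A" using assms by simp
  have "lfsum (\<lambda>i. f i + g i) = (\<Sum>i\<in>?A. f i + g i)" by (rule lfsum_eq_sum[OF fin]) auto
  also have "\<dots> = sum f ?A + sum g ?A" by (rule sum.distrib)
  also have "sum f ?A = lfsum f" by (rule lfsum_eq_sum[OF fin, symmetric]) auto
  also have "sum g ?A = lfsum g" by (rule lfsum_eq_sum[OF fin, symmetric]) auto
  finally show ?thesis .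
qed

lemma lfsum_uminus:
  fixes f :: "'i \<Rightarrow> 'b::ab_group_add"
  shows "lfsum (\<lambda>i. - f i) = - lfsum f"
  by (simp add: lfsum_def sum_negf)

lemma lfsum_swap:
  assumes "finite {(i, j). f i j \<noteq> 0}"
  shows "lfsum (\<lambda>i. lfsum (\<lambda>j. f i j)) = lfsum (\<lambda>j. lfsum (\<lambda>i. f i j))"
proof -
  let ?A = "fst ` {(i, j). f i j \<noteq> 0}" and ?B = "snd ` {(i, j). f i j \<noteq> 0}"
  have fin: "finite ?A" "finite ?B" using assms by auto
  have 1: "lfsum (\<lambda>j. f i j) = (\<Sum>j\<in>?B. f i j)" for i
    by (rule lfsum_eq_sum[OF fin(2)]) force
  have 2: "lfsum (\<lambda>i. f i j) = (\<Sum>i\<in>?A. f i j)" for j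
    by (rule lfsum_eq_sum[OF fin(1)]) force
  have "lfsum (\<lambda>i. lfsum (\<lambda>j. f i j)) = (\<Sum>i\<in>?A. \<Sum>j\<in>?B. f i j)"
    unfolding 1 by (rule lfsum_eq_sum[OF fin(1)], rule sum.neutral) force
  also have "\<dots> = (\<Sum>j\<in>?B. \<Sum>i\<in>?A. f i j)" by (rule sum.swap)
  also have "\<dots> = lfsum (\<lambda>j. lfsum (\<lambda>i. f i j))"
    unfolding 2 by (rule lfsum_eq_sum[OF fin(2), symmetric], rule sum.neutral) force
  finally show ?thesis .
qed

lemma lfsum_pair:
  assumes "finite {(i, j). f i j \<noteq> 0}"
  shows "lfsum (\<lambda>i. lfsum (\<lambda>j. f i j)) = lfsum (\<lambda>(i, j). f i j)"
proof -
  let ?A = "fst ` {(i, j). f i j \<noteq> 0}" and ?B = "snd ` {(i, j). f i j \<noteq> 0}"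
  have fin: "finite ?A" "finite ?B" using assms by auto
  have 1: "lfsum (\<lambda>j. f i j) = (\<Sum>j\<in>?B. f i j)" for i
    by (rule lfsum_eq_sum[OF fin(2)]) force
  have "lfsum (\<lambda>i. lfsum (\<lambda>j. f i j)) = (\<Sum>i\<in>?A. \<Sum>j\<in>?B. f i j)"
    unfolding 1 by (rule lfsum_eq_sum[OF fin(1)], rule sum.neutral) force
  also have "\<dots> = (\<Sum>(i,j)\<in>?A \<times> ?B. f i j)" by (rule sum.cartesian_product)
  also have "\<dots> = lfsum (\<lambda>(i, j). f i j)"
    by (rule lfsum_eq_sum[symmetric]) (use fin in force)+
  finally show ?thesis .
qed

lemma lfsum_sum:
  assumes "finite A" "\<And>a. a \<in> A \<Longrightarrow> finite {i. f a i \<noteq> 0}"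
  shows "lfsum (\<lambda>i. \<Sum>a\<in>A. f a i) = (\<Sum>a\<in>A. lfsum (f a))"
proof -
  let ?B = "\<Union>a\<in>A. {i. f a i \<noteq> 0}"
  have fin: "finite ?B" using assms by auto
  have "lfsum (\<lambda>i. \<Sum>a\<in>A. f a i) = (\<Sum>i\<in>?B. \<Sum>a\<in>A. f a i)"
    by (rule lfsum_eq_sum[OF fin], rule sum.neutral) auto
  also have "\<dots> = (\<Sum>a\<in>A. \<Sum>i\<in>?B. f a i)" by (rule sum.swap)
  also have "\<dots> = (\<Sum>a\<in>A. lfsum (f a))"
    by (rule sum.cong[OF refl], rule lfsum_eq_sum[OF fin, symmetric]) auto
  finally show ?thesis .
qed

lemma ser_mult_alt: "(f \<odot> g) e = (\<Sum>d | f d \<noteq> 0 \<and> g (e - d) \<noteq> 0. f d * g (e - d))"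
  by (simp add: ser_mult_def fun_diff_def)

lemma ser_mult_eq_sum:
  assumes "finite D" "\<And>d. f d \<noteq> 0 \<Longrightarrow> g (e - d) \<noteq> 0 \<Longrightarrow> d \<in> D"
  shows "(f \<odot> g) e = (\<Sum>d\<in>D. f d * g (e - d))"
  unfolding ser_mult_alt using assms by (intro sum.mono_neutral_left) auto

lemma ser_mult_nonzeroE:
  assumes "(f \<odot> g) e \<noteq> 0"
  obtains d where "f d \<noteq> 0" "g (e - d) \<noteq> 0"
proof -
  have "{d. f d \<noteq> 0 \<and> g (e - d) \<noteq> 0} \<noteq> {}"
    using assms unfolding ser_mult_alt by force
  then show ?thesis using that by blast
qed

lemma ser_mult_commute: "f \<odot> g = g \<odot> f"
proof
  fix e
  show "(f \<odot> g) e = (g \<odot> f) e"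
    unfolding ser_mult_alt
    by (rule sum.reindex_bij_witness[of _ "\<lambda>d. e - d" "\<lambda>d. e - d"]) auto
qed

lemma ser_mult_zero [simp]: "0 \<odot> f = 0" "f \<odot> 0 = 0"
  by (auto simp: ser_mult_alt fun_eq_iff)

lemma mon_mult: "(mon d \<odot> g) e = g (e - d)"
  by (subst ser_mult_eq_sum[of "{d}"]) (auto simp: mon_def split: if_splits)

lemma mon_mult_mon: "mon c \<odot> mon d = mon (c + d)"
  by (rule ext) (simp add: mon_mult, simp add: mon_def diff_eq_eq add.commute)

text \<open>A monomial only shifts the exponents, so that associativity holds here even where the
  convolution of \<open>f\<close> and \<open>g\<close> is an infinite sum.\<close>

lemma mon_mult_assoc: "(mon d \<odot> f) \<odot> g = mon d \<odot> (f \<odot> g)"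
proof
  fix e
  show "((mon d \<odot> f) \<odot> g) e = (mon d \<odot> (f \<odot> g)) e"
    unfolding mon_mult unfolding ser_mult_alt mon_mult
    by (rule sum.reindex_bij_witness[of _ "\<lambda>c. c + d" "\<lambda>c. c - d"]) (auto simp: algebra_simps)
qed

lemma mult_mon_left_commute: "f \<odot> (mon d \<odot> g) = mon d \<odot> (f \<odot> g)"
  by (simp only: ser_mult_commute[of f] mon_mult_assoc)

lemma mon_zero_mult [simp]: "mon (\<lambda>_. 0) \<odot> f = f" "f \<odot> mon (\<lambda>_. 0) = f"
  by (auto simp: fun_eq_iff mon_mult ser_mult_commute[of f] fun_diff_def)

lemma mon_add: "mon d \<odot> (f + g) = mon d \<odot> f + mon d \<odot> g"
  by (auto simp: fun_eq_iff mon_mult)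

lemma ser_sum_morphism:
  assumes "\<And>f g. h (f + g) = h f + h (g :: ser)" "h 0 = 0"
  shows "h (\<Sum>i\<in>A. f i) = (\<Sum>i\<in>A. h (f i) :: ser)"
proof (induction A rule: infinite_finite_induct)
  case (infinite A)
  show ?case unfolding sum.infinite[OF infinite] by (rule assms)
next
  case empty
  show ?case unfolding sum.empty by (rule assms)
next
  case (insert x F)
  show ?case unfolding sum.insert[OF insert(1,2)] assms insert(3) by (rule refl)
qed

lemma mon_sum: "mon d \<odot> (\<Sum>i\<in>A. f i) = (\<Sum>i\<in>A. mon d \<odot> f i)"
  by (rule ser_sum_morphism) (rule mon_add, rule ser_mult_zero)

lemma sum_ser_apply: "(\<Sum>i\<in>A. f i) e = (\<Sum>i\<in>A. (f i :: ser) e)"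
  by (induction A rule: infinite_finite_induct) auto

lemma mon_ser_sum: "mon d \<odot> ser_sum f = ser_sum (\<lambda>i. mon d \<odot> f i)"
  by (auto simp: fun_eq_iff mon_mult ser_sum_def)

lemma ser_smult_mult: "ser_smult c f \<odot> g = ser_smult c (f \<odot> g)"
proof (cases "c = 0")
  case False
  then show ?thesis by (auto simp: fun_eq_iff ser_mult_alt ser_smult_def sum_distrib_left mult.assoc)
next
  case True
  then show ?thesis by (simp add: ser_smult_def ser_mult_alt fun_eq_iff)
qed

lemma mult_ser_smult: "f \<odot> ser_smult c g = ser_smult c (f \<odot> g)"
  by (simp only: ser_mult_commute[of f] ser_smult_mult)

text \<open>The exponents of a power of one variable.\<close>

definition sg :: "var \<Rightarrow> complex \<Rightarrow> monom" where
  "sg u c = (\<lambda>u'. if u' = u then c else 0)"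

lemma pw_eq_mon: "pw u c = mon (sg u c)"
  by (simp add: pw_def sg_def)

lemma sg_add: "sg u c + sg u d = sg u (c + d)"
  by (auto simp: sg_def)

lemma sg_same [simp]: "sg u c u = c" and sg_other [simp]: "v \<noteq> u \<Longrightarrow> sg u c v = 0"
  by (auto simp: sg_def)

lemma pw_mult_pw: "pw u c \<odot> pw u d = pw u (c + d)"
  by (simp add: pw_eq_mon mon_mult_mon sg_add)

lemma pw_zero: "pw u 0 = mon (\<lambda>_. 0)"
  by (simp add: pw_def)

lemma pw_pw_mult: "pw u x \<odot> (pw u y \<odot> f) = pw u (x + y) \<odot> f"
  by (simp only: pw_mult_pw[symmetric]) (simp only: pw_eq_mon mon_mult_assoc)

lemma pw_pair_cancel: "(pw u x \<odot> f) \<odot> (pw u (- x) \<odot> h) = f \<odot> h"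
proof -
  have "(pw u x \<odot> f) \<odot> (pw u (- x) \<odot> h) = pw u x \<odot> (f \<odot> (pw u (- x) \<odot> h))"
    unfolding pw_eq_mon by (rule mon_mult_assoc)
  also have "f \<odot> (pw u (- x) \<odot> h) = pw u (- x) \<odot> (f \<odot> h)"
    unfolding pw_eq_mon by (rule mult_mon_left_commute)
  also have "pw u x \<odot> \<dots> = f \<odot> h"
    unfolding pw_pw_mult right_minus pw_zero by (rule mon_zero_mult)
  finally show ?thesis .
qed

text \<open>Series of the form \<open>\<Sum>\<^sub>k c\<^sub>k z\<^bsup>d\<^sub>k\<^esup>\<close>, into which all derivatives of \<open>1/(u-v)\<close> expand.\<close>

definition mser :: "(nat \<Rightarrow> complex) \<Rightarrow> (nat \<Rightarrow> monom) \<Rightarrow> ser" where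
  "mser c d = ser_sum (\<lambda>k. ser_smult (c k) (mon (d k)))"

lemma mser_at: assumes "inj d" shows "mser c d (d k) = c k"
proof -
  have "mser c d (d k) = lfsum (\<lambda>j. if j = k then c k else 0)"
    unfolding mser_def ser_sum_def
    by (rule arg_cong[of _ _ lfsum], rule ext)
      (use injD[OF assms, of k] in \<open>auto simp: ser_smult_def mon_def\<close>)
  then show ?thesis by (simp add: lfsum_single)
qed

lemma mser_off: assumes "e \<notin> range d" shows "mser c d e = 0"
proof -
  have "mser c d e = lfsum (\<lambda>j::nat. 0)"
    unfolding mser_def ser_sum_def
    by (rule arg_cong[of _ _ lfsum], rule ext) (use assms in \<open>auto simp: ser_smult_def mon_def\<close>)
  then show ?thesis by simp
qed

text \<open>The exponents \<open>d k\<close> are distinct, so that the convolution can be indexed by \<open>k\<close>, and both sides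
  are sums over the same set, finite or not.\<close>

lemma mser_mult:
  assumes "inj d"
  shows "(mser c d \<odot> g) e = lfsum (\<lambda>k. c k * g (e - d k))"
proof -
  have "(mser c d \<odot> g) e = (\<Sum>x\<in>d ` {k. c k \<noteq> 0 \<and> g (e - d k) \<noteq> 0}. mser c d x * g (e - x))"
    unfolding ser_mult_alt
  proof (rule sum.cong)
    show "{x. mser c d x \<noteq> 0 \<and> g (e - x) \<noteq> 0} = d ` {k. c k \<noteq> 0 \<and> g (e - d k) \<noteq> 0}"
    proof (rule set_eqI)
      fix x
      show "x \<in> {x. mser c d x \<noteq> 0 \<and> g (e - x) \<noteq> 0} \<longleftrightarrow>
            x \<in> d ` {k. c k \<noteq> 0 \<and> g (e - d k) \<noteq> 0}"
      proof (cases "x \<in> range d")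
        case True
        then obtain k where "x = d k" by blast
        then show ?thesis using assms by (auto simp: mser_at inj_image_mem_iff)
      next
        case False
        then show ?thesis by (auto simp: mser_off)
      qed
    qed
  qed simp
  also have "\<dots> = (\<Sum>k | c k \<noteq> 0 \<and> g (e - d k) \<noteq> 0. c k * g (e - d k))"
    by (subst sum.reindex) (use assms in \<open>auto simp: mser_at inj_on_def dest: injD\<close>)
  also have "\<dots> = lfsum (\<lambda>k. c k * g (e - d k))"
    unfolding lfsum_def by (rule sum.cong) auto
  finally show ?thesis .
qed

lemma mser_eqI:
  assumes "inj d" "\<And>k. f (d k) = c k" "\<And>e. e \<notin> range d \<Longrightarrow> f e = 0"
  shows "f = mser c d"
proof
  fix e
  show "f e = mser c d e"
    by (cases "e \<in> range d") (use assms in \<open>auto simp: mser_at mser_off\<close>)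
qed

lemma pd_alt: "pd u f e = (e u + 1) * f (e + sg u 1)"
proof -
  have "e(u := e u + 1) = e + sg u 1" by (auto simp: sg_def)
  then show ?thesis by (simp add: pd_def)
qed

lemma pd_mser:
  assumes "inj d"
  shows "pd u (mser c d) = mser (\<lambda>k. c k * d k u) (\<lambda>k. d k - sg u 1)"
proof (rule mser_eqI)
  show "inj (\<lambda>k. d k - sg u 1)" using assms by (auto simp: inj_def)
  show "pd u (mser c d) (d k - sg u 1) = c k * d k u" for k
    using assms by (simp add: pd_alt mser_at)
  fix e assume "e \<notin> range (\<lambda>k. d k - sg u 1)"
  then have "e + sg u 1 \<notin> range d"
    by (auto simp: image_iff) (metis add_diff_cancel)
  then show "pd u (mser c d) e = 0" by (simp add: pd_alt mser_off)
qed

lemma gchoose_Suc_mult: "(a gchoose m) * (a - of_nat m) = of_nat (Suc m) * (a gchoose Suc m)"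
  for a :: complex
  using gbinomial_mult_1[of a m] by (simp add: algebra_simps)

section \<open>Cones of exponents\<close>

text \<open>As \<open>lfsum\<close> of an infinitely supported family is \<open>0\<close>, every interchange of sums needs this
  condition.\<close>

definition pfin :: "('i \<Rightarrow> ser) \<Rightarrow> bool" where
  "pfin f \<longleftrightarrow> (\<forall>e. finite {i. f i e \<noteq> 0})"

locale expansion =
  fixes g n :: nat and r :: "var \<Rightarrow> nat"
  assumes order: "expansion_order g n r"
begin

definition V0 :: "var set" where
  "V0 = {VarX} \<union> VarY ` {1..n} \<union> VarW ` idx g \<union> VarA ` {0..2}"

definition vars :: "var set" where
  "vars = V0 \<union> VarR ` {1..g}"

definition rdeg :: "monom \<Rightarrow> complex" where
  "rdeg e = (\<Sum>a=1..g. e (VarR a))"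

text \<open>The linear forms that bound the exponents. At a variable \<open>u\<close> other than the \<open>\<rho>\<^sub>a\<close> it is the sum of
  the exponents of all variables not larger than \<open>u\<close>, which for a correlation series is the weight
  of an intermediate state, minus the weights of the vectors that produce it. A derivative lowers
  this sum, but a derivative of high order always comes with a high power of some \<open>\<rho>\<^sub>a\<close>: this is why
  the \<open>\<rho>\<close>-degree is added, with a factor \<open>10\<close> that also pays for the poles of \<open>\<pi>\<^sub>2\<close>. The factors \<open>2\<close>
  turn the half-integral powers of \<open>\<rho>\<^sub>a\<close> into integral ones. The form at \<open>None\<close> is twice the total
  \<open>\<rho>\<close>-degree; it depends on the others, and serves to make the sums over matrix indices finite.\<close>

definition deg :: "var option \<Rightarrow> monom \<Rightarrow> complex" where
  "deg i e = (case i of None \<Rightarrow> 2 * rdeg e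
     | Some u \<Rightarrow> if u \<in> V0 then (\<Sum>u' | u' \<in> V0 \<and> r u' \<le> r u. e u') + 10 * rdeg e else 2 * e u)"

text \<open>The bound at \<open>None\<close> is split into \<open>c None\<close> and \<open>k\<close>, as \<open>k\<close> varies with the matrix indices and \<open>c\<close>
  does not.\<close>

definition cone :: "(var option \<Rightarrow> complex) \<Rightarrow> nat \<Rightarrow> monom \<Rightarrow> bool" where
  "cone c k e \<longleftrightarrow> (\<forall>u. u \<notin> vars \<longrightarrow> e u = 0) \<and>
     (\<forall>u\<in>vars. deg (Some u) e - c (Some u) \<in> \<nat>) \<and> deg None e - c None - of_nat k \<in> \<nat>"

definition good :: "(var option \<Rightarrow> complex) \<Rightarrow> nat \<Rightarrow> ser \<Rightarrow> bool" where
  "good c k f \<longleftrightarrow> (\<forall>e. f e \<noteq> 0 \<longrightarrow> cone c k e)"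

lemma finite_idx: "finite (idx g)"
  by (rule finite_subset[of _ "{- int g..int g}"]) (auto simp: idx_def)

lemma finite_V0: "finite V0"
  by (auto simp: V0_def finite_idx)

lemma finite_vars: "finite vars"
  by (auto simp: vars_def finite_V0)

lemma r_inj: "u \<in> V0 \<Longrightarrow> v \<in> V0 \<Longrightarrow> r u = r v \<Longrightarrow> u = v"
  using order unfolding expansion_order_def V0_def inj_on_def by blast

lemma VarR_V0 [simp]: "VarR a \<notin> V0"
  by (auto simp: V0_def)

lemma rdeg_add: "rdeg (d + e) = rdeg d + rdeg e"
  by (simp add: rdeg_def sum.distrib)

lemma deg_add: "deg i (d + e) = deg i d + deg i e"
  by (auto simp: deg_def rdeg_add sum.distrib algebra_simps split: option.split)

lemma deg_diff: "deg i (d - e) = deg i d - deg i e"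
  using deg_add[of i "d - e" e] by simp

lemma rdeg_sg: "rdeg (sg u x) = (if u \<in> VarR ` {1..g} then x else 0)"
proof (cases "\<exists>a. u = VarR a")
  case True
  then obtain a where a: "u = VarR a" by blast
  have "rdeg (sg u x) = (\<Sum>b=1..g. if b = a then x else 0)"
    unfolding rdeg_def by (rule sum.cong) (auto simp: a sg_def)
  then show ?thesis by (auto simp: a image_iff)
next
  case False
  then have "sg u x (VarR b) = 0" for b by (metis sg_other)
  with False show ?thesis by (auto simp: rdeg_def)
qed

lemma deg_sg_V0:
  assumes "u \<in> V0" "v \<in> V0"
  shows "deg (Some v) (sg u x) = (if r u \<le> r v then x else 0)"
proof -
  have "(\<Sum>u' | u' \<in> V0 \<and> r u' \<le> r v. sg u x u') = (\<Sum>u' | u' \<in> V0 \<and> r u' \<le> r v. if u' = u then x else 0)"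
    by (rule sum.cong) (auto simp: sg_def)
  moreover have "u \<notin> VarR ` {1..g}" using assms by auto
  ultimately show ?thesis using assms finite_V0 by (simp add: deg_def rdeg_sg)
qed

lemma deg_sg_V0_R:
  assumes "u \<in> V0"
  shows "deg (Some (VarR a)) (sg u x) = 0"
  using assms by (auto simp: deg_def sg_def)

lemma deg_sg_V0_None:
  assumes "u \<in> V0"
  shows "deg None (sg u x) = 0"
  using assms by (auto simp: deg_def rdeg_sg)

lemma deg_sg_R_V0:
  assumes "v \<in> V0" "a \<in> {1..g}"
  shows "deg (Some v) (sg (VarR a) x) = 10 * x"
proof -
  have "(\<Sum>u' | u' \<in> V0 \<and> r u' \<le> r v. sg (VarR a) x u') = 0"
    by (rule sum.neutral) (auto simp: sg_def)
  then show ?thesis using assms by (simp add: deg_def rdeg_sg)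
qed

lemma deg_sg_R_R: "deg (Some (VarR b)) (sg (VarR a) x) = (if a = b then 2 * x else 0)"
  by (auto simp: deg_def sg_def)

lemma deg_sg_R_None: "a \<in> {1..g} \<Longrightarrow> deg None (sg (VarR a) x) = 2 * x"
  by (auto simp: deg_def rdeg_sg)

text \<open>The partial sums determine the exponents one after the other, beginning with the smallest
  variable.\<close>

lemma deg_injective:
  assumes "\<And>u. u \<notin> vars \<Longrightarrow> d u = 0" "\<And>u. u \<in> vars \<Longrightarrow> deg (Some u) d = 0"
  shows "d = 0"
proof -
  have R: "d (VarR a) = 0" for a
  proof (cases "VarR a \<in> vars")
    case True
    then show ?thesis using assms(2)[of "VarR a"] by (simp add: deg_def)
  qed (simp add: assms(1))
  have rd: "rdeg d = 0" by (simp add: rdeg_def R)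
  have V: "d u = 0" if "u \<in> V0" for u
    using that
  proof (induction "r u" arbitrary: u rule: less_induct)
    case less
    have "(\<Sum>u' | u' \<in> V0 \<and> r u' \<le> r u. d u') = (\<Sum>u' \<in> {u}. d u')"
    proof (rule sum.mono_neutral_right)
      show "\<forall>i\<in>{u' \<in> V0. r u' \<le> r u} - {u}. d i = 0"
        using less r_inj by (metis (no_types, lifting) Diff_iff insertCI le_neq_implies_less mem_Collect_eq)
    qed (use finite_V0 less in auto)
    then show ?case using assms(2)[of u] less by (simp add: deg_def rd vars_def)
  qed
  show ?thesis
  proof
    fix u show "d u = 0 u"
      by (cases "u \<in> V0"; cases "u \<in> vars") (use V R assms(1) in \<open>auto simp: vars_def\<close>)
  qed
qed

text \<open>The values of the forms at \<open>d\<close> and \<open>e - d\<close> are, up to fixed translations, natural numbers with a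
  prescribed sum, and they determine \<open>d\<close>. Hence all products of series in cones are finite sums.\<close>

lemma cone_finite: "finite {d. cone c k d \<and> cone c' k' (e - d)}"
proof -
  let ?S = "{d. cone c k d \<and> cone c' k' (e - d)}"
  let ?\<phi> = "\<lambda>d. restrict (\<lambda>u. deg (Some u) d - c (Some u)) vars"
  let ?B = "\<lambda>u. (of_nat ` {.. nat \<lfloor>Re (deg (Some u) e - c (Some u) - c' (Some u))\<rfloor>} :: complex set)"
  have inj: "inj_on ?\<phi> ?S"
  proof (rule inj_onI)
    fix d d' assume S: "d \<in> ?S" "d' \<in> ?S" and eq: "?\<phi> d = ?\<phi> d'"
    have "deg (Some u) d = deg (Some u) d'" if "u \<in> vars" for u
      using fun_cong[OF eq, of u] that by simp
    moreover have "d u = 0" "d' u = 0" if "u \<notin> vars" for u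
      using S that by (auto simp: cone_def)
    ultimately have "d - d' = 0"
      by (intro deg_injective) (auto simp: deg_diff)
    then show "d = d'" by simp
  qed
  have "?\<phi> ` ?S \<subseteq> PiE vars ?B"
  proof (rule image_subsetI)
    fix d assume "d \<in> ?S"
    then have d: "cone c k d" "cone c' k' (e - d)" by auto
    show "?\<phi> d \<in> PiE vars ?B"
    proof (rule PiE_I)
      fix u assume u: "u \<in> vars"
      obtain j j' where j: "deg (Some u) d - c (Some u) = of_nat j"
        "deg (Some u) (e - d) - c' (Some u) = of_nat j'"
        using d u unfolding cone_def by (metis Nats_cases)
      have "deg (Some u) e - c (Some u) - c' (Some u) = of_nat j + of_nat j'"
        unfolding j[symmetric] by (simp add: deg_diff)
      then have "j \<le> nat \<lfloor>Re (deg (Some u) e - c (Some u) - c' (Some u))\<rfloor>"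
        by (simp add: le_nat_floor)
      then show "?\<phi> d u \<in> ?B u" using u j by auto
    qed simp
  qed
  moreover have "finite (PiE vars ?B)" by (intro finite_PiE finite_vars) auto
  ultimately have "finite (?\<phi> ` ?S)" by (rule finite_subset)
  then show ?thesis using inj finite_imageD by blast
qed

lemma good_conv_finite:
  assumes "good c k f" "good c' k' h"
  shows "finite {d. f d \<noteq> 0 \<and> h (e - d) \<noteq> 0}"
  by (rule finite_subset[OF _ cone_finite[of c k c' k' e]]) (use assms in \<open>auto simp: good_def\<close>)

lemma cone_add: "cone c k d \<Longrightarrow> cone c' k' d' \<Longrightarrow> cone (c + c') (k + k') (d + d')"
  unfolding cone_def
proof (intro conjI ballI allI impI; elim conjE)
  fix u assume "\<forall>u\<in>vars. deg (Some u) d - c (Some u) \<in> \<nat>" "\<forall>u\<in>vars. deg (Some u) d' - c' (Some u) \<in> \<nat>"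
    and u: "u \<in> vars"
  then have "(deg (Some u) d - c (Some u)) + (deg (Some u) d' - c' (Some u)) \<in> \<nat>"
    by (intro Nats_add) auto
  then show "deg (Some u) (d + d') - (c + c') (Some u) \<in> \<nat>"
    by (simp add: deg_add algebra_simps)
next
  assume "deg None d - c None - of_nat k \<in> \<nat>" "deg None d' - c' None - of_nat k' \<in> \<nat>"
  then have "(deg None d - c None - of_nat k) + (deg None d' - c' None - of_nat k') \<in> \<nat>"
    by (intro Nats_add) auto
  then show "deg None (d + d') - (c + c') None - of_nat (k + k') \<in> \<nat>"
    by (simp add: deg_add algebra_simps)
qed auto

lemma good_mult: "good c k f \<Longrightarrow> good c' k' h \<Longrightarrow> good (c + c') (k + k') (f \<odot> h)"
  unfolding good_def
proof (intro allI impI)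
  fix e assume H: "\<forall>e. f e \<noteq> 0 \<longrightarrow> cone c k e" "\<forall>e. h e \<noteq> 0 \<longrightarrow> cone c' k' e"
    and "(f \<odot> h) e \<noteq> 0"
  then obtain d where "f d \<noteq> 0" "h (e - d) \<noteq> 0" by (elim ser_mult_nonzeroE)
  then show "cone (c + c') (k + k') e" using H cone_add[of c k d c' k' "e - d"] by simp
qed

lemma good_zero: "good c k 0" by (simp add: good_def)

lemma good_add: "good c k f \<Longrightarrow> good c k h \<Longrightarrow> good c k (f + h)"
  by (auto simp: good_def) (metis add.right_neutral)

lemma good_uminus: "good c k f \<Longrightarrow> good c k (- f)"
  by (auto simp: good_def)

lemma good_diff: "good c k f \<Longrightarrow> good c k h \<Longrightarrow> good c k (f - h)"
  by (auto simp: good_def) (metis diff_zero)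

lemma good_smult: "good c k f \<Longrightarrow> good c k (ser_smult a f)"
  by (auto simp: good_def ser_smult_def)

lemma good_sum: "(\<And>i. i \<in> A \<Longrightarrow> good c k (f i)) \<Longrightarrow> good c k (\<Sum>i\<in>A. f i)"
proof (induction A rule: infinite_finite_induct)
  case (infinite A)
  then show ?case unfolding sum.infinite[OF infinite(1)] by (simp only: good_zero)
next
  case empty
  then show ?case unfolding sum.empty by (simp only: good_zero)
next
  case (insert x F)
  show ?case unfolding sum.insert[OF insert(1,2)] by (intro good_add insert) auto
qed

lemma good_ser_sum: "(\<And>i. good c k (f i)) \<Longrightarrow> good c k (ser_sum f)"
proof -
  assume H: "\<And>i. good c k (f i)"
  have "\<exists>i. f i e \<noteq> 0" if "ser_sum f e \<noteq> 0" for e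
    using that unfolding ser_sum_def by (metis (mono_tags, lifting) lfsum_def sum.neutral)
  then show ?thesis using H by (metis good_def)
qed

lemma good_mon: "cone c k d \<Longrightarrow> good c k (mon d)"
  by (auto simp: good_def mon_def)

lemma good_mono: assumes "good c k f" "k' \<le> k" shows "good c k' f"
proof -
  have "cone c k' e" if "cone c k e" for e
  proof -
    have "(deg None e - c None - of_nat k) + of_nat (k - k') \<in> \<nat>"
      using that by (intro Nats_add) (auto simp: cone_def)
    then have "deg None e - c None - of_nat k' \<in> \<nat>"
      using assms(2) by (simp add: of_nat_diff algebra_simps)
    then show ?thesis using that by (auto simp: cone_def)
  qed
  then show ?thesis using assms(1) by (auto simp: good_def)
qed

lemma good_weaken:
  assumes "good c k f" "\<And>u. u \<in> vars \<Longrightarrow> c (Some u) - c' (Some u) \<in> \<nat>"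
    "c None + of_nat k - c' None - of_nat k' \<in> \<nat>"
  shows "good c' k' f"
proof -
  have "cone c' k' e" if "cone c k e" for e
  proof -
    have "deg (Some u) e - c' (Some u) \<in> \<nat>" if "u \<in> vars" for u
    proof -
      have "(deg (Some u) e - c (Some u)) + (c (Some u) - c' (Some u)) \<in> \<nat>"
        using \<open>cone c k e\<close> that assms(2) by (intro Nats_add) (auto simp: cone_def)
      then show ?thesis by simp
    qed
    moreover have "(deg None e - c None - of_nat k) + (c None + of_nat k - c' None - of_nat k') \<in> \<nat>"
      using \<open>cone c k e\<close> assms(3) by (intro Nats_add) (auto simp: cone_def)
    ultimately show ?thesis using \<open>cone c k e\<close> by (simp add: cone_def algebra_simps)
  qed
  then show ?thesis using assms(1) by (auto simp: good_def)
qed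

lemma ser_mult_cone:
  assumes "\<And>d. f d \<noteq> 0 \<Longrightarrow> cone c k d" "\<And>d. h d \<noteq> 0 \<Longrightarrow> cone c' k' d"
  shows "(f \<odot> h) e = (\<Sum>d | cone c k d \<and> cone c' k' (e - d). f d * h (e - d))"
  by (rule ser_mult_eq_sum[OF cone_finite]) (use assms in auto)

lemma pfin_mult:
  assumes "\<And>i. good c k (f i)" "pfin f" "good c' k' h"
  shows "pfin (\<lambda>i. f i \<odot> h)"
  unfolding pfin_def
proof
  fix e
  have "{i. (f i \<odot> h) e \<noteq> 0} \<subseteq> (\<Union>d\<in>{d. cone c k d \<and> cone c' k' (e - d)}. {i. f i d \<noteq> 0})"
    using assms(1,3) by (auto simp: good_def elim!: ser_mult_nonzeroE)
  moreover have "finite \<dots>" using assms(2) cone_finite by (auto simp: pfin_def)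
  ultimately show "finite {i. (f i \<odot> h) e \<noteq> 0}" by (rule finite_subset)
qed

text \<open>As all \<open>f i\<close> lie in one cone, the set of exponents that contribute to the product at a given
  monomial is finite independently of \<open>i\<close>.\<close>

lemma ser_sum_mult:
  assumes "\<And>i. good c k (f i)" "pfin f" "good c' k' h"
  shows "ser_sum f \<odot> h = ser_sum (\<lambda>i. f i \<odot> h)"
proof
  fix e
  let ?D = "{d. cone c k d \<and> cone c' k' (e - d)}"
  have "(ser_sum f \<odot> h) e = (\<Sum>d\<in>?D. ser_sum f d * h (e - d))"
    using good_ser_sum[of c k f] assms by (intro ser_mult_cone) (auto simp: good_def)
  also have "\<dots> = (\<Sum>d\<in>?D. lfsum (\<lambda>i. f i d * h (e - d)))"
    by (simp add: ser_sum_def lfsum_cmult mult.commute[of _ "h _"])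
  also have "\<dots> = lfsum (\<lambda>i. \<Sum>d\<in>?D. f i d * h (e - d))"
    by (rule lfsum_sum[symmetric]) (use assms(2) cone_finite in \<open>auto simp: pfin_def elim!: rev_finite_subset\<close>)
  also have "\<dots> = lfsum (\<lambda>i. (f i \<odot> h) e)"
    by (rule arg_cong[of _ _ lfsum], rule ext, rule ser_mult_cone[symmetric])
      (use assms in \<open>auto simp: good_def\<close>)
  finally show "(ser_sum f \<odot> h) e = ser_sum (\<lambda>i. f i \<odot> h) e" by (simp add: ser_sum_def)
qed

lemma mult_ser_sum:
  assumes "\<And>i. good c k (f i)" "pfin f" "good c' k' h"
  shows "h \<odot> ser_sum f = ser_sum (\<lambda>i. h \<odot> f i)"
  using ser_sum_mult[OF assms] by (simp only: ser_mult_commute[of h])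

lemma ser_expand: "f = ser_sum (\<lambda>d. ser_smult (f d) (mon d))"
proof
  fix e
  have "ser_sum (\<lambda>d. ser_smult (f d) (mon d)) e = lfsum (\<lambda>d. if d = e then f e else 0)"
    unfolding ser_sum_def by (rule arg_cong[of _ _ lfsum]) (auto simp: ser_smult_def mon_def)
  then show "f e = ser_sum (\<lambda>d. ser_smult (f d) (mon d)) e" by (simp add: lfsum_single)
qed

lemma expand_mult:
  assumes "good c k f" "good c' k' h"
  shows "f \<odot> h = ser_sum (\<lambda>d. ser_smult (f d) (mon d \<odot> h))"
    and "pfin (\<lambda>d. ser_smult (f d) (mon d \<odot> h))"
    and "\<And>d. good (c + c') (k + k') (ser_smult (f d) (mon d \<odot> h))"
proof -
  have g: "good c k (ser_smult (f d) (mon d))" for d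
    using assms(1) by (auto simp: good_def ser_smult_def mon_def)
  have p: "pfin (\<lambda>d. ser_smult (f d) (mon d))"
    by (auto simp: pfin_def ser_smult_def mon_def elim!: rev_finite_subset)
  show "f \<odot> h = ser_sum (\<lambda>d. ser_smult (f d) (mon d \<odot> h))"
    using ser_sum_mult[OF g p assms(2)] ser_expand[of f] by (simp only: ser_smult_mult)
  show "pfin (\<lambda>d. ser_smult (f d) (mon d \<odot> h))"
    using pfin_mult[OF g p assms(2)] by (simp only: ser_smult_mult)
  show "good (c + c') (k + k') (ser_smult (f d) (mon d \<odot> h))" for d
    using good_mult[OF g assms(2)] by (simp only: ser_smult_mult)
qed

text \<open>A series is the sum of its monomials, and for a monomial in the place of \<open>f\<close> the law is a shift of
  exponents.\<close>

lemma ser_mult_assoc: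
  assumes "good c k f" "good c' k' h" "good c'' k'' q"
  shows "(f \<odot> h) \<odot> q = f \<odot> (h \<odot> q)"
proof -
  note e = expand_mult[OF assms(1,2)]
  have "(f \<odot> h) \<odot> q = ser_sum (\<lambda>d. ser_smult (f d) (mon d \<odot> h)) \<odot> q" by (simp only: e(1))
  also have "\<dots> = ser_sum (\<lambda>d. ser_smult (f d) (mon d \<odot> h) \<odot> q)"
    by (rule ser_sum_mult[OF e(3) e(2) assms(3)])
  also have "\<dots> = f \<odot> (h \<odot> q)"
    by (simp only: expand_mult(1)[OF assms(1) good_mult[OF assms(2,3)]] ser_smult_mult mon_mult_assoc)
  finally show ?thesis .
qed

lemma ser_mult_left_commute:
  assumes "good c k f" "good c' k' h" "good c'' k'' q"
  shows "f \<odot> (h \<odot> q) = h \<odot> (f \<odot> q)"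
  by (metis assms ser_mult_assoc ser_mult_commute)

lemma distrib_right:
  assumes "good c k f" "good c' k' f'" "good c'' k'' h"
  shows "(f + f') \<odot> h = f \<odot> h + f' \<odot> h"
proof
  fix e
  let ?D = "{d. cone c k d \<and> cone c'' k'' (e - d)} \<union> {d. cone c' k' d \<and> cone c'' k'' (e - d)}"
  have D: "finite ?D" using cone_finite by simp
  have "((f + f') \<odot> h) e = (\<Sum>d\<in>?D. (f + f') d * h (e - d))"
  proof (rule ser_mult_eq_sum[OF D])
    fix d assume "(f + f') d \<noteq> 0" "h (e - d) \<noteq> 0"
    then have "f d \<noteq> 0 \<or> f' d \<noteq> 0" by auto
    with \<open>h (e - d) \<noteq> 0\<close> show "d \<in> ?D" using assms by (auto simp: good_def)
  qed
  also have "\<dots> = (\<Sum>d\<in>?D. f d * h (e - d)) + (\<Sum>d\<in>?D. f' d * h (e - d))"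
    by (simp add: sum.distrib algebra_simps)
  also have "(\<Sum>d\<in>?D. f d * h (e - d)) = (f \<odot> h) e"
    by (rule ser_mult_eq_sum[OF D, symmetric]) (use assms in \<open>auto simp: good_def\<close>)
  also have "(\<Sum>d\<in>?D. f' d * h (e - d)) = (f' \<odot> h) e"
    by (rule ser_mult_eq_sum[OF D, symmetric]) (use assms in \<open>auto simp: good_def\<close>)
  finally show "((f + f') \<odot> h) e = (f \<odot> h + f' \<odot> h) e"
    unfolding plus_fun_apply[of "f \<odot> h" "f' \<odot> h"] .
qed

lemma distrib_left:
  assumes "good c k f" "good c' k' f'" "good c'' k'' h"
  shows "h \<odot> (f + f') = h \<odot> f + h \<odot> f'"
  using distrib_right[OF assms] by (simp only: ser_mult_commute)

lemma mult_uminus: "f \<odot> (- h) = - (f \<odot> h)" "(- f) \<odot> h = - (f \<odot> h)"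
proof -
  have *: "- f = ser_smult (- 1) f" for f by (auto simp: ser_smult_def)
  show "f \<odot> (- h) = - (f \<odot> h)" "(- f) \<odot> h = - (f \<odot> h)"
    by (simp_all only: * mult_ser_smult ser_smult_mult)
qed

lemma diff_distrib_left:
  assumes "good c k f" "good c' k' f'" "good c'' k'' h"
  shows "h \<odot> (f - f') = h \<odot> f - h \<odot> f'"
  using distrib_left[OF assms(1) good_uminus[OF assms(2)] assms(3)] by (simp add: mult_uminus)

lemma sum_distrib_left_ser:
  assumes "finite A" "\<And>i. i \<in> A \<Longrightarrow> good c k (f i)" "good c'' k'' h"
  shows "h \<odot> (\<Sum>i\<in>A. f i) = (\<Sum>i\<in>A. h \<odot> f i)"
  using assms(1,2)
proof (induction A rule: finite_induct)
  case empty
  show ?case unfolding sum.empty by (rule ser_mult_zero)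
next
  case (insert x F)
  have "h \<odot> (f x + (\<Sum>i\<in>F. f i)) = h \<odot> f x + h \<odot> (\<Sum>i\<in>F. f i)"
    by (rule distrib_left[of c k _ c k _ c'' k'']) (use insert assms in \<open>auto intro!: good_sum\<close>)
  then show ?case using insert unfolding sum.insert[OF insert(1,2)] by (metis insertCI)
qed

lemma sum_distrib_right_ser:
  assumes "finite A" "\<And>i. i \<in> A \<Longrightarrow> good c k (f i)" "good c'' k'' h"
  shows "(\<Sum>i\<in>A. f i) \<odot> h = (\<Sum>i\<in>A. f i \<odot> h)"
  using sum_distrib_left_ser[OF assms] by (simp only: ser_mult_commute[of _ h])

text \<open>The \<open>\<rho>\<close>-degree is fixed at a given monomial, so that a family of growing \<open>\<rho>\<close>-degree contributes
  to it finitely often.\<close>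

lemma pfin_growing:
  assumes "\<And>i. i \<in> A \<Longrightarrow> good c (w i) (f i)" "\<And>i. i \<notin> A \<Longrightarrow> f i = 0"
    "\<And>N. finite {i\<in>A. w i \<le> N}"
  shows "pfin f"
  unfolding pfin_def
proof
  fix e
  have "{i. f i e \<noteq> 0} \<subseteq> {i\<in>A. w i \<le> nat \<lfloor>Re (deg None e - c None)\<rfloor>}"
  proof safe
    fix i assume i: "f i e \<noteq> 0"
    then show "i \<in> A" using assms(2) by (metis zero_fun_apply)
    then obtain j where "deg None e - c None - of_nat (w i) = of_nat j"
      using assms(1) i unfolding good_def cone_def by (metis Nats_cases)
    then have "deg None e - c None = of_nat (w i) + of_nat j" by (simp add: algebra_simps)
    then show "w i \<le> nat \<lfloor>Re (deg None e - c None)\<rfloor>" by (simp add: le_nat_floor)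
  qed
  then show "finite {i. f i e \<noteq> 0}" using assms(3) by (rule finite_subset)
qed

end

section \<open>Rows and matrices of series\<close>

lemma ser_sum_swap:
  assumes "pfin (\<lambda>(i, j). F i j)"
  shows "ser_sum (\<lambda>i. ser_sum (F i)) = ser_sum (\<lambda>j. ser_sum (\<lambda>i. F i j))"
proof
  fix e
  have "{(i, j). F i j e \<noteq> 0} = {p. (case p of (i, j) \<Rightarrow> F i j) e \<noteq> 0}" by auto
  then have "finite {(i, j). F i j e \<noteq> 0}" using assms by (simp add: pfin_def)
  from lfsum_swap[OF this] show "ser_sum (\<lambda>i. ser_sum (F i)) e = ser_sum (\<lambda>j. ser_sum (\<lambda>i. F i j)) e"
    by (simp add: ser_sum_def)
qed

lemma ser_sum_add:
  assumes "pfin f" "pfin h"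
  shows "ser_sum (\<lambda>i. f i + h i) = ser_sum f + ser_sum h"
  using assms by (auto simp: ser_sum_def pfin_def lfsum_add)

lemma ser_sum_uminus: "ser_sum (\<lambda>i. - f i) = - ser_sum f"
  by (auto simp: ser_sum_def lfsum_uminus)

lemma ser_sum_diff:
  assumes "pfin f" "pfin h"
  shows "ser_sum (\<lambda>i. f i - h i) = ser_sum f - ser_sum h"
proof -
  have "pfin (\<lambda>i. - h i)" using assms(2) by (simp add: pfin_def)
  from ser_sum_add[OF assms(1) this] show ?thesis by (simp only: ser_sum_uminus) simp
qed

lemma ser_sum_Suc:
  assumes "pfin f"
  shows "ser_sum f = f 0 + ser_sum (\<lambda>k. f (Suc k))"
proof
  fix e
  let ?S = "{k. f k e \<noteq> 0}" and ?T = "{k. f (Suc k) e \<noteq> 0}"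
  have fin: "finite ?S" using assms by (simp add: pfin_def)
  have T: "finite ?T" using finite_vimageI[OF fin, of Suc] by (simp add: vimage_def)
  have "lfsum (\<lambda>k. f k e) = (\<Sum>k\<in>insert 0 (Suc ` ?T). f k e)"
  proof (rule lfsum_eq_sum)
    fix k assume "k \<notin> insert 0 (Suc ` ?T)"
    then show "f k e = 0" by (cases k) auto
  qed (use T in simp)
  also have "\<dots> = f 0 e + (\<Sum>k\<in>?T. f (Suc k) e)"
    using T by (subst sum.insert) (auto simp: sum.reindex)
  also have "(\<Sum>k\<in>?T. f (Suc k) e) = lfsum (\<lambda>k. f (Suc k) e)" by (simp add: lfsum_def)
  finally show "ser_sum f e = (f 0 + ser_sum (\<lambda>k. f (Suc k))) e" by (simp add: ser_sum_def)
qed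

lemma ser_sum_single: "(\<And>i. i \<noteq> j \<Longrightarrow> f i = 0) \<Longrightarrow> ser_sum f = f j"
proof
  fix e assume H: "\<And>i. i \<noteq> j \<Longrightarrow> f i = 0"
  have "lfsum (\<lambda>i. f i e) = (\<Sum>i\<in>{j}. f i e)"
    by (rule lfsum_eq_sum) (use H in auto)
  then show "ser_sum f e = f j e" by (simp add: ser_sum_def)
qed

context expansion
begin

abbreviation J :: "mindex set" where "J \<equiv> {i. fst i \<in> idx g}"

lemma finite_J_le:
  assumes "\<And>i. i \<in> J \<Longrightarrow> snd i \<le> w i + K"
  shows "finite {i\<in>J. w i \<le> N}"
proof (rule finite_subset)
  show "{i\<in>J. w i \<le> N} \<subseteq> idx g \<times> {..N + K}"
    using assms by (fastforce dest: assms)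
qed (simp add: finite_idx)

lemma finite_JJ_le:
  assumes "\<And>i j. i \<in> J \<Longrightarrow> j \<in> J \<Longrightarrow> snd i + snd j \<le> w i j + K"
  shows "finite {p\<in>J \<times> J. (case p of (i, j) \<Rightarrow> w i j) \<le> N}"
proof (rule finite_subset)
  show "{p\<in>J \<times> J. (case p of (i, j) \<Rightarrow> w i j) \<le> N} \<subseteq> (idx g \<times> {..N + K}) \<times> (idx g \<times> {..N + K})"
  proof
    fix x assume x: "x \<in> {p\<in>J \<times> J. (case p of (i, j) \<Rightarrow> w i j) \<le> N}"
    then show "x \<in> (idx g \<times> {..N + K}) \<times> (idx g \<times> {..N + K})"
      using assms[of "fst x" "snd x"] by (auto simp: mem_Times_iff split: prod.splits)
  qed
qed (simp add: finite_idx)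

lemma pfin_dot:
  assumes "\<And>i. i \<in> J \<Longrightarrow> good c (w i) (f i)" "\<And>i. i \<in> J \<Longrightarrow> snd i \<le> w i + K"
  shows "pfin (\<lambda>i. if fst i \<in> idx g then f i else 0)"
  by (rule pfin_growing[of J c w]) (use assms finite_J_le[OF assms(2)] in auto)

lemma good_dot:
  assumes "\<And>i. i \<in> J \<Longrightarrow> good c k (p i \<odot> q i)"
  shows "good c k (dot g p q)"
  unfolding dot_def
proof (rule good_ser_sum)
  show "good c k (if fst i \<in> idx g then p i \<odot> q i else 0)" for i
    using assms[of i] good_zero[of c k] by simp
qed

lemma dot_cong: "(\<And>i. i \<in> J \<Longrightarrow> p i = p' i) \<Longrightarrow> (\<And>i. i \<in> J \<Longrightarrow> q i = q' i) \<Longrightarrow> dot g p q = dot g p' q'"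
  unfolding dot_def by (rule arg_cong[of _ _ ser_sum]) auto

lemma dot_mult:
  assumes "\<And>i. i \<in> J \<Longrightarrow> good c (w i) (p i \<odot> q i)" "\<And>i. i \<in> J \<Longrightarrow> snd i \<le> w i + K"
    "good c' k' h"
  shows "dot g p q \<odot> h = ser_sum (\<lambda>i. if fst i \<in> idx g then (p i \<odot> q i) \<odot> h else 0)"
proof -
  let ?f = "\<lambda>i. if fst i \<in> idx g then p i \<odot> q i else 0"
  have "dot g p q \<odot> h = ser_sum (\<lambda>i. ?f i \<odot> h)"
    unfolding dot_def
  proof (rule ser_sum_mult)
    show "good c 0 (?f i)" for i
      using good_mono[OF assms(1), of i 0] good_zero by auto
    show "pfin ?f" by (rule pfin_dot[of c w _ K]) (use assms in auto)
    show "good c' k' h" by fact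
  qed
  also have "(\<lambda>i. ?f i \<odot> h) = (\<lambda>i. if fst i \<in> idx g then (p i \<odot> q i) \<odot> h else 0)" by auto
  finally show ?thesis .
qed

text \<open>The numbers \<open>wp\<close>, \<open>wm\<close> and \<open>wq\<close> bound \<open>\<rho>\<close>-degrees. Only their sum is required to grow with the
  indices: among the powers of a matrix is the identity, whose entries have degree \<open>0\<close>.\<close>

lemma dot_assoc:
  assumes p: "\<And>i. i \<in> J \<Longrightarrow> good c (wp i) (p i)"
    and M: "\<And>i j. i \<in> J \<Longrightarrow> j \<in> J \<Longrightarrow> good c' (wm i j) (M i j)"
    and q: "\<And>j. j \<in> J \<Longrightarrow> good c'' (wq j) (q j)"
    and K: "\<And>i j. i \<in> J \<Longrightarrow> j \<in> J \<Longrightarrow> snd i + snd j \<le> wp i + wm i j + wq j + K"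
  shows "dot g (row_mult g p M) q = dot g p (\<lambda>i. dot g (M i) q)"
proof -
  define F where "F i j = (if i \<in> J \<and> j \<in> J then p i \<odot> (M i j \<odot> q j) else 0)" for i j
  have 1: "row_mult g p M j \<odot> q j = ser_sum (\<lambda>i. F i j)" if j: "j \<in> J" for j
  proof -
    have "row_mult g p M j \<odot> q j = ser_sum (\<lambda>i. if fst i \<in> idx g then (p i \<odot> M i j) \<odot> q j else 0)"
      unfolding row_mult_def
    proof (rule dot_mult)
      show "i \<in> J \<Longrightarrow> good (c + c') (wp i + wm i j) (p i \<odot> M i j)" for i
        using p M j by (intro good_mult) auto
      show "i \<in> J \<Longrightarrow> snd i \<le> (wp i + wm i j) + (wq j + K)" for i using K[of i j] j by simp
      show "good c'' (wq j) (q j)" using q j by simp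
    qed
    also have "(\<lambda>i. if fst i \<in> idx g then (p i \<odot> M i j) \<odot> q j else 0) = (\<lambda>i. F i j)"
      using j by (auto simp: F_def fun_eq_iff intro!: ser_mult_assoc[THEN fun_cong] p M q)
    finally show ?thesis .
  qed
  have 2: "p i \<odot> dot g (M i) q = ser_sum (\<lambda>j. F i j)" if i: "i \<in> J" for i
  proof -
    have "dot g (M i) q \<odot> p i = ser_sum (\<lambda>j. if fst j \<in> idx g then (M i j \<odot> q j) \<odot> p i else 0)"
    proof (rule dot_mult)
      show "j \<in> J \<Longrightarrow> good (c' + c'') (wm i j + wq j) (M i j \<odot> q j)" for j
        using q M i by (intro good_mult) auto
      show "j \<in> J \<Longrightarrow> snd j \<le> (wm i j + wq j) + (wp i + K)" for j using K[of i j] i by simp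
      show "good c (wp i) (p i)" using p i by simp
    qed
    also have "(\<lambda>j. if fst j \<in> idx g then (M i j \<odot> q j) \<odot> p i else 0) = (\<lambda>j. F i j)"
      using i by (auto simp: F_def fun_eq_iff ser_mult_commute[of "p i"])
    finally show ?thesis by (simp only: ser_mult_commute)
  qed
  have "pfin (\<lambda>(i, j). F i j)"
  proof (rule pfin_growing[of "J \<times> J" "c + (c' + c'')" "\<lambda>(i, j). wp i + (wm i j + wq j)"])
    show "x \<in> J \<times> J \<Longrightarrow> good (c + (c' + c'')) ((\<lambda>(i, j). wp i + (wm i j + wq j)) x) (case x of (i, j) \<Rightarrow> F i j)" for x
      by (auto simp: F_def intro!: good_mult p M q)
    show "x \<notin> J \<times> J \<Longrightarrow> (case x of (i, j) \<Rightarrow> F i j) = 0" for x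
      by (cases x) (auto simp: F_def)
    show "finite {x \<in> J \<times> J. (\<lambda>(i, j). wp i + (wm i j + wq j)) x \<le> N}" for N
      by (rule finite_JJ_le[of _ K]) (use K in \<open>simp add: add.assoc\<close>)
  qed
  note swap = ser_sum_swap[OF this]
  have "dot g (row_mult g p M) q = ser_sum (\<lambda>j. ser_sum (\<lambda>i. F i j))"
    unfolding dot_def[of g "row_mult g p M"]
  proof (rule arg_cong[of _ _ ser_sum], rule ext)
    fix j show "(if fst j \<in> idx g then row_mult g p M j \<odot> q j else 0) = ser_sum (\<lambda>i. F i j)"
      using 1[of j] by (cases "j \<in> J") (simp_all add: F_def ser_sum_def zero_fun_def)
  qed
  moreover have "dot g p (\<lambda>i. dot g (M i) q) = ser_sum (\<lambda>i. ser_sum (\<lambda>j. F i j))"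
    unfolding dot_def[of g p]
  proof (rule arg_cong[of _ _ ser_sum], rule ext)
    fix i show "(if fst i \<in> idx g then p i \<odot> dot g (M i) q else 0) = ser_sum (\<lambda>j. F i j)"
      using 2[of i] by (cases "i \<in> J") (simp_all add: F_def ser_sum_def zero_fun_def)
  qed
  ultimately show ?thesis using swap by (simp only:)
qed

lemma dot_mult_right:
  assumes "\<And>i. i \<in> J \<Longrightarrow> good c (wp i) (p i)" "\<And>i. i \<in> J \<Longrightarrow> good c' (wq i) (q i)"
    "\<And>i. i \<in> J \<Longrightarrow> snd i \<le> wp i + wq i + K" "good c'' k'' h"
  shows "dot g p (\<lambda>i. q i \<odot> h) = dot g p q \<odot> h"
proof -
  have "dot g p q \<odot> h = ser_sum (\<lambda>i. if fst i \<in> idx g then (p i \<odot> q i) \<odot> h else 0)"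
    by (rule dot_mult[of "c + c'" "\<lambda>i. wp i + wq i" _ _ K]) (use assms good_mult in auto)
  also have "(\<lambda>i. if fst i \<in> idx g then (p i \<odot> q i) \<odot> h else 0) =
      (\<lambda>i. if fst i \<in> idx g then p i \<odot> (q i \<odot> h) else 0)"
    by (auto simp: fun_eq_iff intro!: ser_mult_assoc[THEN fun_cong] assms)
  finally show ?thesis by (simp add: dot_def)
qed

lemma dot_diff_right:
  assumes "\<And>i. i \<in> J \<Longrightarrow> good c (wp i) (p i)" "\<And>i. i \<in> J \<Longrightarrow> good c' (wq i) (q i)"
    "\<And>i. i \<in> J \<Longrightarrow> good c' (wq i) (q' i)"
    "\<And>i. i \<in> J \<Longrightarrow> snd i \<le> wp i + wq i + K"
  shows "dot g p (\<lambda>i. q i - q' i) = dot g p q - dot g p q'"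
proof -
  have "dot g p q - dot g p q' = ser_sum (\<lambda>i. (if fst i \<in> idx g then p i \<odot> q i else 0) -
       (if fst i \<in> idx g then p i \<odot> q' i else 0))"
    unfolding dot_def
    by (rule ser_sum_diff[symmetric]; rule pfin_dot[of "c + c'" "\<lambda>i. wp i + wq i" _ K])
      (use assms good_mult in auto)
  also have "(\<lambda>i. (if fst i \<in> idx g then p i \<odot> q i else 0) -
       (if fst i \<in> idx g then p i \<odot> q' i else 0)) = (\<lambda>i. if fst i \<in> idx g then p i \<odot> (q i - q' i) else 0)"
    by (rule ext) (use diff_distrib_left[OF assms(2,3,1)] in auto)
  finally show ?thesis unfolding dot_def by (rule sym)
qed

lemma dot_add_right:
  assumes "\<And>i. i \<in> J \<Longrightarrow> good c (wp i) (p i)" "\<And>i. i \<in> J \<Longrightarrow> good c' (wq i) (q i)"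
    "\<And>i. i \<in> J \<Longrightarrow> good c' (wq i) (q' i)"
    "\<And>i. i \<in> J \<Longrightarrow> snd i \<le> wp i + wq i + K"
  shows "dot g p (\<lambda>i. q i + q' i) = dot g p q + dot g p q'"
proof -
  have "dot g p q + dot g p q' = ser_sum (\<lambda>i. (if fst i \<in> idx g then p i \<odot> q i else 0) +
       (if fst i \<in> idx g then p i \<odot> q' i else 0))"
    unfolding dot_def
    by (rule ser_sum_add[symmetric]; rule pfin_dot[of "c + c'" "\<lambda>i. wp i + wq i" _ K])
      (use assms good_mult in auto)
  also have "(\<lambda>i. (if fst i \<in> idx g then p i \<odot> q i else 0) +
       (if fst i \<in> idx g then p i \<odot> q' i else 0)) = (\<lambda>i. if fst i \<in> idx g then p i \<odot> (q i + q' i) else 0)"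
    by (rule ext) (use distrib_left[OF assms(2,3,1)] in auto)
  finally show ?thesis unfolding dot_def by (rule sym)
qed

lemma dot_sum_right:
  assumes "\<And>i. i \<in> J \<Longrightarrow> good c (wp i) (p i)"
    "\<And>i a. i \<in> J \<Longrightarrow> a \<in> A \<Longrightarrow> good c' (wq i) (q a i)"
    "\<And>i. i \<in> J \<Longrightarrow> snd i \<le> wp i + wq i + K" "finite A"
  shows "dot g p (\<lambda>i. \<Sum>a\<in>A. q a i) = (\<Sum>a\<in>A. dot g p (q a))"
  using assms(4,2)
proof (induction A rule: finite_induct)
  case empty
  have "(\<lambda>i. if fst i \<in> idx g then p i \<odot> 0 else 0) = (\<lambda>i. 0)" by (intro ext) (simp only: ser_mult_zero if_cancel)
  then have "dot g p (\<lambda>i. 0) = 0" unfolding dot_def by (simp add: ser_sum_def zero_fun_def)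
  then show ?case unfolding sum.empty .
next
  case (insert a A)
  have "dot g p (\<lambda>i. \<Sum>a\<in>insert a A. q a i) = dot g p (\<lambda>i. q a i + (\<Sum>a\<in>A. q a i))"
    unfolding sum.insert[OF insert(1,2)] by (rule refl)
  also have "\<dots> = dot g p (q a) + dot g p (\<lambda>i. \<Sum>a\<in>A. q a i)"
  proof (rule dot_add_right)
    show "i \<in> J \<Longrightarrow> good c (wp i) (p i)" for i by (rule assms(1))
    show "i \<in> J \<Longrightarrow> good c' (wq i) (q a i)" for i by (rule insert(4)) simp_all
    show "i \<in> J \<Longrightarrow> good c' (wq i) (\<Sum>a\<in>A. q a i)" for i by (rule good_sum, rule insert(4)) simp_all
    show "i \<in> J \<Longrightarrow> snd i \<le> wp i + wq i + K" for i by (rule assms(3))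
  qed
  also have "dot g p (\<lambda>i. \<Sum>a\<in>A. q a i) = (\<Sum>a\<in>A. dot g p (q a))"
    by (rule insert(3), rule insert(4)) simp_all
  finally show ?case unfolding sum.insert[OF insert(1,2)] .
qed

lemma dot_diff_left:
  assumes "\<And>i. i \<in> J \<Longrightarrow> good c (wp i) (p i)" "\<And>i. i \<in> J \<Longrightarrow> good c (wp i) (p' i)"
    "\<And>i. i \<in> J \<Longrightarrow> good c' (wq i) (q i)"
    "\<And>i. i \<in> J \<Longrightarrow> snd i \<le> wp i + wq i + K"
  shows "dot g (\<lambda>i. p i - p' i) q = dot g p q - dot g p' q"
proof -
  have *: "dot g a b = dot g b a" for a b
    unfolding dot_def
    by (rule arg_cong[of _ _ ser_sum], rule ext) (metis ser_mult_commute)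
  show ?thesis unfolding *[of _ q]
    by (rule dot_diff_right[of c' wq _ c wp _ _ K]) (use assms in \<open>auto simp: add.commute\<close>)
qed

lemma good_mat_id: "good 0 0 (mat_id i j)"
proof -
  have "deg x (\<lambda>_. 0) = 0" for x using deg_add[of x "\<lambda>_. 0" "\<lambda>_. 0"] by (simp add: plus_fun_def)
  then have "cone 0 0 (\<lambda>_. 0)" by (auto simp: cone_def)
  then show ?thesis by (auto simp: mat_id_def good_zero intro: good_mon)
qed

lemma dot_mat_id:
  assumes "j \<in> J"
  shows "dot g p (\<lambda>l. mat_id l j) = p j" "dot g (mat_id j) q = q j"
proof -
  have "dot g p (\<lambda>l. mat_id l j) = (if fst j \<in> idx g then p j \<odot> mat_id j j else 0)"
    unfolding dot_def by (rule ser_sum_single) (auto simp: mat_id_def)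
  then show "dot g p (\<lambda>l. mat_id l j) = p j" using assms by (simp add: mat_id_def)
  have "dot g (mat_id j) q = (if fst j \<in> idx g then mat_id j j \<odot> q j else 0)"
    unfolding dot_def by (rule ser_sum_single) (auto simp: mat_id_def)
  then show "dot g (mat_id j) q = q j" using assms by (simp add: mat_id_def)
qed

text \<open>The geometric series commutes with \<open>M\<close>, which gives \<open>N = p + NM\<close> for \<open>N = p(I - M)\<^bsup>-1\<^esup>\<close>. Then
  \<open>pZ = NZ - NMZ = N(Z - MZ)\<close>; a system \<open>Z = Y + MZ\<close> is thus solved as far as \<open>pZ\<close> is concerned.\<close>

lemma geometric_solve:
  fixes M :: "mindex \<Rightarrow> mindex \<Rightarrow> ser"
  assumes M: "\<And>i j. i \<in> J \<Longrightarrow> j \<in> J \<Longrightarrow> good 0 (snd i + snd j + 1) (M i j)"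
    and p: "\<And>i. i \<in> J \<Longrightarrow> good c (snd i) (p i)"
    and Z: "\<And>i. i \<in> J \<Longrightarrow> good c' (snd i) (Z i)"
  defines "N \<equiv> row_mult g p (mat_geometric g M)"
  shows "dot g p Z = dot g N (\<lambda>i. Z i - dot g (M i) Z)"
    and "\<And>j. j \<in> J \<Longrightarrow> good c 0 (N j)"
proof -
  define Mp where "Mp k = (mat_mult g M ^^ k) mat_id" for k
  have Mp0: "Mp 0 = mat_id" and MpS: "Mp (Suc k) i j = dot g (M i) (\<lambda>l. Mp k l j)" for k i j
    by (simp_all add: Mp_def mat_mult_def row_mult_def)
  have gMp: "good 0 k (Mp k i j)" if "i \<in> J" "j \<in> J" for k i j
    using that
  proof (induction k arbitrary: i)
    case 0
    show ?case unfolding Mp0 by (rule good_mat_id)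
  next
    case (Suc k)
    show ?case unfolding MpS
    proof (rule good_dot)
      fix l assume l: "l \<in> J"
      have "good (0 + 0) ((snd i + snd l + 1) + k) (M i l \<odot> Mp k l j)"
        by (rule good_mult[OF M[OF Suc(2) l] Suc(1)[OF l Suc(3)]])
      then show "good 0 (Suc k) (M i l \<odot> Mp k l j)"
        using good_mono by fastforce
    qed
  qed
  have gMp0: "good 0 0 (Mp k i j)" if "i \<in> J" "j \<in> J" for k i j
    using gMp[OF that] good_mono by blast
  \<comment> \<open>\<open>Mp\<close> is defined by multiplication with \<open>M\<close> on the left\<close>
  have comm: "Mp (Suc k) i j = dot g (Mp k i) (\<lambda>l. M l j)" if "i \<in> J" "j \<in> J" for k i j
    using that
  proof (induction k arbitrary: i)
    case 0
    then show ?case by (simp only: MpS Mp0 dot_mat_id)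
  next
    case (Suc k)
    have "Mp (Suc (Suc k)) i j = dot g (M i) (\<lambda>l. dot g (Mp k l) (\<lambda>l. M l j))"
      unfolding MpS[of "Suc k"] by (rule dot_cong) (use Suc in auto)
    also have "\<dots> = dot g (row_mult g (M i) (Mp k)) (\<lambda>l. M l j)"
    proof (rule dot_assoc[symmetric])
      show "l \<in> J \<Longrightarrow> good 0 (snd i + snd l + 1) (M i l)" for l using M Suc by auto
      show "l \<in> J \<Longrightarrow> l' \<in> J \<Longrightarrow> good 0 0 (Mp k l l')" for l l' by (rule gMp0)
      show "l \<in> J \<Longrightarrow> good 0 (snd l + snd j + 1) (M l j)" for l using M Suc by auto
      show "l \<in> J \<Longrightarrow> l' \<in> J \<Longrightarrow> snd l + snd l' \<le> (snd i + snd l + 1) + 0 + (snd l' + snd j + 1) + 0"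
        for l l' by simp
    qed
    also have "row_mult g (M i) (Mp k) = Mp (Suc k) i" by (auto simp: row_mult_def MpS)
    finally show ?case .
  qed
  define P where "P k = row_mult g p (Mp k)" for k
  have gP: "good c k (P k j)" if "j \<in> J" for k j
    unfolding P_def row_mult_def
  proof (rule good_dot)
    fix l assume "l \<in> J"
    then have "good (c + 0) (snd l + k) (p l \<odot> Mp k l j)" using p gMp that by (intro good_mult) auto
    then show "good c k (p l \<odot> Mp k l j)" using good_mono by fastforce
  qed
  have P0: "P 0 j = p j" if "j \<in> J" for j
    using that by (simp add: P_def row_mult_def Mp0 dot_mat_id)
  have PS: "P (Suc k) j = dot g (P k) (\<lambda>l. M l j)" if j: "j \<in> J" for k j
  proof -
    have "P (Suc k) j = dot g p (\<lambda>i. dot g (Mp k i) (\<lambda>l. M l j))"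
      unfolding P_def row_mult_def by (rule dot_cong) (use comm j in auto)
    also have "\<dots> = dot g (P k) (\<lambda>l. M l j)"
      unfolding P_def
    proof (rule dot_assoc[symmetric])
      show "l \<in> J \<Longrightarrow> good c (snd l) (p l)" for l by (rule p)
      show "l \<in> J \<Longrightarrow> l' \<in> J \<Longrightarrow> good 0 0 (Mp k l l')" for l l' by (rule gMp0)
      show "l \<in> J \<Longrightarrow> good 0 (snd l + snd j + 1) (M l j)" for l using M j by auto
      show "l \<in> J \<Longrightarrow> l' \<in> J \<Longrightarrow> snd l + snd l' \<le> snd l + 0 + (snd l' + snd j + 1) + 0" for l l' by simp
    qed
    finally show ?thesis .
  qed
  have pfP: "pfin (\<lambda>k. P k j)" if "j \<in> J" for j
  proof (rule pfin_growing[of UNIV c "\<lambda>k. k"])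
    show "finite {i \<in> UNIV. i \<le> N}" for N :: nat by simp
  qed (use that gP in auto)
  have N: "N j = ser_sum (\<lambda>k. P k j)" if j: "j \<in> J" for j
  proof -
    define F where "F i k = (if i \<in> J then p i \<odot> Mp k i j else 0)" for i k
    have "pfin (\<lambda>(i, k). F i k)"
    proof (rule pfin_growing[of "J \<times> UNIV" c "\<lambda>(i, k). snd i + k"])
      show "x \<in> J \<times> UNIV \<Longrightarrow> good c (case x of (i, k) \<Rightarrow> snd i + k) (case x of (i, k) \<Rightarrow> F i k)" for x
      proof (cases x)
        case (Pair i k)
        assume "x \<in> J \<times> UNIV"
        then have "good (c + 0) (snd i + k) (p i \<odot> Mp k i j)" using Pair p gMp j by (intro good_mult) auto
        then show ?thesis using Pair \<open>x \<in> J \<times> UNIV\<close> by (simp add: F_def)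
      qed
      show "finite {x \<in> J \<times> UNIV. (case x of (i, k) \<Rightarrow> snd i + k) \<le> N}" for N
        by (rule finite_subset[of _ "(idx g \<times> {..N}) \<times> {..N}"]) (auto simp: finite_idx)
    qed (auto simp: F_def)
    note sw = ser_sum_swap[OF this]
    have "N j = ser_sum (\<lambda>i. ser_sum (\<lambda>k. F i k))"
      unfolding N_def row_mult_def dot_def
    proof (rule arg_cong[of _ _ ser_sum], rule ext)
      fix i
      show "(if fst i \<in> idx g then p i \<odot> mat_geometric g M i j else 0) = ser_sum (F i)"
      proof (cases "i \<in> J")
        case True
        have "p i \<odot> ser_sum (\<lambda>k. Mp k i j) = ser_sum (\<lambda>k. p i \<odot> Mp k i j)"
        proof (rule mult_ser_sum)
          show "good 0 0 (Mp k i j)" for k using True j by (rule gMp0)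
          show "pfin (\<lambda>k. Mp k i j)"
          proof (rule pfin_growing[of UNIV 0 "\<lambda>k. k"])
            show "finite {i \<in> UNIV. i \<le> N}" for N :: nat by simp
          qed (use True j gMp in auto)
          show "good c (snd i) (p i)" using p True by simp
        qed
        moreover have "F i = (\<lambda>k. p i \<odot> Mp k i j)" using True by (simp add: F_def fun_eq_iff)
        moreover have "mat_geometric g M i j = ser_sum (\<lambda>k. Mp k i j)"
          by (simp add: mat_geometric_def Mp_def)
        ultimately show ?thesis using True by simp
      next
        case False
        then show ?thesis by (simp add: F_def ser_sum_def zero_fun_def)
      qed
    qed
    also have "\<dots> = ser_sum (\<lambda>k. P k j)"
      unfolding sw by (rule arg_cong[of _ _ ser_sum]) (simp add: fun_eq_iff P_def row_mult_def dot_def F_def)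
    finally show ?thesis .
  qed
  show gN: "good c 0 (N j)" if "j \<in> J" for j
    unfolding N[OF that] by (rule good_ser_sum) (use gP good_mono that in blast)
  have Nrec: "N j = p j + row_mult g N M j" if j: "j \<in> J" for j
  proof -
    define F where "F k l = (if l \<in> J then P k l \<odot> M l j else 0)" for k l
    have "pfin (\<lambda>(k, l). F k l)"
    proof (rule pfin_growing[of "UNIV \<times> J" c "\<lambda>(k, l). k + snd l"])
      show "x \<in> UNIV \<times> J \<Longrightarrow> good c (case x of (k, l) \<Rightarrow> k + snd l) (case x of (k, l) \<Rightarrow> F k l)" for x
      proof (cases x rule: prod.exhaust)
        case (Pair k l)
        assume "x \<in> UNIV \<times> J"
        then have "good (c + 0) (k + (snd l + snd j + 1)) (P k l \<odot> M l j)" using Pair M gP j by (intro good_mult) auto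
        then have "good c (k + snd l) (P k l \<odot> M l j)" using good_mono by fastforce
        then show ?thesis using Pair \<open>x \<in> UNIV \<times> J\<close> by (simp add: F_def)
      qed
      show "finite {x \<in> UNIV \<times> J. (case x of (k, l) \<Rightarrow> k + snd l) \<le> N}" for N
        by (rule finite_subset[of _ "{..N} \<times> (idx g \<times> {..N})"]) (auto simp: finite_idx)
    qed (auto simp: F_def)
    note sw = ser_sum_swap[OF this]
    have "N j = P 0 j + ser_sum (\<lambda>k. P (Suc k) j)"
      unfolding N[OF j] by (rule ser_sum_Suc[OF pfP[OF j]])
    also have "(\<lambda>k. P (Suc k) j) = (\<lambda>k. ser_sum (F k))"
    proof
      fix k
      have "F k = (\<lambda>l. if fst l \<in> idx g then P k l \<odot> M l j else 0)"
        by (simp add: F_def fun_eq_iff)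
      then show "P (Suc k) j = ser_sum (F k)" by (simp add: PS[OF j] dot_def)
    qed
    also have "ser_sum (\<lambda>k. ser_sum (F k)) = ser_sum (\<lambda>l. ser_sum (\<lambda>k. F k l))" by (rule sw)
    also have "(\<lambda>l. ser_sum (\<lambda>k. F k l)) = (\<lambda>l. if fst l \<in> idx g then N l \<odot> M l j else 0)"
    proof
      fix l
      show "ser_sum (\<lambda>k. F k l) = (if fst l \<in> idx g then N l \<odot> M l j else 0)"
      proof (cases "l \<in> J")
        case True
        have "ser_sum (\<lambda>k. P k l) \<odot> M l j = ser_sum (\<lambda>k. P k l \<odot> M l j)"
        proof (rule ser_sum_mult)
          show "good c 0 (P k l)" for k using gP[OF True, of k] good_mono by blast
          show "pfin (\<lambda>k. P k l)" by (rule pfP[OF True])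
          show "good 0 (snd l + snd j + 1) (M l j)" using M True j by auto
        qed
        then show ?thesis using True by (simp add: F_def N)
      next
        case False
        then show ?thesis by (simp add: F_def ser_sum_def zero_fun_def)
      qed
    qed
    finally show ?thesis unfolding P0[OF j] row_mult_def dot_def .
  qed
  have gNM: "good c (snd j) (row_mult g N M j)" if "j \<in> J" for j
    unfolding row_mult_def
  proof (rule good_dot)
    fix l assume "l \<in> J"
    then have "good (c + 0) (0 + (snd l + snd j + 1)) (N l \<odot> M l j)" using gN M that by (intro good_mult) auto
    then show "good c (snd j) (N l \<odot> M l j)" using good_mono by fastforce
  qed
  have gMZ: "good c' (snd i) (dot g (M i) Z)" if "i \<in> J" for i
  proof (rule good_dot)
    fix l assume "l \<in> J"
    then have "good (0 + c') ((snd i + snd l + 1) + snd l) (M i l \<odot> Z l)" using Z M that by (intro good_mult) auto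
    then show "good c' (snd i) (M i l \<odot> Z l)" using good_mono by fastforce
  qed
  have "dot g p Z = dot g (\<lambda>j. N j - row_mult g N M j) Z"
    by (rule dot_cong, rule eq_diff_eq[THEN iffD2, OF Nrec[symmetric]]) simp_all
  also have "\<dots> = dot g N Z - dot g (row_mult g N M) Z"
  proof (rule dot_diff_left)
    show "i \<in> J \<Longrightarrow> good c 0 (N i)" for i by (rule gN)
    show "i \<in> J \<Longrightarrow> good c 0 (row_mult g N M i)" for i using gNM good_mono by blast
    show "i \<in> J \<Longrightarrow> good c' (snd i) (Z i)" for i by (rule Z)
    show "snd i \<le> 0 + snd i + 0" for i :: mindex by simp
  qed
  also have "dot g (row_mult g N M) Z = dot g N (\<lambda>i. dot g (M i) Z)"
  proof (rule dot_assoc)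
    show "i \<in> J \<Longrightarrow> good c 0 (N i)" for i by (rule gN)
    show "i \<in> J \<Longrightarrow> j \<in> J \<Longrightarrow> good 0 (snd i + snd j + 1) (M i j)" for i j by (rule M)
    show "i \<in> J \<Longrightarrow> good c' (snd i) (Z i)" for i by (rule Z)
    show "snd i + snd j \<le> 0 + (snd i + snd j + 1) + snd j + 0" for i j :: mindex by simp
  qed
  also have "dot g N Z - \<dots> = dot g N (\<lambda>i. Z i - dot g (M i) Z)"
  proof (rule dot_diff_right[symmetric])
    show "i \<in> J \<Longrightarrow> good c 0 (N i)" for i by (rule gN)
    show "i \<in> J \<Longrightarrow> good c' (snd i) (Z i)" for i by (rule Z)
    show "i \<in> J \<Longrightarrow> good c' (snd i) (dot g (M i) Z)" for i by (rule gMZ)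
    show "snd i \<le> 0 + snd i + 0" for i :: mindex by simp
  qed
  finally show "dot g p Z = dot g N (\<lambda>i. Z i - dot g (M i) Z)" .
qed

end

section \<open>Divided derivatives\<close>

lemma pd_add: "pd u (f + h) = pd u f + pd u h"
  by (rule ext) (simp add: pd_def algebra_simps)

lemma pd_zero: "pd u 0 = 0"
  by (rule ext) (simp add: pd_def)

lemma pd_smult: "pd u (ser_smult c f) = ser_smult c (pd u f)"
  by (rule ext) (simp add: pd_def ser_smult_def)

lemma pd_ser_sum: "pd u (ser_sum f) = ser_sum (\<lambda>i. pd u (f i))"
  by (rule ext) (simp add: pd_def ser_sum_def lfsum_cmult)

lemma smult_smult: "ser_smult a (ser_smult b f) = ser_smult (a * b) f"
  by (rule ext) (simp add: ser_smult_def)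

lemma smult_add: "ser_smult a (f + h) = ser_smult a f + ser_smult a h"
  by (rule ext) (simp add: ser_smult_def algebra_simps)

lemma smult_one: "ser_smult 1 f = f"
  by (simp add: ser_smult_def)

lemma smult_zero: "ser_smult 0 f = 0"
  by (rule ext) (simp add: ser_smult_def)

lemma smult_zero_right: "ser_smult a 0 = 0"
  by (rule ext) (simp add: ser_smult_def)

lemma pdd_0: "pdd u 0 f = f"
  by (simp add: pdd_def smult_one)

lemma pdd_1: "pdd u 1 f = pd u f"
  by (simp add: pdd_def smult_one)

lemma pdd_Suc: "pdd u (Suc m) f = ser_smult (1 / of_nat (Suc m)) (pd u (pdd u m f))"
  by (simp add: pdd_def pd_smult smult_smult mult.commute)

lemma pdd_add: "pdd u m (f + h) = pdd u m f + pdd u m h"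
proof (induction m)
  case 0 show ?case by (simp only: pdd_0)
next
  case (Suc m) show ?case by (simp only: pdd_Suc Suc pd_add smult_add)
qed

lemma pdd_zero: "pdd u m 0 = 0"
proof (induction m)
  case 0 show ?case by (simp only: pdd_0)
next
  case (Suc m) show ?case by (simp only: pdd_Suc Suc pd_zero smult_zero_right)
qed

lemma pdd_sum: "pdd u m (\<Sum>i\<in>A. f i) = (\<Sum>i\<in>A. pdd u m (f i))"
  by (rule ser_sum_morphism) (rule pdd_add, rule pdd_zero)

lemma pdd_smult: "pdd u m (ser_smult c f) = ser_smult c (pdd u m f)"
proof (induction m)
  case 0 show ?case by (simp only: pdd_0)
next
  case (Suc m) show ?case by (simp only: pdd_Suc Suc pd_smult smult_smult mult.commute)
qed

lemma pdd_mser: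
  assumes "inj d"
  shows "pdd u m (mser c d) = mser (\<lambda>k. c k * (d k u gchoose m)) (\<lambda>k. d k - sg u (of_nat m))"
proof (induction m)
  case 0
  have "d k - sg u 0 = d k" for k by (auto simp: sg_def)
  then show ?case by (simp add: pdd_0)
next
  case (Suc m)
  have inj: "inj (\<lambda>k. d k - sg u x)" for x using assms by (auto simp: inj_def)
  have sg: "d k - sg u (of_nat m) - sg u 1 = d k - sg u (of_nat (Suc m))" for k
    by (auto simp: sg_def)
  have sm: "ser_smult a (mser c' d') = mser (\<lambda>k. a * c' k) d'" if "inj d'" for a c' d'
    by (rule mser_eqI) (use that in \<open>auto simp: ser_smult_def mser_at mser_off\<close>)
  have cf: "1 / of_nat (Suc m) * (c k * (d k u gchoose m) * (d k - sg u (of_nat m)) u) = c k * (d k u gchoose Suc m)" for k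
    using gchoose_Suc_mult[of "d k u" m] by (simp add: field_simps del: of_nat_Suc)
  have "pdd u (Suc m) (mser c d) = ser_smult (1 / of_nat (Suc m))
      (mser (\<lambda>k. c k * (d k u gchoose m) * (d k - sg u (of_nat m)) u) (\<lambda>k. d k - sg u (of_nat m) - sg u 1))"
    by (simp only: pdd_Suc Suc pd_mser[OF inj])
  also have "\<dots> = mser (\<lambda>k. c k * (d k u gchoose Suc m)) (\<lambda>k. d k - sg u (of_nat (Suc m)))"
    unfolding sg sm[OF inj] cf ..
  finally show ?case .
qed

lemma mon_mult_mser: "mon x \<odot> mser c d = mser c (\<lambda>k. x + d k)"
  unfolding mser_def mon_ser_sum mult_ser_smult mon_mult_mon ..

subsection \<open>Independence of a variable\<close>

definition indep :: "var \<Rightarrow> ser \<Rightarrow> bool" where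
  "indep u f \<longleftrightarrow> (\<forall>e. f e \<noteq> 0 \<longrightarrow> e u = 0)"

lemma indep_mult: "indep u f \<Longrightarrow> indep u h \<Longrightarrow> indep u (f \<odot> h)"
  unfolding indep_def
proof (intro allI impI)
  fix e assume *: "\<forall>e. f e \<noteq> 0 \<longrightarrow> e u = 0" "\<forall>e. h e \<noteq> 0 \<longrightarrow> e u = 0" and "(f \<odot> h) e \<noteq> 0"
  then obtain d where "f d \<noteq> 0" "h (e - d) \<noteq> 0" by (elim ser_mult_nonzeroE)
  then have "d u = 0" "(e - d) u = 0" using * by blast+
  then show "e u = 0" by simp
qed

lemma indep_add: "indep u f \<Longrightarrow> indep u h \<Longrightarrow> indep u (f + h)"
  by (auto simp: indep_def) (metis add.right_neutral)

lemma indep_uminus: "indep u f \<Longrightarrow> indep u (- f)"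
  by (auto simp: indep_def)

lemma indep_diff: "indep u f \<Longrightarrow> indep u h \<Longrightarrow> indep u (f - h)"
  by (auto simp: indep_def) (metis diff_zero)

lemma indep_zero: "indep u 0" by (simp add: indep_def)

lemma indep_smult: "indep u f \<Longrightarrow> indep u (ser_smult c f)"
  by (auto simp: indep_def ser_smult_def)

lemma indep_ser_sum: "(\<And>i. indep u (f i)) \<Longrightarrow> indep u (ser_sum f)"
proof -
  assume H: "\<And>i. indep u (f i)"
  have "\<exists>i. f i e \<noteq> 0" if "ser_sum f e \<noteq> 0" for e
    using that unfolding ser_sum_def by (metis (mono_tags, lifting) lfsum_def sum.neutral)
  then show ?thesis using H by (metis indep_def)
qed

lemma indep_sum: "(\<And>i. i \<in> A \<Longrightarrow> indep u (f i)) \<Longrightarrow> indep u (\<Sum>i\<in>A. f i)"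
proof (induction A rule: infinite_finite_induct)
  case (infinite A)
  then show ?case unfolding sum.infinite[OF infinite(1)] by (simp only: indep_zero)
next
  case empty
  then show ?case unfolding sum.empty by (simp only: indep_zero)
next
  case (insert x F)
  show ?case unfolding sum.insert[OF insert(1,2)] by (intro indep_add insert) auto
qed

lemma indep_mon: "d u = 0 \<Longrightarrow> indep u (mon d)"
  by (auto simp: indep_def mon_def)

lemma indep_pw: "u \<noteq> v \<Longrightarrow> indep u (pw v x)"
  by (simp add: pw_eq_mon indep_mon)

lemma indep_pd: "u \<noteq> v \<Longrightarrow> indep u f \<Longrightarrow> indep u (pd v f)"
  unfolding indep_def
proof (intro allI impI)
  fix e assume "u \<noteq> v" "\<forall>e. f e \<noteq> 0 \<longrightarrow> e u = 0" "pd v f e \<noteq> 0"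
  then have "(e + sg v 1) u = 0" by (auto simp: pd_alt)
  then show "e u = 0" using \<open>u \<noteq> v\<close> by simp
qed

lemma indep_pdd: "u \<noteq> v \<Longrightarrow> indep u f \<Longrightarrow> indep u (pdd v m f)"
proof (induction m)
  case 0 then show ?case by (simp only: pdd_0)
next
  case (Suc m)
  show ?case unfolding pdd_Suc by (rule indep_smult, rule indep_pd, rule Suc(2), rule Suc(1), rule Suc(2), rule Suc(3))
qed

text \<open>As the exponent of \<open>u\<close> in \<open>f\<close> is \<open>0\<close>, differentiation multiplies all terms of the convolution by
  the same number.\<close>

lemma pd_mult_indep:
  assumes "indep u f"
  shows "pd u (f \<odot> h) = f \<odot> pd u h"
proof
  fix e
  show "pd u (f \<odot> h) e = (f \<odot> pd u h) e"
  proof (cases "e u + 1 = 0")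
    case True
    have "(f \<odot> pd u h) e = 0" unfolding ser_mult_alt
    proof (rule sum.neutral, rule ballI)
      fix d assume "d \<in> {d. f d \<noteq> 0 \<and> pd u h (e - d) \<noteq> 0}"
      then have "d u = 0" using assms by (auto simp: indep_def)
      then show "f d * pd u h (e - d) = 0" using True by (simp add: pd_alt)
    qed
    then show ?thesis using True by (simp add: pd_alt)
  next
    case False
    have eq: "e + sg u 1 - d = e - d + sg u 1" for d by simp
    show ?thesis unfolding pd_alt[of u "f \<odot> h"] ser_mult_alt sum_distrib_left
    proof (rule sum.cong)
      show "{d. f d \<noteq> 0 \<and> h (e + sg u 1 - d) \<noteq> 0} = {d. f d \<noteq> 0 \<and> pd u h (e - d) \<noteq> 0}"
        using assms False by (auto simp: pd_alt indep_def eq)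
      fix d assume "d \<in> {d. f d \<noteq> 0 \<and> pd u h (e - d) \<noteq> 0}"
      then have "d u = 0" using assms by (auto simp: indep_def)
      then show "(e u + 1) * (f d * h (e + sg u 1 - d)) = f d * pd u h (e - d)"
        by (simp add: pd_alt eq)
    qed
  qed
qed

lemma pdd_mult_indep: "indep u f \<Longrightarrow> pdd u m (f \<odot> h) = f \<odot> pdd u m h"
proof (induction m)
  case 0 show ?case by (simp only: pdd_0)
next
  case (Suc m)
  show ?case by (simp only: pdd_Suc Suc(1)[OF Suc(2)] pd_mult_indep[OF Suc(2)] mult_ser_smult)
qed

lemma pdd_mult_indep': "indep u h \<Longrightarrow> pdd u m (f \<odot> h) = pdd u m f \<odot> h"
  using pdd_mult_indep[of u h m f] by (simp only: ser_mult_commute)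

lemma pdd_pw: "pdd u m (pw u x) = ser_smult (x gchoose m) (pw u (x - of_nat m))"
proof (induction m)
  case 0 show ?case by (simp add: pdd_0 smult_one)
next
  case (Suc m)
  have pd: "pd u (pw u y) = ser_smult y (pw u (y - 1))" for y
  proof
    fix e
    have "e + sg u 1 = sg u y \<longleftrightarrow> e = sg u (y - 1)"
      by (metis add_diff_cancel_right' diff_add_cancel sg_add)
    then show "pd u (pw u y) e = ser_smult y (pw u (y - 1)) e"
      by (auto simp: pd_alt pw_eq_mon mon_def ser_smult_def)
  qed
  have "1 / of_nat (Suc m) * ((x gchoose m) * (x - of_nat m)) = x gchoose Suc m"
    using gchoose_Suc_mult[of x m] by (simp add: field_simps del: of_nat_Suc)
  moreover have "x - of_nat m - 1 = x - of_nat (Suc m)" by simp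
  ultimately show ?case
    by (simp only: pdd_Suc Suc pd_smult pd smult_smult)
qed

subsection \<open>The expansion of \<open>1/(u-v)\<close>\<close>

lemma pfin_mser: assumes "inj d" shows "pfin (\<lambda>k. ser_smult (c k) (mon (d k)))"
  unfolding pfin_def
proof
  fix e
  have "{k. ser_smult (c k) (mon (d k)) e \<noteq> 0} \<subseteq> d -` {e}"
    by (auto simp: ser_smult_def mon_def)
  moreover have "finite (d -` {e})" using assms by (intro finite_vimageI) auto
  ultimately show "finite {k. ser_smult (c k) (mon (d k)) e \<noteq> 0}" by (rule finite_subset)
qed

text \<open>The exponents of the term \<open>v\<^sup>ku\<^bsup>-k-1\<^esup>\<close> of \<open>1/(u-v)\<close>, expanded where \<open>u\<close> is larger than \<open>v\<close>.\<close>

definition geo :: "var \<Rightarrow> var \<Rightarrow> nat \<Rightarrow> monom" where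
  "geo v u k = sg v (of_nat k) + sg u (- of_nat k - 1)"

lemma inj_geo: "u \<noteq> v \<Longrightarrow> inj (geo v u)"
proof (rule injI)
  fix k l assume "u \<noteq> v" "geo v u k = geo v u l"
  then have "geo v u k v = geo v u l v" by (simp only:)
  then show "k = l" using \<open>u \<noteq> v\<close> by (simp add: geo_def)
qed

lemma inv_diff_mser:
  "inv_diff r u v = (if r v < r u then mser (\<lambda>_. 1) (geo v u) else mser (\<lambda>_. - 1) (geo u v))"
proof -
  have 1: "ser_sum (\<lambda>k::nat. pw a (of_nat k) \<odot> pw b (- of_nat k - 1)) = mser (\<lambda>_. 1) (geo a b)" for a b
    by (simp add: mser_def pw_eq_mon mon_mult_mon smult_one geo_def)
  have "- mser (\<lambda>_. 1) (geo a b) = mser (\<lambda>_. - 1) (geo a b)" for a b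
    unfolding mser_def ser_sum_uminus[symmetric]
    by (rule arg_cong[of _ _ ser_sum]) (simp add: ser_smult_def fun_eq_iff)
  then show ?thesis unfolding inv_diff_def 1 by simp
qed

text \<open>The two series differ by a shift of the index and telescope.\<close>

lemma diff_mult_mser:
  assumes "u \<noteq> v"
  shows "pw u 1 \<odot> mser (\<lambda>_. 1) (geo v u) - pw v 1 \<odot> mser (\<lambda>_. 1) (geo v u) = mon (\<lambda>_. 0)"
proof -
  define d :: "nat \<Rightarrow> monom" where "d k = sg v (of_nat k) + sg u (- of_nat k)" for k
  have 1: "sg u 1 + geo v u k = d k" for k
    by (auto simp: d_def geo_def sg_def fun_eq_iff)
  have 2: "sg v 1 + geo v u k = d (Suc k)" for k
    by (auto simp: d_def geo_def sg_def fun_eq_iff)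
  have inj: "inj d"
  proof (rule injI)
    fix k l assume "d k = d l"
    then have "d k v = d l v" by (simp only:)
    then show "k = l" using assms by (simp add: d_def)
  qed
  have d0: "d 0 = (\<lambda>_. 0)" by (auto simp: d_def sg_def fun_eq_iff)
  have "mser (\<lambda>_. 1) d = ser_smult 1 (mon (d 0)) + ser_sum (\<lambda>k. ser_smult 1 (mon (d (Suc k))))"
    unfolding mser_def by (rule ser_sum_Suc[OF pfin_mser[OF inj]])
  then have "mser (\<lambda>_. 1) d - mser (\<lambda>_. 1) (\<lambda>k. d (Suc k)) = mon (\<lambda>_. 0)"
    unfolding mser_def[of _ "\<lambda>k. d (Suc k)"] smult_one d0 by (metis add_diff_cancel_right')
  then show ?thesis by (simp only: pw_eq_mon mon_mult_mser 1 2)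
qed

lemma pw_diff_mult:
  "(pw u x - pw v y) \<odot> f = pw u x \<odot> f - pw v y \<odot> f"
proof
  fix e
  let ?D = "{sg u x, sg v y}"
  have "((pw u x - pw v y) \<odot> f) e = (\<Sum>d\<in>?D. (pw u x - pw v y) d * f (e - d))"
    by (rule ser_mult_eq_sum) (auto simp: pw_eq_mon mon_def split: if_splits)
  then show "((pw u x - pw v y) \<odot> f) e = (pw u x \<odot> f - pw v y \<odot> f) e"
    unfolding fun_diff_def[of "pw u x \<odot> f"] unfolding pw_eq_mon mon_mult
    by (cases "sg u x = sg v y") (auto simp: mon_def)
qed

lemma diff_mult_inv_diff:
  assumes "u \<noteq> v"
  shows "(pw u 1 - pw v 1) \<odot> inv_diff r u v = mon (\<lambda>_. 0)"
proof (cases "r v < r u")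
  case True
  then show ?thesis using diff_mult_mser[OF assms] by (simp add: inv_diff_mser pw_diff_mult)
next
  case False
  have *: "mser (\<lambda>_. - 1) (geo u v) = - mser (\<lambda>_. 1) (geo u v)"
    unfolding mser_def ser_sum_uminus[symmetric]
    by (rule arg_cong[of _ _ ser_sum]) (simp add: ser_smult_def fun_eq_iff)
  have neg: "f \<odot> (- h) = - (f \<odot> h)" for f h :: ser
    using mult_ser_smult[of f "-1" h] by (simp add: ser_smult_def fun_Compl_def)
  have "(pw u 1 - pw v 1) \<odot> inv_diff r u v =
      - (pw u 1 \<odot> mser (\<lambda>_. 1) (geo u v) - pw v 1 \<odot> mser (\<lambda>_. 1) (geo u v))"
    using False by (simp only: inv_diff_mser if_False * neg pw_diff_mult)
  also have "\<dots> = mon (\<lambda>_. 0)" unfolding minus_diff_eq by (rule diff_mult_mser) (use assms in simp)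
  finally show ?thesis .
qed

lemma pdd_pdd_inv_diff:
  assumes "u \<noteq> v"
  shows "pdd u m (pdd v s (inv_diff r u v)) =
    (if r v < r u
     then mser (\<lambda>k. (of_nat k gchoose s) * ((- of_nat k - 1) gchoose m))
            (\<lambda>k. geo v u k - sg v (of_nat s) - sg u (of_nat m))
     else mser (\<lambda>k. - (((- of_nat k - 1) gchoose s) * (of_nat k gchoose m)))
            (\<lambda>k. geo u v k - sg v (of_nat s) - sg u (of_nat m)))"
proof -
  have inj: "inj (\<lambda>k. geo v u k - sg v (of_nat s))" "inj (\<lambda>k. geo u v k - sg v (of_nat s))"
    using inj_geo[of u v] inj_geo[of v u] assms by (auto simp: inj_def)
  have e: "geo v u k v = of_nat k" "geo u v k v = - of_nat k - 1"
     "geo v u k u = - of_nat k - 1" "geo u v k u = of_nat k" for k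
    using assms by (auto simp: geo_def)
  show ?thesis
    using inj_geo[of u v] inj_geo[of v u] assms
    by (simp add: inv_diff_mser pdd_mser inj e)
qed

lemma indep_inv_diff: assumes "w \<noteq> u" "w \<noteq> v" shows "indep w (inv_diff r u v)"
proof -
  have "indep w (mser c (geo a b))" if "w \<noteq> a" "w \<noteq> b" for c a b
    unfolding mser_def using that
    by (intro indep_ser_sum indep_smult indep_mon) (simp add: geo_def)
  then show ?thesis using assms by (simp add: inv_diff_mser)
qed

section \<open>The expansion of \<open>\<pi>\<^sub>2\<close>\<close>

context expansion
begin

text \<open>A bound on the partial sums alone, as is appropriate for series without \<open>\<rho>\<^sub>a\<close>, such as \<open>\<pi>\<^sub>2\<close>.\<close>

definition sc :: "int \<Rightarrow> var option \<Rightarrow> complex" where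
  "sc j i = (case i of Some u \<Rightarrow> if u \<in> V0 then of_int j else 0 | None \<Rightarrow> 0)"

lemma sc_add: "sc i + sc j = sc (i + j)"
  by (rule ext) (auto simp: sc_def split: option.split)

lemma sc_0: "sc 0 = 0"
  by (rule ext) (auto simp: sc_def split: option.split)

lemma good_sc_mono:
  assumes "good (c + sc j) k f" "j' \<le> j" "k' \<le> k"
  shows "good (c + sc j') k' f"
proof (rule good_weaken[OF assms(1)])
  have int_Nats: "(of_int j :: complex) - of_int j' \<in> \<nat>"
  proof -
    obtain l where "j = j' + int l" using assms(2) by (metis zle_iff_zadd)
    then show ?thesis by simp
  qed
  then show "(c + sc j) (Some u) - (c + sc j') (Some u) \<in> \<nat>" for u
    by (auto simp: sc_def)
  show "(c + sc j) None + of_nat k - (c + sc j') None - of_nat k' \<in> \<nat>"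
    using assms(3) by (auto simp: sc_def simp flip: of_nat_diff)
qed

lemma good_sc_mono0:
  assumes "good (sc j) k f" "j' \<le> j" "k' \<le> k"
  shows "good (sc j') k' f"
  using good_sc_mono[of 0 j k f j' k'] assms by simp

lemma good_sc_mult: "good (sc i) k f \<Longrightarrow> good (sc j) k' h \<Longrightarrow> good (sc (i + j)) (k + k') (f \<odot> h)"
  using good_mult[of "sc i" k f "sc j" k' h] by (simp only: sc_add)

lemma V0_vars: "u \<in> V0 \<Longrightarrow> u \<in> vars"
  by (simp add: vars_def)

lemma vars_cases: "u \<in> vars \<Longrightarrow> (u \<in> V0 \<Longrightarrow> P) \<Longrightarrow> (\<And>a. u = VarR a \<Longrightarrow> a \<in> {1..g} \<Longrightarrow> P) \<Longrightarrow> P"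
  by (auto simp: vars_def)

lemma good_pw_V0: "u \<in> V0 \<Longrightarrow> good (sc 0) 0 (pw u (of_nat k))"
  unfolding pw_eq_mon
proof (rule good_mon)
  assume u: "u \<in> V0"
  show "cone (sc 0) 0 (sg u (of_nat k))"
    unfolding cone_def
  proof (intro conjI allI impI ballI)
    show "w \<notin> vars \<Longrightarrow> sg u (of_nat k) w = 0" for w using V0_vars[OF u] by (auto simp: sg_def)
    show "w \<in> vars \<Longrightarrow> deg (Some w) (sg u (of_nat k)) - sc 0 (Some w) \<in> \<nat>" for w
      using u by (auto simp: sc_0 deg_sg_V0 deg_sg_V0_R elim!: vars_cases)
  qed (use u in \<open>simp add: sc_0 deg_sg_V0_None\<close>)
qed

lemma rho_index: "a \<in> idx g \<Longrightarrow> nat \<bar>a\<bar> \<in> {1..g}"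
  by (auto simp: idx_def)

lemma cone_rho:
  assumes "a \<in> idx g"
  shows "cone (sc (5 * int m)) m (sg (rho a) (of_nat m / 2))"
  using rho_index[OF assms]
  by (auto simp: cone_def rho_def deg_sg_R_V0 deg_sg_R_R deg_sg_R_None sc_def vars_def
      elim!: vars_cases intro!: sg_other)

lemma good_pw_rho: "a \<in> idx g \<Longrightarrow> good (sc (5 * int m)) m (pw (rho a) (of_nat m / 2))"
  unfolding pw_eq_mon by (rule good_mon[OF cone_rho])

text \<open>The partial sums of the exponents of \<open>v\<^sup>ku\<^bsup>-k-1\<^esup>\<close> are \<open>0\<close>, \<open>k\<close> and \<open>-1\<close>.\<close>

lemma cone_geo:
  assumes "u \<in> V0" "v \<in> V0" "u \<noteq> v" "r v \<le> r u"
  shows "cone (sc (- 1)) 0 (geo v u k)"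
proof -
  have "deg (Some w) (geo v u k) - sc (- 1) (Some w) \<in> \<nat>" if "w \<in> vars" for w
    using that
  proof (rule vars_cases)
    assume w: "w \<in> V0"
    have "(of_nat k + 1 :: complex) = of_nat (Suc k)" by simp
    then have "(of_nat k + 1 :: complex) \<in> \<nat>" by (metis of_nat_in_Nats)
    then show ?thesis using w assms by (auto simp: geo_def deg_add deg_sg_V0 sc_def)
  next
    fix a assume "w = VarR a"
    then show ?thesis using assms by (auto simp: geo_def deg_add deg_sg_V0_R sc_def)
  qed
  moreover have "geo v u k w = 0" if "w \<notin> vars" for w
    using that assms V0_vars by (auto simp: geo_def sg_def)
  moreover have "deg None (geo v u k) = 0"
    using assms by (simp add: geo_def deg_add deg_sg_V0_None)
  ultimately show ?thesis by (simp add: cone_def sc_def)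
qed

lemma good_inv_diff:
  assumes "u \<in> V0" "v \<in> V0" "u \<noteq> v"
  shows "good (sc (- 1)) 0 (inv_diff r u v)"
  unfolding inv_diff_mser mser_def
  using cone_geo[OF assms] cone_geo[OF assms(2,1)] assms(3)
  by (auto intro!: good_ser_sum good_smult good_mon)

lemma good_pd:
  assumes "good c k f" "u \<in> V0"
  shows "good (c + sc (- 1)) k (pd u f)"
  unfolding good_def
proof (intro allI impI)
  fix e assume "pd u f e \<noteq> 0"
  then have c: "cone c k (e + sg u 1)" using assms(1) by (auto simp: good_def pd_alt)
  have e: "e = (e + sg u 1) - sg u 1" by simp
  have dd: "deg i e = deg i (e + sg u 1) - deg i (sg u 1)" for i by (metis deg_diff e)
  have "deg (Some w) e - (c + sc (- 1)) (Some w) \<in> \<nat>" if w: "w \<in> vars" for w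
  proof -
    have "deg (Some w) (e + sg u 1) - c (Some w) \<in> \<nat>" using c w by (auto simp: cone_def)
    then have *: "(deg (Some w) (e + sg u 1) - c (Some w)) + 1 \<in> \<nat>"
      "deg (Some w) (e + sg u 1) - c (Some w) \<in> \<nat>" by (auto intro: Nats_add)
    from w show ?thesis
    proof (rule vars_cases)
      assume "w \<in> V0"
      then show ?thesis using * assms(2) by (auto simp: dd[of "Some w"] deg_sg_V0 sc_def algebra_simps)
    next
      fix a assume "w = VarR a"
      then show ?thesis using * assms(2) by (simp add: dd[of "Some (VarR a)"] deg_sg_V0_R sc_def)
    qed
  qed
  moreover have "e w = 0" if "w \<notin> vars" for w
  proof -
    have "w \<noteq> u" using that assms(2) V0_vars by auto
    moreover have "(e + sg u 1) w = 0" using c that by (auto simp: cone_def)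
    ultimately show ?thesis by simp
  qed
  moreover have "deg None e - (c + sc (- 1)) None - of_nat k \<in> \<nat>"
    using c assms(2) by (simp add: dd[of None] deg_sg_V0_None sc_def cone_def)
  ultimately show "cone (c + sc (- 1)) k e" by (simp add: cone_def)
qed

lemma good_pdd:
  assumes "good c k f" "u \<in> V0"
  shows "good (c + sc (- int m)) k (pdd u m f)"
proof (induction m)
  case 0
  then show ?case using assms(1) by (simp add: pdd_0 sc_0)
next
  case (Suc m)
  have "good (c + sc (- int m) + sc (- 1)) k (pdd u (Suc m) f)"
    unfolding pdd_Suc by (rule good_smult, rule good_pd, rule Suc, rule assms)
  moreover have "c + sc (- int m) + sc (- 1) = c + sc (- int (Suc m))"
    by (simp add: add.assoc sc_add add.commute)
  ultimately show ?case by (simp only:)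
qed

lemma good_sc_pdd: "good (sc j) k f \<Longrightarrow> u \<in> V0 \<Longrightarrow> good (sc (j - int m)) k (pdd u m f)"
  using good_pdd[of "sc j" k f u m] by (simp add: sc_add)

subsection \<open>Rings of integral series\<close>

text \<open>These series form a commutative ring, in which polynomial identities can be checked by rewriting.\<close>

definition laurent :: "ser \<Rightarrow> bool" where
  "laurent f \<longleftrightarrow> (\<exists>j. good (sc j) 0 f)"

lemma laurentI: "good (sc j) k f \<Longrightarrow> laurent f"
  unfolding laurent_def by (rule exI, rule good_mono, assumption, rule le0)

lemma laurent_mult [intro, simp]: "laurent f \<Longrightarrow> laurent h \<Longrightarrow> laurent (f \<odot> h)"
  unfolding laurent_def using good_sc_mult[of _ 0 f _ 0 h] by (metis add_0)

lemma laurent_add [intro, simp]: "laurent f \<Longrightarrow> laurent h \<Longrightarrow> laurent (f + h)"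
  unfolding laurent_def
proof safe
  fix i j assume "good (sc i) 0 f" "good (sc j) 0 h"
  then have "good (sc (min i j)) 0 f" "good (sc (min i j)) 0 h"
    by (auto intro: good_sc_mono0)
  then show "\<exists>j. good (sc j) 0 (f + h)" using good_add by blast
qed

lemma laurent_uminus [intro, simp]: "laurent f \<Longrightarrow> laurent (- f)"
  unfolding laurent_def using good_uminus by blast

lemma laurent_diff [intro, simp]: "laurent f \<Longrightarrow> laurent h \<Longrightarrow> laurent (f - h)"
  using laurent_add[of f "- h"] by simp

lemma laurent_pw [intro, simp]: "u \<in> V0 \<Longrightarrow> laurent (pw u (of_nat k))"
  using good_pw_V0 laurentI by blast

lemma laurent_pw_num [intro, simp]: "u \<in> V0 \<Longrightarrow> laurent (pw u 0)" "u \<in> V0 \<Longrightarrow> laurent (pw u 1)" "u \<in> V0 \<Longrightarrow> laurent (pw u 2)"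
  using laurent_pw[of u 0] laurent_pw[of u 1] laurent_pw[of u 2] by simp_all

lemma laurent_inv_diff [intro, simp]: "u \<in> V0 \<Longrightarrow> v \<in> V0 \<Longrightarrow> u \<noteq> v \<Longrightarrow> laurent (inv_diff r u v)"
  using good_inv_diff laurentI by blast

lemma laurent_assoc: "laurent f \<Longrightarrow> laurent h \<Longrightarrow> laurent q \<Longrightarrow> (f \<odot> h) \<odot> q = f \<odot> (h \<odot> q)"
  unfolding laurent_def by (elim exE) (rule ser_mult_assoc)

lemma laurent_left_commute: "laurent f \<Longrightarrow> laurent h \<Longrightarrow> laurent q \<Longrightarrow> f \<odot> (h \<odot> q) = h \<odot> (f \<odot> q)"
  unfolding laurent_def by (elim exE) (rule ser_mult_left_commute)

lemma laurent_distrib: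
  "laurent f \<Longrightarrow> laurent h \<Longrightarrow> laurent q \<Longrightarrow> (f + h) \<odot> q = f \<odot> q + h \<odot> q"
  "laurent f \<Longrightarrow> laurent h \<Longrightarrow> laurent q \<Longrightarrow> q \<odot> (f + h) = q \<odot> f + q \<odot> h"
  "laurent f \<Longrightarrow> laurent h \<Longrightarrow> laurent q \<Longrightarrow> q \<odot> (f - h) = q \<odot> f - q \<odot> h"
  "laurent f \<Longrightarrow> laurent h \<Longrightarrow> laurent q \<Longrightarrow> (f - h) \<odot> q = f \<odot> q - h \<odot> q"
  unfolding laurent_def ser_mult_commute[of _ q]
  by ((elim exE, rule distrib_left | elim exE, rule diff_distrib_left); assumption)+

text \<open>For \<open>P(z) = (z - A\<^sub>0)(z - A\<^sub>1)(z - A\<^sub>2)\<close>, the last factor is the difference quotient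
  \<open>(P(U) - P(W))/(U - W)\<close>; its coefficients in \<open>W\<close> are the numerators of the \<open>f\<^sub>\<ell>\<close>.\<close>

lemma cubic_identity:
  assumes "laurent U" "laurent W" "laurent A0" "laurent A1" "laurent A2"
  shows "(W - A0) \<odot> (W - A1) \<odot> (W - A2) = (U - A0) \<odot> (U - A1) \<odot> (U - A2) - (U - W) \<odot>
    ((U \<odot> U - (A0 + A1 + A2) \<odot> U + (A0 \<odot> A1 + A0 \<odot> A2 + A1 \<odot> A2)) + (U - (A0 + A1 + A2)) \<odot> W + W \<odot> W)"
  using assms
  by (simp only: laurent_distrib laurent_mult laurent_add laurent_diff,
      simp only: laurent_assoc laurent_left_commute ser_mult_commute laurent_mult laurent_add laurent_diff, simp only: algebra_simps)

lemma VarA_V0: "l \<le> 2 \<Longrightarrow> VarA l \<in> V0"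
  by (auto simp: V0_def)

text \<open>This is \<open>cubic_identity\<close>, multiplied by the inverses of \<open>U - W\<close> and of the \<open>U - A\<^sub>\<ell>\<close>.\<close>

lemma pi2_decomp:
  assumes u: "u \<in> V0" and v: "v \<in> V0" and uv: "u \<noteq> v" and uA: "\<And>l. u \<noteq> VarA l"
  shows "pi2 r u v = inv_diff r u v + (\<Sum>l\<le>2. f2 r l u \<odot> pw v (of_nat l))"
proof -
  define U W \<iota> where "U = pw u 1" and "W = pw v 1" and "\<iota> = inv_diff r u v"
  define A \<kappa> where "A l = pw (VarA l) 1" and "\<kappa> l = inv_diff r u (VarA l)" for l
  define K where "K = \<kappa> 0 \<odot> \<kappa> 1 \<odot> \<kappa> 2"
  define n0 n1 where "n0 = U \<odot> U - (A 0 + A 1 + A 2) \<odot> U + (A 0 \<odot> A 1 + A 0 \<odot> A 2 + A 1 \<odot> A 2)"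
    and "n1 = U - (A 0 + A 1 + A 2)"
  define N where "N = n0 + n1 \<odot> W + W \<odot> W"
  have laurent: "laurent U" "laurent W" "laurent \<iota>" "laurent (A 0)" "laurent (A 1)" "laurent (A 2)" "laurent (\<kappa> 0)" "laurent (\<kappa> 1)" "laurent (\<kappa> 2)"
    using u v uv uA by (auto simp: U_def W_def \<iota>_def A_def \<kappa>_def VarA_V0)
  have QK: "laurent K" "laurent n0" "laurent n1" "laurent N" using laurent by (auto simp: K_def n0_def n1_def N_def)
  have QUW: "laurent (U - W)" using laurent by auto
  have inv: "(U - W) \<odot> \<iota> = mon (\<lambda>_. 0)"
    unfolding U_def W_def \<iota>_def by (rule diff_mult_inv_diff[OF uv])
  have invA: "(U - A l) \<odot> \<kappa> l = mon (\<lambda>_. 0)" for l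
    unfolding U_def A_def \<kappa>_def by (rule diff_mult_inv_diff[OF uA])
  have rearr: "(x0 \<odot> y0) \<odot> (x1 \<odot> y1) \<odot> (x2 \<odot> y2) = (x0 \<odot> x1 \<odot> x2) \<odot> (y0 \<odot> y1 \<odot> y2)"
    if "laurent x0" "laurent x1" "laurent x2" "laurent y0" "laurent y1" "laurent y2" for x0 x1 x2 y0 y1 y2
    using that by (simp only: laurent_assoc laurent_left_commute ser_mult_commute laurent_mult)
  have "pi2 r u v = \<iota> \<odot> (((W - A 0) \<odot> \<kappa> 0) \<odot> ((W - A 1) \<odot> \<kappa> 1) \<odot> ((W - A 2) \<odot> \<kappa> 2))"
    by (simp add: pi2_def Let_def \<iota>_def W_def A_def \<kappa>_def)
  also have "\<dots> = \<iota> \<odot> (((W - A 0) \<odot> (W - A 1) \<odot> (W - A 2)) \<odot> K)"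
    unfolding K_def using laurent by (subst rearr) auto
  also have "(W - A 0) \<odot> (W - A 1) \<odot> (W - A 2) = (U - A 0) \<odot> (U - A 1) \<odot> (U - A 2) - (U - W) \<odot> N"
    unfolding N_def n0_def n1_def by (rule cubic_identity) (use laurent in auto)
  also have "\<dots> \<odot> K = (U - A 0) \<odot> (U - A 1) \<odot> (U - A 2) \<odot> K - (U - W) \<odot> N \<odot> K"
    using laurent QK by (intro laurent_distrib) auto
  also have "(U - A 0) \<odot> (U - A 1) \<odot> (U - A 2) \<odot> K = mon (\<lambda>_. 0)"
    unfolding K_def using laurent by (subst rearr[symmetric]) (auto simp: invA)
  also have "\<iota> \<odot> (mon (\<lambda>_. 0) - (U - W) \<odot> N \<odot> K) = \<iota> \<odot> mon (\<lambda>_. 0) - \<iota> \<odot> ((U - W) \<odot> N \<odot> K)"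
  proof (rule laurent_distrib(3))
    show "laurent (mon (\<lambda>_. 0))" using laurent_pw_num(1)[OF u] by (simp add: pw_zero)
  qed (use laurent QK in auto)
  also have "\<iota> \<odot> ((U - W) \<odot> N \<odot> K) = ((U - W) \<odot> \<iota>) \<odot> (N \<odot> K)"
    using laurent QK QUW by (simp only: laurent_assoc laurent_left_commute ser_mult_commute laurent_mult)
  finally have pi: "pi2 r u v = \<iota> - N \<odot> K"
    unfolding inv mon_zero_mult .
  have f2: "f2 r 0 u = - (n0 \<odot> K)" "f2 r 1 u = - (n1 \<odot> K)" "f2 r 2 u = - K"
    by (simp_all add: f2_def Let_def n0_def n1_def K_def U_def A_def \<kappa>_def pw_mult_pw pw_zero)
  have "{..2::nat} = {0, 1, 2}" by auto
  then have "(\<Sum>l\<le>2. f2 r l u \<odot> pw v (of_nat l)) =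
      f2 r 0 u \<odot> mon (\<lambda>_. 0) + (f2 r 1 u \<odot> W + f2 r 2 u \<odot> (W \<odot> W))"
    by (simp add: W_def pw_mult_pw pw_zero)
  also have "\<dots> = - (n0 \<odot> K) + (- (n1 \<odot> W \<odot> K) - W \<odot> W \<odot> K)"
  proof -
    have "n1 \<odot> K \<odot> W = n1 \<odot> W \<odot> K" "K \<odot> (W \<odot> W) = W \<odot> W \<odot> K"
      using laurent QK by (simp_all only: laurent_assoc laurent_left_commute ser_mult_commute laurent_mult)
    then show ?thesis unfolding f2 mult_uminus mon_zero_mult diff_conv_add_uminus by (simp only:)
  qed
  also have "\<dots> = - (N \<odot> K)"
  proof -
    have "N \<odot> K = n0 \<odot> K + n1 \<odot> W \<odot> K + W \<odot> W \<odot> K"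
      unfolding N_def using laurent QK by (subst laurent_distrib(1), auto)+
    then show ?thesis by (simp only: minus_add_distrib diff_conv_add_uminus add.assoc)
  qed
  finally show ?thesis unfolding pi \<iota>_def[symmetric] diff_conv_add_uminus by (simp only:)
qed

lemma good_pi2:
  assumes u: "u \<in> V0" and v: "v \<in> V0" and uv: "u \<noteq> v" and uA: "\<And>l. u \<noteq> VarA l"
  shows "good (sc (- 4)) 0 (pi2 r u v)"
proof -
  have q: "good (sc (- 1)) 0 ((pw v 1 - pw (VarA l) 1) \<odot> inv_diff r u (VarA l))" if "l \<le> 2" for l
  proof -
    have "good (sc (0 + - 1)) (0 + 0) ((pw v 1 - pw (VarA l) 1) \<odot> inv_diff r u (VarA l))"
      by (rule good_sc_mult, rule good_diff)
        (use good_pw_V0[OF v, of 1] good_pw_V0[OF VarA_V0[OF that], of 1]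
          good_inv_diff[OF u VarA_V0[OF that] uA] in auto)
    then show ?thesis by simp
  qed
  have "good (sc (- 1 + (- 1 + - 1 + - 1))) (0 + (0 + 0 + 0)) (pi2 r u v)"
    unfolding pi2_def Let_def
    by (rule good_sc_mult[OF good_inv_diff[OF u v uv] good_sc_mult[OF good_sc_mult]]) (rule q, simp)+
  then show ?thesis by simp
qed

lemma good_f2:
  assumes u: "u \<in> V0" and uA: "\<And>l. u \<noteq> VarA l"
  shows "good (sc (- 3)) 0 (f2 r l u)"
proof -
  have pw: "good (sc 0) 0 (pw w 1)" "good (sc 0) 0 (pw w 2)" "good (sc 0) 0 (pw w 0)" if "w \<in> V0" for w
    using good_pw_V0[OF that, of 1] good_pw_V0[OF that, of 2] good_pw_V0[OF that, of 0] by simp_all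
  have m0: "good (sc 0) 0 f \<Longrightarrow> good (sc 0) 0 h \<Longrightarrow> good (sc 0) 0 (f \<odot> h)" for f h
    using good_sc_mult[of 0 0 f 0 0 h] by simp
  have \<kappa>: "good (sc (- 1)) 0 (inv_diff r u (VarA i))" if "i \<le> 2" for i
    by (rule good_inv_diff[OF u VarA_V0[OF that] uA])
  have "good (sc (0 + (- 1 + - 1 + - 1))) (0 + (0 + 0 + 0)) (- f2 r l u)"
    unfolding f2_def Let_def minus_minus
    by (rule good_sc_mult[OF _ good_sc_mult[OF good_sc_mult]])
      (auto intro!: \<kappa> good_add good_diff m0 pw u VarA_V0)
  from good_uminus[OF this] show ?thesis by simp
qed

end

section \<open>The matrices of the sewing scheme\<close>

lemma indep_pi2:
  assumes "w \<noteq> u" "w \<noteq> v" "\<And>l. w \<noteq> VarA l"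
  shows "indep w (pi2 r u v)"
  unfolding pi2_def Let_def
  by (intro indep_mult indep_diff indep_inv_diff indep_pw) (use assms in auto)

lemma indep_f2:
  assumes "w \<noteq> u" "\<And>l. w \<noteq> VarA l"
  shows "indep w (f2 r l u)"
  unfolding f2_def Let_def
  by (intro indep_mult indep_diff indep_uminus indep_inv_diff)
    (use assms in \<open>auto intro!: indep_mult indep_diff indep_add indep_pw\<close>)

text \<open>The part of \<open>\<partial>\<^sub>u\<^sup>m\<partial>\<^sub>v\<^sup>s\<pi>\<^sub>2(u,v)/m!s!\<close> that is polynomial in \<open>v\<close>. It has a meaning for
  \<open>u = v\<close> too, where it enters the matrix \<open>A\<close>.\<close>

definition fpart :: "(var \<Rightarrow> nat) \<Rightarrow> var \<Rightarrow> nat \<Rightarrow> var \<Rightarrow> nat \<Rightarrow> ser" where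
  "fpart r u m v s = (\<Sum>l\<le>2. ser_smult (of_nat (l choose s))
     (pdd u m (f2 r l u) \<odot> pw v (of_nat l - of_nat s)))"

lemma rho_uminus [simp]: "rho (- a) = rho a"
  by (simp add: rho_def)

lemma idx_uminus: "a \<in> idx g \<Longrightarrow> - a \<in> idx g"
  by (simp add: idx_def)

context expansion
begin

lemma VarX_V0: "VarX \<in> V0" and VarW_V0: "a \<in> idx g \<Longrightarrow> VarW a \<in> V0"
  and VarY_V0: "k \<in> {1..n} \<Longrightarrow> VarY k \<in> V0"
  by (auto simp: V0_def)

lemma idx_sum_split:
  "(\<Sum>b\<in>idx g. h b) = (\<Sum>a=1..g. h (int a) + h (- int a) :: 'z::comm_monoid_add)"
proof -
  have "idx g = int ` {1..g} \<union> (\<lambda>a. - int a) ` {1..g}"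
  proof
    show "idx g \<subseteq> int ` {1..g} \<union> (\<lambda>a. - int a) ` {1..g}"
    proof
      fix a assume "a \<in> idx g"
      then have "nat \<bar>a\<bar> \<in> {1..g}" by (rule rho_index)
      moreover have "a = int (nat \<bar>a\<bar>) \<or> a = - int (nat \<bar>a\<bar>)" by auto
      ultimately show "a \<in> int ` {1..g} \<union> (\<lambda>a. - int a) ` {1..g}" by blast
    qed
  qed (auto simp: idx_def)
  then have "(\<Sum>b\<in>idx g. h b) = (\<Sum>b\<in>int ` {1..g}. h b) + (\<Sum>b\<in>(\<lambda>a. - int a) ` {1..g}. h b)"
    by (simp only:) (rule sum.union_disjoint, auto)
  also have "(\<Sum>b\<in>int ` {1..g}. h b) = (\<Sum>a=1..g. h (int a))"
    by (subst sum.reindex) auto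
  also have "(\<Sum>b\<in>(\<lambda>a. - int a) ` {1..g}. h b) = (\<Sum>a=1..g. h (- int a))"
    by (subst sum.reindex) (auto simp: inj_on_def)
  finally show ?thesis by (simp only: sum.distrib)
qed

lemma pdd_pdd_pi2:
  assumes "u \<in> V0" "v \<in> V0" "u \<noteq> v" "\<And>l. u \<noteq> VarA l" "\<And>l. v \<noteq> VarA l"
  shows "pdd u m (pdd v s (pi2 r u v)) = pdd u m (pdd v s (inv_diff r u v)) + fpart r u m v s"
proof -
  have "pdd u m (pdd v s (f2 r l u \<odot> pw v (of_nat l))) =
      ser_smult (of_nat (l choose s)) (pdd u m (f2 r l u) \<odot> pw v (of_nat l - of_nat s))" for l
    unfolding pdd_mult_indep[OF indep_f2[OF assms(3)[symmetric] assms(5)]] pdd_pw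
      mult_ser_smult pdd_smult binomial_gbinomial
    by (subst pdd_mult_indep'[OF indep_pw[OF assms(3)]]) simp
  then show ?thesis
    unfolding pi2_decomp[OF assms(1-4)] pdd_add pdd_sum fpart_def by simp
qed

lemma good_fterm:
  assumes u: "u \<in> V0" and v: "v \<in> V0" and uA: "\<And>l. u \<noteq> VarA l"
  shows "good (sc (- 3 - int m)) 0 (ser_smult (of_nat (l choose s))
     (pdd u m (f2 r l u) \<odot> pw v (of_nat l - of_nat s)))"
proof (cases "s \<le> l")
  case True
  have "good (sc ((- 3 - int m) + 0)) (0 + 0) (pdd u m (f2 r l u) \<odot> pw v (of_nat (l - s)))"
    by (intro good_sc_mult good_sc_pdd good_f2 good_pw_V0 u v uA)
  then show ?thesis using True by (auto simp: of_nat_diff intro: good_smult)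
next
  case False
  then have "l choose s = 0" by simp
  then show ?thesis by (simp only: of_nat_0 smult_zero good_zero)
qed

lemma good_fpart:
  assumes "u \<in> V0" "v \<in> V0" "\<And>l. u \<noteq> VarA l"
  shows "good (sc (- 3 - int m)) 0 (fpart r u m v s)"
  unfolding fpart_def by (rule good_sum) (rule good_fterm[OF assms])

lemma good_pdd_pi2:
  assumes "u \<in> V0" "v \<in> V0" "u \<noteq> v" "\<And>l. u \<noteq> VarA l"
  shows "good (sc (- 4 - int s - int m)) 0 (pdd u m (pdd v s (pi2 r u v)))"
  by (intro good_sc_pdd good_pi2 assms)

text \<open>For small \<open>s\<close> the poles of \<open>\<pi>\<^sub>2\<close> outweigh \<open>\<rho>\<^sub>b\<^bsup>s/2\<^esup>\<close>. The row \<open>L\<Delta>\<close> involves \<open>s \<ge> 3\<close> only, where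
  the bound is positive.\<close>

lemma good_Lrow:
  assumes "b \<in> idx g"
  shows "good (sc (4 * int s - 4)) s (Lrow r (b, s))"
proof -
  have "good (sc (5 * int s + (- 4 - int s))) (s + 0) (Lrow r (b, s))"
    unfolding Lrow_def prod.case
    by (intro good_sc_mult good_pw_rho good_sc_pdd good_pi2 VarX_V0 VarW_V0 assms) auto
  then show ?thesis by (rule good_sc_mono0) auto
qed

lemma good_Rcol:
  assumes "a \<in> idx g" "k \<in> {1..n}"
  shows "good 0 (m + 1) (Rcol r (VarY k) (a, m))"
proof -
  have "good (sc (5 * int (m + 1) + (- 4 - int m))) ((m + 1) + 0) (Rcol r (VarY k) (a, m))"
    unfolding Rcol_def prod.case
    by (intro good_sc_mult good_pw_rho good_sc_pdd good_pi2 VarY_V0 VarW_V0 idx_uminus assms) auto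
  then show ?thesis unfolding sc_0[symmetric] by (rule good_sc_mono0) auto
qed

lemma pd_Rcol:
  "pd (VarY k) (Rcol r (VarY k) (a, m)) = pw (rho a) (of_nat (m + 1) / 2) \<odot>
     pd (VarY k) (pdd (VarW (- a)) m (pi2 r (VarW (- a)) (VarY k)))"
  unfolding Rcol_def prod.case by (rule pd_mult_indep[OF indep_pw]) (simp add: rho_def)

lemma good_pd_Rcol:
  assumes "a \<in> idx g" "k \<in> {1..n}"
  shows "good 0 (m + 1) (pd (VarY k) (Rcol r (VarY k) (a, m)))"
proof -
  have "good (sc (5 * int (m + 1) + ((- 4 - int m) - int 1))) ((m + 1) + 0) (pd (VarY k) (Rcol r (VarY k) (a, m)))"
    unfolding pd_Rcol unfolding pdd_1[symmetric]
    by (intro good_sc_mult good_pw_rho good_sc_pdd good_pi2 VarY_V0 VarW_V0 idx_uminus assms) auto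
  then show ?thesis unfolding sc_0[symmetric] by (rule good_sc_mono0) auto
qed

text \<open>The power of \<open>\<rho>\<close> contributes \<open>5(m+s+1)\<close> to the partial sums, against which the derivatives and the
  poles of \<open>\<pi>\<^sub>2\<close> cost at most \<open>4+m+s\<close>.\<close>

lemma good_Amat:
  assumes "a \<in> idx g" "b \<in> idx g"
  shows "good 0 (m + s + 1) (Amat r (a, m) (b, s))"
proof (cases "a = - b")
  case True
  have A: "Amat r (a, m) (b, s) = pw (rho a) (of_nat (m + s + 1) / 2) \<odot> fpart r (VarW (- a)) m (VarW (- a)) s"
    by (simp add: Amat_def True fpart_def)
  have "good (sc (5 * int (m + s + 1) + (- 3 - int m))) ((m + s + 1) + 0) (Amat r (a, m) (b, s))"
    unfolding A by (intro good_sc_mult good_pw_rho good_fpart VarW_V0 idx_uminus assms) auto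
  then show ?thesis unfolding sc_0[symmetric] by (rule good_sc_mono0) auto
next
  case False
  have A: "Amat r (a, m) (b, s) = pw (rho a) (of_nat (m + 1) / 2) \<odot> pw (rho b) (of_nat s / 2) \<odot>
         pdd (VarW (- a)) m (pdd (VarW b) s (pi2 r (VarW (- a)) (VarW b)))"
    using False by (simp add: Amat_def)
  have "good (sc ((5 * int (m + 1) + 5 * int s) + (- 4 - int s - int m))) (((m + 1) + s) + 0) (Amat r (a, m) (b, s))"
    unfolding A
    by (intro good_sc_mult good_pw_rho good_pdd_pi2 VarW_V0 idx_uminus assms) (use False in auto)
  then show ?thesis unfolding sc_0[symmetric] by (rule good_sc_mono0) auto
qed

lemma dot_Delta:
  assumes "b \<in> idx g"
  shows "dot g p (\<lambda>i. Delta i (b, s)) = p (b, s + 3)"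
proof -
  have "dot g p (\<lambda>i. Delta i (b, s)) = (if fst (b, s + 3) \<in> idx g then p (b, s + 3) \<odot> Delta (b, s + 3) (b, s) else 0)"
    unfolding dot_def by (rule ser_sum_single) (auto simp: Delta_def)
  then show ?thesis using assms by (simp add: Delta_def)
qed

text \<open>Solving the recursion for the modes beyond \<open>2\<close> with the inverse of \<open>I - A\<Delta>\<close>.\<close>

lemma Linv_solve:
  assumes Z: "\<And>i. i \<in> J \<Longrightarrow> good c (snd i) (Z i)"
  shows "dot g (\<lambda>(b, s). Lrow r (b, s + 3)) Z =
      dot g (Linv g r) (\<lambda>i. Z i - dot g (\<lambda>(b, s). Amat r i (b, s + 3)) Z)"
    and "\<And>j. j \<in> J \<Longrightarrow> good 0 0 (Linv g r j)"
proof -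
  let ?p = "row_mult g (Lrow r) Delta" and ?M = "mat_mult g (Amat r) Delta"
  have p: "?p j = (case j of (b, s) \<Rightarrow> Lrow r (b, s + 3))" if "j \<in> J" for j
    using that by (cases j) (simp add: row_mult_def dot_Delta)
  have M: "?M i j = (case j of (b, s) \<Rightarrow> Amat r i (b, s + 3))" if "j \<in> J" for i j
    using that by (cases j) (simp add: mat_mult_def row_mult_def dot_Delta)
  have gp: "good 0 (snd j) (?p j)" if "j \<in> J" for j
  proof -
    obtain b s where j: "j = (b, s)" by (cases j)
    then have "good (sc (4 * int (s + 3) - 4)) (s + 3) (Lrow r (b, s + 3))"
      using that good_Lrow[of b "s + 3"] by simp
    then have "good (sc 0) s (Lrow r (b, s + 3))" by (rule good_sc_mono0) auto
    then show ?thesis using p[OF that] j by (simp add: sc_0)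
  qed
  have gM: "good 0 (snd i + snd j + 1) (?M i j)" if "i \<in> J" "j \<in> J" for i j
  proof -
    obtain b s a m where j: "j = (b, s)" "i = (a, m)" by (cases j, cases i)
    then have "good 0 (m + (s + 3) + 1) (Amat r (a, m) (b, s + 3))"
      using that good_Amat[of a b m "s + 3"] by simp
    then have "good 0 (m + s + 1) (Amat r (a, m) (b, s + 3))" by (rule good_mono) auto
    then show ?thesis using M[OF that(2)] j by simp
  qed
  note solve = geometric_solve[of ?M 0 ?p c Z, OF gM gp Z]
  have "dot g (\<lambda>(b, s). Lrow r (b, s + 3)) Z = dot g ?p Z"
    by (rule dot_cong) (use p in auto)
  also have "\<dots> = dot g (Linv g r) (\<lambda>i. Z i - dot g (?M i) Z)"
    unfolding Linv_def by (rule solve(1))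
  also have "\<dots> = dot g (Linv g r) (\<lambda>i. Z i - dot g (\<lambda>(b, s). Amat r i (b, s + 3)) Z)"
  proof (rule dot_cong)
    fix i assume "i \<in> J"
    have "dot g (?M i) Z = dot g (\<lambda>(b, s). Amat r i (b, s + 3)) Z"
      by (rule dot_cong) (use M in auto)
    then show "Z i - dot g (?M i) Z = Z i - dot g (\<lambda>(b, s). Amat r i (b, s + 3)) Z" by (simp only:)
  qed simp
  finally show "dot g (\<lambda>(b, s). Lrow r (b, s + 3)) Z =
      dot g (Linv g r) (\<lambda>i. Z i - dot g (\<lambda>(b, s). Amat r i (b, s + 3)) Z)" .
  show "\<And>j. j \<in> J \<Longrightarrow> good 0 0 (Linv g r j)"
    unfolding Linv_def by (rule solve(2))
qed

text \<open>Separates the modes \<open>0\<close>, \<open>1\<close>, \<open>2\<close>, which act as differential operators, from the others.\<close>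

lemma dot_split:
  assumes p: "\<And>i. i \<in> J \<Longrightarrow> good c (w i) (p i \<odot> q i)" and w: "\<And>i. i \<in> J \<Longrightarrow> snd i \<le> w i + K"
  shows "dot g p q = (\<Sum>a\<in>idx g. \<Sum>l\<le>2. p (a, l) \<odot> q (a, l)) +
     dot g (\<lambda>(b, s). p (b, s + 3)) (\<lambda>(b, s). q (b, s + 3))"
proof
  fix e
  define f where "f i = (if fst i \<in> idx g then (p i \<odot> q i) e else 0)" for i
  let ?S = "{i. f i \<noteq> 0}"
  have "finite {i. (if fst i \<in> idx g then p i \<odot> q i else 0) e \<noteq> 0}"
    using pfin_dot[OF p w] by (simp add: pfin_def)
  then have fin: "finite ?S" by (rule rev_finite_subset) (auto simp: f_def)
  define h where "h = (\<lambda>(b :: int, s :: nat). (b, s + 3))"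
  have inj: "inj h" by (auto simp: h_def inj_def)
  have dot: "dot g p q e = lfsum f"
    unfolding dot_def ser_sum_def f_def by (rule arg_cong[of _ _ lfsum]) auto
  have dot': "dot g (\<lambda>(b, s). p (b, s + 3)) (\<lambda>(b, s). q (b, s + 3)) e = lfsum (\<lambda>i. f (h i))"
    unfolding dot_def ser_sum_def f_def h_def by (rule arg_cong[of _ _ lfsum]) (auto simp: fun_eq_iff)
  have fin2: "finite (h -` ?S)" by (rule finite_vimageI[OF fin inj])
  have "lfsum f = (\<Sum>i \<in> idx g \<times> {..2} \<union> h ` (h -` ?S). f i)"
  proof (rule lfsum_eq_sum)
    show "finite (idx g \<times> {..2} \<union> h ` (h -` ?S))" using fin2 finite_idx by auto
    fix i assume i: "i \<notin> idx g \<times> {..2} \<union> h ` (h -` ?S)"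
    show "f i = 0"
    proof (cases "snd i \<le> 2")
      case True
      then show ?thesis using i by (cases i) (auto simp: f_def)
    next
      case False
      then have "i = h (fst i, snd i - 3)" by (cases i) (auto simp: h_def)
      then show ?thesis using i by (metis (mono_tags, lifting) UnI2 imageI mem_Collect_eq vimageI2)
    qed
  qed
  also have "\<dots> = sum f (idx g \<times> {..2}) + sum f (h ` (h -` ?S))"
    by (rule sum.union_disjoint) (use fin2 finite_idx in \<open>auto simp: h_def\<close>)
  also have "sum f (h ` (h -` ?S)) = (\<Sum>i\<in>h -` ?S. f (h i))"
    using inj by (subst sum.reindex) (auto intro: inj_on_subset)
  also have "\<dots> = lfsum (\<lambda>i. f (h i))"
    by (rule lfsum_eq_sum[symmetric]) (use fin2 in auto)
  also have "sum f (idx g \<times> {..2}) = (\<Sum>a\<in>idx g. \<Sum>l\<le>2. (p (a, l) \<odot> q (a, l)) e)"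
    unfolding sum.cartesian_product by (rule sum.cong) (auto simp: f_def)
  finally show "dot g p q e = ((\<Sum>a\<in>idx g. \<Sum>l\<le>2. p (a, l) \<odot> q (a, l)) +
     dot g (\<lambda>(b, s). p (b, s + 3)) (\<lambda>(b, s). q (b, s + 3))) e"
    by (simp only: plus_fun_apply sum_ser_apply dot dot')
qed

end

section \<open>Chains of intertwining operators\<close>

lemma cmodes_of_int: "cmodes Y u (of_int k) w = Y u k w"
  by (simp add: cmodes_def)

lemma gchoose_0_left: "(0 :: complex) gchoose i = (if i = 0 then 1 else 0)"
  by (cases i) auto

text \<open>A product of intertwining operators whose labels and vectors are functions of the variable, so that
  the vector at one place is replaced by a function update. It acts on a state \<open>w\<close> of any module, and
  this allows a chain to be cut in two.\<close>

primrec op_chain :: "('a, 'm) voa_system \<Rightarrow> (var \<Rightarrow> 'a) \<Rightarrow> monom \<Rightarrow> 'a \<Rightarrow> (var \<times> 'a) list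
    \<Rightarrow> (var \<Rightarrow> 'm) \<Rightarrow> 'm \<Rightarrow> 'm" where
  "op_chain S lab e \<gamma> [] U w = w"
| "op_chain S lab e \<gamma> (q # sk) U w =
     inter S \<gamma> (lab (fst q)) (snd q) (U (fst q)) (- e (fst q) - 1) (op_chain S lab e (snd q) sk U w)"

primrec end_label :: "'a \<Rightarrow> (var \<times> 'a) list \<Rightarrow> 'a" where
  "end_label \<gamma> [] = \<gamma>"
| "end_label \<gamma> (q # sk) = end_label (snd q) sk"

lemma op_chain_append: "op_chain S lab e \<gamma> (P @ R) U w = op_chain S lab e \<gamma> P U (op_chain S lab e (end_label \<gamma> P) R U w)"
  by (induction P arbitrary: \<gamma>) auto

lemma end_label_append: "end_label \<gamma> (P @ R) = end_label (end_label \<gamma> P) R"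
  by (induction P arbitrary: \<gamma>) auto

lemma op_chain_cong:
  assumes "\<And>z. z \<in> fst ` set sk \<Longrightarrow> e z = e' z" "\<And>z. z \<in> fst ` set sk \<Longrightarrow> U z = U' z"
  shows "op_chain S lab e \<gamma> sk U w = op_chain S lab e' \<gamma> sk U' w"
  using assms by (induction sk arbitrary: \<gamma>) auto

lemma op_prod_eq_op_chain:
  "op_prod S e \<gamma> (map (\<lambda>(z, \<beta>). (z, lab z, U z, \<beta>)) sk) = op_chain S lab e \<gamma> sk U (vac S)"
  by (induction sk arbitrary: \<gamma>) auto

context voa_modules
begin

sublocale vs: vector_space "smult S" by (rule vector_space)

abbreviation L :: "'a \<Rightarrow> int \<Rightarrow> 'm \<Rightarrow> 'm" where
  "L \<alpha> k w \<equiv> vir S (mode S \<alpha>) k w"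

abbreviation l0 :: 'a where "l0 \<equiv> lab0 S"

lemma ordinary: "ordinary_module S (carr S \<alpha>) (mode S \<alpha>)"
  using irreducible[of \<alpha>] by (simp add: irreducible_module_def)

lemma subspace_carr: "vs.subspace (carr S \<alpha>)"
  using ordinary[of \<alpha>] by (simp add: ordinary_module_def)

lemma carr_0: "0 \<in> carr S \<alpha>"
  by (rule vs.subspace_0[OF subspace_carr])

lemma module_intertwining:
  "intertwining S (carr S \<alpha>) (mode S \<alpha>) (alg S) (Ymode S) (carr S \<alpha>) (mode S \<alpha>) (cmodes (mode S \<alpha>))"
  using ordinary[of \<alpha>] by (simp add: ordinary_module_def)

lemma intertwining_bilin:
  assumes "intertwining S W3 Y3 W1 Y1 W2 Y2 I"
  shows "v \<in> W1 \<Longrightarrow> w \<in> W2 \<Longrightarrow> I v c w \<in> W3"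
    "v \<in> W1 \<Longrightarrow> v' \<in> W1 \<Longrightarrow> w \<in> W2 \<Longrightarrow> I (v + v') c w = I v c w + I v' c w"
    "v \<in> W1 \<Longrightarrow> w \<in> W2 \<Longrightarrow> w' \<in> W2 \<Longrightarrow> I v c (w + w') = I v c w + I v c w'"
    "v \<in> W1 \<Longrightarrow> w \<in> W2 \<Longrightarrow> I (smult S k v) c w = smult S k (I v c w)"
    "v \<in> W1 \<Longrightarrow> w \<in> W2 \<Longrightarrow> I v c (smult S k w) = smult S k (I v c w)"
proof -
  have b: "bilin_on (smult S) W1 W2 (smult S) W3 (\<lambda>v w. I v c w)" for c
    using assms unfolding intertwining_def by blast
  show "v \<in> W1 \<Longrightarrow> w \<in> W2 \<Longrightarrow> I v c w \<in> W3"
    "v \<in> W1 \<Longrightarrow> v' \<in> W1 \<Longrightarrow> w \<in> W2 \<Longrightarrow> I (v + v') c w = I v c w + I v' c w"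
    "v \<in> W1 \<Longrightarrow> w \<in> W2 \<Longrightarrow> w' \<in> W2 \<Longrightarrow> I v c (w + w') = I v c w + I v c w'"
    "v \<in> W1 \<Longrightarrow> w \<in> W2 \<Longrightarrow> I (smult S k v) c w = smult S k (I v c w)"
    "v \<in> W1 \<Longrightarrow> w \<in> W2 \<Longrightarrow> I v c (smult S k w) = smult S k (I v c w)"
    using b[of c] unfolding bilin_on_def by auto
qed

lemma intertwining_trunc:
  assumes "intertwining S W3 Y3 W1 Y1 W2 Y2 I" "v \<in> W1" "w \<in> W2"
  obtains N where "\<And>k. k \<ge> N \<Longrightarrow> I v (c + of_nat k) w = 0"
  using assms unfolding intertwining_def by blast

lemma intertwining_borcherds:
  assumes "intertwining S W3 Y3 W1 Y1 W2 Y2 I" "u \<in> alg S" "v \<in> W1" "w \<in> W2"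
  shows "lfsum (\<lambda>i::nat. smult S (of_int m gchoose i)
                 (I (Y1 u (l + int i) v) (of_int m + n - of_nat i) w)) =
        lfsum (\<lambda>i::nat. smult S ((- 1) ^ i * (of_int l gchoose i))
                 (Y3 u (m + l - int i) (I v (n + of_nat i) w)
                  - smult S ((- 1) powi l)
                      (I v (n + of_int l - of_nat i) (Y2 u (m + int i) w))))"
  using assms unfolding intertwining_def by blast

lemma intertwining_deriv:
  assumes "intertwining S W3 Y3 W1 Y1 W2 Y2 I" "v \<in> W1" "w \<in> W2"
  shows "I (vir S Y1 (- 1) v) c w = smult S (- c) (I v (c - 1) w)"
  using assms unfolding intertwining_def by blast

text \<open>The Borcherds identity for \<open>l = 0\<close>, where its right-hand side has a single term.\<close>

lemma intertwining_commutator: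
  assumes I: "intertwining S W3 Y3 W1 Y1 W2 Y2 I" and u: "u \<in> alg S" and v: "v \<in> W1" and w: "w \<in> W2"
  shows "Y3 u m (I v n w) - I v n (Y2 u m w) =
    lfsum (\<lambda>i::nat. smult S (of_int m gchoose i) (I (Y1 u (int i) v) (of_int m + n - of_nat i) w))"
proof -
  have "lfsum (\<lambda>i::nat. smult S ((- 1) ^ i * (of_int 0 gchoose i))
                 (Y3 u (m + 0 - int i) (I v (n + of_nat i) w)
                  - smult S ((- 1) powi 0)
                      (I v (n + of_int 0 - of_nat i) (Y2 u (m + int i) w)))) =
        lfsum (\<lambda>i::nat. if i = 0 then Y3 u m (I v n w) - I v n (Y2 u m w) else 0)"
    by (rule lfsum_cong) (auto simp: gchoose_0_left)
  also have "\<dots> = Y3 u m (I v n w) - I v n (Y2 u m w)" by (rule lfsum_single)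
  finally show ?thesis
    using intertwining_borcherds[OF I u v w, of m 0 n] by simp
qed

lemma L_in: "w \<in> carr S \<alpha> \<Longrightarrow> L \<alpha> k w \<in> carr S \<alpha>"
  using intertwining_bilin(1)[OF module_intertwining conf, of w \<alpha> "of_int (k + 1)"]
  by (simp only: cmodes_of_int vir_def)

lemma L_add: "w \<in> carr S \<alpha> \<Longrightarrow> w' \<in> carr S \<alpha> \<Longrightarrow> L \<alpha> k (w + w') = L \<alpha> k w + L \<alpha> k w'"
  using intertwining_bilin(3)[OF module_intertwining conf, of w \<alpha> w' "of_int (k + 1)"]
  by (simp only: cmodes_of_int vir_def)

lemma L_smult: "w \<in> carr S \<alpha> \<Longrightarrow> L \<alpha> k (smult S x w) = smult S x (L \<alpha> k w)"
  using intertwining_bilin(5)[OF module_intertwining conf, of w \<alpha> "of_int (k + 1)"]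
  by (simp only: cmodes_of_int vir_def)

lemma L_0: "L \<alpha> k 0 = 0"
  using L_smult[OF carr_0, of \<alpha> k 0] by simp

lemma L_trunc:
  assumes "w \<in> carr S \<alpha>"
  obtains N where "\<And>i. i > N \<Longrightarrow> L \<alpha> (int i - 1) w = 0"
proof -
  obtain N where N: "\<And>k. k \<ge> N \<Longrightarrow> cmodes (mode S \<alpha>) (conf S) (0 + of_nat k) w = 0"
    using intertwining_trunc[OF module_intertwining conf assms, of 0] by blast
  have "L \<alpha> (int i - 1) w = 0" if "i > N" for i
    using N[of i] that cmodes_of_int[of "mode S \<alpha>" "conf S" "int i" w] by (simp add: vir_def)
  then show ?thesis using that by blast
qed

lemma inter_in: "v \<in> carr S \<alpha> \<Longrightarrow> w \<in> carr S \<beta> \<Longrightarrow> inter S \<gamma> \<alpha> \<beta> v c w \<in> carr S \<gamma>"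
  by (rule intertwining_bilin(1)[OF inter])

lemma inter_commutator:
  assumes v: "v \<in> carr S \<alpha>" and w: "w \<in> carr S \<beta>"
    and N: "\<And>i. i > N \<Longrightarrow> L \<alpha> (int i - 1) v = 0"
  shows "L \<gamma> k (inter S \<gamma> \<alpha> \<beta> v c w) = inter S \<gamma> \<alpha> \<beta> v c (L \<beta> k w) +
    (\<Sum>i\<le>N. smult S (of_int (k + 1) gchoose i)
       (inter S \<gamma> \<alpha> \<beta> (L \<alpha> (int i - 1) v) (of_int (k + 1) + c - of_nat i) w))"
proof -
  have z: "inter S \<gamma> \<alpha> \<beta> 0 c w = 0" for c
    using intertwining_bilin(4)[OF inter carr_0 w, where k = 0] by simp
  have "L \<gamma> k (inter S \<gamma> \<alpha> \<beta> v c w) - inter S \<gamma> \<alpha> \<beta> v c (L \<beta> k w) =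
    lfsum (\<lambda>i. smult S (of_int (k + 1) gchoose i)
       (inter S \<gamma> \<alpha> \<beta> (L \<alpha> (int i - 1) v) (of_int (k + 1) + c - of_nat i) w))"
    using intertwining_commutator[OF inter conf v w, of \<gamma> "k + 1" c] by (simp add: vir_def)
  also have "\<dots> = (\<Sum>i\<le>N. smult S (of_int (k + 1) gchoose i)
       (inter S \<gamma> \<alpha> \<beta> (L \<alpha> (int i - 1) v) (of_int (k + 1) + c - of_nat i) w))"
    by (rule lfsum_le) (simp add: N z)
  finally show ?thesis by (simp add: algebra_simps)
qed

lemma inter_add_right:
  "v \<in> carr S \<alpha> \<Longrightarrow> w \<in> carr S \<beta> \<Longrightarrow> w' \<in> carr S \<beta> \<Longrightarrow>
   inter S \<gamma> \<alpha> \<beta> v c (w + w') = inter S \<gamma> \<alpha> \<beta> v c w + inter S \<gamma> \<alpha> \<beta> v c w'"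
  by (rule intertwining_bilin(3)[OF inter])

lemma inter_smult_right:
  "v \<in> carr S \<alpha> \<Longrightarrow> w \<in> carr S \<beta> \<Longrightarrow>
   inter S \<gamma> \<alpha> \<beta> v c (smult S k w) = smult S k (inter S \<gamma> \<alpha> \<beta> v c w)"
  by (rule intertwining_bilin(5)[OF inter])

lemma op_chain_in:
  assumes "\<And>z. z \<in> fst ` set sk \<Longrightarrow> U z \<in> carr S (lab z)" "w \<in> carr S (end_label \<gamma> sk)"
  shows "op_chain S lab e \<gamma> sk U w \<in> carr S \<gamma>"
  using assms by (induction sk arbitrary: \<gamma>) (auto intro!: inter_in)

lemma op_chain_add:
  assumes "\<And>z. z \<in> fst ` set sk \<Longrightarrow> U z \<in> carr S (lab z)"
    "w \<in> carr S (end_label \<gamma> sk)" "w' \<in> carr S (end_label \<gamma> sk)"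
  shows "op_chain S lab e \<gamma> sk U (w + w') = op_chain S lab e \<gamma> sk U w + op_chain S lab e \<gamma> sk U w'"
  using assms by (induction sk arbitrary: \<gamma>) (auto intro!: inter_add_right op_chain_in)

lemma op_chain_smult:
  assumes "\<And>z. z \<in> fst ` set sk \<Longrightarrow> U z \<in> carr S (lab z)" "w \<in> carr S (end_label \<gamma> sk)"
  shows "op_chain S lab e \<gamma> sk U (smult S x w) = smult S x (op_chain S lab e \<gamma> sk U w)"
  using assms by (induction sk arbitrary: \<gamma>) (auto intro!: inter_smult_right op_chain_in)

lemma sum_carr: "(\<And>i. i \<in> A \<Longrightarrow> f i \<in> carr S \<alpha>) \<Longrightarrow> sum f A \<in> carr S \<alpha>"
  by (rule vs.subspace_sum[OF subspace_carr])

lemma smult_carr: "w \<in> carr S \<alpha> \<Longrightarrow> smult S x w \<in> carr S \<alpha>"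
  by (rule vs.subspace_scale[OF subspace_carr])

lemma diff_carr: "w \<in> carr S \<alpha> \<Longrightarrow> w' \<in> carr S \<alpha> \<Longrightarrow> w - w' \<in> carr S \<alpha>"
  by (rule vs.subspace_diff[OF subspace_carr])

lemma add_carr: "w \<in> carr S \<alpha> \<Longrightarrow> w' \<in> carr S \<alpha> \<Longrightarrow> w + w' \<in> carr S \<alpha>"
  by (rule vs.subspace_add[OF subspace_carr])

lemma op_chain_sum:
  assumes "\<And>z. z \<in> fst ` set sk \<Longrightarrow> U z \<in> carr S (lab z)"
    "\<And>i. i \<in> A \<Longrightarrow> f i \<in> carr S (end_label \<gamma> sk)"
  shows "op_chain S lab e \<gamma> sk U (\<Sum>i\<in>A. f i) = (\<Sum>i\<in>A. op_chain S lab e \<gamma> sk U (f i))"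
proof -
  have 0: "op_chain S lab e \<gamma> sk U 0 = 0"
    using op_chain_smult[OF assms(1) carr_0, where x = 0] by simp
  show ?thesis using assms(2)
  proof (induction A rule: infinite_finite_induct)
    case (insert x F)
    then show ?case using assms(1) by (simp add: op_chain_add sum_carr)
  qed (simp_all add: 0)
qed

definition act :: "(var \<Rightarrow> 'a) \<Rightarrow> (var \<Rightarrow> 'm) \<Rightarrow> var \<Rightarrow> int \<Rightarrow> var \<Rightarrow> 'm" where
  "act lab U z k = U(z := L (lab z) k (U z))"

lemma act_in:
  assumes "\<And>z. z \<in> Z \<Longrightarrow> U z \<in> carr S (lab z)" "z \<in> Z"
  shows "act lab U z' k z \<in> carr S (lab z)"
  using assms by (auto simp: act_def L_in)

text \<open>\<open>L(k)\<close> passes the operators one after the other. At each it leaves the modes \<open>L(i-1)\<close> of the vector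
  at \<open>z\<close>, with a factor \<open>z\<^bsup>k+1-i\<^esup>\<close> that appears as a shift of the exponent.\<close>

lemma op_chain_commutator:
  assumes "distinct (map fst sk)" "\<And>z. z \<in> fst ` set sk \<Longrightarrow> U z \<in> carr S (lab z)"
    "w \<in> carr S (end_label \<gamma> sk)"
    "\<And>z i. z \<in> fst ` set sk \<Longrightarrow> i > N \<Longrightarrow> L (lab z) (int i - 1) (U z) = 0"
  shows "L \<gamma> k (op_chain S lab e \<gamma> sk U w) = op_chain S lab e \<gamma> sk U (L (end_label \<gamma> sk) k w) +
    (\<Sum>z\<in>fst ` set sk. \<Sum>i\<le>N. smult S (of_int (k + 1) gchoose i)
       (op_chain S lab (e - sg z (of_int (k + 1) - of_nat i)) \<gamma> sk (act lab U z (int i - 1)) w))"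
  using assms
proof (induction sk arbitrary: \<gamma>)
  case Nil
  then show ?case by simp
next
  case (Cons q sk)
  obtain z \<beta> where q: "q = (z, \<beta>)" by (cases q)
  let ?Z = "fst ` set sk" and ?x = "op_chain S lab e \<beta> sk U w"
  let ?c = "- e z - 1"
  have U: "U z \<in> carr S (lab z)" "\<And>z. z \<in> ?Z \<Longrightarrow> U z \<in> carr S (lab z)"
    using Cons.prems(2) q by auto
  have zZ: "z \<notin> ?Z" using Cons.prems(1) q by auto
  have w: "w \<in> carr S (end_label \<beta> sk)" using Cons.prems(3) q by simp
  have x: "?x \<in> carr S \<beta>" using op_chain_in[OF U(2) w] .
  have N: "\<And>z i. z \<in> ?Z \<Longrightarrow> i > N \<Longrightarrow> L (lab z) (int i - 1) (U z) = 0"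
    "\<And>i. i > N \<Longrightarrow> L (lab z) (int i - 1) (U z) = 0"
    using Cons.prems(4) q by auto
  define t where "t y i = smult S (of_int (k + 1) gchoose i)
       (op_chain S lab (e - sg y (of_int (k + 1) - of_nat i)) \<beta> sk (act lab U y (int i - 1)) w)" for y i
  have tin: "t y i \<in> carr S \<beta>" for y i
    unfolding t_def by (intro smult_carr op_chain_in act_in U w) auto
  have IH: "L \<beta> k ?x = op_chain S lab e \<beta> sk U (L (end_label \<beta> sk) k w) + (\<Sum>y\<in>?Z. \<Sum>i\<le>N. t y i)"
    unfolding t_def by (rule Cons.IH) (use Cons.prems(1) q U(2) w N in auto)
  have in1: "op_chain S lab e \<beta> sk U (L (end_label \<beta> sk) k w) \<in> carr S \<beta>"
    by (intro op_chain_in U L_in w)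
  have lin: "inter S \<gamma> (lab z) \<beta> (U z) ?c (\<Sum>y\<in>?Z. \<Sum>i\<le>N. t y i) =
      (\<Sum>y\<in>?Z. \<Sum>i\<le>N. inter S \<gamma> (lab z) \<beta> (U z) ?c (t y i))"
  proof -
    have U': "U y \<in> carr S (lab y)" if "y \<in> fst ` set [(z, \<beta>)]" for y using U(1) that by simp
    have "op_chain S lab e \<gamma> [(z, \<beta>)] U (\<Sum>y\<in>?Z. \<Sum>i\<le>N. t y i) =
        (\<Sum>y\<in>?Z. op_chain S lab e \<gamma> [(z, \<beta>)] U (\<Sum>i\<le>N. t y i))"
      by (rule op_chain_sum[OF U']) (auto intro: sum_carr tin)
    also have "\<dots> = (\<Sum>y\<in>?Z. \<Sum>i\<le>N. op_chain S lab e \<gamma> [(z, \<beta>)] U (t y i))"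
      by (rule sum.cong[OF refl], rule op_chain_sum[OF U']) (auto intro: tin)
    finally have "op_chain S lab e \<gamma> [(z, \<beta>)] U (\<Sum>y\<in>?Z. \<Sum>i\<le>N. t y i) = \<dots>" .
    then show ?thesis by simp
  qed
  have step: "inter S \<gamma> (lab z) \<beta> (U z) ?c (t y i) =
      smult S (of_int (k + 1) gchoose i)
       (op_chain S lab (e - sg y (of_int (k + 1) - of_nat i)) \<gamma> (q # sk) (act lab U y (int i - 1)) w)"
    if "y \<in> ?Z" for y i
  proof -
    have yz: "y \<noteq> z" using that zZ by auto
    let ?o = "op_chain S lab (e - sg y (of_int (k + 1) - of_nat i)) \<beta> sk (act lab U y (int i - 1)) w"
    have "?o \<in> carr S \<beta>"
      by (rule op_chain_in[OF _ w], rule act_in[where Z = ?Z, OF U(2)])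
    then have "inter S \<gamma> (lab z) \<beta> (U z) ?c (t y i) =
        smult S (of_int (k + 1) gchoose i) (inter S \<gamma> (lab z) \<beta> (U z) ?c ?o)"
      unfolding t_def by (rule inter_smult_right[OF U(1)])
    then show ?thesis using yz by (simp add: q act_def)
  qed
  have head: "inter S \<gamma> (lab z) \<beta> (L (lab z) (int i - 1) (U z)) (of_int (k + 1) + ?c - of_nat i) ?x =
     op_chain S lab (e - sg z (of_int (k + 1) - of_nat i)) \<gamma> (q # sk) (act lab U z (int i - 1)) w" for i
  proof -
    have "op_chain S lab (e - sg z (of_int (k + 1) - of_nat i)) \<beta> sk (act lab U z (int i - 1)) w = ?x"
      by (rule op_chain_cong) (use zZ in \<open>force simp: act_def sg_def\<close>)+
    then show ?thesis by (simp add: q act_def algebra_simps)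
  qed
  have "L \<gamma> k (op_chain S lab e \<gamma> (q # sk) U w) = inter S \<gamma> (lab z) \<beta> (U z) ?c (L \<beta> k ?x) +
    (\<Sum>i\<le>N. smult S (of_int (k + 1) gchoose i)
       (inter S \<gamma> (lab z) \<beta> (L (lab z) (int i - 1) (U z)) (of_int (k + 1) + ?c - of_nat i) ?x))"
    using inter_commutator[OF U(1) x N(2), where \<gamma> = \<gamma> and k = k and c = "?c"] by (simp add: q)
  also have "inter S \<gamma> (lab z) \<beta> (U z) ?c (L \<beta> k ?x) =
      inter S \<gamma> (lab z) \<beta> (U z) ?c (op_chain S lab e \<beta> sk U (L (end_label \<beta> sk) k w)) +
      (\<Sum>y\<in>?Z. \<Sum>i\<le>N. inter S \<gamma> (lab z) \<beta> (U z) ?c (t y i))"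
    unfolding IH lin[symmetric] by (intro inter_add_right U in1 sum_carr tin)
  also have "(\<Sum>y\<in>?Z. \<Sum>i\<le>N. inter S \<gamma> (lab z) \<beta> (U z) ?c (t y i)) =
      (\<Sum>y\<in>?Z. \<Sum>i\<le>N. smult S (of_int (k + 1) gchoose i)
       (op_chain S lab (e - sg y (of_int (k + 1) - of_nat i)) \<gamma> (q # sk) (act lab U y (int i - 1)) w))"
    by (intro sum.cong refl step)
  finally have "L \<gamma> k (op_chain S lab e \<gamma> (q # sk) U w) =
      op_chain S lab e \<gamma> (q # sk) U (L (end_label \<gamma> (q # sk)) k w) +
      ((\<Sum>i\<le>N. smult S (of_int (k + 1) gchoose i)
        (op_chain S lab (e - sg z (of_int (k + 1) - of_nat i)) \<gamma> (q # sk) (act lab U z (int i - 1)) w)) +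
      (\<Sum>y\<in>?Z. \<Sum>i\<le>N. smult S (of_int (k + 1) gchoose i)
       (op_chain S lab (e - sg y (of_int (k + 1) - of_nat i)) \<gamma> (q # sk) (act lab U y (int i - 1)) w)))"
    unfolding head by (simp only: op_chain.simps end_label.simps q fst_conv snd_conv add_ac)
  moreover have "fst ` set (q # sk) = insert z ?Z" by (simp add: q)
  ultimately show ?case using zZ by (simp only: sum.insert finite_imageI List.finite_set not_False_eq_True)
qed

end

section \<open>Vacuum expectation values\<close>

context voa_modules
begin

lemma L_vac: "k \<ge> - 1 \<Longrightarrow> L l0 k (vac S) = 0"
  using creation(2)[OF conf, of "k + 1"] by (simp add: vir_def)

lemma conf_eq: "conf S = L l0 (- 2) (vac S)"
  using creation(1)[OF conf] by (simp add: vir_def)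

lemma virasoro_vac:
  "m + k \<noteq> 0 \<Longrightarrow> L l0 m (L l0 k (vac S)) - L l0 k (L l0 m (vac S)) = smult S (of_int (m - k)) (L l0 (m + k) (vac S))"
proof -
  assume mk: "m + k \<noteq> 0"
  obtain c where c: "\<forall>m n. \<forall>v\<in>alg S. L l0 m (L l0 n v) - L l0 n (L l0 m v) =
          smult S (of_int (m - n)) (L l0 (m + n) v)
          + (if m + n = 0 then smult S (c * of_int (m ^ 3 - m) / 12) v else 0)"
    using virasoro by blast
  show ?thesis using c[rule_format, OF vac(1), of m k] mk by simp
qed

lemma conf_weight: "conf S \<in> wspace S (alg S) (Ymode S) (of_nat 2)"
  using virasoro_vac[of 0 "- 2"] conf by (simp add: wspace_def L_vac L_0 conf_eq[symmetric])

lemma L1_conf: "L l0 1 (conf S) = 0"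
  using virasoro_vac[of 1 "- 2"] by (simp add: L_vac L_0 conf_eq[symmetric])

lemma mode_zero: "w \<in> carr S \<alpha> \<Longrightarrow> mode S \<alpha> 0 p w = 0"
  using intertwining_bilin(4)[OF module_intertwining carr_0, of w \<alpha> 0 "of_int p"]
  by (simp add: cmodes_of_int)

lemma pairing_add: "w \<in> carr S \<alpha> \<Longrightarrow> x \<in> carr S (dual S \<alpha>) \<Longrightarrow> y \<in> carr S (dual S \<alpha>) \<Longrightarrow>
    pairing S \<alpha> w (x + y) = pairing S \<alpha> w x + pairing S \<alpha> w y"
  and pairing_smult: "w \<in> carr S \<alpha> \<Longrightarrow> x \<in> carr S (dual S \<alpha>) \<Longrightarrow>
    pairing S \<alpha> w (smult S k x) = k * pairing S \<alpha> w x"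
  and pairing_add_left: "w \<in> carr S \<alpha> \<Longrightarrow> w' \<in> carr S \<alpha> \<Longrightarrow> x \<in> carr S (dual S \<alpha>) \<Longrightarrow>
    pairing S \<alpha> (w + w') x = pairing S \<alpha> w x + pairing S \<alpha> w' x"
  and pairing_smult_left: "w \<in> carr S \<alpha> \<Longrightarrow> x \<in> carr S (dual S \<alpha>) \<Longrightarrow>
    pairing S \<alpha> (smult S k w) x = k * pairing S \<alpha> w x"
  using pairing_bilinear[of \<alpha>] by (auto simp: bilin_on_def)

lemma pairing_zero_left: "x \<in> carr S (dual S \<alpha>) \<Longrightarrow> pairing S \<alpha> 0 x = 0"
  using pairing_smult_left[OF carr_0, of x \<alpha> 0] by simp

lemma pairing_zero_right: "w \<in> carr S \<alpha> \<Longrightarrow> pairing S \<alpha> w 0 = 0"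
  using pairing_smult[OF _ carr_0, of w \<alpha> 0] by simp

lemma pairing_sum:
  assumes "w \<in> carr S \<alpha>" "\<And>i. i \<in> A \<Longrightarrow> f i \<in> carr S (dual S \<alpha>)"
  shows "pairing S \<alpha> w (\<Sum>i\<in>A. f i) = (\<Sum>i\<in>A. pairing S \<alpha> w (f i))"
  using assms(2)
proof (induction A rule: infinite_finite_induct)
  case (insert x F)
  then show ?case using assms(1) by (simp add: pairing_add sum_carr)
qed (simp_all add: pairing_zero_right assms(1))

text \<open>Since \<open>L(1)\<omega> = 0\<close>, only the first term of the formula for the contragredient action survives.\<close>

lemma pairing_L:
  assumes w: "w \<in> carr S \<alpha>" and x: "x \<in> carr S (dual S \<alpha>)"
  shows "pairing S \<alpha> w (L (dual S \<alpha>) k x) = pairing S \<alpha> (L \<alpha> (- k) w) x"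
proof -
  have i0: "{..2::nat} = {0, 1, 2}" by auto
  have 2: "(L l0 1 ^^ 2) (conf S) = 0"
    by (simp add: L1_conf L_0 numeral_2_eq_2)
  show ?thesis
    using contragredient[OF conf_weight w x, of "k + 1"] w x
    unfolding i0 by (simp add: 2 L1_conf mode_zero pairing_zero_left)
      (simp add: vir_def algebra_simps)
qed

abbreviation pv :: "'m \<Rightarrow> complex" where "pv x \<equiv> pairing S l0 (vac S) x"

lemma pv_L: "x \<in> alg S \<Longrightarrow> k \<le> 1 \<Longrightarrow> pv (L l0 k x) = 0"
  using pairing_L[OF vac(1), of x k] by (simp add: dual_lab0 L_vac pairing_zero_left)

lemma pv_add: "x \<in> alg S \<Longrightarrow> y \<in> alg S \<Longrightarrow> pv (x + y) = pv x + pv y"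
  using pairing_add[OF vac(1), of x y] by (simp add: dual_lab0)

lemma pv_smult: "x \<in> alg S \<Longrightarrow> pv (smult S k x) = k * pv x"
  using pairing_smult[OF vac(1), of x k] by (simp add: dual_lab0)

lemma pv_sum: "(\<And>i. i \<in> A \<Longrightarrow> f i \<in> alg S) \<Longrightarrow> pv (\<Sum>i\<in>A. f i) = (\<Sum>i\<in>A. pv (f i))"
  using pairing_sum[OF vac(1), of A f] by (simp add: dual_lab0)

lemma pv_sum2:
  assumes "\<And>z i. z \<in> A \<Longrightarrow> x z i \<in> alg S"
  shows "pv (\<Sum>z\<in>A. \<Sum>i\<le>N. smult S (c z i) (x z i)) = (\<Sum>z\<in>A. \<Sum>i\<le>(N::nat). c z i * pv (x z i))"
proof -
  have "pv (\<Sum>z\<in>A. \<Sum>i\<le>N. smult S (c z i) (x z i)) = (\<Sum>z\<in>A. pv (\<Sum>i\<le>N. smult S (c z i) (x z i)))"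
    by (rule pv_sum) (auto intro!: sum_carr smult_carr assms)
  also have "\<dots> = (\<Sum>z\<in>A. \<Sum>i\<le>N. pv (smult S (c z i) (x z i)))"
    by (rule sum.cong[OF refl], rule pv_sum) (auto intro!: smult_carr assms)
  also have "\<dots> = (\<Sum>z\<in>A. \<Sum>i\<le>N. c z i * pv (x z i))"
    by (intro sum.cong refl pv_smult assms)
  finally show ?thesis .
qed

end

text \<open>A chain of intertwining operators from \<open>V\<close> to \<open>V\<close> at distinct variables.\<close>

locale voa_chain = voa_modules S for S :: "('a, 'm::ab_group_add) voa_system" (structure) +
  fixes lab :: "var \<Rightarrow> 'a" and sk :: "(var \<times> 'a) list"
  assumes distinct: "distinct (map fst sk)" and end_label: "end_label (lab0 S) sk = lab0 S"
begin

definition Z :: "var set" where "Z = fst ` set sk"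

definition ok :: "(var \<Rightarrow> 'm) \<Rightarrow> bool" where "ok U \<longleftrightarrow> (\<forall>z\<in>Z. U z \<in> carr S (lab z))"

definition bnd :: "nat \<Rightarrow> (var \<Rightarrow> 'm) \<Rightarrow> bool" where
  "bnd N U \<longleftrightarrow> (\<forall>z\<in>Z. \<forall>i>N. L (lab z) (int i - 1) (U z) = 0)"

text \<open>The coefficient, at the monomial \<open>e\<close>, of the vacuum expectation value of the chain with vectors \<open>U\<close>.\<close>

definition G :: "monom \<Rightarrow> (var \<Rightarrow> 'm) \<Rightarrow> complex" where
  "G e U = pv (op_chain S lab e l0 sk U (vac S))"

lemma finite_Z: "finite Z" by (simp add: Z_def)

lemma okD: "ok U \<Longrightarrow> z \<in> Z \<Longrightarrow> U z \<in> carr S (lab z)" by (simp add: ok_def)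

lemma ok_act: "ok U \<Longrightarrow> ok (act lab U z k)" by (auto simp: ok_def act_def L_in)

lemma bnd_mono: "bnd N U \<Longrightarrow> N \<le> N' \<Longrightarrow> bnd N' U" by (auto simp: bnd_def)

lemma bnd_exists: assumes "ok U" obtains N where "bnd N U"
proof -
  have "\<exists>N. \<forall>i>N. L (lab z) (int i - 1) (U z) = 0" if "z \<in> Z" for z
    using L_trunc[OF okD[OF assms that]] by metis
  then obtain N where N: "\<And>z i. z \<in> Z \<Longrightarrow> i > N z \<Longrightarrow> L (lab z) (int i - 1) (U z) = 0" by metis
  have "bnd (Max (insert 0 (N ` Z))) U"
    unfolding bnd_def
  proof (intro ballI allI impI)
    fix z i assume "z \<in> Z" "Max (insert 0 (N ` Z)) < i"
    moreover have "N z \<le> Max (insert 0 (N ` Z))" using \<open>z \<in> Z\<close> finite_Z by (intro Max_ge) auto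
    ultimately show "L (lab z) (int i - 1) (U z) = 0" using N by simp
  qed
  then show ?thesis using that by blast
qed

lemma op_chain_alg: "ok U \<Longrightarrow> op_chain S lab e l0 sk U (vac S) \<in> alg S"
  by (rule op_chain_in) (auto simp: ok_def Z_def end_label vac)

lemma pv_L_op_chain:
  assumes "ok U" "bnd N U" "k \<ge> - 1"
  shows "pv (L l0 k (op_chain S lab e l0 sk U (vac S))) =
    (\<Sum>z\<in>Z. \<Sum>i\<le>N. (of_int (k + 1) gchoose i) *
       G (e - sg z (of_int (k + 1) - of_nat i)) (act lab U z (int i - 1)))"
proof -
  have "op_chain S lab e l0 sk U 0 = 0"
  proof -
    have U: "U z \<in> carr S (lab z)" if "z \<in> fst ` set sk" for z
      using assms(1) that by (auto simp: ok_def Z_def)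
    show ?thesis using op_chain_sum[OF U, where A = "{}"] by simp
  qed
  moreover have "L l0 k (op_chain S lab e l0 sk U (vac S)) = op_chain S lab e l0 sk U (L (end_label l0 sk) k (vac S)) +
    (\<Sum>z\<in>fst ` set sk. \<Sum>i\<le>N. smult S (of_int (k + 1) gchoose i)
       (op_chain S lab (e - sg z (of_int (k + 1) - of_nat i)) l0 sk (act lab U z (int i - 1)) (vac S)))"
    by (rule op_chain_commutator) (use distinct assms in \<open>auto simp: ok_def bnd_def Z_def end_label vac\<close>)
  ultimately have "L l0 k (op_chain S lab e l0 sk U (vac S)) =
    (\<Sum>z\<in>Z. \<Sum>i\<le>N. smult S (of_int (k + 1) gchoose i)
       (op_chain S lab (e - sg z (of_int (k + 1) - of_nat i)) l0 sk (act lab U z (int i - 1)) (vac S)))"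
    using assms(3) by (simp add: end_label L_vac Z_def)
  then show ?thesis
    unfolding G_def using pv_sum2[where A = Z] op_chain_alg[OF ok_act[OF assms(1)]] by simp
qed

text \<open>The global Ward identities: the vacuum is annihilated by \<open>L(-1)\<close>, \<open>L(0)\<close> and \<open>L(1)\<close> on
  both sides.\<close>

lemma ward:
  assumes "ok U" "bnd N U" "l \<le> 2"
  shows "(\<Sum>z\<in>Z. \<Sum>i\<le>N. (of_nat l gchoose i) *
       G (e - sg z (of_nat l - of_nat i)) (act lab U z (int i - 1))) = 0"
  using pv_L_op_chain[OF assms(1,2), of "int l - 1" e] pv_L[OF op_chain_alg[OF assms(1)], of "int l - 1" e] assms(3)
  by simp

lemma conf_left:
  assumes "ok U" "bnd N U"
  shows "pv (mode S l0 (conf S) (int j) (op_chain S lab e l0 sk U (vac S))) =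
    (\<Sum>z\<in>Z. \<Sum>i\<le>N. (of_nat j gchoose i) *
       G (e - sg z (of_nat j - of_nat i)) (act lab U z (int i - 1)))"
  using pv_L_op_chain[OF assms, of "int j - 1" e] by (simp add: vir_def)

lemma conf_left_neg:
  assumes "ok U" "p < 0"
  shows "pv (mode S l0 (conf S) p (op_chain S lab e l0 sk U (vac S))) = 0"
  using pv_L[OF op_chain_alg[OF assms(1)], of "p - 1"] assms(2) by (simp add: vir_def)

end

section \<open>Creation modes\<close>

context voa_chain
begin

text \<open>The modes \<open>L(-m-2)\<close> acting on a vector of the chain are regular parts of the conformal
  field at its variable; by the Jacobi identity they spread over the other vectors.\<close>

lemma creation_mode:
  assumes ok: "ok U" and bnd: "bnd N U" and sk: "sk = P @ (p, \<beta>) # R"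
  obtains M0 where "\<And>M. M \<ge> M0 \<Longrightarrow> G e (act lab U p (- int m - 2)) =
    (\<Sum>i\<le>M. ((- 1) ^ i * ((- of_nat m - 1) gchoose i)) *
      (- (\<Sum>z\<in>fst ` set P. \<Sum>s\<le>N. ((- of_nat m - 1 - of_nat i) gchoose s) *
            G (e - sg p (of_nat i) - sg z (- of_nat m - 1 - of_nat i - of_nat s)) (act lab U z (int s - 1)))
       - (- 1) powi (- int m - 1) * (\<Sum>z\<in>fst ` set R. \<Sum>s\<le>N. (of_nat i gchoose s) *
            G (e - sg p (- of_nat m - 1 - of_nat i) - sg z (of_nat i - of_nat s)) (act lab U z (int s - 1)))))"
proof -
  let ?g = "end_label l0 P" and ?v = "U p" and ?c = "- e p - 1"
  define x where "x = op_chain S lab e \<beta> R U (vac S)"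
  let ?I = "inter S ?g (lab p) \<beta>"
  have dist: "p \<notin> fst ` set P" "p \<notin> fst ` set R" "fst ` set P \<inter> fst ` set R = {}"
    "distinct (map fst P)" "distinct (map fst R)"
    using distinct unfolding sk by auto
  have ZP: "fst ` set P \<subseteq> Z" and ZR: "fst ` set R \<subseteq> Z" and pZ: "p \<in> Z"
    unfolding Z_def unfolding sk by auto
  have UP: "\<And>z. z \<in> fst ` set P \<Longrightarrow> U z \<in> carr S (lab z)"
    and UR: "\<And>z. z \<in> fst ` set R \<Longrightarrow> U z \<in> carr S (lab z)" and Up: "U p \<in> carr S (lab p)"
    using ok ZP ZR pZ by (auto simp: ok_def)
  have eR: "end_label \<beta> R = l0" using end_label by (simp add: sk end_label_append)
  have x: "x \<in> carr S \<beta>" unfolding x_def by (rule op_chain_in) (use UR eR vac in auto)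
  define B :: "nat \<Rightarrow> complex" where "B i = (- 1) ^ i * ((- of_nat m - 1) gchoose i)" for i
  define sn :: complex where "sn = (- 1) powi (- int m - 1)"
  define y where "y i = ?I ?v (?c + of_nat i) x" for i :: nat
  define d where "d i = ?I ?v (?c + of_int (- int m - 1) - of_nat i) (L \<beta> (int i - 1) x)" for i :: nat
  have yin: "y i \<in> carr S ?g" and din: "d i \<in> carr S ?g" for i
    unfolding y_def d_def by (intro inter_in Up x L_in)+
  define f where "f i = smult S (B i) (L ?g (- int m - 2 - int i) (y i) + smult S (- sn) (d i))" for i
  have fin: "f i \<in> carr S ?g" for i
    unfolding f_def by (intro smult_carr add_carr L_in yin din)
  \<comment> \<open>the Borcherds identity with one of its parameters equal to zero\<close>
  have "lfsum (\<lambda>i::nat. smult S (of_int 0 gchoose i)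
          (?I (mode S (lab p) (conf S) (- int m - 1 + int i) ?v) (of_int 0 + ?c - of_nat i) x)) =
        lfsum (\<lambda>i::nat. if i = 0 then ?I (L (lab p) (- int m - 2) ?v) ?c x else 0)"
    by (rule lfsum_cong) (auto simp: gchoose_0_left vir_def algebra_simps)
  also have "\<dots> = ?I (L (lab p) (- int m - 2) ?v) ?c x" by (rule lfsum_single)
  finally have "?I (L (lab p) (- int m - 2) ?v) ?c x =
       lfsum (\<lambda>i::nat. smult S ((- 1) ^ i * (of_int (- int m - 1) gchoose i))
                 (mode S ?g (conf S) (0 + (- int m - 1) - int i) (?I ?v (?c + of_nat i) x)
                  - smult S ((- 1) powi (- int m - 1))
                      (?I ?v (?c + of_int (- int m - 1) - of_nat i) (mode S \<beta> (conf S) (0 + int i) x))))"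
    using intertwining_borcherds[OF inter[of ?g] conf Up x, where m = 0 and l = "- int m - 1" and n = ?c] by simp
  also have "\<dots> = lfsum f"
    by (rule lfsum_cong) (simp add: f_def B_def sn_def y_def d_def vir_def, simp add: algebra_simps)
  finally have lf: "?I (L (lab p) (- int m - 2) ?v) ?c x = lfsum f" .
  obtain N1 where N1: "\<And>k. k \<ge> N1 \<Longrightarrow> ?I ?v (?c + of_nat k) x = 0"
    using intertwining_trunc[OF inter[of ?g] Up x, where c = ?c] by blast
  obtain N2 where N2: "\<And>i. i > N2 \<Longrightarrow> L \<beta> (int i - 1) x = 0"
    using L_trunc[OF x] by blast
  have I0: "?I ?v c 0 = 0" for c
    using intertwining_bilin(5)[OF inter Up carr_0, where k = 0] by simp
  have f0: "f i = 0" if "i > max N1 N2" for i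
    using N1[of i] N2[of i] that by (simp add: f_def y_def d_def I0 L_0)
  have oP: "op_chain S lab e l0 P U w \<in> alg S" if "w \<in> carr S ?g" for w
    by (rule op_chain_in) (use UP that in auto)
  have "op_chain S lab e l0 sk (act lab U p (- int m - 2)) (vac S) =
      op_chain S lab e l0 P U (?I (L (lab p) (- int m - 2) ?v) ?c x)"
  proof -
    have 1: "op_chain S lab e \<beta> R (act lab U p (- int m - 2)) (vac S) = x"
      unfolding x_def by (rule op_chain_cong) (use dist in \<open>force simp: act_def\<close>)+
    have 2: "op_chain S lab e l0 P (act lab U p (- int m - 2)) w = op_chain S lab e l0 P U w" for w
      by (rule op_chain_cong) (use dist in \<open>force simp: act_def\<close>)+
    show ?thesis by (simp add: sk op_chain_append 1 2) (simp add: act_def)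
  qed
  then have G1: "G e (act lab U p (- int m - 2)) = pv (op_chain S lab e l0 P U (lfsum f))"
    by (simp add: G_def lf)
  have step: "pv (op_chain S lab e l0 P U (f i)) = B i *
      (- (\<Sum>z\<in>fst ` set P. \<Sum>s\<le>N. ((- of_nat m - 1 - of_nat i) gchoose s) *
            G (e - sg p (of_nat i) - sg z (- of_nat m - 1 - of_nat i - of_nat s)) (act lab U z (int s - 1)))
       - sn * (\<Sum>z\<in>fst ` set R. \<Sum>s\<le>N. (of_nat i gchoose s) *
            G (e - sg p (- of_nat m - 1 - of_nat i) - sg z (of_nat i - of_nat s)) (act lab U z (int s - 1))))"
    (is "_ = B i * (- ?s1 - sn * ?s2)") for i
  proof -
    let ?k = "- int m - 2 - int i"
    have k1: "of_int (?k + 1) = (- of_nat m - 1 - of_nat i :: complex)" by simp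
    have a: "pv (op_chain S lab e l0 P U (L ?g ?k (y i))) = - ?s1"
    proof -
      have com: "L l0 ?k (op_chain S lab e l0 P U (y i)) = op_chain S lab e l0 P U (L ?g ?k (y i)) +
        (\<Sum>z\<in>fst ` set P. \<Sum>s\<le>N. smult S (of_int (?k + 1) gchoose s)
         (op_chain S lab (e - sg z (of_int (?k + 1) - of_nat s)) l0 P (act lab U z (int s - 1)) (y i)))"
        by (rule op_chain_commutator) (use dist UP yin bnd ZP in \<open>auto simp: bnd_def\<close>)
      have eq: "op_chain S lab (e - sg z t) l0 P (act lab U z k) (y i) =
          op_chain S lab (e - sg p (of_nat i) - sg z t) l0 sk (act lab U z k) (vac S)"
        if z: "z \<in> fst ` set P" for z k t
      proof -
        have zp: "p \<noteq> z" "z \<notin> fst ` set R" using z dist by auto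
        have 1: "op_chain S lab (e - sg p (of_nat i) - sg z t) \<beta> R (act lab U z k) (vac S) = x"
          unfolding x_def
          by (rule op_chain_cong) (use dist zp in \<open>force simp: act_def sg_def\<close>)+
        have 2: "op_chain S lab (e - sg p (of_nat i) - sg z t) l0 P (act lab U z k) w =
            op_chain S lab (e - sg z t) l0 P (act lab U z k) w" for w
          by (rule op_chain_cong) (use dist in \<open>force simp: sg_def\<close>)+
        have 3: "act lab U z k p = U p" "- (e - sg p (of_nat i) - sg z t) p - 1 = ?c + of_nat i"
          using zp by (auto simp: act_def)
        show ?thesis unfolding sk op_chain_append 2 by (simp only: op_chain.simps fst_conv snd_conv 1 3 y_def)
      qed
      have "0 = pv (L l0 ?k (op_chain S lab e l0 P U (y i)))"
        using pv_L[OF oP[OF yin], where k = ?k] by simp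
      also have "\<dots> = pv (op_chain S lab e l0 P U (L ?g ?k (y i))) + ?s1"
        unfolding com
      proof (subst pv_add)
        show "op_chain S lab e l0 P U (L ?g ?k (y i)) \<in> alg S" by (rule oP[OF L_in[OF yin]])
        have inP: "op_chain S lab e' l0 P (act lab U z k) (y i) \<in> alg S" for e' z k
          by (rule op_chain_in[OF act_in[where Z = "fst ` set P", OF UP]]) (auto simp: yin)
        then show "(\<Sum>z\<in>fst ` set P. \<Sum>s\<le>N. smult S (of_int (?k + 1) gchoose s)
         (op_chain S lab (e - sg z (of_int (?k + 1) - of_nat s)) l0 P (act lab U z (int s - 1)) (y i))) \<in> alg S"
          by (intro sum_carr smult_carr)
        have "pv (\<Sum>z\<in>fst ` set P. \<Sum>s\<le>N. smult S (of_int (?k + 1) gchoose s)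
         (op_chain S lab (e - sg z (of_int (?k + 1) - of_nat s)) l0 P (act lab U z (int s - 1)) (y i))) = ?s1"
          unfolding pv_sum2[OF inP] G_def k1
          by (intro sum.cong refl) (simp add: eq)
        then show "pv (op_chain S lab e l0 P U (L ?g ?k (y i))) + pv (\<Sum>z\<in>fst ` set P. \<Sum>s\<le>N. smult S (of_int (?k + 1) gchoose s)
         (op_chain S lab (e - sg z (of_int (?k + 1) - of_nat s)) l0 P (act lab U z (int s - 1)) (y i))) =
          pv (op_chain S lab e l0 P U (L ?g ?k (y i))) + ?s1" by simp
      qed
      finally show ?thesis by (simp add: eq_neg_iff_add_eq_0)
    qed
    have b: "pv (op_chain S lab e l0 P U (d i)) = ?s2"
    proof -
      let ?e = "e - sg p (- of_nat m - 1 - of_nat i)" and ?Pp = "P @ [(p, \<beta>)]"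
      define t where "t z s = op_chain S lab (e - sg z (of_nat i - of_nat s)) \<beta> R (act lab U z (int s - 1)) (vac S)"
        for z s
      have tin: "t z s \<in> carr S \<beta>" for z s
        unfolding t_def by (rule op_chain_in[OF act_in[where Z = "fst ` set R", OF UR]]) (auto simp: eR vac)
      have U': "U z \<in> carr S (lab z)" if "z \<in> fst ` set ?Pp" for z
        using that UP Up by auto
      have 0: "op_chain S lab e \<beta> R U 0 = 0"
        using op_chain_sum[OF UR, where A = "{}"] by simp
      have com: "L \<beta> (int i - 1) x = op_chain S lab e \<beta> R U (L (end_label \<beta> R) (int i - 1) (vac S)) +
        (\<Sum>z\<in>fst ` set R. \<Sum>s\<le>N. smult S (of_int (int i - 1 + 1) gchoose s)
         (op_chain S lab (e - sg z (of_int (int i - 1 + 1) - of_nat s)) \<beta> R (act lab U z (int s - 1)) (vac S)))"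
        unfolding x_def
        by (rule op_chain_commutator) (use dist UR eR vac bnd ZR in \<open>auto simp: bnd_def\<close>)
      then have Lx: "L \<beta> (int i - 1) x = (\<Sum>z\<in>fst ` set R. \<Sum>s\<le>N. smult S (of_nat i gchoose s) (t z s))"
        by (simp add: eR L_vac 0 t_def)
      have "op_chain S lab e l0 P U (d i) = op_chain S lab ?e l0 ?Pp U (L \<beta> (int i - 1) x)"
      proof -
        have "op_chain S lab ?e l0 P U w = op_chain S lab e l0 P U w" for w
          by (rule op_chain_cong) (use dist in \<open>force simp: sg_def\<close>)+
        moreover have "- ?e p - 1 = ?c + of_int (- int m - 1) - of_nat i" by simp
        ultimately show ?thesis by (simp only: op_chain_append op_chain.simps fst_conv snd_conv d_def)
      qed
      also have "\<dots> = (\<Sum>z\<in>fst ` set R. \<Sum>s\<le>N. smult S (of_nat i gchoose s) (op_chain S lab ?e l0 ?Pp U (t z s)))"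
      proof -
        have "op_chain S lab ?e l0 ?Pp U (L \<beta> (int i - 1) x) =
          (\<Sum>z\<in>fst ` set R. op_chain S lab ?e l0 ?Pp U (\<Sum>s\<le>N. smult S (of_nat i gchoose s) (t z s)))"
          unfolding Lx by (rule op_chain_sum[OF U']) (auto simp: end_label_append intro: sum_carr smult_carr tin)
        also have "\<dots> = (\<Sum>z\<in>fst ` set R. \<Sum>s\<le>N. op_chain S lab ?e l0 ?Pp U (smult S (of_nat i gchoose s) (t z s)))"
          by (rule sum.cong[OF refl], rule op_chain_sum[OF U']) (auto simp: end_label_append intro: smult_carr tin)
        also have "\<dots> = (\<Sum>z\<in>fst ` set R. \<Sum>s\<le>N. smult S (of_nat i gchoose s) (op_chain S lab ?e l0 ?Pp U (t z s)))"
          by (intro sum.cong refl, rule op_chain_smult[OF U']) (auto simp: end_label_append tin)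
        finally show ?thesis .
      qed
      finally have dd: "op_chain S lab e l0 P U (d i) = \<dots>" .
      have eq: "op_chain S lab ?e l0 ?Pp U (t z s) =
          op_chain S lab (?e - sg z (of_nat i - of_nat s)) l0 sk (act lab U z (int s - 1)) (vac S)"
        if z: "z \<in> fst ` set R" for z s
      proof -
        let ?e' = "?e - sg z (of_nat i - of_nat s)"
        have zp: "p \<noteq> z" "z \<notin> fst ` set P" using z dist by auto
        have 1: "op_chain S lab ?e' \<beta> R (act lab U z (int s - 1)) (vac S) = t z s"
          unfolding t_def
          by (rule op_chain_cong) (use dist in \<open>force simp: sg_def\<close>)+
        have 2: "op_chain S lab ?e' l0 P (act lab U z (int s - 1)) w = op_chain S lab ?e l0 P U w" for w
          by (rule op_chain_cong) (use dist zp in \<open>force simp: sg_def act_def\<close>)+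
        have 3: "act lab U z (int s - 1) p = U p" "?e' p = ?e p"
          using zp by (auto simp: act_def)
        show ?thesis unfolding sk op_chain_append 2 by (simp only: op_chain.simps fst_conv snd_conv 1 3)
      qed
      have inP: "op_chain S lab ?e l0 ?Pp U (t z s) \<in> alg S" for z s
        by (rule op_chain_in[OF U']) (auto simp: end_label_append tin)
      show ?thesis unfolding dd pv_sum2[OF inP] G_def
        by (intro sum.cong refl) (simp add: eq)
    qed
    have "pv (op_chain S lab e l0 P U (f i)) = B i * (pv (op_chain S lab e l0 P U (L ?g ?k (y i))) + - sn * pv (op_chain S lab e l0 P U (d i)))"
    proof -
      let ?a = "L ?g ?k (y i)" and ?o = "op_chain S lab e l0 P U"
      have "?o (f i) = smult S (B i) (?o (?a + smult S (- sn) (d i)))"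
        unfolding f_def by (rule op_chain_smult[OF UP], assumption, intro add_carr smult_carr L_in yin din)
      also have "?o (?a + smult S (- sn) (d i)) = ?o ?a + ?o (smult S (- sn) (d i))"
        by (rule op_chain_add[OF UP], assumption) (intro smult_carr L_in yin din)+
      also have "?o (smult S (- sn) (d i)) = smult S (- sn) (?o (d i))"
        by (rule op_chain_smult[OF UP], assumption, rule din)
      finally have "pv (?o (f i)) = B i * pv (?o ?a + smult S (- sn) (?o (d i)))"
        using pv_smult[of "?o ?a + smult S (- sn) (?o (d i))" "B i"]
        by (simp only: add_carr smult_carr L_in yin din oP)
      also have "pv (?o ?a + smult S (- sn) (?o (d i))) = pv (?o ?a) + pv (smult S (- sn) (?o (d i)))"
        by (intro pv_add smult_carr oP L_in yin din)
      also have "pv (smult S (- sn) (?o (d i))) = - sn * pv (?o (d i))"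
        by (intro pv_smult oP din)
      finally show ?thesis .
    qed
    then show ?thesis unfolding a b by simp
  qed
  have "G e (act lab U p (- int m - 2)) = (\<Sum>i\<le>M. B i *
      (- (\<Sum>z\<in>fst ` set P. \<Sum>s\<le>N. ((- of_nat m - 1 - of_nat i) gchoose s) *
            G (e - sg p (of_nat i) - sg z (- of_nat m - 1 - of_nat i - of_nat s)) (act lab U z (int s - 1)))
       - sn * (\<Sum>z\<in>fst ` set R. \<Sum>s\<le>N. (of_nat i gchoose s) *
            G (e - sg p (- of_nat m - 1 - of_nat i) - sg z (of_nat i - of_nat s)) (act lab U z (int s - 1)))))"
    if M: "M \<ge> max N1 N2" for M
  proof -
    have "lfsum f = (\<Sum>i\<le>M. f i)" by (rule lfsum_le) (use f0 M in auto)
    then have "G e (act lab U p (- int m - 2)) = pv (\<Sum>i\<le>M. op_chain S lab e l0 P U (f i))"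
      unfolding G1 by (simp add: op_chain_sum[OF UP fin])
    also have "\<dots> = (\<Sum>i\<le>M. pv (op_chain S lab e l0 P U (f i)))"
      by (rule pv_sum) (rule oP[OF fin])
    finally show ?thesis unfolding step .
  qed
  then show ?thesis using that unfolding B_def sn_def by blast
qed

end

section \<open>Weights\<close>

lemma gchoose_1_left: "(1 :: complex) gchoose i = (if i \<le> 1 then 1 else 0)"
proof -
  have "(1 :: complex) gchoose i = of_nat (1 choose i)" using binomial_gbinomial[of 1 i, where ?'a = complex] by (metis of_nat_1)
  then show ?thesis by (cases i) (auto simp: binomial_eq_0)
qed

context voa_modules
begin

abbreviation wsp :: "'a \<Rightarrow> complex \<Rightarrow> 'm set" where
  "wsp \<alpha> c \<equiv> wspace S (carr S \<alpha>) (mode S \<alpha>) c"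

lemma wspD: "w \<in> wsp \<alpha> c \<Longrightarrow> w \<in> carr S \<alpha>" "w \<in> wsp \<alpha> c \<Longrightarrow> L \<alpha> 0 w = smult S c w"
  by (auto simp: wspace_def)

lemma wspI: "w \<in> carr S \<alpha> \<Longrightarrow> L \<alpha> 0 w = smult S c w \<Longrightarrow> w \<in> wsp \<alpha> c"
  by (auto simp: wspace_def)

lemma wsp_smult: "w \<in> wsp \<alpha> c \<Longrightarrow> smult S x w \<in> wsp \<alpha> c"
  by (auto simp: wspace_def L_smult smult_carr mult.commute)

lemma wsp_subspace: "vs.subspace (wsp \<alpha> c)"
  by (rule vs.subspaceI) (auto simp: wspace_def L_0 carr_0 L_add L_smult add_carr smult_carr
      vs.scale_right_distrib mult.commute)

text \<open>Eigenvectors of eigenvalues other than \<open>c\<close> cannot add up to a nonzero eigenvector of eigenvalue \<open>c\<close>.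
  One summand is removed by applying \<open>L(0) - \<mu>\<close> with its eigenvalue \<open>\<mu>\<close>.\<close>

lemma eigen_sum_zero:
  assumes "finite T" "\<And>a. a \<in> T \<Longrightarrow> x a \<in> wsp \<alpha> (\<mu> a)" "\<And>a. a \<in> T \<Longrightarrow> \<mu> a \<noteq> c"
    "(\<Sum>a\<in>T. x a) \<in> wsp \<alpha> c"
  shows "(\<Sum>a\<in>T. x a) = 0"
  using assms
proof (induction T arbitrary: x rule: finite_induct)
  case (insert a T)
  let ?w = "\<Sum>b\<in>insert a T. x b" and ?x = "\<lambda>b. smult S (\<mu> b - \<mu> a) (x b)"
  have xin: "b \<in> insert a T \<Longrightarrow> x b \<in> carr S \<alpha>" for b using insert.prems(1) wspD by blast
  have Lsum: "L \<alpha> 0 (\<Sum>b\<in>A. x b) = (\<Sum>b\<in>A. smult S (\<mu> b) (x b))" if "A \<subseteq> insert a T" for A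
    using that
  proof (induction A rule: infinite_finite_induct)
    case (insert b F)
    then have "x b \<in> carr S \<alpha>" "(\<Sum>b\<in>F. x b) \<in> carr S \<alpha>" "x b \<in> wsp \<alpha> (\<mu> b)"
      using xin insert.prems \<open>\<And>a. a \<in> _ \<Longrightarrow> x a \<in> wsp \<alpha> (\<mu> a)\<close> by (auto intro!: sum_carr)
    then show ?case using insert by (simp add: L_add wspD(2))
  qed (auto simp: L_0)
  have "(\<Sum>b\<in>T. ?x b) = (\<Sum>b\<in>insert a T. ?x b)" using insert.hyps by simp
  also have "\<dots> = (\<Sum>b\<in>insert a T. smult S (\<mu> b) (x b)) - smult S (\<mu> a) ?w"
    by (simp only: vs.scale_left_diff_distrib sum_subtractf vs.scale_sum_right)
  also have "\<dots> = L \<alpha> 0 ?w - smult S (\<mu> a) ?w" by (simp only: Lsum[OF order_refl])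
  also have "\<dots> = smult S (c - \<mu> a) ?w"
    by (simp only: wspD(2)[OF insert.prems(3)] vs.scale_left_diff_distrib)
  finally have eq: "(\<Sum>b\<in>T. ?x b) = smult S (c - \<mu> a) ?w" .
  have "(\<Sum>b\<in>T. ?x b) = 0"
  proof (rule insert.IH)
    show "b \<in> T \<Longrightarrow> ?x b \<in> wsp \<alpha> (\<mu> b)" for b using insert.prems(1) wsp_smult by blast
    show "b \<in> T \<Longrightarrow> \<mu> b \<noteq> c" for b using insert.prems(2) by blast
    show "(\<Sum>b\<in>T. ?x b) \<in> wsp \<alpha> c" unfolding eq by (rule wsp_smult[OF insert.prems(3)])
  qed
  then show ?case using eq insert.prems(2)[of a] by auto
qed simp

definition hw :: "'a \<Rightarrow> complex" where
  "hw \<alpha> = (SOME h. vs.span (\<Union>n::nat. wsp \<alpha> (h + of_nat n)) = carr S \<alpha> \<and>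
          (\<forall>n::nat. \<exists>B. finite B \<and> vs.span B = wsp \<alpha> (h + of_nat n)))"

lemma hw: "vs.span (\<Union>n::nat. wsp \<alpha> (hw \<alpha> + of_nat n)) = carr S \<alpha>"
    "\<exists>B. finite B \<and> vs.span B = wsp \<alpha> (hw \<alpha> + of_nat k)"
proof -
  have "\<exists>h. vs.span (\<Union>n::nat. wsp \<alpha> (h + of_nat n)) = carr S \<alpha> \<and>
          (\<forall>n::nat. \<exists>B. finite B \<and> vs.span B = wsp \<alpha> (h + of_nat n))"
    using ordinary[of \<alpha>] unfolding ordinary_module_def by (elim conjE)
  note s = someI_ex[OF this, folded hw_def]
  show "vs.span (\<Union>n::nat. wsp \<alpha> (hw \<alpha> + of_nat n)) = carr S \<alpha>" by (rule conjunct1[OF s])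
  show "\<exists>B. finite B \<and> vs.span B = wsp \<alpha> (hw \<alpha> + of_nat k)" by (rule spec[OF conjunct2[OF s]])
qed

lemma weight_mem:
  assumes w: "w \<in> wsp \<alpha> c" and nz: "w \<noteq> 0"
  shows "c - hw \<alpha> \<in> \<nat>"
proof (rule ccontr)
  assume c: "c - hw \<alpha> \<notin> \<nat>"
  have "w \<in> vs.span (\<Union>n::nat. wsp \<alpha> (hw \<alpha> + of_nat n))" using w by (simp add: hw wspD)
  then obtain T u where T: "finite T" "T \<subseteq> (\<Union>n::nat. wsp \<alpha> (hw \<alpha> + of_nat n))"
    and w_eq: "w = (\<Sum>a\<in>T. smult S (u a) a)"
    unfolding vs.span_explicit by blast
  have "\<exists>k. a \<in> wsp \<alpha> (hw \<alpha> + of_nat k)" if "a \<in> T" for a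
    using subsetD[OF T(2) that] by (elim UN_E) (rule exI)
  then obtain k where k: "\<And>a. a \<in> T \<Longrightarrow> a \<in> wsp \<alpha> (hw \<alpha> + of_nat (k a))"
    using bchoice[of T "\<lambda>a k. a \<in> wsp \<alpha> (hw \<alpha> + of_nat k)"] by auto
  have "(\<Sum>a\<in>T. smult S (u a) a) = 0"
  proof (rule eigen_sum_zero[OF T(1)])
    show "a \<in> T \<Longrightarrow> smult S (u a) a \<in> wsp \<alpha> (hw \<alpha> + of_nat (k a))" for a
      by (rule wsp_smult[OF k])
    show "a \<in> T \<Longrightarrow> hw \<alpha> + of_nat (k a) \<noteq> c" for a
      using c by (metis add_diff_cancel_left' of_nat_in_Nats)
    show "(\<Sum>a\<in>T. smult S (u a) a) \<in> wsp \<alpha> c" using w w_eq by simp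
  qed
  then show False using nz w_eq by simp
qed

text \<open>A homogeneous basis has finitely many vectors of each weight, because a weight outside
  \<open>h + \<nat>\<close> does not occur and the other weight spaces are finite-dimensional.\<close>

lemma finite_weight:
  assumes ind: "\<not> vs.dependent B"
  shows "finite {b \<in> B. b \<in> wsp \<alpha> c}"
proof (cases "c - hw \<alpha> \<in> \<nat>")
  case True
  then obtain k where "c - hw \<alpha> = of_nat k" by (metis Nats_cases)
  then have "c = hw \<alpha> + of_nat k" by (simp add: algebra_simps)
  with hw(2)[of \<alpha> k] obtain T where T: "finite T" "vs.span T = wsp \<alpha> c" by auto
  have "\<not> vs.dependent {b \<in> B. b \<in> wsp \<alpha> c}"
    using ind vs.dependent_mono[of "{b \<in> B. b \<in> wsp \<alpha> c}" B] by blast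
  moreover have "{b \<in> B. b \<in> wsp \<alpha> c} \<subseteq> vs.span T" using T(2) by blast
  ultimately show ?thesis using vs.independent_span_bound[OF T(1)] by blast
next
  case False
  have "0 \<notin> B" using ind vs.dependent_zero by blast
  then have "{b \<in> B. b \<in> wsp \<alpha> c} = {}" using False weight_mem by auto
  then show ?thesis by (simp only: finite.emptyI)
qed

text \<open>In the commutator with \<open>L(0)\<close> the modes \<open>L(-1)v\<close> and \<open>L(0)v\<close> remain, and the first is evaluated by
  the derivative property.\<close>

lemma weight_commutator:
  assumes I: "intertwining S W3 Y3 W1 Y1 W2 Y2 I" and v: "v \<in> W1" and w: "w \<in> W2"
    and c1: "vir S Y1 0 v = smult S c1 v"
  shows "vir S Y3 0 (I v c w) - I v c (vir S Y2 0 w) = smult S (c1 - c - 1) (I v c w)"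
proof -
  have "vir S Y3 0 (I v c w) - I v c (vir S Y2 0 w) = 
    lfsum (\<lambda>i::nat. smult S (of_int 1 gchoose i) (I (Y1 (conf S) (int i) v) (of_int 1 + c - of_nat i) w))"
    using intertwining_commutator[OF I conf v w, of 1 c] by (simp add: vir_def)
  also have "\<dots> = (\<Sum>i\<in>{0,1::nat}. smult S (of_int 1 gchoose i) (I (Y1 (conf S) (int i) v) (of_int 1 + c - of_nat i) w))"
    by (rule lfsum_eq_sum) (auto simp: gchoose_1_left)
  also have "\<dots> = I (vir S Y1 (- 1) v) (1 + c) w + I (vir S Y1 0 v) c w"
    by (simp add: vir_def)
  also have "\<dots> = smult S (- (1 + c)) (I v c w) + smult S c1 (I v c w)"
    using intertwining_deriv[OF I v w, of "1 + c"] intertwining_bilin(4)[OF I v w, of c1 c] c1 by simp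
  also have "\<dots> = smult S (c1 - c - 1) (I v c w)"
    unfolding vs.scale_left_distrib[symmetric] by (simp add: algebra_simps)
  finally show ?thesis .
qed

lemma L_weight: "w \<in> wsp \<alpha> c \<Longrightarrow> L \<alpha> k w \<in> wsp \<alpha> (c - of_int k)"
proof -
  assume w: "w \<in> wsp \<alpha> c"
  have c2: "L l0 0 (conf S) = smult S 2 (conf S)" using conf_weight by (simp add: wspace_def)
  have "L \<alpha> 0 (cmodes (mode S \<alpha>) (conf S) (of_int (k + 1)) w) - cmodes (mode S \<alpha>) (conf S) (of_int (k + 1)) (L \<alpha> 0 w)
     = smult S (2 - of_int (k + 1) - 1) (cmodes (mode S \<alpha>) (conf S) (of_int (k + 1)) w)"
    by (rule weight_commutator[OF module_intertwining conf wspD(1)[OF w] c2])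
  then have "L \<alpha> 0 (L \<alpha> k w) - L \<alpha> k (L \<alpha> 0 w) = smult S (- of_int k) (L \<alpha> k w)"
    unfolding cmodes_of_int by (simp add: vir_def)
  moreover have "L \<alpha> k (L \<alpha> 0 w) = smult S c (L \<alpha> k w)"
    by (simp add: wspD(2)[OF w] L_smult wspD(1)[OF w])
  ultimately have "L \<alpha> 0 (L \<alpha> k w) = smult S (- of_int k) (L \<alpha> k w) + smult S c (L \<alpha> k w)"
    by (simp only: diff_eq_eq)
  then have "L \<alpha> 0 (L \<alpha> k w) = smult S (c - of_int k) (L \<alpha> k w)"
    unfolding vs.scale_left_distrib[symmetric] by simp
  then show ?thesis by (rule wspI[OF L_in[OF wspD(1)[OF w]]])
qed

lemma inter_weight:
  assumes v: "v \<in> wsp \<alpha> c1" and w: "w \<in> wsp \<beta> c2"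
  shows "inter S \<gamma> \<alpha> \<beta> v c w \<in> wsp \<gamma> (c1 + c2 - c - 1)"
proof (rule wspI)
  let ?x = "inter S \<gamma> \<alpha> \<beta> v c w"
  show "?x \<in> carr S \<gamma>" by (intro inter_in wspD(1)[OF v] wspD(1)[OF w])
  have "L \<gamma> 0 ?x - inter S \<gamma> \<alpha> \<beta> v c (L \<beta> 0 w) = smult S (c1 - c - 1) ?x"
    by (rule weight_commutator[OF inter wspD(1)[OF v] wspD(1)[OF w] wspD(2)[OF v]])
  moreover have "inter S \<gamma> \<alpha> \<beta> v c (L \<beta> 0 w) = smult S c2 ?x"
    by (simp add: wspD[OF w] inter_smult_right[OF wspD(1)[OF v]])
  ultimately have "L \<gamma> 0 ?x = smult S (c1 - c - 1) ?x + smult S c2 ?x"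
    by (simp only: diff_eq_eq)
  then show "L \<gamma> 0 ?x = smult S (c1 + c2 - c - 1) ?x"
    unfolding vs.scale_left_distrib[symmetric] by (simp add: algebra_simps)
qed

lemma vac_weight: "vac S \<in> wsp l0 0"
  by (rule wspI) (simp_all add: vac L_vac)

lemma op_chain_weight:
  assumes "\<And>z. z \<in> fst ` set sk \<Longrightarrow> U z \<in> wsp (lab z) (\<omega> z)" "distinct (map fst sk)"
    "end_label \<gamma> sk = l0"
  shows "op_chain S lab e \<gamma> sk U (vac S) \<in> wsp \<gamma> (\<Sum>z\<in>fst ` set sk. e z + \<omega> z)"
  using assms
proof (induction sk arbitrary: \<gamma>)
  case Nil
  then show ?case by (simp add: vac_weight)
next
  case (Cons q sk)
  let ?s = "\<Sum>z\<in>fst ` set sk. e z + \<omega> z"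
  have "op_chain S lab e (snd q) sk U (vac S) \<in> wsp (snd q) ?s"
    by (rule Cons.IH) (use Cons.prems in auto)
  then have "op_chain S lab e \<gamma> (q # sk) U (vac S) \<in> wsp \<gamma> (\<omega> (fst q) + ?s - (- e (fst q) - 1) - 1)"
    unfolding op_chain.simps by (intro inter_weight Cons.prems(1)) auto
  moreover have "(\<Sum>z\<in>fst ` set (q # sk). e z + \<omega> z) = e (fst q) + \<omega> (fst q) + ?s"
    using Cons.prems(2) by simp
  ultimately show ?case by (simp add: algebra_simps)
qed

end

context voa_chain
begin

text \<open>If a coefficient does not vanish, every intermediate state has a weight of its module.\<close>

lemma G_nonzero_weight:
  assumes U: "\<And>z. z \<in> Z \<Longrightarrow> U z \<in> wsp (lab z) (\<omega> z)" and sk: "sk = P @ R" and nz: "G e U \<noteq> 0"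
  shows "(\<Sum>z\<in>fst ` set R. e z + \<omega> z) - hw (end_label l0 P) \<in> \<nat>"
proof -
  let ?x = "op_chain S lab e (end_label l0 P) R U (vac S)"
  have Z: "Z = fst ` set P \<union> fst ` set R" unfolding Z_def unfolding sk by auto
  have UP: "z \<in> fst ` set P \<Longrightarrow> U z \<in> carr S (lab z)" for z using U Z wspD by blast
  have "?x \<in> wsp (end_label l0 P) (\<Sum>z\<in>fst ` set R. e z + \<omega> z)"
    by (rule op_chain_weight) (use U Z distinct end_label in \<open>auto simp: sk end_label_append\<close>)
  moreover have "?x \<noteq> 0"
  proof
    assume "?x = 0"
    then have "op_chain S lab e l0 sk U (vac S) = op_chain S lab e l0 P U (sum (\<lambda>i. i) {})"
      by (simp add: sk op_chain_append)
    also have "\<dots> = 0" by (subst op_chain_sum) (use UP in auto)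
    finally show False using nz by (simp add: G_def pairing_zero_right vac)
  qed
  ultimately show ?thesis by (rule weight_mem)
qed

lemma split_at:
  assumes "z \<in> Z" obtains P \<beta> R where "sk = P @ (z, \<beta>) # R"
proof -
  obtain \<beta> where "(z, \<beta>) \<in> set sk" using assms by (auto simp: Z_def)
  then show ?thesis using that by (meson split_list)
qed

lemma G_cong:
  assumes "\<And>z. z \<in> Z \<Longrightarrow> e z = e' z" "\<And>z. z \<in> Z \<Longrightarrow> U z = U' z"
  shows "G e U = G e' U'"
  unfolding G_def using op_chain_cong[of sk e e' U U'] assms by (simp add: Z_def)

lemma G_linear:
  assumes ok: "\<And>y. y \<in> Z \<Longrightarrow> y \<noteq> z \<Longrightarrow> U y \<in> carr S (lab y)" and z: "z \<in> Z"
    and x: "\<And>i. i \<in> A \<Longrightarrow> x i \<in> carr S (lab z)"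
  shows "G e (U(z := \<Sum>i\<in>A. smult S (c i) (x i))) = (\<Sum>i\<in>A. c i * G e (U(z := x i)))"
proof -
  obtain P \<beta> R where sk: "sk = P @ (z, \<beta>) # R" using split_at[OF z] .
  have dist: "z \<notin> fst ` set P" "z \<notin> fst ` set R"
    using distinct unfolding sk by auto
  have Z: "Z = fst ` set P \<union> insert z (fst ` set R)" unfolding Z_def unfolding sk by auto
  have UP: "\<And>z. z \<in> fst ` set P \<Longrightarrow> U z \<in> carr S (lab z)"
    and UR: "\<And>z. z \<in> fst ` set R \<Longrightarrow> U z \<in> carr S (lab z)"
    using ok dist Z by auto
  let ?y = "op_chain S lab e \<beta> R U (vac S)" and ?g = "end_label l0 P"
  let ?I = "\<lambda>v. inter S ?g (lab z) \<beta> v (- e z - 1) ?y"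
  have "end_label \<beta> R = l0" using end_label by (simp add: sk end_label_append)
  then have y: "?y \<in> carr S \<beta>" by (intro op_chain_in) (use UR vac in auto)
  have eq: "op_chain S lab e l0 sk (U(z := v)) (vac S) = op_chain S lab e l0 P U (?I v)" for v
  proof -
    have 1: "op_chain S lab e \<beta> R (U(z := v)) (vac S) = ?y"
      by (rule op_chain_cong) (use dist in force)+
    have 2: "op_chain S lab e l0 P (U(z := v)) w = op_chain S lab e l0 P U w" for w
      by (rule op_chain_cong) (use dist in force)+
    show ?thesis by (simp add: sk op_chain_append 1 2)
  qed
  have Iin: "v \<in> carr S (lab z) \<Longrightarrow> ?I v \<in> carr S ?g" for v by (intro inter_in y)
  have I: "?I (\<Sum>i\<in>A. smult S (c i) (x i)) = (\<Sum>i\<in>A. smult S (c i) (?I (x i)))"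
    using x
  proof (induction A rule: infinite_finite_induct)
    case (insert a F)
    then show ?case
      using intertwining_bilin(2,4)[OF inter] y by (simp add: sum_carr smult_carr)
  qed (use intertwining_bilin(4)[OF inter carr_0 y, where k = 0] in simp_all)
  have oin: "i \<in> A \<Longrightarrow> op_chain S lab e l0 P U (?I (x i)) \<in> alg S" for i
    by (rule op_chain_in[OF UP]) (auto intro: Iin x)
  have "op_chain S lab e l0 P U (\<Sum>i\<in>A. smult S (c i) (?I (x i))) =
      (\<Sum>i\<in>A. op_chain S lab e l0 P U (smult S (c i) (?I (x i))))"
    by (rule op_chain_sum[OF UP]) (auto intro: smult_carr Iin x)
  also have "\<dots> = (\<Sum>i\<in>A. smult S (c i) (op_chain S lab e l0 P U (?I (x i))))"
    by (rule sum.cong[OF refl], rule op_chain_smult[OF UP]) (auto intro: Iin x)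
  finally have "G e (U(z := \<Sum>i\<in>A. smult S (c i) (x i))) =
      pv (\<Sum>i\<in>A. smult S (c i) (op_chain S lab e l0 P U (?I (x i))))"
    unfolding G_def eq I by simp
  also have "\<dots> = (\<Sum>i\<in>A. pv (smult S (c i) (op_chain S lab e l0 P U (?I (x i)))))"
    by (rule pv_sum) (intro smult_carr oin)
  also have "\<dots> = (\<Sum>i\<in>A. c i * G e (U(z := x i)))"
    unfolding G_def eq by (intro sum.cong refl pv_smult oin)
  finally show ?thesis .
qed

lemma G_smult:
  assumes "ok U" "z \<in> Z"
  shows "G e (U(z := smult S c (U z))) = c * G e U"
  using G_linear[of z U "{()}" "\<lambda>_. U z" e "\<lambda>_. c"] assms by (simp add: ok_def)

lemma G_zero:
  assumes "ok U" "z \<in> Z"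
  shows "G e (U(z := 0)) = 0"
  using G_smult[OF assms, of e 0] by simp

lemma G_deriv:
  assumes ok: "ok U" and z: "z \<in> Z"
  shows "G e (act lab U z (- 1)) = (e z + 1) * G (e + sg z 1) U"
proof -
  obtain P \<beta> R where sk: "sk = P @ (z, \<beta>) # R" using split_at[OF z] .
  have dist: "z \<notin> fst ` set P" "z \<notin> fst ` set R"
    using distinct unfolding sk by auto
  have Z: "Z = fst ` set P \<union> insert z (fst ` set R)" unfolding Z_def unfolding sk by auto
  have UP: "\<And>z. z \<in> fst ` set P \<Longrightarrow> U z \<in> carr S (lab z)"
    and UR: "\<And>z. z \<in> fst ` set R \<Longrightarrow> U z \<in> carr S (lab z)" and Uz: "U z \<in> carr S (lab z)"
    using ok dist Z by (auto simp: ok_def)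
  let ?y = "op_chain S lab e \<beta> R U (vac S)" and ?g = "end_label l0 P" and ?e = "e + sg z 1"
  let ?I = "inter S ?g (lab z) \<beta>"
  have "end_label \<beta> R = l0" using end_label by (simp add: sk end_label_append)
  then have y: "?y \<in> carr S \<beta>" by (intro op_chain_in) (use UR vac in auto)
  have 1: "op_chain S lab e l0 sk (act lab U z (- 1)) (vac S) = op_chain S lab e l0 P U (?I (L (lab z) (- 1) (U z)) (- e z - 1) ?y)"
  proof -
    have 1: "op_chain S lab e \<beta> R (act lab U z (- 1)) (vac S) = ?y"
      by (rule op_chain_cong) (use dist in \<open>force simp: act_def\<close>)+
    have 2: "op_chain S lab e l0 P (act lab U z (- 1)) w = op_chain S lab e l0 P U w" for w
      by (rule op_chain_cong) (use dist in \<open>force simp: act_def\<close>)+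
    show ?thesis by (simp add: sk op_chain_append 1 2) (simp add: act_def)
  qed
  have 2: "op_chain S lab ?e l0 sk U (vac S) = op_chain S lab e l0 P U (?I (U z) (- e z - 1 - 1) ?y)"
  proof -
    have 1: "op_chain S lab ?e \<beta> R U (vac S) = ?y"
      by (rule op_chain_cong) (use dist in \<open>force simp: sg_def\<close>)+
    have 2: "op_chain S lab ?e l0 P U w = op_chain S lab e l0 P U w" for w
      by (rule op_chain_cong) (use dist in \<open>force simp: sg_def\<close>)+
    have 3: "- ?e z - 1 = - e z - 1 - 1" by simp
    show ?thesis unfolding sk op_chain_append 2 op_chain.simps fst_conv snd_conv 1 3 ..
  qed
  have "?I (L (lab z) (- 1) (U z)) (- e z - 1) ?y = smult S (- (- e z - 1)) (?I (U z) (- e z - 1 - 1) ?y)"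
    by (rule intertwining_deriv[OF inter Uz y])
  moreover have "?I (U z) (- e z - 1 - 1) ?y \<in> carr S ?g" by (intro inter_in Uz y)
  ultimately have "op_chain S lab e l0 sk (act lab U z (- 1)) (vac S) = smult S (e z + 1) (op_chain S lab ?e l0 sk U (vac S))"
    unfolding 1 2 by (simp add: op_chain_smult[OF UP])
  then show ?thesis unfolding G_def by (simp add: pv_smult op_chain_alg[OF ok])
qed

end

section \<open>The correlation series\<close>

locale correlation = voa_modules S + expansion g n r
  for S :: "('a, 'm::ab_group_add) voa_system" (structure) and g n r +
  fixes \<alpha> \<beta> \<gamma> \<delta> :: "nat \<Rightarrow> 'a" and v :: "nat \<Rightarrow> 'm" and m :: "nat \<Rightarrow> complex"
    and B :: "nat \<Rightarrow> 'm set" and b' :: "nat \<Rightarrow> 'm \<Rightarrow> 'm"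
  assumes g: "g \<ge> 1"
    and basis: "\<And>a. a \<in> {1..g} \<Longrightarrow> homogeneous_basis S (\<alpha> a) (B a)"
    and dual_basis: "\<And>a. a \<in> {1..g} \<Longrightarrow> dual_basis S (\<alpha> a) (B a) (b' a)"
    and prim: "\<And>k. k \<in> {1..n} \<Longrightarrow> primary S (\<gamma> k) (m k) (v k)"
begin

definition lab :: "var \<Rightarrow> 'a" where
  "lab z = (case z of VarY k \<Rightarrow> \<gamma> k
     | VarW a \<Rightarrow> if a > 0 then \<alpha> (nat a) else dual S (\<alpha> (nat (- a))) | _ \<Rightarrow> lab0 S)"

definition handle_chain :: "(var \<times> 'a) list" where
  "handle_chain = concat (map (\<lambda>a. [(VarW (int a), int_lab S g \<beta> (2 * a - 1)),
     (VarW (- int a), int_lab S g \<beta> (2 * a))]) [1..<Suc g])"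

definition insertion_chain :: "(var \<times> 'a) list" where
  "insertion_chain = map (\<lambda>k. (VarY k, if k < n then \<delta> k else lab0 S)) [1..<Suc n]"

definition sk :: "(var \<times> 'a) list" where "sk = insertion_chain @ handle_chain"

definition vec :: "(nat \<Rightarrow> 'm) \<Rightarrow> var \<Rightarrow> 'm" where
  "vec b z = (case z of VarY k \<Rightarrow> v k
     | VarW a \<Rightarrow> if a > 0 then b (nat a) else b' (nat (- a)) (b (nat (- a))) | _ \<Rightarrow> 0)"

lemma set_handle_chain: "fst ` set handle_chain = VarW ` idx g"
proof -
  have "fst ` set handle_chain = (\<Union>a\<in>{1..g}. {VarW (int a), VarW (- int a)})"
    by (auto simp: handle_chain_def image_Un image_UN atLeastLessThanSuc_atLeastAtMost simp del: upt_Suc)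
  also have "\<dots> = VarW ` idx g"
  proof
    show "VarW ` idx g \<subseteq> (\<Union>a\<in>{1..g}. {VarW (int a), VarW (- int a)})"
    proof
      fix x assume "x \<in> VarW ` idx g"
      then obtain a where a: "x = VarW a" "a \<in> idx g" by blast
      then have "nat \<bar>a\<bar> \<in> {1..g}" using rho_index by blast
      moreover have "x \<in> {VarW (int (nat \<bar>a\<bar>)), VarW (- int (nat \<bar>a\<bar>))}" using a by auto
      ultimately show "x \<in> (\<Union>a\<in>{1..g}. {VarW (int a), VarW (- int a)})" by blast
    qed
  qed (auto simp: idx_def)
  finally show ?thesis .
qed

lemma set_insertion_chain: "fst ` set insertion_chain = VarY ` {1..n}"
  by (auto simp: insertion_chain_def image_image atLeastLessThanSuc_atLeastAtMost simp del: upt_Suc)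

lemma sorted_handle_chain_upto:
  assumes "j \<le> g"
  shows "sorted_wrt (\<lambda>p q. r (fst q) < r (fst p)) (concat (map (\<lambda>a. [(VarW (int a), int_lab S g \<beta> (2 * a - 1)),
     (VarW (- int a), int_lab S g \<beta> (2 * a))]) [1..<Suc j]))"
  using assms
proof (induction j)
  case (Suc j)
  have W: "r (VarW b) < r (VarW a)" if "a \<in> idx g" "b \<in> idx g" "wpos a < wpos b" for a b
    using order that by (auto simp: expansion_order_def)
  have "r (VarW (- int (Suc j))) < r (VarW (int (Suc j)))"
    by (rule W) (use Suc in \<open>auto simp: idx_def wpos_def\<close>)
  moreover have "r (VarW (int (Suc j))) < r (VarW (int a))" "r (VarW (- int (Suc j))) < r (VarW (int a))"
    "r (VarW (int (Suc j))) < r (VarW (- int a))" "r (VarW (- int (Suc j))) < r (VarW (- int a))"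
    if "a \<in> {1..j}" for a
    by (rule W; use Suc that in \<open>auto simp: idx_def wpos_def\<close>)+
  ultimately show ?case
    using Suc by (auto simp: sorted_wrt_append)
qed simp

text \<open>The variables in the chain are in the order of the expansion. Hence the partial sums in \<open>deg\<close> run
  over right ends of the chain.\<close>

lemma sorted_sk: "sorted_wrt (\<lambda>p q. r (fst q) < r (fst p)) sk"
proof -
  have Y: "r (VarY l) < r (VarY k)" if "k \<in> {1..n}" "l \<in> {1..n}" "k < l" for k l
    using order that by (auto simp: expansion_order_def)
  have "sorted_wrt (\<lambda>p q. r (fst q) < r (fst p)) insertion_chain"
    unfolding insertion_chain_def sorted_wrt_map
    by (rule sorted_wrt_mono_rel[OF _ sorted_wrt_upt]) (auto intro!: Y)
  moreover have "sorted_wrt (\<lambda>p q. r (fst q) < r (fst p)) handle_chain"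
    unfolding handle_chain_def by (rule sorted_handle_chain_upto) simp
  moreover have "r (fst q) < r (fst p)" if "p \<in> set insertion_chain" "q \<in> set handle_chain" for p q
  proof -
    have "fst p \<in> VarY ` {1..n}" "fst q \<in> VarW ` idx g"
      using that set_insertion_chain set_handle_chain by blast+
    then show ?thesis using order by (auto simp: expansion_order_def)
  qed
  ultimately show ?thesis unfolding sk_def sorted_wrt_append by blast
qed

lemma distinct_sk: "distinct (map fst sk)"
proof -
  have "sorted_wrt (\<lambda>x y. r y < r x) (map fst sk)" using sorted_sk by (simp add: sorted_wrt_map)
  moreover have "sorted_wrt (\<lambda>x y. r y < r x) l \<Longrightarrow> distinct l" for l :: "var list"
    by (induction l) auto
  ultimately show ?thesis by blast
qed

lemma end_label_sk: "end_label l0 sk = l0"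
proof -
  obtain k where k: "g = Suc k" using g by (cases g) auto
  have "end_label \<gamma> handle_chain = l0" for \<gamma>
    unfolding handle_chain_def by (simp add: k end_label_append int_lab_def)
  then show ?thesis by (simp add: sk_def end_label_append)
qed

sublocale voa_chain S lab sk
  by unfold_locales (rule distinct_sk, rule end_label_sk)

lemma Z_eq: "Z = VarY ` {1..n} \<union> VarW ` idx g"
  unfolding Z_def by (simp only: sk_def set_append image_Un set_insertion_chain set_handle_chain)

lemma Z_V0: "Z \<subseteq> V0"
  by (auto simp: Z_eq V0_def)

lemma Z_cases:
  assumes "z \<in> Z"
  obtains k where "z = VarY k" "k \<in> {1..n}" | a where "z = VarW (int a)" "a \<in> {1..g}"
    | a where "z = VarW (- int a)" "a \<in> {1..g}"
proof -
  have "fst ` set handle_chain = (\<Union>a\<in>{1..g}. {VarW (int a), VarW (- int a)})"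
    by (auto simp: handle_chain_def image_Un image_UN atLeastLessThanSuc_atLeastAtMost simp del: upt_Suc)
  then have "Z = VarY ` {1..n} \<union> (\<Union>a\<in>{1..g}. {VarW (int a), VarW (- int a)})"
    using set_handle_chain Z_eq by simp
  then show ?thesis using assms that by auto
qed

lemma idx_cases:
  assumes "a \<in> idx g"
  obtains c where "c \<in> {1..g}" "a = int c" | c where "c \<in> {1..g}" "a = - int c"
proof -
  have "nat \<bar>a\<bar> \<in> {1..g}" by (rule rho_index[OF assms])
  moreover have "a = int (nat \<bar>a\<bar>) \<or> a = - int (nat \<bar>a\<bar>)" by auto
  ultimately show ?thesis using that by blast
qed

subsection \<open>Weights\<close>

lemma basis_facts:
  assumes a: "a \<in> {1..g}"
  shows "\<not> vs.dependent (B a)" "vs.span (B a) = carr S (\<alpha> a)"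
    "x \<in> B a \<Longrightarrow> x \<in> carr S (\<alpha> a)" "x \<in> B a \<Longrightarrow> x \<in> wsp (\<alpha> a) (wt S (\<alpha> a) x)"
    "x \<in> B a \<Longrightarrow> x \<in> wsp (\<alpha> a) c \<longleftrightarrow> wt S (\<alpha> a) x = c"
proof -
  show 1: "\<not> vs.dependent (B a)" and 2: "vs.span (B a) = carr S (\<alpha> a)"
    using basis[OF a] by (simp_all add: homogeneous_basis_def)
  show "x \<in> B a \<Longrightarrow> x \<in> carr S (\<alpha> a)" using 2 vs.span_base by blast
  have u: "wt S (\<alpha> a) x = c" if x: "x \<in> B a" "x \<in> wsp (\<alpha> a) c" for c
  proof -
    have "x \<noteq> 0" using 1 x vs.dependent_zero by blast
    then have "d = c" if "L (\<alpha> a) 0 x = smult S d x" for d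
      using wspD(2)[OF x(2)] that by (simp add: vs.scale_cancel_right)
    then show ?thesis unfolding wt_def using wspD(2)[OF x(2)] by blast
  qed
  show "x \<in> B a \<Longrightarrow> x \<in> wsp (\<alpha> a) (wt S (\<alpha> a) x)"
    using basis[OF a] u unfolding homogeneous_basis_def by blast
  then show "x \<in> B a \<Longrightarrow> x \<in> wsp (\<alpha> a) c \<longleftrightarrow> wt S (\<alpha> a) x = c" using u by blast
qed

lemma dual_facts:
  assumes a: "a \<in> {1..g}" and x: "x \<in> B a"
  shows "b' a x \<in> carr S (dual S (\<alpha> a))"
    "y \<in> B a \<Longrightarrow> pairing S (\<alpha> a) y (b' a x) = (if y = x then 1 else 0)"
  using dual_basis[OF a] x by (auto simp: dual_basis_def)

lemma dual_eqI:
  assumes a: "a \<in> {1..g}" and x: "x \<in> carr S (dual S (\<alpha> a))" "y \<in> carr S (dual S (\<alpha> a))"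
    and eq: "\<And>b. b \<in> B a \<Longrightarrow> pairing S (\<alpha> a) b x = pairing S (\<alpha> a) b y"
  shows "x = y"
proof -
  have d: "x - y \<in> carr S (dual S (\<alpha> a))" using x by (rule diff_carr)
  have xy: "pairing S (\<alpha> a) w (x - y) = pairing S (\<alpha> a) w x - pairing S (\<alpha> a) w y" if "w \<in> carr S (\<alpha> a)" for w
    using pairing_add[OF that d x(2)] by simp
  have "carr S (\<alpha> a) \<subseteq> {w \<in> carr S (\<alpha> a). pairing S (\<alpha> a) w (x - y) = 0}"
  proof -
    have "vs.span (B a) \<subseteq> {w \<in> carr S (\<alpha> a). pairing S (\<alpha> a) w (x - y) = 0}"
    proof (rule vs.span_minimal)
      show "B a \<subseteq> {w \<in> carr S (\<alpha> a). pairing S (\<alpha> a) w (x - y) = 0}"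
        using basis_facts(3)[OF a] eq xy by auto
      show "vs.subspace {w \<in> carr S (\<alpha> a). pairing S (\<alpha> a) w (x - y) = 0}"
        by (rule vs.subspaceI)
          (auto simp: carr_0 pairing_zero_left d add_carr smult_carr pairing_add_left pairing_smult_left)
    qed
    then show ?thesis using basis_facts(2)[OF a] by simp
  qed
  then have "x - y = 0" using pairing_nondegenerate(2)[OF d] by blast
  then show ?thesis by simp
qed

lemma dual_weight:
  assumes a: "a \<in> {1..g}" and x: "x \<in> B a"
  shows "b' a x \<in> wsp (dual S (\<alpha> a)) (wt S (\<alpha> a) x)"
proof (rule wspI)
  show d: "b' a x \<in> carr S (dual S (\<alpha> a))" by (rule dual_facts[OF a x])
  show "L (dual S (\<alpha> a)) 0 (b' a x) = smult S (wt S (\<alpha> a) x) (b' a x)"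
  proof (rule dual_eqI[OF a])
    show "L (dual S (\<alpha> a)) 0 (b' a x) \<in> carr S (dual S (\<alpha> a))" by (rule L_in[OF d])
    show "smult S (wt S (\<alpha> a) x) (b' a x) \<in> carr S (dual S (\<alpha> a))" by (rule smult_carr[OF d])
    fix b assume b: "b \<in> B a"
    have bc: "b \<in> carr S (\<alpha> a)" by (rule basis_facts(3)[OF a b])
    show "pairing S (\<alpha> a) b (L (dual S (\<alpha> a)) 0 (b' a x)) = pairing S (\<alpha> a) b (smult S (wt S (\<alpha> a) x) (b' a x))"
      using wspD(2)[OF basis_facts(4)[OF a b]]
      by (simp add: pairing_L[OF bc d] pairing_smult[OF bc d] pairing_smult_left[OF bc d] dual_facts(2)[OF a x b])
  qed
qed

definition weight_at :: "(nat \<Rightarrow> 'm) \<Rightarrow> var \<Rightarrow> complex" where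
  "weight_at b z = (case z of VarY k \<Rightarrow> m k | VarW a \<Rightarrow> wt S (\<alpha> (nat \<bar>a\<bar>)) (b (nat \<bar>a\<bar>)) | _ \<Rightarrow> 0)"

abbreviation bases :: "(nat \<Rightarrow> 'm) set" where "bases \<equiv> PiE {1..g} B"

lemma vec_weight:
  assumes b: "b \<in> bases" and z: "z \<in> Z"
  shows "vec b z \<in> wsp (lab z) (weight_at b z)"
  using z
proof (cases rule: Z_cases)
  case (1 k)
  then show ?thesis using prim by (auto simp: vec_def lab_def weight_at_def primary_def)
next
  case (2 a)
  then have "b a \<in> B a" using b by (auto simp: PiE_mem)
  then show ?thesis using 2 basis_facts(4) by (simp add: vec_def lab_def weight_at_def)
next
  case (3 a)
  then have "b a \<in> B a" using b by (auto simp: PiE_mem)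
  then show ?thesis using 3 dual_weight by (simp add: vec_def lab_def weight_at_def)
qed

lemma vec_ok: "b \<in> bases \<Longrightarrow> ok (vec b)"
  unfolding ok_def using vec_weight wspD by blast

text \<open>The choices of basis vectors that contribute to the monomial \<open>e\<close>: their weights are the exponents of
  the \<open>\<rho>\<^sub>a\<close>.\<close>

definition bases_at :: "monom \<Rightarrow> (nat \<Rightarrow> 'm) set" where
  "bases_at e = {b \<in> bases. \<forall>a\<in>{1..g}. wt S (\<alpha> a) (b a) = e (VarR a)}"

lemma bases_at_eq: "bases_at e = PiE {1..g} (\<lambda>a. {x \<in> B a. wt S (\<alpha> a) x = e (VarR a)})"
  by (auto simp: bases_at_def PiE_iff extensional_def)

lemma finite_bases_at: "finite (bases_at e)"
  unfolding bases_at_eq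
proof (rule finite_PiE)
  fix a assume a: "a \<in> {1..g}"
  have "{x \<in> B a. wt S (\<alpha> a) x = e (VarR a)} = {x \<in> B a. x \<in> wsp (\<alpha> a) (e (VarR a))}"
    using basis_facts(5)[OF a] by blast
  then show "finite {x \<in> B a. wt S (\<alpha> a) x = e (VarR a)}"
    using finite_weight[OF basis_facts(1)[OF a]] by simp
qed simp

lemma bases_at_cong: "(\<And>a. a \<in> {1..g} \<Longrightarrow> e (VarR a) = e' (VarR a)) \<Longrightarrow> bases_at e = bases_at e'"
  by (auto simp: bases_at_def)

definition sup :: "monom \<Rightarrow> bool" where
  "sup e \<longleftrightarrow> (\<forall>u. u \<notin> Z \<union> VarR ` {1..g} \<longrightarrow> e u = 0)"

text \<open>The sum over the bases of \<open>\<Prod>\<^sub>a\<rho>\<^sub>a\<^bsup>wt(b\<^sub>a)\<^esup>\<close> times the expectation value with vectors \<open>U b\<close>,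
  written by coefficients.\<close>

definition C :: "((nat \<Rightarrow> 'm) \<Rightarrow> var \<Rightarrow> 'm) \<Rightarrow> ser" where
  "C U = (\<lambda>e. if sup e then \<Sum>b\<in>bases_at e. G e (U b) else 0)"

text \<open>The correlation series without the conformal vector, and its variants in which \<open>L(k)\<close> is applied to
  the vector at \<open>z\<close>.\<close>

definition F :: ser where "F = C vec"

definition D :: "var \<Rightarrow> int \<Rightarrow> ser" where "D z k = C (\<lambda>b. act lab (vec b) z k)"

definition rho_weights :: "(nat \<Rightarrow> 'm) \<Rightarrow> monom" where
  "rho_weights b = (\<lambda>u. case u of VarR a \<Rightarrow> if a \<in> {1..g} then wt S (\<alpha> a) (b a) else 0 | _ \<Rightarrow> 0)"

text \<open>Multiplication by \<open>\<Prod>\<^sub>a\<rho>\<^sub>a\<^bsup>wt(b\<^sub>a)\<^esup>\<close> shifts the exponents of the \<open>\<rho>\<^sub>a\<close>, so that at \<open>e\<close> only the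
  members of \<open>bases_at e\<close> remain. The set \<open>X\<close> holds the variables outside the chain: none, or that of
  the conformal vector.\<close>

lemma ser_sum_C:
  assumes vev: "\<And>b e. b \<in> bases \<Longrightarrow> V b e = (if \<forall>u. u \<notin> Z \<union> X \<longrightarrow> e u = 0 then G' b e else 0)"
    and X: "\<And>a. VarR a \<notin> X"
    and G': "\<And>b e e'. b \<in> bases \<Longrightarrow> (\<And>z. z \<in> Z \<union> X \<Longrightarrow> e z = e' z) \<Longrightarrow> G' b e = G' b e'"
  shows "ser_sum (\<lambda>b. if b \<in> bases then mon (rho_weights b) \<odot> V b else 0) e =
    (if \<forall>u. u \<notin> Z \<union> X \<union> VarR ` {1..g} \<longrightarrow> e u = 0 then \<Sum>b\<in>bases_at e. G' b e else 0)"
proof -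
  have ZR: "VarR a \<notin> Z" for a by (auto simp: Z_eq)
  have w0: "rho_weights b u = 0" if "u \<notin> VarR ` {1..g}" for b u
    using that by (cases u) (auto simp: rho_weights_def)
  have wR: "rho_weights b (VarR a) = wt S (\<alpha> a) (b a)" if "a \<in> {1..g}" for a b
    using that by (simp add: rho_weights_def)
  have t: "(if b \<in> bases then mon (rho_weights b) \<odot> V b else 0) e =
     (if b \<in> bases_at e \<and> (\<forall>u. u \<notin> Z \<union> X \<union> VarR ` {1..g} \<longrightarrow> e u = 0) then G' b e else 0)" for b
  proof (cases "b \<in> bases")
    case True
    have "(\<forall>u. u \<notin> Z \<union> X \<longrightarrow> (e - rho_weights b) u = 0) \<longleftrightarrow>
        b \<in> bases_at e \<and> (\<forall>u. u \<notin> Z \<union> X \<union> VarR ` {1..g} \<longrightarrow> e u = 0)" (is "?l \<longleftrightarrow> ?r")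
    proof
      assume l: ?l
      have "wt S (\<alpha> a) (b a) = e (VarR a)" if "a \<in> {1..g}" for a
        using l[rule_format, of "VarR a"] that ZR X by (simp add: wR)
      moreover have "e u = 0" if "u \<notin> Z \<union> X \<union> VarR ` {1..g}" for u
      proof -
        have "(e - rho_weights b) u = 0" using l that by blast
        moreover have "rho_weights b u = 0" by (rule w0) (use that in blast)
        ultimately show ?thesis unfolding minus_apply by (simp only: diff_0_right)
      qed
      ultimately show ?r using True by (simp add: bases_at_def)
    next
      assume rr: ?r
      show ?l
      proof (intro allI impI)
        fix u assume u: "u \<notin> Z \<union> X"
        show "(e - rho_weights b) u = 0"
        proof (cases "u \<in> VarR ` {1..g}")
          case True
          then show ?thesis using rr by (auto simp: bases_at_def wR)
        next
          case False
          then show ?thesis using rr u w0[OF False, of b] by simp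
        qed
      qed
    qed
    moreover have "G' b (e - rho_weights b) = G' b e"
    proof (rule G'[OF True])
      fix z assume "z \<in> Z \<union> X"
      then have "z \<notin> VarR ` {1..g}" using ZR X by auto
      then show "(e - rho_weights b) z = e z" using w0[of z b] by simp
    qed
    ultimately show ?thesis by (simp only: mon_mult vev[OF True] True if_True)
  qed (auto simp: bases_at_def)
  have "lfsum (\<lambda>b. if b \<in> bases_at e \<and> P then G' b e else 0) = (if P then \<Sum>b\<in>bases_at e. G' b e else 0)" for P
    by (cases P) (simp_all add: lfsum_eq_sum[OF finite_bases_at[of e]])
  then show ?thesis unfolding ser_sum_def t .
qed

end

section \<open>Virasoro modes in the correlation series\<close>

lemma set_dropWhile_sorted:
  assumes "sorted_wrt (\<lambda>p q. f q < f p) l"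
  shows "set (dropWhile (\<lambda>q. (c::nat) < f q) l) = {q \<in> set l. f q \<le> c}"
  using assms by (induction l) auto

context correlation
begin

definition lowest_weight_at :: "var \<Rightarrow> complex" where
  "lowest_weight_at z = (case z of VarY k \<Rightarrow> m k | VarW a \<Rightarrow> hw (\<alpha> (nat \<bar>a\<bar>)) | _ \<Rightarrow> 0)"

text \<open>The values of \<open>deg\<close> that result if the intermediate state and the basis vectors all have the lowest
  weights of their modules.\<close>

definition cF :: "var option \<Rightarrow> complex" where
  "cF i = (case i of None \<Rightarrow> 2 * (\<Sum>a=1..g. hw (\<alpha> a))
     | Some u \<Rightarrow> if u \<in> V0
         then hw (end_label l0 (takeWhile (\<lambda>q. r u < r (fst q)) sk)) - (\<Sum>z | z \<in> Z \<and> r z \<le> r u. lowest_weight_at z)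
            + 10 * (\<Sum>a=1..g. hw (\<alpha> a))
         else (case u of VarR a \<Rightarrow> 2 * hw (\<alpha> a) | _ \<Rightarrow> 0))"

lemma weight_excess:
  assumes "b \<in> bases"
  obtains N where "\<And>a. a \<in> {1..g} \<Longrightarrow> wt S (\<alpha> a) (b a) = hw (\<alpha> a) + of_nat (N a)"
proof -
  have "\<exists>k::nat. wt S (\<alpha> a) (b a) = hw (\<alpha> a) + of_nat k" if a: "a \<in> {1..g}" for a
  proof -
    have ba: "b a \<in> B a" using assms a by (auto simp: PiE_mem)
    then have "b a \<noteq> 0" using basis_facts(1)[OF a] vs.dependent_zero by metis
    then have "wt S (\<alpha> a) (b a) - hw (\<alpha> a) \<in> \<nat>"
      by (rule weight_mem[OF basis_facts(4)[OF a ba]])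
    then obtain k where "wt S (\<alpha> a) (b a) - hw (\<alpha> a) = of_nat k" by (elim Nats_cases)
    then show ?thesis by (intro exI[of _ k]) (simp add: algebra_simps)
  qed
  then show ?thesis using that by metis
qed

lemma idx_sum: "(\<Sum>a\<in>idx g. f (nat \<bar>a\<bar>)) = 2 * (\<Sum>a=1..g. f a :: nat)"
  by (simp add: idx_sum_split sum.distrib)

lemma VarR_Z: "VarR a \<notin> Z" by (auto simp: Z_eq)

lemma C_nonzeroE:
  assumes "C U e \<noteq> 0"
  obtains b where "sup e" "b \<in> bases_at e" "G e (U b) \<noteq> 0"
  using assms that unfolding C_def by (metis (mono_tags, lifting) sum.neutral)

text \<open>Lower bounds for the exponents: the partial sums of the exponents of the smallest
  variables are the weights of intermediate states, up to the weights of inserted vectors.\<close>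

lemma good_C:
  assumes U: "\<And>b z. b \<in> bases \<Longrightarrow> z \<in> Z \<Longrightarrow> U b z \<in> wsp (lab z) (weight_at b z - (if z = y then of_int k else 0))"
  shows "good (cF + sc (min k 0)) 0 (C U)"
  unfolding good_def
proof (intro allI impI)
  fix e assume "C U e \<noteq> 0"
  then obtain b where sup: "sup e" and b: "b \<in> bases_at e" and nz: "G e (U b) \<noteq> 0" by (elim C_nonzeroE)
  have bP: "b \<in> bases" and be: "\<And>a. a \<in> {1..g} \<Longrightarrow> wt S (\<alpha> a) (b a) = e (VarR a)" using b by (auto simp: bases_at_def)
  obtain N where N: "\<And>a. a \<in> {1..g} \<Longrightarrow> wt S (\<alpha> a) (b a) = hw (\<alpha> a) + of_nat (N a)"
    using weight_excess[OF bP] by blast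
  have eN: "e (VarR a) = hw (\<alpha> a) + of_nat (N a)" if "a \<in> {1..g}" for a
    using be N that by metis
  have rd: "rdeg e = (\<Sum>a=1..g. hw (\<alpha> a)) + of_nat (\<Sum>a=1..g. N a)"
    unfolding rdeg_def by (simp add: eN sum.distrib)
  have out: "e u = 0" if "u \<notin> vars" for u
  proof -
    have "u \<notin> Z \<union> VarR ` {1..g}" using that Z_V0 by (auto simp: vars_def)
    then show ?thesis using sup by (simp add: sup_def)
  qed
  have Some_V0: "deg (Some u) e - (cF + sc (min k 0)) (Some u) \<in> \<nat>" if u: "u \<in> V0" for u
  proof -
    let ?P = "takeWhile (\<lambda>q. r u < r (fst q)) sk" and ?R = "dropWhile (\<lambda>q. r u < r (fst q)) sk"
    let ?Z = "{z. z \<in> Z \<and> r z \<le> r u}"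
    have sR: "set ?R = {q \<in> set sk. r (fst q) \<le> r u}"
      by (rule set_dropWhile_sorted[OF sorted_sk])
    have R: "fst ` set ?R = ?Z" unfolding sR Z_def by blast
    have fin: "finite ?Z" using finite_Z by simp
    have "(\<Sum>z\<in>fst ` set ?R. e z + (weight_at b z - (if z = y then of_int k else 0))) - hw (end_label l0 ?P) \<in> \<nat>"
      by (rule G_nonzero_weight[OF U[OF bP] _ nz]) simp_all
    then obtain j where j: "(\<Sum>z\<in>?Z. e z + (weight_at b z - (if z = y then of_int k else 0))) - hw (end_label l0 ?P) = of_nat j"
      unfolding R by (elim Nats_cases)
    have "(\<Sum>z\<in>?Z. e z + (weight_at b z - (if z = y then of_int k else 0))) =
        (\<Sum>z\<in>?Z. e z) + (\<Sum>z\<in>?Z. weight_at b z) - (if y \<in> ?Z then of_int k else 0)"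
      using fin by (simp add: sum.distrib sum_subtractf)
    with j have se: "(\<Sum>z\<in>?Z. e z) = of_nat j + hw (end_label l0 ?P) - (\<Sum>z\<in>?Z. weight_at b z) + (if y \<in> ?Z then of_int k else 0)"
      by (simp add: algebra_simps)
    \<comment> \<open>the excess of the weight at \<open>z\<close> over the lowest one\<close>
    define nq where "nq z = (case z of VarW a \<Rightarrow> N (nat \<bar>a\<bar>) | _ \<Rightarrow> 0)" for z
    have omq: "weight_at b z = lowest_weight_at z + of_nat (nq z)" if "z \<in> Z" for z
      using that by (cases rule: Z_cases) (simp_all add: weight_at_def lowest_weight_at_def nq_def N)
    have "(\<Sum>z\<in>?Z. nq z) \<le> (\<Sum>z\<in>Z. nq z)" by (rule sum_mono2) (auto simp: finite_Z)
    also have "\<dots> = (\<Sum>z\<in>VarW ` idx g. nq z)"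
      by (rule sum.mono_neutral_right) (auto simp: Z_eq finite_idx nq_def)
    also have "\<dots> = 2 * (\<Sum>a=1..g. N a)"
      by (subst sum.reindex) (auto simp: inj_on_def nq_def idx_sum)
    \<comment> \<open>a weight of a basis vector occurs at the two ends of its handle only, so it is subtracted
      at most twice, while the \<open>\<rho>\<close>-degree adds it ten times\<close>
    finally have q: "(\<Sum>z\<in>?Z. nq z) \<le> 10 * (\<Sum>a=1..g. N a)" by simp
    have somq: "(\<Sum>z\<in>?Z. weight_at b z) = (\<Sum>z\<in>?Z. lowest_weight_at z) + of_nat (\<Sum>z\<in>?Z. nq z)"
      by (simp add: omq sum.distrib)
    have "(\<Sum>u' | u' \<in> V0 \<and> r u' \<le> r u. e u') = (\<Sum>z\<in>?Z. e z)"
    proof (rule sum.mono_neutral_right)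
      show "\<forall>i\<in>{u' \<in> V0. r u' \<le> r u} - ?Z. e i = 0"
      proof
        fix i assume "i \<in> {u' \<in> V0. r u' \<le> r u} - ?Z"
        then have "i \<notin> Z \<union> VarR ` {1..g}" by auto
        then show "e i = 0" using sup by (simp add: sup_def)
      qed
    qed (use finite_V0 Z_V0 in auto)
    then have "deg (Some u) e - (cF + sc (min k 0)) (Some u) =
        of_nat j + ((if y \<in> ?Z then of_int k else 0) - of_int (min k 0)) +
        (of_nat (10 * (\<Sum>a=1..g. N a)) - of_nat (\<Sum>z\<in>?Z. nq z))"
      using u by (simp add: deg_def cF_def sc_def rd se somq algebra_simps)
    also have "of_nat (10 * (\<Sum>a=1..g. N a)) - of_nat (\<Sum>z\<in>?Z. nq z) =
        (of_nat (10 * (\<Sum>a=1..g. N a) - (\<Sum>z\<in>?Z. nq z)) :: complex)"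
      by (rule of_nat_diff[OF q, symmetric])
    also have "(if y \<in> ?Z then of_int k else 0) - of_int (min k 0) =
        (of_nat (nat ((if y \<in> ?Z then k else 0) - min k 0)) :: complex)"
      by (simp add: min_def)
    finally show ?thesis by (simp only: of_nat_add[symmetric] of_nat_in_Nats)
  qed
  have Some_R: "deg (Some (VarR a)) e - (cF + sc (min k 0)) (Some (VarR a)) \<in> \<nat>" if "a \<in> {1..g}" for a
  proof -
    have "deg (Some (VarR a)) e - (cF + sc (min k 0)) (Some (VarR a)) = of_nat (2 * N a)"
      using eN[OF that] by (simp add: deg_def cF_def sc_def)
    then show ?thesis by (simp only: of_nat_in_Nats)
  qed
  have "deg None e - (cF + sc (min k 0)) None - of_nat 0 = of_nat (2 * (\<Sum>a=1..g. N a))"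
    by (simp add: deg_def cF_def sc_def rd)
  then have "deg None e - (cF + sc (min k 0)) None - of_nat 0 \<in> \<nat>" by (simp only: of_nat_in_Nats)
  then show "cone (cF + sc (min k 0)) 0 e"
    unfolding cone_def using out Some_V0 Some_R by (auto elim!: vars_cases)
qed

lemma good_D:
  assumes "y \<in> Z"
  shows "good (cF + sc (min k 0)) 0 (D y k)"
  unfolding D_def
proof (rule good_C)
  fix b z assume b: "b \<in> bases" and z: "z \<in> Z"
  show "act lab (vec b) y k z \<in> wsp (lab z) (weight_at b z - (if z = y then of_int k else 0))"
    using vec_weight[OF b z] L_weight by (auto simp: act_def)
qed

lemma good_F: "good cF 0 F"
proof -
  have "good (cF + sc (min 0 0)) 0 (C vec)"
    by (rule good_C[where y = VarX]) (simp only: of_int_0 if_cancel diff_0_right vec_weight)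
  then show ?thesis by (simp add: F_def sc_0)
qed

subsection \<open>Modes that act as differential operators\<close>

lemma sup_shift: "u \<in> Z \<union> VarR ` {1..g} \<Longrightarrow> sup (e + sg u x) \<longleftrightarrow> sup e"
  unfolding sup_def by (rule all_cong) (metis add.right_neutral plus_fun_apply sg_other)

lemma sup_shift_minus: "u \<in> Z \<union> VarR ` {1..g} \<Longrightarrow> sup (e - sg u x) \<longleftrightarrow> sup e"
  using sup_shift[of u "e - sg u x" x] by simp

lemma bases_at_shift: "u \<in> Z \<Longrightarrow> bases_at (e + sg u x) = bases_at e"
  using VarR_Z by (intro bases_at_cong) (auto simp: sg_def)

lemma bases_at_shift_minus: "u \<in> Z \<Longrightarrow> bases_at (e - sg u x) = bases_at e"
  using bases_at_shift[of u "e - sg u x" x] by simp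

lemma bases_at_bases: "b \<in> bases_at e \<Longrightarrow> b \<in> bases" by (simp add: bases_at_def)

lemma D_deriv:
  assumes z: "z \<in> Z"
  shows "D z (- 1) = pd z F"
proof
  fix e
  show "D z (- 1) e = pd z F e"
    using z by (auto simp: D_def F_def C_def pd_alt sup_shift bases_at_shift sum_distrib_left
        intro!: sum.cong G_deriv[OF vec_ok[OF bases_at_bases]])
qed

lemma D_zero_mode:
  assumes z: "z \<in> Z"
  shows "D z 0 e = (if sup e then \<Sum>b\<in>bases_at e. weight_at b z * G e (vec b) else 0)"
proof -
  have "G e (act lab (vec b) z 0) = weight_at b z * G e (vec b)" if b: "b \<in> bases_at e" for b
    using wspD(2)[OF vec_weight[OF bases_at_bases[OF b] z]] G_smult[OF vec_ok[OF bases_at_bases[OF b]] z]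
    by (simp add: act_def)
  then show ?thesis by (simp add: D_def C_def)
qed

lemma D_weight_Y:
  assumes "k \<in> {1..n}"
  shows "D (VarY k) 0 = ser_smult (m k) F"
proof
  fix e
  have "VarY k \<in> Z" using assms by (simp add: Z_eq)
  then show "D (VarY k) 0 e = ser_smult (m k) F e"
    by (simp add: D_zero_mode weight_at_def ser_smult_def F_def C_def sum_distrib_left)
qed

lemma D_primary:
  assumes "k \<in> {1..n}" "i > 0"
  shows "D (VarY k) i = 0"
proof
  fix e
  have z: "VarY k \<in> Z" using assms by (simp add: Z_eq)
  have "G e (act lab (vec b) (VarY k) i) = 0" if b: "b \<in> bases_at e" for b
  proof -
    have "L (lab (VarY k)) i (vec b (VarY k)) = 0"
      using prim[OF assms(1)] assms(2) by (simp add: primary_def lab_def vec_def)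
    then show ?thesis unfolding act_def using G_zero[OF vec_ok[OF bases_at_bases[OF b]] z] by simp
  qed
  then show "D (VarY k) i e = 0 e" by (simp add: D_def C_def)
qed

lemma D_weight_W:
  assumes "a \<in> {1..g}"
  shows "D (VarW (int a)) 0 = pw (VarR a) 1 \<odot> pd (VarR a) F"
proof
  fix e
  have z: "VarW (int a) \<in> Z" using assms by (auto simp: Z_eq idx_def)
  have "(pw (VarR a) 1 \<odot> pd (VarR a) F) e = e (VarR a) * F e"
    by (simp add: pw_eq_mon mon_mult pd_alt)
  also have "\<dots> = D (VarW (int a)) 0 e"
    using assms by (auto simp: D_zero_mode[OF z] F_def C_def sum_distrib_left bases_at_def weight_at_def intro!: sum.cong)
  finally show "D (VarW (int a)) 0 e = (pw (VarR a) 1 \<odot> pd (VarR a) F) e" by simp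
qed

subsection \<open>Duality of the two ends of a handle\<close>

text \<open>By linear independence of eigenvectors only basis vectors of the weight of \<open>x\<close> occur in \<open>x\<close>.\<close>

lemma expand_basis:
  assumes a: "a \<in> {1..g}" and x: "x \<in> wsp (\<alpha> a) \<mu>"
  shows "x = (\<Sum>c | c \<in> B a \<and> wt S (\<alpha> a) c = \<mu>. smult S (pairing S (\<alpha> a) x (b' a c)) c)"
proof -
  let ?B = "{c. c \<in> B a \<and> wt S (\<alpha> a) c = \<mu>}"
  have finB: "finite ?B"
    using finite_weight[OF basis_facts(1)[OF a], of "\<alpha> a" \<mu>] basis_facts(5)[OF a]
    by (elim rev_finite_subset) auto
  have "x \<in> vs.span (B a)" using wspD(1)[OF x] basis_facts(2)[OF a] by simp
  then obtain T u where T: "finite T" "T \<subseteq> B a" and xT: "x = (\<Sum>c\<in>T. smult S (u c) c)"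
    unfolding vs.span_explicit by blast
  define w where "w c = (if c \<in> T then u c else 0)" for c
  let ?T = "{c \<in> T. wt S (\<alpha> a) c \<noteq> \<mu>}"
  have Tw: "c \<in> T \<Longrightarrow> c \<in> wsp (\<alpha> a) (wt S (\<alpha> a) c)" for c using basis_facts(4)[OF a] T by blast
  have Bw: "c \<in> ?B \<Longrightarrow> c \<in> wsp (\<alpha> a) \<mu>" for c using basis_facts(4)[OF a] by blast
  have split: "x = (\<Sum>c\<in>?B. smult S (w c) c) + (\<Sum>c\<in>?T. smult S (u c) c)"
  proof -
    have "(\<Sum>c\<in>?B. smult S (w c) c) = (\<Sum>c\<in>{c \<in> T. wt S (\<alpha> a) c = \<mu>}. smult S (u c) c)"
      by (rule sum.mono_neutral_cong_right) (use finB T in \<open>auto simp: w_def\<close>)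
    moreover have "(\<Sum>c\<in>T. smult S (u c) c) = (\<Sum>c\<in>{c \<in> T. wt S (\<alpha> a) c = \<mu>} \<union> ?T. smult S (u c) c)"
      by (rule sum.cong) auto
    moreover have "\<dots> = (\<Sum>c\<in>{c \<in> T. wt S (\<alpha> a) c = \<mu>}. smult S (u c) c) + (\<Sum>c\<in>?T. smult S (u c) c)"
      by (rule sum.union_disjoint) (use T in auto)
    ultimately show ?thesis using xT by simp
  qed
  have Bin: "(\<Sum>c\<in>?B. smult S (w c) c) \<in> wsp (\<alpha> a) \<mu>"
    by (rule vs.subspace_sum[OF wsp_subspace]) (intro wsp_smult Bw)
  have "(\<Sum>c\<in>?T. smult S (u c) c) = x - (\<Sum>c\<in>?B. smult S (w c) c)" using split by (simp add: algebra_simps)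
  then have "(\<Sum>c\<in>?T. smult S (u c) c) \<in> wsp (\<alpha> a) \<mu>"
    using vs.subspace_diff[OF wsp_subspace x Bin] by simp
  then have "(\<Sum>c\<in>?T. smult S (u c) c) = 0"
    by (rule eigen_sum_zero[rotated 3]) (use T Tw wsp_smult in auto)
  with split have xB: "x = (\<Sum>c\<in>?B. smult S (w c) c)" by simp
  have "pairing S (\<alpha> a) x (b' a c) = w c" if c: "c \<in> ?B" for c
  proof -
    have cB: "c \<in> B a" using c by simp
    have d: "b' a c \<in> carr S (dual S (\<alpha> a))" by (rule dual_facts(1)[OF a cB])
    have "pairing S (\<alpha> a) (\<Sum>e\<in>A. smult S (w e) e) (b' a c) = (\<Sum>e\<in>A. w e * (if e = c then 1 else 0))"
      if "A \<subseteq> ?B" for A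
      using that
    proof (induction A rule: infinite_finite_induct)
      case (insert e A)
      then have "e \<in> carr S (\<alpha> a)" "(\<Sum>e\<in>A. smult S (w e) e) \<in> carr S (\<alpha> a)" "e \<in> B a"
        using basis_facts(3)[OF a] by (auto intro!: sum_carr smult_carr)
      then show ?case using insert dual_facts(2)[OF a cB]
        by (simp add: pairing_add_left[OF _ _ d] pairing_smult_left[OF _ d] smult_carr)
    qed (simp_all add: pairing_zero_left d)
    from this[OF order_refl] have "pairing S (\<alpha> a) x (b' a c) = (\<Sum>e\<in>?B. w e * (if e = c then 1 else 0))"
      using xB by simp
    also have "\<dots> = (\<Sum>e\<in>?B. if e = c then w e else 0)" by (rule sum.cong) auto
    also have "\<dots> = w c" using finB c by simp
    finally show ?thesis .
  qed
  then have "(\<Sum>c\<in>?B. smult S (pairing S (\<alpha> a) x (b' a c)) c) = (\<Sum>c\<in>?B. smult S (w c) c)"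
    by (intro sum.cong) auto
  then show ?thesis using xB by simp
qed

text \<open>A vector of weight \<open>\<mu>\<close> pairs with basis vectors of weight \<open>\<mu>\<close> only, of which there are finitely many;
  the equation then follows from the nondegeneracy of the pairing.\<close>

lemma expand_dual:
  assumes a: "a \<in> {1..g}" and y: "y \<in> wsp (dual S (\<alpha> a)) \<mu>"
  shows "y = (\<Sum>c | c \<in> B a \<and> wt S (\<alpha> a) c = \<mu>. smult S (pairing S (\<alpha> a) c y) (b' a c))"
proof (rule dual_eqI[OF a])
  let ?B = "{c. c \<in> B a \<and> wt S (\<alpha> a) c = \<mu>}"
  have finB: "finite ?B"
    using finite_weight[OF basis_facts(1)[OF a], of "\<alpha> a" \<mu>] basis_facts(5)[OF a]
    by (elim rev_finite_subset) auto
  show yc: "y \<in> carr S (dual S (\<alpha> a))" by (rule wspD(1)[OF y])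
  have din: "c \<in> ?B \<Longrightarrow> b' a c \<in> carr S (dual S (\<alpha> a))" for c using dual_facts(1)[OF a] by simp
  show "(\<Sum>c\<in>?B. smult S (pairing S (\<alpha> a) c y) (b' a c)) \<in> carr S (dual S (\<alpha> a))"
    by (intro sum_carr smult_carr din)
  fix b assume b: "b \<in> B a"
  have bc: "b \<in> carr S (\<alpha> a)" by (rule basis_facts(3)[OF a b])
  have "pairing S (\<alpha> a) b (\<Sum>c\<in>?B. smult S (pairing S (\<alpha> a) c y) (b' a c)) =
      (\<Sum>c\<in>?B. pairing S (\<alpha> a) b (smult S (pairing S (\<alpha> a) c y) (b' a c)))"
    by (rule pairing_sum[OF bc]) (intro smult_carr din)
  also have "\<dots> = (\<Sum>c\<in>?B. if b = c then pairing S (\<alpha> a) b y else 0)"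
    by (intro sum.cong refl) (auto simp: pairing_smult[OF bc din] dual_facts(2)[OF a _ b])
  also have "\<dots> = (if b \<in> ?B then pairing S (\<alpha> a) b y else 0)"
    using finB by simp
  also have "\<dots> = pairing S (\<alpha> a) b y"
  proof (cases "wt S (\<alpha> a) b = \<mu>")
    case False
    have "wt S (\<alpha> a) b * pairing S (\<alpha> a) b y = pairing S (\<alpha> a) (L (\<alpha> a) 0 b) y"
      using wspD(2)[OF basis_facts(4)[OF a b]] pairing_smult_left[OF bc yc] by simp
    also have "\<dots> = \<mu> * pairing S (\<alpha> a) b y"
      using pairing_L[OF bc yc, of 0] wspD(2)[OF y] pairing_smult[OF bc yc] by simp
    finally show ?thesis using False by simp
  qed (use b in simp)
  finally show "pairing S (\<alpha> a) b y = pairing S (\<alpha> a) b (\<Sum>c\<in>?B. smult S (pairing S (\<alpha> a) c y) (b' a c))"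
    by simp
qed

text \<open>As dual bases are inserted at the two ends of a handle, \<open>L(k)\<close> at one end may be replaced by its
  transpose \<open>L(-k)\<close> at the other. The basis vector then has another weight, which changes the power
  of \<open>\<rho>\<^sub>a\<close> by \<open>k\<close>.\<close>

lemma D_dual_pos:
  assumes a: "a \<in> {1..g}"
  shows "D (VarW (int a)) k = pw (VarR a) (of_int k) \<odot> D (VarW (- int a)) (- k)"
proof
  fix e
  let ?z = "VarW (int a)" and ?z' = "VarW (- int a)"
  let ?e = "e - sg (VarR a) (of_int k)"
  have a0: "a > 0" using a by simp
  have z: "?z \<in> Z" "?z' \<in> Z" using a by (auto simp: Z_eq idx_def)
  have lab: "lab ?z = \<alpha> a" "lab ?z' = dual S (\<alpha> a)" using a0 by (simp_all add: lab_def)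
  have vecz: "vec b ?z = b a" "vec b ?z' = b' a (b a)" for b using a0 by (simp_all add: vec_def)
  define lam where "lam = e (VarR a)"
  define B1 where "B1 = {c. c \<in> B a \<and> wt S (\<alpha> a) c = lam}"
  define B2 where "B2 = {c. c \<in> B a \<and> wt S (\<alpha> a) c = lam - of_int k}"
  have sup: "sup ?e \<longleftrightarrow> sup e" by (rule sup_shift_minus) (use a in auto)
  have Geq: "G ?e U = G e U" for U
    by (rule G_cong) (use VarR_Z in \<open>auto simp: sg_def\<close>)
  have eR: "?e (VarR c) = (if c = a then lam - of_int k else e (VarR c))" for c
    by (auto simp: lam_def)
  define X where "X f c = pairing S (\<alpha> a) (L (\<alpha> a) k f) (b' a c)" for f c
  have l: "G e (act lab (vec b) ?z k) = (\<Sum>c\<in>B2. X (b a) c * G e ((vec b)(?z := c)))" if b: "b \<in> bases_at e" for b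
  proof -
    have "b a \<in> B a" "wt S (\<alpha> a) (b a) = lam" using b a by (auto simp: bases_at_def lam_def PiE_mem)
    then have "L (\<alpha> a) k (b a) \<in> wsp (\<alpha> a) (lam - of_int k)"
      using L_weight[OF basis_facts(4)[OF a]] by metis
    from expand_basis[OF a this]
    have "act lab (vec b) ?z k = (vec b)(?z := \<Sum>c\<in>B2. smult S (X (b a) c) c)"
      unfolding act_def lab vecz B2_def X_def by simp
    then show ?thesis
      using G_linear[of ?z "vec b" B2 "\<lambda>c. c" e "X (b a)"] vec_ok[OF bases_at_bases[OF b]] z
        basis_facts(3)[OF a] by (simp add: ok_def lab B2_def)
  qed
  have r: "G e (act lab (vec d) ?z' (- k)) = (\<Sum>f\<in>B1. X f (d a) * G e ((vec d)(?z' := b' a f)))" if d: "d \<in> bases_at ?e" for d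
  proof -
    have "d a \<in> B a" "wt S (\<alpha> a) (d a) = ?e (VarR a)" using d a by (auto simp: bases_at_def PiE_mem)
    then have da: "d a \<in> B a" "wt S (\<alpha> a) (d a) = lam - of_int k" unfolding eR by auto
    then have "L (dual S (\<alpha> a)) (- k) (b' a (d a)) \<in> wsp (dual S (\<alpha> a)) (lam - of_int k - of_int (- k))"
      using L_weight[OF dual_weight[OF a da(1)], of "- k"] by simp
    then have Lw: "L (dual S (\<alpha> a)) (- k) (b' a (d a)) \<in> wsp (dual S (\<alpha> a)) lam" by simp
    have pX: "pairing S (\<alpha> a) f (L (dual S (\<alpha> a)) (- k) (b' a (d a))) = X f (d a)" if "f \<in> B1" for f
      using pairing_L[OF basis_facts(3)[OF a] dual_facts(1)[OF a da(1)], of f "- k"] that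
      by (simp add: X_def B1_def)
    have "L (dual S (\<alpha> a)) (- k) (b' a (d a)) = (\<Sum>f\<in>B1. smult S (X f (d a)) (b' a f))"
    proof -
      let ?y = "L (dual S (\<alpha> a)) (- k) (b' a (d a))"
      have "?y = (\<Sum>f\<in>B1. smult S (pairing S (\<alpha> a) f ?y) (b' a f))"
        using expand_dual[OF a Lw] unfolding B1_def .
      also have "\<dots> = (\<Sum>f\<in>B1. smult S (X f (d a)) (b' a f))"
        by (intro sum.cong refl) (simp only: pX)
      finally show ?thesis .
    qed
    then have "act lab (vec d) ?z' (- k) = (vec d)(?z' := \<Sum>f\<in>B1. smult S (X f (d a)) (b' a f))"
      unfolding act_def lab vecz by simp
    then show ?thesis
      using G_linear[of ?z' "vec d" B1 "b' a" e "\<lambda>f. X f (d a)"] vec_ok[OF bases_at_bases[OF d]] z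
        dual_facts(1)[OF a] by (simp add: ok_def lab B1_def)
  qed
  \<comment> \<open>replacing \<open>b\<^sub>a\<close> at one end by \<open>c\<close> is the same as taking \<open>c\<close> for the basis vector and restoring the
    dual of \<open>b\<^sub>a\<close> at the other end; both double sums run over such pairs\<close>
  have swap: "(vec b)(?z := c) = (vec (b(a := c)))(?z' := b' a (b a))" for b c
    using a0 by (auto simp: vec_def fun_eq_iff split: var.split)
  have "(\<Sum>b\<in>bases_at e. \<Sum>c\<in>B2. X (b a) c * G e ((vec b)(?z := c))) =
      (\<Sum>d\<in>bases_at ?e. \<Sum>f\<in>B1. X f (d a) * G e ((vec d)(?z' := b' a f)))"
    unfolding sum.cartesian_product
  proof (rule sum.reindex_bij_witness[of _ "\<lambda>(d, f). (d(a := f), d a)" "\<lambda>(b, c). (b(a := c), b a)"])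
    fix p assume "p \<in> bases_at e \<times> B2"
    then obtain b c where p: "p = (b, c)" "b \<in> bases_at e" "c \<in> B2" by auto
    have "b(a := c) \<in> bases_at ?e"
      using p a by (auto simp: bases_at_eq PiE_iff eR B2_def extensional_def lam_def)
    moreover have "b a \<in> B1" using p a by (auto simp: bases_at_def B1_def lam_def PiE_mem)
    ultimately show "(case p of (b, c) \<Rightarrow> (b(a := c), b a)) \<in> bases_at ?e \<times> B1" by (simp add: p)
    show "(case case p of (b, c) \<Rightarrow> (b(a := c), b a) of (d, f) \<Rightarrow> X f (d a) * G e ((vec d)(?z' := b' a f))) =
        (case p of (b, c) \<Rightarrow> X (b a) c * G e ((vec b)(?z := c)))"
      unfolding p prod.case swap by simp
  next
    fix p assume "p \<in> bases_at ?e \<times> B1"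
    then obtain d f where p: "p = (d, f)" "d \<in> bases_at ?e" "f \<in> B1" by auto
    have "d(a := f) \<in> bases_at e"
      using p a by (auto simp: bases_at_eq PiE_iff eR B1_def lam_def extensional_def split: if_splits)
    moreover have "d a \<in> B2"
      using p a unfolding bases_at_eq B2_def PiE_iff eR by auto
    ultimately show "(case p of (d, f) \<Rightarrow> (d(a := f), d a)) \<in> bases_at e \<times> B2" by (simp add: p)
  qed auto
  then show "D ?z k e = (pw (VarR a) (of_int k) \<odot> D ?z' (- k)) e"
    using l r by (simp add: D_def C_def pw_eq_mon mon_mult sup Geq)
qed

lemma D_dual:
  assumes a: "a \<in> idx g"
  shows "D (VarW a) k = pw (rho a) (of_int k) \<odot> D (VarW (- a)) (- k)"
  using a
proof (cases rule: idx_cases)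
  case (1 c)
  then show ?thesis using D_dual_pos by (simp add: rho_def)
next
  case (2 c)
  have "D (VarW (int c)) (- k) = pw (VarR c) (of_int (- k)) \<odot> D (VarW (- int c)) k"
    using D_dual_pos[OF 2(1), of "- k"] by simp
  moreover have "pw (VarR c) (of_int k) \<odot> (pw (VarR c) (of_int (- k)) \<odot> f) = f" for f
    unfolding pw_eq_mon mon_mult_assoc[symmetric] mon_mult_mon sg_add
    by (simp add: pw_eq_mon[symmetric] pw_zero)
  ultimately show ?thesis using 2 by (simp add: rho_def)
qed

end

section \<open>The conformal vector in the correlation series\<close>

lemma gchoose_minus_Suc: "((- of_nat i - 1 :: complex) gchoose m) = (- 1) ^ m * of_nat ((i + m) choose m)"
proof -
  have "((- of_nat i - 1 :: complex) gchoose m) = (- (of_nat i + 1)) gchoose m" by simp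
  also have "\<dots> = (- 1) ^ m * ((of_nat i + 1 + of_nat m - 1) gchoose m)" by (rule gbinomial_minus)
  also have "(of_nat i + 1 + of_nat m - 1 :: complex) = of_nat (i + m)" by simp
  finally show ?thesis by (simp only: binomial_gbinomial)
qed

lemma creation_coeff: "(- 1) ^ i * ((- of_nat m - 1 :: complex) gchoose i) = of_nat ((m + i) choose m)"
proof -
  have "(m + i) choose i = (m + i) choose m" using binomial_symmetric[of i "m + i"] by simp
  moreover have "(- 1 :: complex) ^ i * (- 1) ^ i = 1" by (simp flip: power_mult_distrib)
  ultimately show ?thesis unfolding gchoose_minus_Suc by (simp flip: mult.assoc)
qed

lemma fpart_gt: "s > 2 \<Longrightarrow> fpart r u m v s = 0"
  unfolding fpart_def
proof (rule sum.neutral, rule ballI)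
  fix l :: nat assume "s > 2" "l \<in> {..2}"
  then have "l choose s = 0" by (simp add: binomial_eq_0)
  then show "ser_smult (of_nat (l choose s)) (pdd u m (f2 r l u) \<odot> pw v (of_nat l - of_nat s)) = 0"
    by (simp only: of_nat_0 smult_zero)
qed

context correlation
begin

lemma handle_ops_eq: "handle_ops S g \<alpha> \<beta> b' b = map (\<lambda>(z, \<beta>). (z, lab z, vec b z, \<beta>)) handle_chain"
  unfolding handle_ops_def handle_chain_def map_concat map_map
  by (rule arg_cong[where f = concat], rule map_cong) (auto simp: lab_def vec_def simp del: upt_Suc)

abbreviation ins :: "(var \<times> 'a \<times> 'm \<times> complex) list" where
  "ins \<equiv> map (\<lambda>k. (VarY k, \<gamma> k, v k, m k)) [1..<Suc n]"

abbreviation dls :: "'a list" where "dls \<equiv> map \<delta> [1..<n]"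

lemma ops_eq:
  "map (\<lambda>((z, \<gamma>, v, m), \<delta>'). (z, \<gamma>, v, \<delta>')) (zip ins (dls @ [lab0 S])) =
    map (\<lambda>(z, \<beta>). (z, lab z, vec b z, \<beta>)) insertion_chain"
proof (cases "n = 0")
  case True
  then show ?thesis unfolding insertion_chain_def by simp
next
  case False
  have d: "dls @ [lab0 S] = map (\<lambda>k. if k < n then \<delta> k else lab0 S) [1..<Suc n]"
    using False by simp
  show ?thesis
    unfolding d zip_map_map zip_same_conv_map insertion_chain_def map_map
    by (rule map_cong) (auto simp: lab_def vec_def)
qed

lemma corr_form_F: "fst (corr_form S g B b' \<alpha> \<beta> ins dls) = F"
proof -
  have "vev S (map (\<lambda>((z, \<gamma>, v, m), \<delta>'). (z, \<gamma>, v, \<delta>')) (zip ins (dls @ [lab0 S])) @ handle_ops S g \<alpha> \<beta> b' b) e =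
      (if \<forall>u. u \<notin> Z \<union> {} \<longrightarrow> e u = 0 then G e (vec b) else 0)" for b e
  proof -
    have 1: "map (\<lambda>((z, \<gamma>, v, m), \<delta>'). (z, \<gamma>, v, \<delta>')) (zip ins (dls @ [lab0 S])) @ handle_ops S g \<alpha> \<beta> b' b =
        map (\<lambda>(z, \<beta>). (z, lab z, vec b z, \<beta>)) sk" (is "?l = ?r")
      unfolding handle_ops_eq ops_eq[of b] sk_def by (simp only: map_append)
    have 2: "fst ` set ?r = Z" by (force simp: Z_def)
    show ?thesis unfolding vev_def 1 2 op_prod_eq_op_chain G_def by (simp only: Un_empty_right)
  qed
  note V = this
  show ?thesis
  proof
    fix e
    show "fst (corr_form S g B b' \<alpha> \<beta> ins dls) e = F e"
      unfolding corr_form_def Let_def fst_conv F_def C_def sup_def rho_weights_def[symmetric]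
      by (subst ser_sum_C[where X = "{}" and G' = "\<lambda>b e. G e (vec b)", OF V]) (auto intro: G_cong)
  qed
qed

lemma corr_form_conf:
  "fst (corr_form S g B b' \<alpha> \<beta> ((VarX, lab0 S, conf S, 2) # ins) (lab0 S # dls)) e =
    (if \<forall>u. u \<notin> Z \<union> {VarX} \<union> VarR ` {1..g} \<longrightarrow> e u = 0
     then \<Sum>b\<in>bases_at e. pv (cmodes (mode S l0) (conf S) (- e VarX - 1) (op_chain S lab e l0 sk (vec b) (vac S)))
     else 0)"
proof -
  let ?ops = "map (\<lambda>((z, \<gamma>, v, m), \<delta>'). (z, \<gamma>, v, \<delta>')) (zip ((VarX, lab0 S, conf S, 2) # ins) ((lab0 S # dls) @ [lab0 S]))"
  have V: "vev S (?ops @ handle_ops S g \<alpha> \<beta> b' b) e =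
      (if \<forall>u. u \<notin> Z \<union> {VarX} \<longrightarrow> e u = 0
       then pv (cmodes (mode S l0) (conf S) (- e VarX - 1) (op_chain S lab e l0 sk (vec b) (vac S))) else 0)"
    if b: "b \<in> bases" for b e
  proof -
    have 1: "?ops @ handle_ops S g \<alpha> \<beta> b' b =
        (VarX, lab0 S, conf S, lab0 S) # map (\<lambda>(z, \<beta>). (z, lab z, vec b z, \<beta>)) sk" (is "?l = ?r")
      unfolding handle_ops_eq sk_def append_Cons zip_Cons_Cons list.map prod.case ops_eq[of b]
      by (simp only: map_append)
    have 2: "fst ` set ?r = Z \<union> {VarX}" by (force simp: Z_def)
    have 3: "inter S l0 l0 l0 (conf S) c (op_chain S lab e l0 sk (vec b) (vac S)) =
        cmodes (mode S l0) (conf S) c (op_chain S lab e l0 sk (vec b) (vac S))" for c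
      by (rule norm_left[OF conf op_chain_alg[OF vec_ok[OF b]]])
    show ?thesis unfolding vev_def 1 2 op_prod.simps prod.case op_prod_eq_op_chain 3 ..
  qed
  have cong: "pv (cmodes (mode S l0) (conf S) (- e VarX - 1) (op_chain S lab e l0 sk (vec b) (vac S))) =
     pv (cmodes (mode S l0) (conf S) (- e' VarX - 1) (op_chain S lab e' l0 sk (vec b) (vac S)))"
    if "\<And>z. z \<in> Z \<union> {VarX} \<Longrightarrow> e z = e' z" for b e e'
  proof -
    have "op_chain S lab e l0 sk (vec b) (vac S) = op_chain S lab e' l0 sk (vec b) (vac S)"
      by (rule op_chain_cong) (use that in \<open>auto simp: Z_def\<close>)
    then show ?thesis using that[of VarX] by simp
  qed
  show ?thesis
    unfolding corr_form_def Let_def fst_conv rho_weights_def[symmetric]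
    by (rule ser_sum_C[where X = "{VarX}" and
        G' = "\<lambda>b e. pv (cmodes (mode S l0) (conf S) (- e VarX - 1) (op_chain S lab e l0 sk (vec b) (vac S)))", OF V])
      (assumption, simp, rule cong, simp)
qed

subsection \<open>Ward identities for the correlation series\<close>

lemma bnd_bases_at: obtains N where "N \<ge> 2" "\<And>b. b \<in> bases_at e \<Longrightarrow> bnd N (vec b)"
proof -
  have "\<forall>b\<in>bases_at e. \<exists>N. bnd N (vec b)" using bnd_exists[OF vec_ok[OF bases_at_bases]] by metis
  then obtain f where f: "\<And>b. b \<in> bases_at e \<Longrightarrow> bnd (f b) (vec b)" by metis
  let ?N = "Max (insert 2 (f ` bases_at e))"
  have "bnd ?N (vec b)" if "b \<in> bases_at e" for b
    by (rule bnd_mono[OF f[OF that]]) (use that finite_bases_at in auto)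
  moreover have "?N \<ge> 2" using finite_bases_at by simp
  ultimately show ?thesis using that by blast
qed

lemma D_shift:
  assumes "z \<in> Z" "z' \<in> Z"
  shows "D z k (e - sg z' x) = (if sup e then \<Sum>b\<in>bases_at e. G (e - sg z' x) (act lab (vec b) z k) else 0)"
  using assms by (simp add: D_def C_def sup_shift_minus bases_at_shift_minus)

lemma D_ward:
  assumes l: "l \<le> 2"
  shows "(\<Sum>z\<in>Z. \<Sum>s\<le>2. ser_smult (of_nat (l choose s)) (pw z (of_nat l - of_nat s) \<odot> D z (int s - 1))) = 0"
proof
  fix e
  obtain N where N: "N \<ge> 2" "\<And>b. b \<in> bases_at e \<Longrightarrow> bnd N (vec b)" using bnd_bases_at[of e] by blast
  have "(\<Sum>z\<in>Z. \<Sum>s\<le>2. ser_smult (of_nat (l choose s)) (pw z (of_nat l - of_nat s) \<odot> D z (int s - 1))) e =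
      (\<Sum>z\<in>Z. \<Sum>s\<le>2. of_nat (l choose s) * D z (int s - 1) (e - sg z (of_nat l - of_nat s)))"
    by (simp add: sum_ser_apply ser_smult_def pw_eq_mon mon_mult)
  also have "\<dots> = (if sup e then \<Sum>z\<in>Z. \<Sum>s\<le>2. \<Sum>b\<in>bases_at e. of_nat (l choose s) * G (e - sg z (of_nat l - of_nat s)) (act lab (vec b) z (int s - 1)) else 0)"
    by (simp add: D_shift sum_distrib_left)
  also have "(\<Sum>z\<in>Z. \<Sum>s\<le>2. \<Sum>b\<in>bases_at e. of_nat (l choose s) * G (e - sg z (of_nat l - of_nat s)) (act lab (vec b) z (int s - 1))) =
      (\<Sum>b\<in>bases_at e. \<Sum>z\<in>Z. \<Sum>s\<le>2. of_nat (l choose s) * G (e - sg z (of_nat l - of_nat s)) (act lab (vec b) z (int s - 1)))"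
    by (simp only: sum.swap[of _ "bases_at e"])
  also have "\<dots> = 0"
  proof (rule sum.neutral, rule ballI)
    fix b assume b: "b \<in> bases_at e"
    have "(\<Sum>s\<le>2. of_nat (l choose s) * G (e - sg z (of_nat l - of_nat s)) (act lab (vec b) z (int s - 1))) =
        (\<Sum>s\<le>N. (of_nat l gchoose s) * G (e - sg z (of_nat l - of_nat s)) (act lab (vec b) z (int s - 1)))" for z
      unfolding binomial_gbinomial[symmetric]
      by (rule sum.mono_neutral_left) (use N(1) l in \<open>auto simp: binomial_eq_0\<close>)
    then show "(\<Sum>z\<in>Z. \<Sum>s\<le>2. of_nat (l choose s) * G (e - sg z (of_nat l - of_nat s)) (act lab (vec b) z (int s - 1))) = 0"
      using ward[OF vec_ok[OF bases_at_bases[OF b]] N(2)[OF b] l] by simp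
  qed
  finally show "(\<Sum>z\<in>Z. \<Sum>s\<le>2. ser_smult (of_nat (l choose s)) (pw z (of_nat l - of_nat s) \<odot> D z (int s - 1))) e = 0 e"
    by simp
qed

lemma good_D_mode: "z \<in> Z \<Longrightarrow> good (cF + sc (- 1)) 0 (D z (int s - 1))"
  by (rule good_sc_mono[OF good_D]) auto

lemma fpart_sum:
  assumes u: "u \<in> V0" and uA: "\<And>l. u \<noteq> VarA l"
  shows "(\<Sum>z\<in>Z. \<Sum>s\<le>2. fpart r u k z s \<odot> D z (int s - 1)) = 0"
proof -
  define f where "f l = pdd u k (f2 r l u)" for l
  define T where "T l z s = ser_smult (of_nat (l choose s)) (pw z (of_nat l - of_nat s) \<odot> D z (int s - 1))" for l z s
  have gf: "good (sc (- 3 - int k)) 0 (f l)" for l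
    unfolding f_def by (intro good_sc_pdd good_f2 u uA)
  have gT: "good (cF + sc (- 1)) 0 (T l z s)" if z: "z \<in> Z" for l z s
  proof (cases "s \<le> l")
    case True
    have zV: "z \<in> V0" using z Z_V0 by blast
    have "good (sc 0 + (cF + sc (- 1))) (0 + 0) (pw z (of_nat (l - s)) \<odot> D z (int s - 1))"
      by (intro good_mult good_pw_V0 good_D_mode z zV)
    then show ?thesis using True unfolding T_def by (intro good_smult) (simp add: of_nat_diff sc_0)
  next
    case False
    then have "l choose s = 0" by simp
    then show ?thesis unfolding T_def by (simp only: of_nat_0 smult_zero good_zero)
  qed
  have t: "fpart r u k z s \<odot> D z (int s - 1) = (\<Sum>l\<le>2. f l \<odot> T l z s)" if z: "z \<in> Z" for z s
  proof -
    have zV: "z \<in> V0" using z Z_V0 by blast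
    have "fpart r u k z s \<odot> D z (int s - 1) =
        (\<Sum>l\<le>2. ser_smult (of_nat (l choose s)) (f l \<odot> pw z (of_nat l - of_nat s)) \<odot> D z (int s - 1))"
      unfolding fpart_def f_def
      by (rule sum_distrib_right_ser[OF _ good_fterm[OF u zV uA] good_D_mode[OF z]]) simp
    also have "\<dots> = (\<Sum>l\<le>2. f l \<odot> T l z s)"
      unfolding T_def pw_eq_mon ser_smult_mult mult_ser_smult
      by (simp only: ser_mult_commute[of "f _" "mon _"] mon_mult_assoc mult_mon_left_commute)
    finally show ?thesis .
  qed
  have "(\<Sum>z\<in>Z. \<Sum>s\<le>2. fpart r u k z s \<odot> D z (int s - 1)) = (\<Sum>z\<in>Z. \<Sum>s\<le>2. \<Sum>l\<le>2. f l \<odot> T l z s)"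
    by (intro sum.cong refl t)
  also have "\<dots> = (\<Sum>z\<in>Z. \<Sum>l\<le>2. \<Sum>s\<le>2. f l \<odot> T l z s)"
    by (rule sum.cong[OF refl], rule sum.swap)
  also have "\<dots> = (\<Sum>l\<le>2. \<Sum>z\<in>Z. \<Sum>s\<le>2. f l \<odot> T l z s)"
    by (rule sum.swap)
  also have "\<dots> = (\<Sum>l\<le>(2::nat). 0)"
  proof (rule sum.cong[OF refl])
    fix l :: nat assume l: "l \<in> {..2}"
    have "(\<Sum>z\<in>Z. \<Sum>s\<le>2. f l \<odot> T l z s) = (\<Sum>z\<in>Z. f l \<odot> (\<Sum>s\<le>2. T l z s))"
      by (intro sum.cong refl sum_distrib_left_ser[symmetric, OF _ gT gf]) auto
    also have "\<dots> = f l \<odot> (\<Sum>z\<in>Z. \<Sum>s\<le>2. T l z s)"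
      by (rule sum_distrib_left_ser[symmetric, OF finite_Z _ gf]) (rule good_sum, rule gT)
    also have "(\<Sum>z\<in>Z. \<Sum>s\<le>2. T l z s) = 0"
      unfolding T_def by (rule D_ward) (use l in simp)
    finally show "(\<Sum>z\<in>Z. \<Sum>s\<le>2. f l \<odot> T l z s) = 0" by (simp only: ser_mult_zero)
  qed
  also have "\<dots> = 0" by (rule sum.neutral_const)
  finally show ?thesis .
qed

text \<open>At a given monomial only finitely many of the modes contribute to a product with
  kernels free of the \<open>\<rho>\<^sub>a\<close>.\<close>

lemma kernel_vanish:
  assumes K: "\<And>a. indep (VarR a) K" and z: "z \<in> Z" and N: "\<And>b. b \<in> bases_at e \<Longrightarrow> bnd N (vec b)" and s: "s > N"
  shows "(K \<odot> D z (int s - 1)) e = 0"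
proof (rule ccontr)
  assume "(K \<odot> D z (int s - 1)) e \<noteq> 0"
  then obtain d where d: "K d \<noteq> 0" "D z (int s - 1) (e - d) \<noteq> 0" by (elim ser_mult_nonzeroE)
  obtain b where b: "b \<in> bases_at (e - d)" "G (e - d) (act lab (vec b) z (int s - 1)) \<noteq> 0"
    using d(2) unfolding D_def by (elim C_nonzeroE)
  have "d (VarR a) = 0" for a using K d(1) by (auto simp: indep_def)
  then have "bases_at (e - d) = bases_at e" by (intro bases_at_cong) simp
  then have "L (lab z) (int s - 1) (vec b z) = 0" using N b(1) z s by (auto simp: bnd_def)
  then have "G (e - d) (act lab (vec b) z (int s - 1)) = 0"
    unfolding act_def using G_zero[OF vec_ok[OF bases_at_bases[OF b(1)]] z] by simp
  then show False using b(2) by simp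
qed

lemma ser_sum_modes:
  assumes K: "\<And>a s. indep (VarR a) (K s)" and z: "z \<in> Z" and N: "\<And>b. b \<in> bases_at e \<Longrightarrow> bnd N (vec b)"
  shows "ser_sum (\<lambda>s. K s \<odot> D z (int s - 1)) e = (\<Sum>s\<le>N. (K s \<odot> D z (int s - 1)) e)"
  unfolding ser_sum_def by (rule lfsum_le) (rule kernel_vanish[OF K z N])

lemma pfin_modes:
  assumes K: "\<And>a s. indep (VarR a) (K s)" and z: "z \<in> Z"
  shows "pfin (\<lambda>s. K s \<odot> D z (int s - 1))"
  unfolding pfin_def
proof
  fix e
  obtain N where N: "\<And>b. b \<in> bases_at e \<Longrightarrow> bnd N (vec b)" using bnd_bases_at[of e] by blast
  have "{s. (K s \<odot> D z (int s - 1)) e \<noteq> 0} \<subseteq> {..N}"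
    using kernel_vanish[OF K z N] by (auto simp: not_less[symmetric])
  then show "finite {s. (K s \<odot> D z (int s - 1)) e \<noteq> 0}" by (rule finite_subset) simp
qed

lemma indep_pdd_inv_diff:
  assumes "u \<in> V0" "z \<in> V0"
  shows "indep (VarR a) (pdd u k (pdd z s (inv_diff r u z)))"
  using assms by (intro indep_pdd indep_inv_diff) auto

text \<open>At the exponent \<open>-j-1\<close> of \<open>x\<close> only the term with index \<open>j\<close> in the expansions of \<open>1/(x-z)\<close> contributes,
  and the equation is \<open>conf_left\<close>. Other exponents of \<open>x\<close> occur on neither side.\<close>

lemma conf_inv_diff:
  "fst (corr_form S g B b' \<alpha> \<beta> ((VarX, lab0 S, conf S, 2) # ins) (lab0 S # dls)) =
    (\<Sum>z\<in>Z. ser_sum (\<lambda>s. pdd VarX 0 (pdd z s (inv_diff r VarX z)) \<odot> D z (int s - 1)))" (is "?F = ?R")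
proof
  fix e
  obtain N where N: "\<And>b. b \<in> bases_at e \<Longrightarrow> bnd N (vec b)" using bnd_bases_at[of e] by blast
  have XZ: "VarX \<notin> Z" by (auto simp: Z_eq)
  define d where "d z s k = geo z VarX k - sg z (of_nat s) - sg VarX (of_nat 0)" for z and s k :: nat
  have inj: "inj (d z s)" if "z \<in> Z" for z s
    using inj_geo[of VarX z] that XZ by (auto simp: d_def inj_def)
  have K: "pdd VarX 0 (pdd z s (inv_diff r VarX z)) = mser (\<lambda>k. of_nat k gchoose s) (d z s)" if z: "z \<in> Z" for z s
  proof -
    have "r z < r VarX" using order z by (auto simp: expansion_order_def Z_eq)
    moreover have "VarX \<noteq> z" using z XZ by auto
    ultimately show ?thesis unfolding d_def by (simp add: pdd_pdd_inv_diff)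
  qed
  have R: "?R e = (\<Sum>z\<in>Z. \<Sum>s\<le>N. lfsum (\<lambda>k. (of_nat k gchoose s) * D z (int s - 1) (e - d z s k)))"
    unfolding sum_ser_apply
    by (intro sum.cong refl, subst ser_sum_modes[OF indep_pdd_inv_diff _ N])
      (use Z_V0 in \<open>auto simp: VarX_V0 K mser_mult[OF inj]\<close>)
  let ?s = "\<forall>u. u \<notin> Z \<union> {VarX} \<union> VarR ` {1..g} \<longrightarrow> e u = 0"
  have dX: "(e - d z s k) VarX = e VarX + of_nat k + 1" if "z \<in> Z" for z s k
    using that XZ by (auto simp: d_def geo_def sg_def)
  have dother: "(e - d z s k) u = e u" if "u \<notin> Z" "u \<noteq> VarX" "z \<in> Z" for u z s k
    using that by (auto simp: d_def geo_def sg_def)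
  have supd: "sup (e - d z s k) \<longleftrightarrow> ?s \<and> e VarX = - of_nat k - 1" if z: "z \<in> Z" for z s k
  proof
    assume s: "sup (e - d z s k)"
    then have "(e - d z s k) VarX = 0" using XZ by (auto simp: sup_def)
    then have 1: "e VarX = - of_nat k - 1" unfolding dX[OF z] by (simp add: algebra_simps eq_neg_iff_add_eq_0)
    have "e u = 0" if u: "u \<notin> Z \<union> {VarX} \<union> VarR ` {1..g}" for u
    proof -
      have "(e - d z s k) u = 0" using s u by (simp add: sup_def)
      then show ?thesis using dother[of u z s k] u z by simp
    qed
    then show "?s \<and> e VarX = - of_nat k - 1" using 1 by blast
  next
    assume s: "?s \<and> e VarX = - of_nat k - 1"
    show "sup (e - d z s k)"
      unfolding sup_def
    proof (intro allI impI)
      fix u assume u: "u \<notin> Z \<union> VarR ` {1..g}"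
      show "(e - d z s k) u = 0"
      proof (cases "u = VarX")
        case True
        then show ?thesis using s dX[OF z, of s k] by simp
      next
        case False
        then show ?thesis using s u dother[of u z s k] z by simp
      qed
    qed
  qed
  have BBd: "bases_at (e - d z s k) = bases_at e" if "z \<in> Z" for z s k
    by (rule bases_at_cong, rule dother) (use VarR_Z that in auto)
  show "?F e = ?R e"
  proof (cases "?s \<and> (\<exists>j. e VarX = - of_nat j - 1)")
    case True
    then obtain j where j: "e VarX = - of_nat j - 1" by blast
    have lf: "lfsum (\<lambda>k. (of_nat k gchoose s) * D z (int s - 1) (e - d z s k)) =
       (\<Sum>b\<in>bases_at e. (of_nat j gchoose s) * G (e - sg z (of_nat j - of_nat s)) (act lab (vec b) z (int s - 1)))"
      if z: "z \<in> Z" for z s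
    proof -
      have "lfsum (\<lambda>k. (of_nat k gchoose s) * D z (int s - 1) (e - d z s k)) =
         (\<Sum>k\<in>{j}. (of_nat k gchoose s) * D z (int s - 1) (e - d z s k))"
      proof (rule lfsum_eq_sum)
        fix k assume "k \<notin> {j}"
        then have "\<not> sup (e - d z s k)" using supd[OF z] j by auto
        then show "(of_nat k gchoose s) * D z (int s - 1) (e - d z s k) = 0" by (simp add: D_def C_def)
      qed simp
      also have "\<dots> = (of_nat j gchoose s) * (\<Sum>b\<in>bases_at e. G (e - d z s j) (act lab (vec b) z (int s - 1)))"
        using supd[OF z, of s j] True j by (simp add: D_def C_def BBd[OF z])
      also have "\<dots> = (of_nat j gchoose s) * (\<Sum>b\<in>bases_at e. G (e - sg z (of_nat j - of_nat s)) (act lab (vec b) z (int s - 1)))"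
      proof -
        have "G (e - d z s j) U = G (e - sg z (of_nat j - of_nat s)) U" for U
          by (rule G_cong) (use XZ in \<open>auto simp: d_def geo_def sg_def\<close>)
        then show ?thesis by simp
      qed
      finally show ?thesis by (simp add: sum_distrib_left)
    qed
    have "?R e = (\<Sum>z\<in>Z. \<Sum>s\<le>N. \<Sum>b\<in>bases_at e. (of_nat j gchoose s) * G (e - sg z (of_nat j - of_nat s)) (act lab (vec b) z (int s - 1)))"
      unfolding R by (intro sum.cong refl lf)
    also have "\<dots> = (\<Sum>b\<in>bases_at e. \<Sum>z\<in>Z. \<Sum>s\<le>N. (of_nat j gchoose s) * G (e - sg z (of_nat j - of_nat s)) (act lab (vec b) z (int s - 1)))"
      by (simp only: sum.swap[of _ "bases_at e"])
    also have "\<dots> = (\<Sum>b\<in>bases_at e. pv (mode S l0 (conf S) (int j) (op_chain S lab e l0 sk (vec b) (vac S))))"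
      by (intro sum.cong refl conf_left[symmetric] vec_ok[OF bases_at_bases] N)
    also have "\<dots> = ?F e"
    proof -
      have "- e VarX - 1 = of_int (int j)" using j by simp
      then show ?thesis
        unfolding corr_form_conf if_P[OF conjunct1[OF True]] by (simp only: cmodes_of_int)
    qed
    finally show ?thesis by simp
  next
    case False
    have "D z (int s - 1) (e - d z s k) = 0" if "z \<in> Z" for z s k
      using supd[OF that, of s k] False by (auto simp: D_def C_def)
    then have "?R e = 0" unfolding R by simp
    moreover have "?F e = 0"
    proof (cases ?s)
      case True
      have "pv (cmodes (mode S l0) (conf S) (- e VarX - 1) (op_chain S lab e l0 sk (vec b) (vac S))) = 0" if b: "b \<in> bases_at e" for b
      proof (cases "- e VarX - 1 \<in> \<int>")
        case True
        then obtain i where i: "- e VarX - 1 = of_int i" by (elim Ints_cases)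
        have "i < 0"
        proof (rule ccontr)
          assume "\<not> i < 0"
          moreover have "e VarX = - (- e VarX - 1) - 1" by simp
          ultimately have "e VarX = - of_nat (nat i) - 1" unfolding i by simp
          then show False using False \<open>?s\<close> by blast
        qed
        then show ?thesis unfolding i cmodes_of_int
          by (rule conf_left_neg[OF vec_ok[OF bases_at_bases[OF b]]])
      next
        case False
        then show ?thesis by (simp add: cmodes_def pairing_zero_right vac)
      qed
      then show ?thesis unfolding corr_form_conf by simp
    next
      case False
      then show ?thesis unfolding corr_form_conf by (simp only: if_False)
    qed
    ultimately show ?thesis by simp
  qed
qed

end

section \<open>Creation modes in the correlation series\<close>

context correlation
begin

lemma fst_set_split:
  assumes sk: "sk = P @ (p, \<beta>') # R"
  shows "fst ` set P = {z \<in> Z. r p < r z}" "fst ` set R = {z \<in> Z. r z < r p}"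
proof -
  have s: "sorted_wrt (\<lambda>p q. r (fst q) < r (fst p)) (P @ (p, \<beta>') # R)"
    using sorted_sk unfolding sk .
  have Z: "Z = fst ` set P \<union> insert p (fst ` set R)" unfolding Z_def unfolding sk by auto
  have 1: "\<And>z. z \<in> fst ` set P \<Longrightarrow> r p < r z" "\<And>z. z \<in> fst ` set R \<Longrightarrow> r z < r p"
    using s by (auto simp: sorted_wrt_append)
  show "fst ` set P = {z \<in> Z. r p < r z}" "fst ` set R = {z \<in> Z. r z < r p}"
    unfolding Z by (rule set_eqI, use 1 less_asym less_irrefl in blast)+
qed

text \<open>The coefficients of the divided derivatives \<open>\<partial>\<^sub>p\<^sup>k\<partial>\<^sub>z\<^sup>s\<close> of \<open>1/(p-z)\<close>, and below their exponents,
  indexed as in the Jacobi identity: if \<open>z\<close> is larger than \<open>p\<close> then \<open>i\<close> is the exponent of \<open>p\<close> that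
  remains after differentiation.\<close>

definition kernel_coeff :: "var \<Rightarrow> nat \<Rightarrow> var \<Rightarrow> nat \<Rightarrow> nat \<Rightarrow> complex" where
  "kernel_coeff p k z s i = (if r z < r p then ((- of_nat i - 1) gchoose k) * (of_nat i gchoose s)
     else - (of_nat ((k + i) choose k) * ((- of_nat k - 1 - of_nat i) gchoose s)))"

definition kernel_exp :: "var \<Rightarrow> nat \<Rightarrow> var \<Rightarrow> nat \<Rightarrow> nat \<Rightarrow> monom" where
  "kernel_exp p k z s i = (if r z < r p then sg p (- of_nat k - 1 - of_nat i) + sg z (of_nat i - of_nat s)
     else sg p (of_nat i) + sg z (- of_nat k - 1 - of_nat i - of_nat s))"

lemma kernel_eventually:
  assumes p: "p \<in> Z" and z: "z \<in> Z" "z \<noteq> p"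
  obtains M1 where "\<And>M. M \<ge> M1 \<Longrightarrow> (pdd p k (pdd z s (inv_diff r p z)) \<odot> D z (int s - 1)) e =
      (\<Sum>i\<le>M. kernel_coeff p k z s i * D z (int s - 1) (e - kernel_exp p k z s i))"
proof -
  let ?K = "pdd p k (pdd z s (inv_diff r p z))" and ?D = "D z (int s - 1)"
  have V: "p \<in> V0" "z \<in> V0" using p z Z_V0 by auto
  define c where "c j = (if r z < r p then (of_nat j gchoose s) * ((- of_nat j - 1) gchoose k)
      else - (((- of_nat j - 1) gchoose s) * (of_nat j gchoose k)) :: complex)" for j
  define d where "d j = (if r z < r p then geo z p j else geo p z j) - sg z (of_nat s) - sg p (of_nat k)" for j
  have K: "?K = mser c d"
    using z(2) unfolding pdd_pdd_inv_diff[OF z(2)[symmetric]] c_def d_def by simp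
  have inj: "inj d"
    using inj_geo[of p z] inj_geo[of z p] z(2) by (auto simp: d_def inj_def)
  have gK: "good (sc (- 1 - int s - int k)) 0 ?K"
    by (intro good_sc_pdd good_inv_diff V) (use z in auto)
  have "finite {x. ?K x \<noteq> 0 \<and> ?D (e - x) \<noteq> 0}"
    by (rule good_conv_finite[OF gK good_D_mode[OF z(1)]])
  from finite_vimageI[OF this inj] have "finite {j. c j \<noteq> 0 \<and> ?D (e - d j) \<noteq> 0}"
    by (rule rev_finite_subset) (auto simp: K mser_at[OF inj])
  then obtain M1 where M1: "\<And>j. c j \<noteq> 0 \<and> ?D (e - d j) \<noteq> 0 \<Longrightarrow> j \<le> M1"
    using finite_nat_set_iff_bounded_le[of "{j. c j \<noteq> 0 \<and> ?D (e - d j) \<noteq> 0}"] by auto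
  have "(?K \<odot> ?D) e = (\<Sum>i\<le>M. kernel_coeff p k z s i * ?D (e - kernel_exp p k z s i))" if M: "M \<ge> M1" for M
  proof (cases "r z < r p")
    case True
    have "(?K \<odot> ?D) e = (\<Sum>j\<le>M. c j * ?D (e - d j))"
      unfolding K mser_mult[OF inj]
      by (rule lfsum_le) (use M1 M in force)
    also have "\<dots> = (\<Sum>i\<le>M. kernel_coeff p k z s i * ?D (e - kernel_exp p k z s i))"
    proof (rule sum.cong[OF refl])
      fix i
      have "d i = kernel_exp p k z s i"
        using True z by (auto simp: d_def kernel_exp_def geo_def sg_def fun_eq_iff)
      then show "c i * ?D (e - d i) = kernel_coeff p k z s i * ?D (e - kernel_exp p k z s i)"
        using True by (simp add: c_def kernel_coeff_def)
    qed
    finally show ?thesis .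
  next
    case False
    have "(?K \<odot> ?D) e = (\<Sum>j\<le>k + M. c j * ?D (e - d j))"
      unfolding K mser_mult[OF inj]
      by (rule lfsum_le) (use M1 M in force)
    also have "\<dots> = (\<Sum>j\<in>(+) k ` {..M}. c j * ?D (e - d j))"
    proof (rule sum.mono_neutral_right)
      show "\<forall>j\<in>{..k + M} - (+) k ` {..M}. c j * ?D (e - d j) = 0"
      proof
        fix j assume j: "j \<in> {..k + M} - (+) k ` {..M}"
        have "j < k"
        proof (rule ccontr)
          assume "\<not> j < k"
          then have "j = k + (j - k)" "j - k \<le> M" using j by auto
          then show False using j by blast
        qed
        then have "(of_nat j gchoose k :: complex) = 0"
          by (simp add: binomial_gbinomial[symmetric] binomial_eq_0)
        then show "c j * ?D (e - d j) = 0" using False by (simp add: c_def)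
      qed
    qed auto
    also have "\<dots> = (\<Sum>i\<le>M. c (k + i) * ?D (e - d (k + i)))"
      by (subst sum.reindex) auto
    also have "\<dots> = (\<Sum>i\<le>M. kernel_coeff p k z s i * ?D (e - kernel_exp p k z s i))"
    proof (rule sum.cong[OF refl])
      fix i
      have "d (k + i) = kernel_exp p k z s i"
        using False z by (auto simp: d_def kernel_exp_def geo_def sg_def fun_eq_iff)
      moreover have "c (k + i) = kernel_coeff p k z s i"
      proof -
        have "(- of_nat (k + i) - 1 :: complex) = - of_nat k - 1 - of_nat i" by simp
        moreover have "(of_nat (k + i) gchoose k :: complex) = of_nat ((k + i) choose k)"
          by (simp only: binomial_gbinomial)
        ultimately show ?thesis using False by (simp only: c_def kernel_coeff_def if_False mult.commute)
      qed
      ultimately show "c (k + i) * ?D (e - d (k + i)) = kernel_coeff p k z s i * ?D (e - kernel_exp p k z s i)"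
        by (simp only:)
    qed
    finally show ?thesis .
  qed
  then show ?thesis using that by blast
qed

text \<open>At a given monomial both sides are limits of partial sums that are constant from some index on. The
  bound \<open>M\<close> exceeds the finitely many indices concerned, and for it the equation is \<open>creation_mode\<close>.\<close>

lemma D_creation_inv_diff:
  assumes p: "p \<in> Z"
  shows "D p (- int k - 2) =
    (\<Sum>z\<in>Z - {p}. ser_sum (\<lambda>s. pdd p k (pdd z s (inv_diff r p z)) \<odot> D z (int s - 1)))"
proof
  fix e
  obtain N where N: "\<And>b. b \<in> bases_at e \<Longrightarrow> bnd N (vec b)" using bnd_bases_at[of e] by blast
  obtain P \<beta>' R where sk: "sk = P @ (p, \<beta>') # R" using split_at[OF p] .
  note PR = fst_set_split[OF sk]
  have pV: "p \<in> V0" using p Z_V0 by auto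
  let ?K = "\<lambda>z s. pdd p k (pdd z s (inv_diff r p z)) \<odot> D z (int s - 1)"
  have "\<exists>M1. \<forall>M\<ge>M1. ?K z s e = (\<Sum>i\<le>M. kernel_coeff p k z s i * D z (int s - 1) (e - kernel_exp p k z s i))"
    if "z \<in> Z - {p}" for z s
    using kernel_eventually[OF p, of z k s e] that by blast
  then obtain M1 where M1: "\<And>z s M. z \<in> Z - {p} \<Longrightarrow> M \<ge> M1 z s \<Longrightarrow>
      ?K z s e = (\<Sum>i\<le>M. kernel_coeff p k z s i * D z (int s - 1) (e - kernel_exp p k z s i))"
  proof -
    assume H: "\<And>z s. z \<in> Z - {p} \<Longrightarrow> \<exists>M1. \<forall>M\<ge>M1. ?K z s e = (\<Sum>i\<le>M. kernel_coeff p k z s i * D z (int s - 1) (e - kernel_exp p k z s i))"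
      and T: "\<And>M1. (\<And>z s M. z \<in> Z - {p} \<Longrightarrow> M \<ge> M1 z s \<Longrightarrow>
      ?K z s e = (\<Sum>i\<le>M. kernel_coeff p k z s i * D z (int s - 1) (e - kernel_exp p k z s i))) \<Longrightarrow> thesis"
    show thesis
      by (rule T[of "\<lambda>z s. SOME M1. \<forall>M\<ge>M1. ?K z s e = (\<Sum>i\<le>M. kernel_coeff p k z s i * D z (int s - 1) (e - kernel_exp p k z s i))"])
        (use someI_ex[OF H] in blast)
  qed
  let ?T = "\<lambda>b z s i. kernel_coeff p k z s i * G (e - kernel_exp p k z s i) (act lab (vec b) z (int s - 1))"
  have "\<exists>M2. \<forall>M\<ge>M2. G e (act lab (vec b) p (- int k - 2)) = (\<Sum>i\<le>M. \<Sum>z\<in>Z - {p}. \<Sum>s\<le>N. ?T b z s i)"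
    if b: "b \<in> bases_at e" for b
  proof -
    obtain M2 where M2: "\<And>M. M \<ge> M2 \<Longrightarrow> G e (act lab (vec b) p (- int k - 2)) =
    (\<Sum>i\<le>M. ((- 1) ^ i * ((- of_nat k - 1) gchoose i)) *
      (- (\<Sum>z\<in>fst ` set P. \<Sum>s\<le>N. ((- of_nat k - 1 - of_nat i) gchoose s) *
            G (e - sg p (of_nat i) - sg z (- of_nat k - 1 - of_nat i - of_nat s)) (act lab (vec b) z (int s - 1)))
       - (- 1) powi (- int k - 1) * (\<Sum>z\<in>fst ` set R. \<Sum>s\<le>N. (of_nat i gchoose s) *
            G (e - sg p (- of_nat k - 1 - of_nat i) - sg z (of_nat i - of_nat s)) (act lab (vec b) z (int s - 1)))))"
      using creation_mode[OF vec_ok[OF bases_at_bases[OF b]] N[OF b] sk, of e k] by blast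
    have ZPR: "Z - {p} = fst ` set P \<union> fst ` set R"
    proof -
      have "r z < r p \<or> r p < r z" if "z \<in> Z" "z \<noteq> p" for z
        using r_inj[of z p] that p Z_V0 by (meson linorder_neqE_nat subsetD)
      then show ?thesis unfolding PR by auto
    qed
    have disj: "fst ` set P \<inter> fst ` set R = {}" unfolding PR by auto
    have sgn: "(- 1 :: complex) powi (- int k - 1) = - ((- 1) ^ k)"
    proof -
      have "- int k - 1 = - int (Suc k)" by simp
      then have "(- 1 :: complex) powi (- int k - 1) = inverse ((- 1) ^ Suc k)"
        by (simp only: power_int_minus power_int_of_nat)
      also have "\<dots> = - ((- 1) ^ k)" by (simp add: power_inverse[symmetric])
      finally show ?thesis .
    qed
    have "((- 1) ^ i * ((- of_nat k - 1) gchoose i)) *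
      (- (\<Sum>z\<in>fst ` set P. \<Sum>s\<le>N. ((- of_nat k - 1 - of_nat i) gchoose s) *
            G (e - sg p (of_nat i) - sg z (- of_nat k - 1 - of_nat i - of_nat s)) (act lab (vec b) z (int s - 1)))
       - (- 1) powi (- int k - 1) * (\<Sum>z\<in>fst ` set R. \<Sum>s\<le>N. (of_nat i gchoose s) *
            G (e - sg p (- of_nat k - 1 - of_nat i) - sg z (of_nat i - of_nat s)) (act lab (vec b) z (int s - 1)))) =
      (\<Sum>z\<in>Z - {p}. \<Sum>s\<le>N. ?T b z s i)" (is "?B * (- ?X - ?sn * ?Y) = _") for i
    proof -
      have 1: "(\<Sum>z\<in>fst ` set P. \<Sum>s\<le>N. ?T b z s i) = - (?B * ?X)"
        unfolding sum_distrib_left sum_negf[symmetric]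
      proof (intro sum.cong refl)
        fix z s assume "z \<in> fst ` set P"
        then have nr: "\<not> r z < r p" unfolding PR by auto
        have eq: "e - kernel_exp p k z s i = e - sg p (of_nat i) - sg z (- of_nat k - 1 - of_nat i - of_nat s)"
          using nr by (simp add: kernel_exp_def diff_diff_eq)
        then show "?T b z s i = - (?B * ((- of_nat k - 1 - of_nat i gchoose s) *
            G (e - sg p (of_nat i) - sg z (- of_nat k - 1 - of_nat i - of_nat s)) (act lab (vec b) z (int s - 1))))"
          by (simp only: eq kernel_coeff_def nr if_False creation_coeff) simp
      qed
      have 2: "(\<Sum>z\<in>fst ` set R. \<Sum>s\<le>N. ?T b z s i) = - (?B * (?sn * ?Y))"
        unfolding sum_distrib_left sum_negf[symmetric]
      proof (intro sum.cong refl)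
        fix z s assume "z \<in> fst ` set R"
        then have nr: "r z < r p" unfolding PR by auto
        have eq: "e - kernel_exp p k z s i = e - sg p (- of_nat k - 1 - of_nat i) - sg z (of_nat i - of_nat s)"
          using nr by (simp add: kernel_exp_def diff_diff_eq)
        then show "?T b z s i = - (?B * (?sn * ((of_nat i gchoose s) *
            G (e - sg p (- of_nat k - 1 - of_nat i) - sg z (of_nat i - of_nat s)) (act lab (vec b) z (int s - 1)))))"
          by (simp only: eq kernel_coeff_def nr if_True creation_coeff sgn) (simp add: gchoose_minus_Suc add.commute[of k i])
      qed
      have "(\<Sum>z\<in>Z - {p}. \<Sum>s\<le>N. ?T b z s i) = (\<Sum>z\<in>fst ` set P. \<Sum>s\<le>N. ?T b z s i) + (\<Sum>z\<in>fst ` set R. \<Sum>s\<le>N. ?T b z s i)"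
        unfolding ZPR by (rule sum.union_disjoint) (use disj in auto)
      then show ?thesis unfolding 1 2 by (simp only: right_diff_distrib) simp
    qed
    then show ?thesis using M2 by (intro exI[of _ M2]) simp
  qed
  then obtain M2 where M2: "\<And>b M. b \<in> bases_at e \<Longrightarrow> M \<ge> M2 b \<Longrightarrow>
      G e (act lab (vec b) p (- int k - 2)) = (\<Sum>i\<le>M. \<Sum>z\<in>Z - {p}. \<Sum>s\<le>N. ?T b z s i)"
    using bchoice[of "bases_at e" "\<lambda>b M2. \<forall>M\<ge>M2. G e (act lab (vec b) p (- int k - 2)) = (\<Sum>i\<le>M. \<Sum>z\<in>Z - {p}. \<Sum>s\<le>N. ?T b z s i)"]
    by blast
  define M where "M = Max (insert 0 ((\<lambda>(z, s). M1 z s) ` ((Z - {p}) \<times> {..N}) \<union> M2 ` bases_at e))"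
  have fin: "finite (insert 0 ((\<lambda>(z, s). M1 z s) ` ((Z - {p}) \<times> {..N}) \<union> M2 ` bases_at e))"
    using finite_Z finite_bases_at by auto
  have MM1: "M1 z s \<le> M" if "z \<in> Z - {p}" "s \<le> N" for z s
    unfolding M_def by (rule Max_ge[OF fin]) (use that in force)
  have MM2: "M2 b \<le> M" if "b \<in> bases_at e" for b
    unfolding M_def by (rule Max_ge[OF fin]) (use that in auto)
  have shift: "D z j (e - kernel_exp p k z s i) = (if sup e then \<Sum>b\<in>bases_at e. G (e - kernel_exp p k z s i) (act lab (vec b) z j) else 0)"
    if z: "z \<in> Z" for z j s i
  proof -
    have "sup (e - (sg p x + sg z y)) \<longleftrightarrow> sup e" for x y
      using p z by (simp add: diff_diff_eq[symmetric] sup_shift_minus)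
    moreover have "bases_at (e - (sg p x + sg z y)) = bases_at e" for x y
      using p z by (simp add: diff_diff_eq[symmetric] bases_at_shift_minus)
    ultimately show ?thesis by (simp add: D_def C_def kernel_exp_def)
  qed
  have "(\<Sum>z\<in>Z - {p}. ser_sum (\<lambda>s. ?K z s)) e = (\<Sum>z\<in>Z - {p}. \<Sum>s\<le>N. ?K z s e)"
    unfolding sum_ser_apply
    by (intro sum.cong refl ser_sum_modes N indep_pdd_inv_diff pV) (use Z_V0 in auto)
  also have "\<dots> = (\<Sum>z\<in>Z - {p}. \<Sum>s\<le>N. \<Sum>i\<le>M. kernel_coeff p k z s i * D z (int s - 1) (e - kernel_exp p k z s i))"
    by (intro sum.cong refl M1 MM1) auto
  also have "\<dots> = (if sup e then \<Sum>z\<in>Z - {p}. \<Sum>s\<le>N. \<Sum>i\<le>M. \<Sum>b\<in>bases_at e. ?T b z s i else 0)"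
    by (simp add: shift sum_distrib_left)
  also have "(\<Sum>z\<in>Z - {p}. \<Sum>s\<le>N. \<Sum>i\<le>M. \<Sum>b\<in>bases_at e. ?T b z s i) = (\<Sum>b\<in>bases_at e. \<Sum>z\<in>Z - {p}. \<Sum>s\<le>N. \<Sum>i\<le>M. ?T b z s i)"
    by (simp only: sum.swap[of _ "bases_at e"])
  also have "\<dots> = (\<Sum>b\<in>bases_at e. \<Sum>i\<le>M. \<Sum>z\<in>Z - {p}. \<Sum>s\<le>N. ?T b z s i)"
  proof (rule sum.cong[OF refl])
    fix b
    have "(\<Sum>z\<in>Z - {p}. \<Sum>s\<le>N. \<Sum>i\<le>M. ?T b z s i) = (\<Sum>z\<in>Z - {p}. \<Sum>i\<le>M. \<Sum>s\<le>N. ?T b z s i)"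
      by (rule sum.cong[OF refl], rule sum.swap)
    also have "\<dots> = (\<Sum>i\<le>M. \<Sum>z\<in>Z - {p}. \<Sum>s\<le>N. ?T b z s i)" by (rule sum.swap)
    finally show "(\<Sum>z\<in>Z - {p}. \<Sum>s\<le>N. \<Sum>i\<le>M. ?T b z s i) = (\<Sum>i\<le>M. \<Sum>z\<in>Z - {p}. \<Sum>s\<le>N. ?T b z s i)" .
  qed
  also have "\<dots> = (\<Sum>b\<in>bases_at e. G e (act lab (vec b) p (- int k - 2)))"
    by (intro sum.cong refl M2[symmetric] MM2)
  finally show "D p (- int k - 2) e = (\<Sum>z\<in>Z - {p}. ser_sum (\<lambda>s. ?K z s)) e"
    by (simp add: D_def C_def)
qed

text \<open>Adding the terms that vanish by the Ward identities turns \<open>1/(u-z)\<close> into \<open>\<pi>\<^sub>2(u,z)\<close>.\<close>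

lemma complete_to_pi2:
  assumes u: "u \<in> V0" and uA: "\<And>l. u \<noteq> VarA l" and A: "A \<subseteq> Z" "u \<notin> A"
  shows "(\<Sum>z\<in>A. ser_sum (\<lambda>s. pdd u k (pdd z s (pi2 r u z)) \<odot> D z (int s - 1))) =
    (\<Sum>z\<in>A. ser_sum (\<lambda>s. pdd u k (pdd z s (inv_diff r u z)) \<odot> D z (int s - 1))) +
    (\<Sum>z\<in>A. \<Sum>s\<le>2. fpart r u k z s \<odot> D z (int s - 1))"
  unfolding sum.distrib[symmetric]
proof (rule sum.cong[OF refl])
  fix z assume zA: "z \<in> A"
  then have z: "z \<in> Z" "z \<in> V0" "u \<noteq> z" using A Z_V0 by auto
  have zA': "z \<noteq> VarA l" for l using z(1) by (auto simp: Z_eq)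
  have ind: "indep (VarR a) (fpart r u k z s)" for a s
    unfolding fpart_def
    by (intro indep_sum indep_smult indep_mult indep_pdd indep_f2 indep_pw) (use u z in auto)
  have "ser_sum (\<lambda>s. pdd u k (pdd z s (pi2 r u z)) \<odot> D z (int s - 1)) =
      ser_sum (\<lambda>s. pdd u k (pdd z s (inv_diff r u z)) \<odot> D z (int s - 1) + fpart r u k z s \<odot> D z (int s - 1))"
  proof (rule arg_cong[where f = ser_sum], rule ext)
    fix s
    show "pdd u k (pdd z s (pi2 r u z)) \<odot> D z (int s - 1) =
      pdd u k (pdd z s (inv_diff r u z)) \<odot> D z (int s - 1) + fpart r u k z s \<odot> D z (int s - 1)"
      unfolding pdd_pdd_pi2[OF u z(2,3) uA zA']
      by (rule distrib_right[OF good_sc_pdd[OF good_sc_pdd[OF good_inv_diff[OF u z(2,3)] z(2)] u]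
            good_fpart[OF u z(2) uA] good_D_mode[OF z(1)]])
  qed
  also have "\<dots> = ser_sum (\<lambda>s. pdd u k (pdd z s (inv_diff r u z)) \<odot> D z (int s - 1)) +
      ser_sum (\<lambda>s. fpart r u k z s \<odot> D z (int s - 1))"
    by (rule ser_sum_add; rule pfin_modes[OF _ z(1)]) (use ind indep_pdd_inv_diff u z in auto)
  also have "ser_sum (\<lambda>s. fpart r u k z s \<odot> D z (int s - 1)) = (\<Sum>s\<le>2. fpart r u k z s \<odot> D z (int s - 1))"
  proof
    fix e
    show "ser_sum (\<lambda>s. fpart r u k z s \<odot> D z (int s - 1)) e = (\<Sum>s\<le>2. fpart r u k z s \<odot> D z (int s - 1)) e"
      unfolding ser_sum_def sum_ser_apply
      by (rule lfsum_le) (simp only: fpart_gt ser_mult_zero zero_fun_apply)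
  qed
  finally show "ser_sum (\<lambda>s. pdd u k (pdd z s (pi2 r u z)) \<odot> D z (int s - 1)) =
      ser_sum (\<lambda>s. pdd u k (pdd z s (inv_diff r u z)) \<odot> D z (int s - 1)) +
      (\<Sum>s\<le>2. fpart r u k z s \<odot> D z (int s - 1))" .
qed

lemma conf_pi2:
  "fst (corr_form S g B b' \<alpha> \<beta> ((VarX, lab0 S, conf S, 2) # ins) (lab0 S # dls)) =
    (\<Sum>z\<in>Z. ser_sum (\<lambda>s. pdd z s (pi2 r VarX z) \<odot> D z (int s - 1)))"
proof -
  have X: "VarX \<noteq> VarA l" for l by simp
  have XZ: "VarX \<notin> Z" by (auto simp: Z_eq)
  show ?thesis
    using complete_to_pi2[OF VarX_V0 X order_refl XZ, of 0]
    unfolding fpart_sum[OF VarX_V0 X] add_0_right conf_inv_diff pdd_0 by (rule sym)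
qed

text \<open>The Ward identity involves all points of the chain, the kernel only those other than \<open>p\<close>. The
  remaining term, at \<open>p\<close> itself, becomes the diagonal part \<open>A\<^bsub>a,-a\<^esub>\<close> of the matrix \<open>A\<close>.\<close>

lemma D_creation:
  assumes p: "p \<in> Z"
  shows "D p (- int k - 2) =
    (\<Sum>z\<in>Z - {p}. ser_sum (\<lambda>s. pdd p k (pdd z s (pi2 r p z)) \<odot> D z (int s - 1))) +
    (\<Sum>s\<le>2. fpart r p k p s \<odot> D p (int s - 1))"
proof -
  have pV: "p \<in> V0" and pA: "p \<noteq> VarA l" for l using p Z_V0 by (auto simp: Z_eq)
  have "0 = (\<Sum>s\<le>2. fpart r p k p s \<odot> D p (int s - 1)) + (\<Sum>z\<in>Z - {p}. \<Sum>s\<le>2. fpart r p k z s \<odot> D z (int s - 1))"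
    unfolding fpart_sum[OF pV pA, symmetric, of k] by (rule sum.remove[OF finite_Z p])
  note w = minus_unique[OF this[symmetric], symmetric]
  have "(\<Sum>z\<in>Z - {p}. ser_sum (\<lambda>s. pdd p k (pdd z s (pi2 r p z)) \<odot> D z (int s - 1))) =
    D p (- int k - 2) + - (\<Sum>s\<le>2. fpart r p k p s \<odot> D p (int s - 1))"
    unfolding D_creation_inv_diff[OF p] unfolding w[symmetric]
    by (rule complete_to_pi2[OF pV pA]) auto
  then show ?thesis by (simp only: add.assoc add.left_inverse add_0_right)
qed

end

section \<open>The modes at the handles\<close>

context expansion
begin

lemma dot_rows:
  assumes p: "\<And>i. i \<in> J \<Longrightarrow> good c (w i) (p i \<odot> q i)" and w: "\<And>i. i \<in> J \<Longrightarrow> snd i \<le> w i + K"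
  shows "dot g p q = (\<Sum>a\<in>idx g. ser_sum (\<lambda>s. p (a, s) \<odot> q (a, s)))"
proof
  fix e
  define f where "f a s = (if a \<in> idx g then (p (a, s) \<odot> q (a, s)) e else 0)" for a s
  have "finite {i. (if fst i \<in> idx g then p i \<odot> q i else 0) e \<noteq> 0}"
    using pfin_dot[OF p w] by (simp add: pfin_def)
  then have fin: "finite {(a, s). f a s \<noteq> 0}"
    by (rule rev_finite_subset) (auto simp: f_def split: if_splits)
  have "dot g p q e = lfsum (\<lambda>(a, s). f a s)"
    unfolding dot_def ser_sum_def by (rule lfsum_cong) (auto simp: f_def)
  also have "\<dots> = lfsum (\<lambda>a. lfsum (f a))" by (rule lfsum_pair[OF fin, symmetric])
  also have "\<dots> = (\<Sum>a\<in>idx g. lfsum (f a))"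
  proof (rule lfsum_eq_sum[OF finite_idx])
    fix a assume "a \<notin> idx g"
    then have "f a = (\<lambda>s. 0)" by (simp add: f_def fun_eq_iff)
    then show "lfsum (f a) = 0" by simp
  qed
  also have "\<dots> = (\<Sum>a\<in>idx g. ser_sum (\<lambda>s. p (a, s) \<odot> q (a, s))) e"
    unfolding sum_ser_apply ser_sum_def
    by (rule sum.cong[OF refl], rule lfsum_cong) (simp add: f_def)
  finally show "dot g p q e = (\<Sum>a\<in>idx g. ser_sum (\<lambda>s. p (a, s) \<odot> q (a, s))) e" .
qed

lemma indep_dot: "(\<And>i. indep u (p i)) \<Longrightarrow> (\<And>i. indep u (q i)) \<Longrightarrow> indep u (dot g p q)"
  unfolding dot_def by (rule indep_ser_sum) (auto intro: indep_mult indep_zero)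

lemma indep_Linv: "indep (VarY k) (Linv g r i)"
proof -
  have rho: "VarY k \<noteq> rho b" for b by (simp add: rho_def)
  have L: "indep (VarY k) (Lrow r j)" for j
    unfolding Lrow_def by (cases j) (auto intro!: indep_mult indep_pw indep_pdd indep_pi2 rho)
  have A: "indep (VarY k) (Amat r i j)" for i j
    unfolding Amat_def by (cases i, cases j)
      (auto intro!: indep_mult indep_pw indep_pdd indep_pi2 indep_sum indep_smult indep_f2 rho)
  have Dl: "indep (VarY k) (Delta i j)" for i j
    unfolding Delta_def by (cases i, cases j) (auto intro!: indep_mon indep_zero)
  have I: "indep (VarY k) (mat_id i j)" for i j
    unfolding mat_id_def by (auto intro!: indep_mon indep_zero)
  have AD: "indep (VarY k) (mat_mult g (Amat r) Delta i j)" for i j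
    unfolding mat_mult_def row_mult_def by (rule indep_dot[OF A Dl])
  have P: "indep (VarY k) ((mat_mult g (mat_mult g (Amat r) Delta) ^^ l) mat_id i j)" for l i j
  proof (induction l arbitrary: i j)
    case 0
    then show ?case by (simp add: I)
  next
    case (Suc l)
    have e: "mat_mult g A C i j = dot g (A i) (\<lambda>i. C i j)" for A C
      by (simp add: mat_mult_def row_mult_def)
    show ?case unfolding funpow.simps comp_def e by (rule indep_dot[OF AD Suc])
  qed
  show ?thesis
    unfolding Linv_def row_mult_def mat_geometric_def
    by (intro indep_dot indep_ser_sum L Dl P)
qed

lemma good_pw_mult:
  assumes "good c k f" "a \<in> idx g"
  shows "\<exists>c'. good c' 0 (pw (rho a) x \<odot> f)"
proof -
  let ?c = "\<lambda>i. deg i (sg (rho a) x)"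
  have "rho a \<in> vars" using rho_index[OF assms(2)] by (simp add: rho_def vars_def)
  then have "cone ?c 0 (sg (rho a) x)" by (auto simp: cone_def sg_def)
  then have "good ?c 0 (pw (rho a) x)" unfolding pw_eq_mon by (rule good_mon)
  from good_mult[OF this good_mono[OF assms(1), of 0]] show ?thesis by auto
qed

end

context correlation
begin

text \<open>With these powers of \<open>\<rho>\<^sub>a\<close> the coefficients of the modes are the entries of \<open>L\<close> and \<open>A\<close>.\<close>

definition X :: "mindex \<Rightarrow> ser" where
  "X = (\<lambda>(a, s). pw (rho a) (- (of_nat s / 2)) \<odot> D (VarW a) (int s - 1))"

lemma X_dual:
  assumes "a \<in> idx g"
  shows "X (a, s) = pw (rho a) (of_nat s / 2 - 1) \<odot> D (VarW (- a)) (1 - int s)"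
proof -
  have e: "- (of_nat s / 2) + of_int (int s - 1) = (of_nat s / 2 - 1 :: complex)"
    by (simp add: field_simps)
  have "X (a, s) = pw (rho a) (- (of_nat s / 2)) \<odot> (pw (rho a) (of_int (int s - 1)) \<odot> D (VarW (- a)) (1 - int s))"
    using D_dual[OF assms, of "int s - 1"] by (simp add: X_def)
  then show ?thesis unfolding pw_pw_mult e .
qed

text \<open>The \<open>10\<close> leaves room for the power \<open>\<rho>\<^sub>a\<^bsup>-1\<^esup>\<close> in \<open>X_dual\<close> and for derivatives of \<open>F\<close>.\<close>

definition cX :: "var option \<Rightarrow> complex" where "cX i = cF i - 10"

lemma numeral_Nats: "x = of_nat k \<Longrightarrow> x \<in> (\<nat> :: complex set)"
  by simp

lemma good_cX: "good (cF + sc (- 1)) 0 f \<Longrightarrow> good cX 0 f"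
proof (erule good_weaken)
  show "(cF + sc (- 1)) (Some u) - cX (Some u) \<in> \<nat>" for u
    by (rule numeral_Nats[of _ "if u \<in> V0 then 9 else 10"]) (simp add: cX_def sc_def)
  show "(cF + sc (- 1)) None + of_nat 0 - cX None - of_nat 0 \<in> \<nat>"
    by (rule numeral_Nats[of _ 10]) (simp add: cX_def sc_def)
qed

lemma W_Z: "a \<in> idx g \<Longrightarrow> VarW a \<in> Z"
  by (auto simp: Z_eq)

lemma Y_Z: "k \<in> {1..n} \<Longrightarrow> VarY k \<in> Z"
  by (auto simp: Z_eq)

lemma good_X:
  assumes a: "a \<in> idx g"
  shows "good cX s (X (a, s))"
proof -
  let ?x = "of_nat s / 2 - 1 :: complex"
  let ?c = "\<lambda>i. deg i (sg (rho a) ?x)"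
  have rho: "nat \<bar>a\<bar> \<in> {1..g}" by (rule rho_index[OF a])
  then have "rho a \<in> vars" by (simp add: rho_def vars_def)
  then have "cone ?c 0 (sg (rho a) ?x)" by (auto simp: cone_def sg_def)
  then have "good ?c 0 (pw (rho a) ?x)" unfolding pw_eq_mon by (rule good_mon)
  from good_mult[OF this good_D[OF W_Z[OF idx_uminus[OF a]], of "1 - int s"]]
  have "good (?c + (cF + sc (min (1 - int s) 0))) (0 + 0) (X (a, s))"
    unfolding X_dual[OF a] .
  then show ?thesis
  proof (rule good_weaken)
    fix u assume "u \<in> vars"
    then show "(?c + (cF + sc (min (1 - int s) 0))) (Some u) - cX (Some u) \<in> \<nat>"
    proof (rule vars_cases)
      assume u: "u \<in> V0"
      show ?thesis
        by (rule numeral_Nats[of _ "nat (5 * int s + min (1 - int s) 0)"])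
          (use u rho in \<open>simp add: cX_def sc_def rho_def deg_sg_R_V0 min_def\<close>)
    next
      fix c assume u: "u = VarR c"
      show ?thesis
        by (rule numeral_Nats[of _ "if nat \<bar>a\<bar> = c then s + 8 else 10"])
          (simp add: u cX_def sc_def rho_def deg_sg_R_R)
    qed
  next
    show "(?c + (cF + sc (min (1 - int s) 0))) None + of_nat (0 + 0) - cX None - of_nat s \<in> \<nat>"
      by (rule numeral_Nats[of _ 8]) (use rho in \<open>simp add: cX_def sc_def rho_def deg_sg_R_None\<close>)
  qed
qed

lemma good_F0: "good cX 0 F"
proof (rule good_cX)
  have "good (cF + sc 0) 0 F" using good_F by (simp add: sc_0)
  then show "good (cF + sc (- 1)) 0 F" by (rule good_sc_mono) auto
qed

lemma good_pd_F: "u \<in> V0 \<Longrightarrow> good cX 0 (pd u F)"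
  by (rule good_cX, rule good_pd[OF good_F])

subsection \<open>The recursion for the modes\<close>

lemma Y_modes:
  assumes k: "k \<in> {1..n}"
  shows "ser_sum (\<lambda>s. K s \<odot> D (VarY k) (int s - 1)) = K 0 \<odot> pd (VarY k) F + K 1 \<odot> ser_smult (m k) F"
proof
  fix e
  have "lfsum (\<lambda>s. (K s \<odot> D (VarY k) (int s - 1)) e) = (\<Sum>s\<in>{0,1}. (K s \<odot> D (VarY k) (int s - 1)) e)"
  proof (rule lfsum_eq_sum)
    fix s :: nat assume "s \<notin> {0, 1}"
    then have "D (VarY k) (int s - 1) = 0" by (intro D_primary[OF k]) auto
    then show "(K s \<odot> D (VarY k) (int s - 1)) e = 0" by (simp only: ser_mult_zero zero_fun_apply)
  qed simp
  also have "\<dots> = (K 0 \<odot> D (VarY k) (- 1)) e + (K 1 \<odot> D (VarY k) 0) e" by simp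
  finally show "ser_sum (\<lambda>s. K s \<odot> D (VarY k) (int s - 1)) e = (K 0 \<odot> pd (VarY k) F + K 1 \<odot> ser_smult (m k) F) e"
    unfolding D_deriv[OF Y_Z[OF k]] D_weight_Y[OF k] plus_fun_apply by (simp only: ser_sum_def)
qed

lemma sum_Z: "(\<Sum>z\<in>Z. h z) = (\<Sum>k=1..n. h (VarY k)) + (\<Sum>a\<in>idx g. h (VarW a))"
  for h :: "var \<Rightarrow> 'z::comm_monoid_add"
proof -
  have "(\<Sum>z\<in>Z. h z) = (\<Sum>z\<in>VarY ` {1..n}. h z) + (\<Sum>z\<in>VarW ` idx g. h z)"
    unfolding Z_eq by (rule sum.union_disjoint) (auto simp: finite_idx)
  also have "(\<Sum>z\<in>VarY ` {1..n}. h z) = (\<Sum>k=1..n. h (VarY k))"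
    by (subst sum.reindex) (auto simp: inj_on_def)
  also have "(\<Sum>z\<in>VarW ` idx g. h z) = (\<Sum>a\<in>idx g. h (VarW a))"
    by (subst sum.reindex) (auto simp: inj_on_def)
  finally show ?thesis .
qed

lemma Lrow_X: "Lrow r (b, s) \<odot> X (b, s) = pdd (VarW b) s (pi2 r VarX (VarW b)) \<odot> D (VarW b) (int s - 1)"
  unfolding Lrow_def X_def prod.case by (rule pw_pair_cancel)

lemma good_Lrow_X: "i \<in> J \<Longrightarrow> good (sc (- 4) + cX) (snd i) (Lrow r i \<odot> X i)"
proof -
  assume i: "i \<in> J"
  then have "good (sc (4 * int (snd i) - 4)) (snd i) (Lrow r i)" using good_Lrow[of "fst i" "snd i"] by simp
  then have "good (sc (- 4)) 0 (Lrow r i)" by (rule good_sc_mono0) auto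
  from good_mult[OF this good_X[of "fst i" "snd i"]] show ?thesis using i by simp
qed

lemma conf_modes:
  "fst (corr_form S g B b' \<alpha> \<beta> ((VarX, lab0 S, conf S, 2) # ins) (lab0 S # dls)) =
    (\<Sum>k=1..n. pi2 r VarX (VarY k) \<odot> pd (VarY k) F + pd (VarY k) (pi2 r VarX (VarY k)) \<odot> ser_smult (m k) F) +
    dot g (Lrow r) X"
proof -
  have "dot g (Lrow r) X = (\<Sum>a\<in>idx g. ser_sum (\<lambda>s. Lrow r (a, s) \<odot> X (a, s)))"
    by (rule dot_rows[where w = snd and K = 0, OF good_Lrow_X]) auto
  then show ?thesis
    unfolding conf_pi2 sum_Z Lrow_X
    by (simp only: Y_modes pdd_0 pdd_1 cong: sum.cong)
qed

lemma good_Amat_X: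
  assumes "i \<in> J" "j \<in> J"
  shows "good cX (snd i + snd j) (Amat r i j \<odot> X j)"
proof -
  have "good 0 (snd i + snd j + 1) (Amat r i j)"
    using good_Amat[of "fst i" "fst j" "snd i" "snd j"] assms by simp
  from good_mult[OF this good_X[of "fst j" "snd j"]]
  have "good (0 + cX) (snd i + snd j + 1 + snd j) (Amat r i j \<odot> X j)" using assms by simp
  then have "good cX (snd i + snd j + 1 + snd j) (Amat r i j \<odot> X j)" by simp
  then show ?thesis by (rule good_mono) simp
qed

text \<open>By \<open>X_dual\<close> the left-hand side is a power of \<open>\<rho>\<^sub>a\<close> times the creation mode \<open>L(-j-2)\<close> at \<open>w\<^bsub>-a\<^esub>\<close>, to which
  \<open>D_creation\<close> applies. The primary vectors contribute the column \<open>R\<close>, the handles the row of \<open>A\<close>.\<close>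

lemma X_recursion:
  assumes a: "a \<in> idx g"
  shows "X (a, j + 3) =
    (\<Sum>k=1..n. Rcol r (VarY k) (a, j) \<odot> pd (VarY k) F + pd (VarY k) (Rcol r (VarY k) (a, j)) \<odot> ser_smult (m k) F) +
    dot g (Amat r (a, j)) X"
proof -
  let ?p = "VarW (- a)" and ?w = "pw (rho a) (of_nat (j + 1) / 2)"
  have a': "- a \<in> idx g" by (rule idx_uminus[OF a])
  have p: "?p \<in> Z" by (rule W_Z[OF a'])
  define H where "H z = ser_sum (\<lambda>s. pdd ?p j (pdd z s (pi2 r ?p z)) \<odot> D z (int s - 1))" for z
  define f where "f = (\<Sum>s\<le>2. fpart r ?p j ?p s \<odot> D ?p (int s - 1))"
  have e: "of_nat (j + 3) / 2 - 1 = (of_nat (j + 1) / 2 :: complex)" by (simp add: field_simps)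
  have "X (a, j + 3) = ?w \<odot> D ?p (- int j - 2)"
  proof -
    have i: "1 - int (j + 3) = - int j - 2" by simp
    show ?thesis unfolding X_dual[OF a] e i ..
  qed
  also have "D ?p (- int j - 2) = (\<Sum>z\<in>Z - {?p}. H z) + f"
    unfolding H_def f_def by (rule D_creation[OF p])
  also have "(\<Sum>z\<in>Z - {?p}. H z) = (\<Sum>z\<in>Z. if z = ?p then 0 else H z)"
    by (rule sum.mono_neutral_cong_left) (auto simp: finite_Z)
  also have "\<dots> = (\<Sum>k=1..n. H (VarY k)) + (\<Sum>b\<in>idx g. if b = - a then 0 else H (VarW b))"
    unfolding sum_Z by simp
  also have "(\<Sum>b\<in>idx g. if b = - a then 0 else H (VarW b)) = (\<Sum>b\<in>idx g - {- a}. H (VarW b))"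
    by (rule sum.mono_neutral_cong_right) (auto simp: finite_idx)
  finally have X1: "X (a, j + 3) = ?w \<odot> (\<Sum>k=1..n. H (VarY k)) +
      (?w \<odot> (\<Sum>b\<in>idx g - {- a}. H (VarW b)) + ?w \<odot> f)"
    unfolding pw_eq_mon by (simp only: mon_add add.assoc)
  have Y: "?w \<odot> (\<Sum>k=1..n. H (VarY k)) = (\<Sum>k=1..n. Rcol r (VarY k) (a, j) \<odot> pd (VarY k) F +
      pd (VarY k) (Rcol r (VarY k) (a, j)) \<odot> ser_smult (m k) F)"
  proof -
    have "?w \<odot> H (VarY k) = Rcol r (VarY k) (a, j) \<odot> pd (VarY k) F +
      pd (VarY k) (Rcol r (VarY k) (a, j)) \<odot> ser_smult (m k) F" if k: "k \<in> {1..n}" for k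
    proof -
      have c: "pd (VarY k) (pdd ?p j f) = pdd ?p j (pd (VarY k) f)" for f
      proof (induction j)
        case 0 show ?case by (simp only: pdd_0)
      next
        case (Suc j)
        have "pd (VarY k) (pd ?p f) = pd ?p (pd (VarY k) f)" for f
          by (rule ext) (simp add: pd_alt sg_def algebra_simps)
        then show ?case by (simp only: pdd_Suc pd_smult Suc)
      qed
      show ?thesis
        unfolding H_def Y_modes[OF k] pd_Rcol c pdd_0 pdd_1
        unfolding Rcol_def prod.case pw_eq_mon mon_add mon_mult_assoc ..
    qed
    then show ?thesis unfolding pw_eq_mon mon_sum by (intro sum.cong) (simp_all only: pw_eq_mon[symmetric])
  qed
  have W: "?w \<odot> H (VarW b) = ser_sum (\<lambda>s. Amat r (a, j) (b, s) \<odot> X (b, s))" if b: "b \<noteq> - a" for b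
  proof -
    have "Amat r (a, j) (b, s) \<odot> X (b, s) = ?w \<odot> (pdd ?p j (pdd (VarW b) s (pi2 r ?p (VarW b))) \<odot> D (VarW b) (int s - 1))" for s
    proof -
      have "a \<noteq> - b" using b by auto
      then have "Amat r (a, j) (b, s) = ?w \<odot> (pw (rho b) (of_nat s / 2) \<odot> pdd ?p j (pdd (VarW b) s (pi2 r ?p (VarW b))))"
        unfolding Amat_def prod.case pw_eq_mon by (simp only: mon_mult_assoc if_True not_False_eq_True)
      then show ?thesis
        unfolding X_def prod.case by (simp only: pw_eq_mon[of "rho a"] mon_mult_assoc pw_pair_cancel)
    qed
    then show ?thesis unfolding H_def pw_eq_mon mon_ser_sum by (simp only:)
  qed
  have Fp: "?w \<odot> f = ser_sum (\<lambda>s. Amat r (a, j) (- a, s) \<odot> X (- a, s))"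
  proof -
    have A: "Amat r (a, j) (- a, s) \<odot> X (- a, s) = ?w \<odot> (fpart r ?p j ?p s \<odot> D ?p (int s - 1))" for s
    proof -
      have "Amat r (a, j) (- a, s) = pw (rho a) (of_nat (j + s + 1) / 2) \<odot> fpart r ?p j ?p s"
        by (simp add: Amat_def fpart_def)
      also have "\<dots> = ?w \<odot> (pw (rho (- a)) (of_nat s / 2) \<odot> fpart r ?p j ?p s)"
        unfolding rho_uminus pw_pw_mult by (simp add: field_simps)
      finally show ?thesis
        unfolding X_def prod.case by (simp only: pw_eq_mon[of "rho a" "of_nat (j + 1) / 2"] mon_mult_assoc pw_pair_cancel)
    qed
    show ?thesis
    proof
      fix e
      have "ser_sum (\<lambda>s. Amat r (a, j) (- a, s) \<odot> X (- a, s)) e = (\<Sum>s\<le>2. (?w \<odot> (fpart r ?p j ?p s \<odot> D ?p (int s - 1))) e)"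
        unfolding ser_sum_def A by (rule lfsum_le) (simp only: fpart_gt ser_mult_zero zero_fun_apply)
      then show "(?w \<odot> f) e = ser_sum (\<lambda>s. Amat r (a, j) (- a, s) \<odot> X (- a, s)) e"
        unfolding f_def pw_eq_mon mon_sum sum_ser_apply by (simp only:)
    qed
  qed
  have "dot g (Amat r (a, j)) X = (\<Sum>b\<in>idx g. ser_sum (\<lambda>s. Amat r (a, j) (b, s) \<odot> X (b, s)))"
      proof (rule dot_rows[where c = cX and w = snd and K = 0])
    fix i assume i: "i \<in> J"
    have "good cX (snd (a, j) + snd i) (Amat r (a, j) i \<odot> X i)"
      by (rule good_Amat_X) (use a i in auto)
    then show "good cX (snd i) (Amat r (a, j) i \<odot> X i)" by (rule good_mono) simp
  qed simp
  also have "\<dots> = ser_sum (\<lambda>s. Amat r (a, j) (- a, s) \<odot> X (- a, s)) +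
      (\<Sum>b\<in>idx g - {- a}. ser_sum (\<lambda>s. Amat r (a, j) (b, s) \<odot> X (b, s)))"
    by (rule sum.remove[OF finite_idx a'])
  also have "(\<Sum>b\<in>idx g - {- a}. ser_sum (\<lambda>s. Amat r (a, j) (b, s) \<odot> X (b, s))) = ?w \<odot> (\<Sum>b\<in>idx g - {- a}. H (VarW b))"
    unfolding pw_eq_mon mon_sum
  proof (rule sum.cong[OF refl])
    fix b assume "b \<in> idx g - {- a}"
    then have "b \<noteq> - a" by simp
    from W[OF this] show "ser_sum (\<lambda>s. Amat r (a, j) (b, s) \<odot> X (b, s)) =
        mon (sg (rho a) (of_nat (j + 1) / 2)) \<odot> H (VarW b)"
      unfolding pw_eq_mon by (rule sym)
  qed
  finally have "dot g (Amat r (a, j)) X = ?w \<odot> (\<Sum>b\<in>idx g - {- a}. H (VarW b)) + ?w \<odot> f"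
    unfolding Fp[symmetric] by (simp only: add.commute)
  then show ?thesis unfolding X1 Y by (simp only:)
qed

end

section \<open>The Ward identity in genus \<open>g\<close>\<close>

context correlation
begin

abbreviation dY :: "nat \<Rightarrow> ser" where "dY k \<equiv> pd (VarY k) F"
abbreviation mF :: "nat \<Rightarrow> ser" where "mF k \<equiv> ser_smult (m k) F"
abbreviation LA :: "mindex \<Rightarrow> ser" where "LA \<equiv> row_mult g (Linv g r) (Amat r)"

lemma good_Linv: "j \<in> J \<Longrightarrow> good 0 0 (Linv g r j)"
  by (rule Linv_solve(2)[of cX "\<lambda>_. 0"]) (auto intro: good_zero)

lemma good_LA: "j \<in> J \<Longrightarrow> good 0 0 (LA j)"
  unfolding row_mult_def
proof (rule good_dot)
  fix i assume "j \<in> J" "i \<in> J"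
  then have "good (0 + 0) (0 + (snd i + snd j + 1)) (Linv g r i \<odot> Amat r i j)"
    using good_Amat[of "fst i" "fst j" "snd i" "snd j"] by (intro good_mult good_Linv) auto
  then have "good 0 (snd i + snd j + 1) (Linv g r i \<odot> Amat r i j)" by simp
  then show "good 0 0 (Linv g r i \<odot> Amat r i j)" by (rule good_mono) simp
qed

lemma good_mF: "good cX 0 (mF k)"
  by (rule good_smult[OF good_F0])

lemma good_dY: "k \<in> {1..n} \<Longrightarrow> good cX 0 (dY k)"
  by (rule good_pd_F[OF VarY_V0])

lemma good_R: "i \<in> J \<Longrightarrow> k \<in> {1..n} \<Longrightarrow> good 0 (snd i) (Rcol r (VarY k) i)"
  using good_Rcol[of "fst i" k "snd i"] good_mono by fastforce

lemma good_pdR: "i \<in> J \<Longrightarrow> k \<in> {1..n} \<Longrightarrow> good 0 (snd i) (pd (VarY k) (Rcol r (VarY k) i))"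
  using good_pd_Rcol[of "fst i" k "snd i"] good_mono by fastforce

text \<open>The modes beyond \<open>2\<close> in \<open>conf_modes\<close> satisfy \<open>X_recursion\<close>, whose inhomogeneous part consists of the
  primary vectors and of the modes up to \<open>2\<close>; \<open>Linv_solve\<close> expresses the former by the latter.\<close>

lemma conf_eliminated:
  "fst (corr_form S g B b' \<alpha> \<beta> ((VarX, lab0 S, conf S, 2) # ins) (lab0 S # dls)) =
    (\<Sum>k=1..n. pi2 r VarX (VarY k) \<odot> dY k + pd (VarY k) (pi2 r VarX (VarY k)) \<odot> mF k) +
    ((\<Sum>a\<in>idx g. \<Sum>l\<le>2. Lrow r (a, l) \<odot> X (a, l)) +
     ((\<Sum>k=1..n. dot g (Linv g r) (Rcol r (VarY k)) \<odot> dY k +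
         dot g (Linv g r) (\<lambda>i. pd (VarY k) (Rcol r (VarY k) i)) \<odot> mF k) +
      (\<Sum>a\<in>idx g. \<Sum>l\<le>2. LA (a, l) \<odot> X (a, l))))"
proof -
  define Zs where "Zs = (\<lambda>(b, s). X (b, s + 3))"
  define Y where "Y k i = Rcol r (VarY k) i \<odot> dY k + pd (VarY k) (Rcol r (VarY k) i) \<odot> mF k" for k i
  define W where "W a l i = Amat r i (a, l) \<odot> X (a, l)" for a l i
  have gZ: "good cX (snd i) (Zs i)" if "i \<in> J" for i
  proof -
    have "good cX (snd i + 3) (X (fst i, snd i + 3))" using that by (intro good_X) simp
    then have "good cX (snd i) (X (fst i, snd i + 3))" by (rule good_mono) simp
    then show ?thesis by (simp add: Zs_def case_prod_beta)
  qed
  have gA: "good cX (snd j) (Amat r i j \<odot> X j)" if "i \<in> J" "j \<in> J" for i j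
    using good_mono[OF good_Amat_X[OF that]] by simp
  have gY1: "good cX (snd i) (Rcol r (VarY k) i \<odot> dY k)"
    and gY2: "good cX (snd i) (pd (VarY k) (Rcol r (VarY k) i) \<odot> mF k)" if "i \<in> J" "k \<in> {1..n}" for i k
    using good_mult[OF good_R[OF that] good_dY[OF that(2)]] good_mult[OF good_pdR[OF that] good_mF[of k]] by simp_all
  have gY: "good cX (snd i) (Y k i)" if "i \<in> J" "k \<in> {1..n}" for i k
    unfolding Y_def by (intro good_add gY1 gY2 that)
  have gW: "good cX (snd i) (W a l i)" if "i \<in> J" "a \<in> idx g" for a l i
    unfolding W_def using good_mono[OF good_Amat_X[of i "(a, l)"]] that by simp
  have rec: "Zs i - dot g (\<lambda>(b, s). Amat r i (b, s + 3)) Zs = (\<Sum>k=1..n. Y k i) + (\<Sum>a\<in>idx g. \<Sum>l\<le>2. W a l i)"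
    if i: "i \<in> J" for i
  proof -
    have "Zs i = (\<Sum>k=1..n. Y k i) + dot g (Amat r i) X"
      using X_recursion[of "fst i" "snd i"] i unfolding Zs_def Y_def case_prod_beta by (simp only: mem_Collect_eq prod.collapse)
    also have "dot g (Amat r i) X = (\<Sum>a\<in>idx g. \<Sum>l\<le>2. W a l i) + dot g (\<lambda>(b, s). Amat r i (b, s + 3)) Zs"
      unfolding W_def Zs_def by (rule dot_split[where w = snd and K = 0, OF gA[OF i]]) auto
    finally have "Zs i = ((\<Sum>k=1..n. Y k i) + (\<Sum>a\<in>idx g. \<Sum>l\<le>2. W a l i)) + dot g (\<lambda>(b, s). Amat r i (b, s + 3)) Zs"
      by (simp only: add.assoc)
    then show ?thesis by (simp only: add_diff_cancel_right')
  qed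
  have K: "snd i \<le> 0 + snd i + 0" for i :: mindex by simp
  have "dot g (\<lambda>(b, s). Lrow r (b, s + 3)) Zs =
      dot g (Linv g r) (\<lambda>i. Zs i - dot g (\<lambda>(b, s). Amat r i (b, s + 3)) Zs)"
    by (rule Linv_solve(1)[OF gZ])
  also have "\<dots> = dot g (Linv g r) (\<lambda>i. (\<Sum>k=1..n. Y k i) + (\<Sum>a\<in>idx g. \<Sum>l\<le>2. W a l i))"
    by (rule dot_cong) (simp_all only: rec)
  also have "\<dots> = dot g (Linv g r) (\<lambda>i. \<Sum>k=1..n. Y k i) + dot g (Linv g r) (\<lambda>i. \<Sum>a\<in>idx g. \<Sum>l\<le>2. W a l i)"
    by (rule dot_add_right[OF good_Linv _ _ K]) (auto intro!: good_sum gY gW)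
  also have "dot g (Linv g r) (\<lambda>i. \<Sum>k=1..n. Y k i) = (\<Sum>k=1..n. dot g (Linv g r) (Y k))"
    by (rule dot_sum_right[OF good_Linv _ K]) (auto intro!: gY)
  also have "\<dots> = (\<Sum>k=1..n. dot g (Linv g r) (Rcol r (VarY k)) \<odot> dY k +
         dot g (Linv g r) (\<lambda>i. pd (VarY k) (Rcol r (VarY k) i)) \<odot> mF k)"
  proof (rule sum.cong[OF refl])
    fix k assume k: "k \<in> {1..n}"
    have "dot g (Linv g r) (Y k) = dot g (Linv g r) (\<lambda>i. Rcol r (VarY k) i \<odot> dY k) +
        dot g (Linv g r) (\<lambda>i. pd (VarY k) (Rcol r (VarY k) i) \<odot> mF k)"
      unfolding Y_def[abs_def] by (rule dot_add_right[OF good_Linv gY1 gY2 K]) (use k in auto)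
    also have "dot g (Linv g r) (\<lambda>i. Rcol r (VarY k) i \<odot> dY k) = dot g (Linv g r) (Rcol r (VarY k)) \<odot> dY k"
      by (rule dot_mult_right[OF good_Linv good_R K good_dY]) (use k in auto)
    also have "dot g (Linv g r) (\<lambda>i. pd (VarY k) (Rcol r (VarY k) i) \<odot> mF k) =
        dot g (Linv g r) (\<lambda>i. pd (VarY k) (Rcol r (VarY k) i)) \<odot> mF k"
      by (rule dot_mult_right[OF good_Linv good_pdR K good_mF]) (use k in auto)
    finally show "dot g (Linv g r) (Y k) = dot g (Linv g r) (Rcol r (VarY k)) \<odot> dY k +
         dot g (Linv g r) (\<lambda>i. pd (VarY k) (Rcol r (VarY k) i)) \<odot> mF k" .
  qed
  also have "dot g (Linv g r) (\<lambda>i. \<Sum>a\<in>idx g. \<Sum>l\<le>2. W a l i) = (\<Sum>a\<in>idx g. dot g (Linv g r) (\<lambda>i. \<Sum>l\<le>2. W a l i))"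
    by (rule dot_sum_right[OF good_Linv _ K finite_idx]) (auto intro!: good_sum gW)
  also have "\<dots> = (\<Sum>a\<in>idx g. \<Sum>l\<le>2. LA (a, l) \<odot> X (a, l))"
  proof (rule sum.cong[OF refl])
    fix a assume a: "a \<in> idx g"
    have "dot g (Linv g r) (\<lambda>i. \<Sum>l\<le>2. W a l i) = (\<Sum>l\<le>2. dot g (Linv g r) (W a l))"
      by (rule dot_sum_right[OF good_Linv _ K]) (use a in \<open>auto intro!: gW\<close>)
    also have "\<dots> = (\<Sum>l\<le>2. LA (a, l) \<odot> X (a, l))"
    proof (rule sum.cong[OF refl])
      fix l :: nat
      have gAa: "good 0 (snd i) (Amat r i (a, l))" if "i \<in> J" for i
        using good_mono[OF good_Amat[of "fst i" a "snd i" l], of "snd i"] that a by simp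
      show "dot g (Linv g r) (W a l) = LA (a, l) \<odot> X (a, l)"
        unfolding W_def[abs_def] row_mult_def
        by (rule dot_mult_right[OF good_Linv gAa K good_X[OF a]])
    qed
    finally show "dot g (Linv g r) (\<lambda>i. \<Sum>l\<le>2. W a l i) = (\<Sum>l\<le>2. LA (a, l) \<odot> X (a, l))" .
  qed
  finally have L3: "dot g (\<lambda>(b, s). Lrow r (b, s + 3)) Zs =
     (\<Sum>k=1..n. dot g (Linv g r) (Rcol r (VarY k)) \<odot> dY k +
         dot g (Linv g r) (\<lambda>i. pd (VarY k) (Rcol r (VarY k) i)) \<odot> mF k) +
     (\<Sum>a\<in>idx g. \<Sum>l\<le>2. LA (a, l) \<odot> X (a, l))" .
  have "dot g (Lrow r) X = (\<Sum>a\<in>idx g. \<Sum>l\<le>2. Lrow r (a, l) \<odot> X (a, l)) + dot g (\<lambda>(b, s). Lrow r (b, s + 3)) Zs"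
    unfolding Zs_def by (rule dot_split[where w = snd and K = 0, OF good_Lrow_X]) auto
  then show ?thesis unfolding conf_modes L3 by (simp only:)
qed

subsection \<open>The differential operator\<close>

lemma schottky_pd_F:
  assumes a: "a \<in> {1..g}" and l: "l \<le> 2"
  shows "schottky_pd a l F = D (VarW (int a)) (int l - 1)"
proof -
  have i: "int a \<in> idx g" "- int a \<in> idx g" using a by (auto simp: idx_def)
  have "l = 0 \<or> l = 1 \<or> l = 2" using l by auto
  then show ?thesis
  proof (elim disjE)
    assume "l = 0"
    then show ?thesis using D_deriv[OF W_Z[OF i(1)]] by (simp add: schottky_pd_def)
  next
    assume "l = 1"
    then show ?thesis using D_weight_W[OF a] by (simp add: schottky_pd_def)
  next
    assume "l = 2"
    then show ?thesis using D_dual_pos[OF a, of 1] D_deriv[OF W_Z[OF i(2)]] by (simp add: schottky_pd_def)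
  qed
qed

text \<open>In \<open>\<Theta>\<close> the forms \<open>T\<close> at \<open>a\<close> and \<open>-a\<close> are combined, because by duality the operator with index \<open>\<ell>\<close> at
  \<open>a\<close> is, up to a power of \<open>\<rho>\<^sub>a\<close>, the mode \<open>2-\<ell>\<close> at \<open>-a\<close>. Apart they give a sum over all ends.\<close>

lemma nabla_F: "nabla g r F = (\<Sum>a\<in>idx g. \<Sum>l\<le>2. (Lrow r (a, l) + LA (a, l)) \<odot> X (a, l))"
proof -
  define LL where "LL i = Lrow r i + LA i" for i
  have T: "Tform g r b l = pw (rho b) (- of_nat l / 2) \<odot> LL (b, l)" for b l
    by (simp only: Tform_def LL_def)
  have gLL: "\<exists>c. good c 0 (pw (rho b) x \<odot> LL (b, l))" if b: "b \<in> idx g" for b l x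
  proof -
    have "good (sc (- 4)) 0 (Lrow r (b, l))" by (rule good_sc_mono0[OF good_Lrow[OF b]]) auto
    moreover have "good (sc (- 4)) 0 (LA (b, l))"
    proof -
      have "good (sc 0) 0 (LA (b, l))" using good_LA[of "(b, l)"] b by (simp add: sc_0)
      then show ?thesis by (rule good_sc_mono0) auto
    qed
    ultimately have "good (sc (- 4)) 0 (LL (b, l))" unfolding LL_def by (rule good_add)
    then show ?thesis by (rule good_pw_mult[OF _ b])
  qed
  have gS: "good cX 0 (schottky_pd a l F)" if a: "a \<in> {1..g}" and l: "l \<le> 2" for a l
    unfolding schottky_pd_F[OF that]
    by (rule good_cX, rule good_D_mode, rule W_Z) (use a in \<open>auto simp: idx_def\<close>)
  have t: "Theta g r a l \<odot> schottky_pd a l F = LL (int a, l) \<odot> X (int a, l) + LL (- int a, 2 - l) \<odot> X (- int a, 2 - l)"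
    if a: "a \<in> {1..g}" and l: "l \<le> 2" for a l
  proof -
    have i: "int a \<in> idx g" "- int a \<in> idx g" using a by (auto simp: idx_def)
    have rho: "rho (int a) = VarR a" "rho (- int a) = VarR a" by (simp_all add: rho_def)
    let ?d = "schottky_pd a l F" and ?l = "- of_nat l / 2 :: complex"
    have e: "1 - of_nat l + - of_nat (2 - l) / 2 = (?l :: complex)" "of_nat (2 - l) / 2 - 1 = ?l"
      using l by (simp_all add: of_nat_diff field_simps)
    \<comment> \<open>the two powers of \<open>\<rho>\<^sub>a\<close> agree, by the previous line\<close>
    have Th: "Theta g r a l = pw (rho (int a)) ?l \<odot> LL (int a, l) + pw (rho (- int a)) ?l \<odot> LL (- int a, 2 - l)"
      unfolding Theta_def T rho pw_pw_mult e ..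
    have X1: "X (int a, l) = pw (VarR a) ?l \<odot> ?d"
      unfolding X_def prod.case schottky_pd_F[OF that] rho by simp
    have X2: "X (- int a, 2 - l) = pw (VarR a) ?l \<odot> ?d"
    proof -
      have "1 - int (2 - l) = int l - 1" using l by (simp add: of_nat_diff)
      then show ?thesis unfolding X_dual[OF i(2)] e schottky_pd_F[OF that] rho minus_minus by (simp only:)
    qed
    obtain c1 c2 where c: "good c1 0 (pw (rho (int a)) ?l \<odot> LL (int a, l))"
      "good c2 0 (pw (rho (- int a)) ?l \<odot> LL (- int a, 2 - l))"
      using gLL[OF i(1)] gLL[OF i(2)] by blast
    have m: "(pw u x \<odot> f) \<odot> h = f \<odot> (pw u x \<odot> h)" for u x f h
      unfolding pw_eq_mon by (simp only: mon_mult_assoc mult_mon_left_commute)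
    show ?thesis
      unfolding Th distrib_right[OF c gS[OF that]] unfolding m rho X1 X2 ..
  qed
  have rev: "(\<Sum>l\<le>2. h (2 - l)) = (\<Sum>l\<le>2. h l)" for h :: "nat \<Rightarrow> ser"
    using sum.nat_diff_reindex[of h 3] by (simp only: lessThan_Suc_atMost numeral_3_eq_3 diff_Suc_Suc numeral_2_eq_2)
  have "nabla g r F = (\<Sum>a=1..g. \<Sum>l\<le>2. LL (int a, l) \<odot> X (int a, l) + LL (- int a, 2 - l) \<odot> X (- int a, 2 - l))"
    unfolding nabla_def by (intro sum.cong refl t) auto
  also have "\<dots> = (\<Sum>a=1..g. (\<Sum>l\<le>2. LL (int a, l) \<odot> X (int a, l)) + (\<Sum>l\<le>2. LL (- int a, l) \<odot> X (- int a, l)))"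
    unfolding sum.distrib using rev[of "\<lambda>l. LL (- int a, l) \<odot> X (- int a, l)" for a] by (simp only:)
  also have "\<dots> = (\<Sum>b\<in>idx g. \<Sum>l\<le>2. LL (b, l) \<odot> X (b, l))"
    by (rule idx_sum_split[symmetric])
  finally show ?thesis unfolding LL_def .
qed

lemma psi2_terms:
  assumes k: "k \<in> {1..n}"
  shows "psi2 g r (VarY k) \<odot> dY k = pi2 r VarX (VarY k) \<odot> dY k + dot g (Linv g r) (Rcol r (VarY k)) \<odot> dY k"
    and "ser_smult (m k) (pd (VarY k) (psi2 g r (VarY k)) \<odot> F) =
      pd (VarY k) (pi2 r VarX (VarY k)) \<odot> mF k + dot g (Linv g r) (\<lambda>i. pd (VarY k) (Rcol r (VarY k) i)) \<odot> mF k"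
proof -
  have gpi: "good (sc (- 4)) 0 (pi2 r VarX (VarY k))"
    by (rule good_pi2[OF VarX_V0 VarY_V0[OF k]]) auto
  have gd: "good 0 0 (dot g (Linv g r) q)" if "\<And>i. i \<in> J \<Longrightarrow> good 0 (snd i) (q i)" for q
  proof (rule good_dot)
    fix i assume i: "i \<in> J"
    have "good (0 + 0) (0 + snd i) (Linv g r i \<odot> q i)" by (rule good_mult[OF good_Linv[OF i] that[OF i]])
    then have "good 0 (snd i) (Linv g r i \<odot> q i)" by simp
    then show "good 0 0 (Linv g r i \<odot> q i)" by (rule good_mono) simp
  qed
  show "psi2 g r (VarY k) \<odot> dY k = pi2 r VarX (VarY k) \<odot> dY k + dot g (Linv g r) (Rcol r (VarY k)) \<odot> dY k"
    unfolding psi2_def by (rule distrib_right[OF gpi gd[OF good_R[OF _ k]] good_dY[OF k]])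
  have "pd (VarY k) (dot g (Linv g r) (Rcol r (VarY k))) = dot g (Linv g r) (\<lambda>i. pd (VarY k) (Rcol r (VarY k) i))"
    unfolding dot_def pd_ser_sum
    by (rule arg_cong[where f = ser_sum], rule ext) (simp only: pd_mult_indep[OF indep_Linv] pd_zero split: if_split, simp)
  then have pd: "pd (VarY k) (psi2 g r (VarY k)) =
      pd (VarY k) (pi2 r VarX (VarY k)) + dot g (Linv g r) (\<lambda>i. pd (VarY k) (Rcol r (VarY k) i))"
    unfolding psi2_def pd_add by (simp only:)
  show "ser_smult (m k) (pd (VarY k) (psi2 g r (VarY k)) \<odot> F) =
      pd (VarY k) (pi2 r VarX (VarY k)) \<odot> mF k + dot g (Linv g r) (\<lambda>i. pd (VarY k) (Rcol r (VarY k) i)) \<odot> mF k"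
    unfolding mult_ser_smult[symmetric] pd
    by (rule distrib_right[OF good_pd[OF gpi VarY_V0[OF k]] gd[OF good_pdR[OF _ k]] good_mF])
qed

theorem corr_form_nabla:
  "corr_form S g B b' \<alpha> \<beta> ((VarX, lab0 S, conf S, 2) # ins) (lab0 S # dls) =
    nabla_form g r n m (corr_form S g B b' \<alpha> \<beta> ins dls)"
proof (rule prod_eqI)
  define a where "a k = pi2 r VarX (VarY k) \<odot> dY k" for k
  define b where "b k = pd (VarY k) (pi2 r VarX (VarY k)) \<odot> mF k" for k
  define c where "c k = dot g (Linv g r) (Rcol r (VarY k)) \<odot> dY k" for k
  define d where "d k = dot g (Linv g r) (\<lambda>i. pd (VarY k) (Rcol r (VarY k) i)) \<odot> mF k" for k
  define p where "p = (\<Sum>a\<in>idx g. \<Sum>l\<le>2. Lrow r (a, l) \<odot> X (a, l))"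
  define q where "q = (\<Sum>a\<in>idx g. \<Sum>l\<le>2. LA (a, l) \<odot> X (a, l))"
  have "nabla g r F = (\<Sum>a\<in>idx g. \<Sum>l\<le>2. Lrow r (a, l) \<odot> X (a, l) + LA (a, l) \<odot> X (a, l))"
    unfolding nabla_F
  proof (intro sum.cong refl)
    fix a l assume a: "a \<in> idx g"
    show "(Lrow r (a, l) + LA (a, l)) \<odot> X (a, l) = Lrow r (a, l) \<odot> X (a, l) + LA (a, l) \<odot> X (a, l)"
      by (rule distrib_right[OF good_Lrow[OF a] good_LA good_X[OF a]]) (simp add: a)
  qed
  then have N: "nabla g r F = p + q" unfolding p_def q_def sum.distrib .
  have P: "(\<Sum>k=1..n. psi2 g r (VarY k) \<odot> dY k + ser_smult (m k) (pd (VarY k) (psi2 g r (VarY k)) \<odot> F)) =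
      (\<Sum>k=1..n. (a k + c k) + (b k + d k))"
    unfolding a_def b_def c_def d_def by (rule sum.cong[OF refl]) (simp only: psi2_terms)
  have "fst (corr_form S g B b' \<alpha> \<beta> ((VarX, lab0 S, conf S, 2) # ins) (lab0 S # dls)) =
      (\<Sum>k=1..n. a k + b k) + (p + ((\<Sum>k=1..n. c k + d k) + q))"
    unfolding conf_eliminated a_def b_def c_def d_def p_def q_def ..
  also have "\<dots> = (p + q) + (\<Sum>k=1..n. (a k + c k) + (b k + d k))"
    unfolding sum.distrib by (simp only: add_ac)
  also have "\<dots> = fst (nabla_form g r n m (corr_form S g B b' \<alpha> \<beta> ins dls))"
    unfolding nabla_form_def fst_conv corr_form_F N P ..
  finally show "fst (corr_form S g B b' \<alpha> \<beta> ((VarX, lab0 S, conf S, 2) # ins) (lab0 S # dls)) =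
    fst (nabla_form g r n m (corr_form S g B b' \<alpha> \<beta> ins dls))" .
  show "snd (corr_form S g B b' \<alpha> \<beta> ((VarX, lab0 S, conf S, 2) # ins) (lab0 S # dls)) =
    snd (nabla_form g r n m (corr_form S g B b' \<alpha> \<beta> ins dls))"
    by (rule ext) (simp add: corr_form_def nabla_form_def Let_def)
qed

end

theorem proposition6p3:
  fixes S :: "('a, 'm::ab_group_add) voa_system"
    and g n :: nat
    and \<alpha> \<beta> \<gamma> \<delta> :: "nat \<Rightarrow> 'a"
    and v :: "nat \<Rightarrow> 'm"
    and m :: "nat \<Rightarrow> complex"
    and B :: "nat \<Rightarrow> 'm set"
    and b' :: "nat \<Rightarrow> 'm \<Rightarrow> 'm"
    and r :: "var \<Rightarrow> nat"
  assumes "voa_modules S"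
    and "g \<ge> 2"
    and "\<And>a. a \<in> {1..g} \<Longrightarrow> homogeneous_basis S (\<alpha> a) (B a)"
    and "\<And>a. a \<in> {1..g} \<Longrightarrow> dual_basis S (\<alpha> a) (B a) (b' a)"
    and "admissible S g \<alpha> \<beta>"
    and "\<And>k. k \<in> {1..n} \<Longrightarrow> primary S (\<gamma> k) (m k) (v k)"
    and "n \<ge> 2 \<Longrightarrow> \<delta> 1 = dual S (\<gamma> 1) \<and> \<delta> (n - 1) = \<gamma> n"
    and "expansion_order g n r"
  defines "ins \<equiv> map (\<lambda>k. (VarY k, \<gamma> k, v k, m k)) [1..<Suc n]"
    and "\<delta>s \<equiv> map \<delta> [1..<n]"
  shows "corr_form S g B b' \<alpha> \<beta> ((VarX, lab0 S, conf S, 2) # ins) (lab0 S # \<delta>s) =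
         nabla_form g r n m (corr_form S g B b' \<alpha> \<beta> ins \<delta>s)"
proof -
  interpret voa_modules S by fact
  interpret correlation S g n r \<alpha> \<beta> \<gamma> \<delta> v m B b'
    by unfold_locales (use assms in auto)
  show ?thesis unfolding ins_def \<delta>s_def by (rule corr_form_nabla)
qed

end
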